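(* Let $N$ be an integer with $$\frac{\binom{n+2}{3}}{n}\le N<\frac{\sqrt{2n^4-2n^2+1}-n^2+n+1}{2},$$ and let $R$ be a general quotient of $S$ of type $(N;2)$. Then $\operatorname{rate}(R)=\frac32$ and $\operatorname{slant}(R)=\frac43$.
   Context: $\mathsf k$ is a field, $n\ge 2$, $S=\mathsf k[x_1,\dots,x_n]$ is standard graded. A quotient $R=S/I$ is of type $(N;2)$ if $I$ is minimally generated by $N$ forms of degree $2$. "A general quotient of $S$ of type $(N;2)$ satisfies a property $( * )$" means: there is a nonempty (Zariski) open subset $U$ of the parameter space $\mathbb P(S_2)^N$ of coefficients of $N$-tuples of quadratic forms (or of the Grassmannian of $N$-dimensional subspaces of $S_2$) such that for each choice of $f_1,\dots,f_N$ corresponding to a point of $U$, the ring $S/(f_1,\dots,f_N)$ satisfies $( * )$. For $i\ge 0$ let $t_i^R(\mathsf k)=\sup\{j: \operatorname{Tor}_i^R(\mathsf k,\mathsf k)_j\ne 0\}$, where $j$ is the internal degree. Define $$\operatorname{rate}(R)=\sup_{i\ge 2}\frac{t_i^R(\mathsf k)-1}{i-1},\qquad \operatorname{slant}(R)=\sup_{i\ge 1}\frac{t_i^R(\mathsf k)}{i}.$$ *)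

theory Defs
  imports
    "HOL-Analysis.Analysis"
    "HOL-Library.Poly_Mapping"
    "HOL-Algebra.Algebra"
    "HOL-Algebra.Algebraic_Closure_Type"
begin

section \<open>Tor, rate and slant of a standard graded algebra\<close>

text \<open>
  A graded ring is a ring \<open>R\<close> together with the family \<open>G\<close> of its homogeneous components:
  \<open>G d\<close> is the set of elements of degree \<open>d\<close>. If \<open>R\<close> is a standard graded algebra over a field
  \<open>k\<close>, then \<open>irrelevant_ideal R G\<close> is its graded maximal ideal \<open>m\<close>, and \<open>k = R/m\<close>.
\<close>

definition irrelevant_ideal :: "('r, 'm) ring_scheme \<Rightarrow> (nat \<Rightarrow> 'r set) \<Rightarrow> 'r set" where
  "irrelevant_ideal R G = genideal R (\<Union>d\<in>{1..}. G d)"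

text \<open>The degree \<open>j\<close> component of the twist \<open>R(-a)\<close>, i.e. the elements of \<open>R\<close> of degree \<open>j - a\<close>.\<close>

definition twist :: "('r, 'm) ring_scheme \<Rightarrow> (nat \<Rightarrow> 'r set) \<Rightarrow> nat \<Rightarrow> nat \<Rightarrow> 'r set" where
  "twist R G a j = (if a \<le> j then G (j - a) else {\<zero>\<^bsub>R\<^esub>})"

abbreviation vecs :: "'r set \<Rightarrow> nat \<Rightarrow> (nat \<Rightarrow> 'r) set" where
  "vecs A p \<equiv> {..<p} \<rightarrow>\<^sub>E A"

definition mat_apply ::
  "('r, 'm) ring_scheme \<Rightarrow> nat \<Rightarrow> nat \<Rightarrow> (nat \<Rightarrow> nat \<Rightarrow> 'r) \<Rightarrow> (nat \<Rightarrow> 'r) \<Rightarrow> (nat \<Rightarrow> 'r)" where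
  "mat_apply R p q A v = (\<lambda>r\<in>{..<p}. finsum R (\<lambda>c. A r c \<otimes>\<^bsub>R\<^esub> v c) {..<q})"

text \<open>
  A graded free resolution \<open>\<dots> \<rightarrow> F\<^sub>2 \<rightarrow> F\<^sub>1 \<rightarrow> F\<^sub>0 \<rightarrow> k \<rightarrow> 0\<close> over \<open>R\<close> by free modules of finite
  rank, with \<open>F\<^sub>0 = R\<close> and the canonical augmentation \<open>R \<rightarrow> R/m = k\<close>. Here \<open>F\<^sub>i\<close> is the direct
  sum of the twists \<open>R(-a i c)\<close> for \<open>c < b i\<close>, and for \<open>i > 0\<close> the matrix \<open>d i\<close> represents the
  degree-preserving differential from \<open>F\<^sub>i\<close> to \<open>F\<^sub>i\<^sub>-\<^sub>1\<close>; the value \<open>d 0\<close> is irrelevant. The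
  resolution is not required to be minimal.
\<close>

definition graded_free_resolution ::
  "('r, 'm) ring_scheme \<Rightarrow> (nat \<Rightarrow> 'r set) \<Rightarrow>
   (nat \<Rightarrow> nat) \<Rightarrow> (nat \<Rightarrow> nat \<Rightarrow> nat) \<Rightarrow> (nat \<Rightarrow> nat \<Rightarrow> nat \<Rightarrow> 'r) \<Rightarrow> bool" where
  "graded_free_resolution R G b a d \<longleftrightarrow>
     b 0 = 1 \<and> a 0 0 = 0 \<and>
     (\<forall>i. \<forall>r<b i. \<forall>c<b (Suc i). d (Suc i) r c \<in> twist R G (a i r) (a (Suc i) c)) \<and>
     mat_apply R (b 0) (b 1) (d 1) ` vecs (carrier R) (b 1) = vecs (irrelevant_ideal R G) (b 0) \<and>
     (\<forall>i. mat_apply R (b (Suc i)) (b (Suc (Suc i))) (d (Suc (Suc i)))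
             ` vecs (carrier R) (b (Suc (Suc i))) =
          {v \<in> vecs (carrier R) (b (Suc i)).
             \<forall>r<b i. mat_apply R (b i) (b (Suc i)) (d (Suc i)) v r = \<zero>\<^bsub>R\<^esub>})"

text \<open>
  Degree \<open>j\<close> cycles and boundaries of the complex obtained from the resolution by tensoring with
  \<open>k\<close> over \<open>R\<close>, i.e. of the quotients \<open>F\<^sub>i / m F\<^sub>i\<close>. Elements are represented by lifts to \<open>F\<^sub>i\<close>;
  note that \<open>m F\<^sub>i\<close> consists of the vectors with all entries in \<open>m\<close>.
\<close>

definition tor_cycles ::
  "('r, 'm) ring_scheme \<Rightarrow> (nat \<Rightarrow> 'r set) \<Rightarrow>
   (nat \<Rightarrow> nat) \<Rightarrow> (nat \<Rightarrow> nat \<Rightarrow> nat) \<Rightarrow> (nat \<Rightarrow> nat \<Rightarrow> nat \<Rightarrow> 'r) \<Rightarrow> nat \<Rightarrow> nat \<Rightarrow> (nat \<Rightarrow> 'r) set" where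
  "tor_cycles R G b a d i j =
     {z \<in> vecs (carrier R) (b i). (\<forall>c<b i. z c \<in> twist R G (a i c) j) \<and>
        (0 < i \<longrightarrow> mat_apply R (b (i - 1)) (b i) (d i) z \<in> vecs (irrelevant_ideal R G) (b (i - 1)))}"

definition tor_boundaries ::
  "('r, 'm) ring_scheme \<Rightarrow> (nat \<Rightarrow> 'r set) \<Rightarrow>
   (nat \<Rightarrow> nat) \<Rightarrow> (nat \<Rightarrow> nat \<Rightarrow> nat) \<Rightarrow> (nat \<Rightarrow> nat \<Rightarrow> nat \<Rightarrow> 'r) \<Rightarrow> nat \<Rightarrow> nat \<Rightarrow> (nat \<Rightarrow> 'r) set" where
  "tor_boundaries R G b a d i j =
     {z \<in> vecs (carrier R) (b i). (\<forall>c<b i. z c \<in> twist R G (a i c) j) \<and>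
        (\<exists>w \<in> vecs (carrier R) (b (Suc i)). \<forall>c<b i.
           z c \<ominus>\<^bsub>R\<^esub> mat_apply R (b i) (b (Suc i)) (d (Suc i)) w c \<in> irrelevant_ideal R G)}"

text \<open>
  \<open>Tor\<^sub>i\<close> of \<open>(k, k)\<close> over \<open>R\<close> is nonzero in internal degree \<open>j\<close>. As usual, this does not depend
  on the chosen graded free resolution; one exists whenever \<open>R\<close> is a finitely generated
  standard graded \<open>k\<close>-algebra.
\<close>

definition tor_nonzero ::
  "('r, 'm) ring_scheme \<Rightarrow> (nat \<Rightarrow> 'r set) \<Rightarrow> nat \<Rightarrow> nat \<Rightarrow> bool" where
  "tor_nonzero R G i j \<longleftrightarrow>
     (\<exists>b a d. graded_free_resolution R G b a d \<and>
              \<not> tor_cycles R G b a d i j \<subseteq> tor_boundaries R G b a d i j)"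

text \<open>Suprema are taken in the extended reals; the supremum of the empty set is \<open>-\<infinity>\<close>.\<close>

definition tor_top :: "('r, 'm) ring_scheme \<Rightarrow> (nat \<Rightarrow> 'r set) \<Rightarrow> nat \<Rightarrow> ereal" where
  "tor_top R G i = (SUP j\<in>{j. tor_nonzero R G i j}. ereal (real j))"

definition rate :: "('r, 'm) ring_scheme \<Rightarrow> (nat \<Rightarrow> 'r set) \<Rightarrow> ereal" where
  "rate R G = (SUP i\<in>{2..}. (tor_top R G i - 1) / ereal (real i - 1))"

definition slant :: "('r, 'm) ring_scheme \<Rightarrow> (nat \<Rightarrow> 'r set) \<Rightarrow> ereal" where
  "slant R G = (SUP i\<in>{1..}. tor_top R G i / ereal (real i))"


section \<open>Polynomial rings and their quotients by quadratic forms\<close>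

text \<open>
  The polynomial ring over \<open>'k\<close> in the variables indexed by \<open>'v\<close>; for finite \<open>'v\<close> these are
  \<open>CARD('v)\<close> variables.
\<close>

type_synonym ('v, 'k) mpoly = "('v \<Rightarrow>\<^sub>0 nat) \<Rightarrow>\<^sub>0 'k"

definition mdeg :: "('v::finite \<Rightarrow>\<^sub>0 nat) \<Rightarrow> nat" where
  "mdeg u = (\<Sum>x\<in>UNIV. Poly_Mapping.lookup u x)"

definition forms :: "nat \<Rightarrow> ('v::finite, 'k::field) mpoly set" where
  "forms d = {p. \<forall>u\<in>Poly_Mapping.keys p. mdeg u = d}"

abbreviation mpoly_ring :: "('v::finite, 'k::field) mpoly ring" where
  "mpoly_ring \<equiv> ring_of_type_algebra"

definition forms_ideal :: "nat \<Rightarrow> (nat \<Rightarrow> ('v::finite, 'k::field) mpoly) \<Rightarrow> ('v, 'k) mpoly set" where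
  "forms_ideal N f = genideal mpoly_ring (f ` {..<N})"

definition quot_ring ::
  "nat \<Rightarrow> (nat \<Rightarrow> ('v::finite, 'k::field) mpoly) \<Rightarrow> ('v, 'k) mpoly set ring" where
  "quot_ring N f = mpoly_ring Quot (forms_ideal N f)"

definition quot_grading ::
  "nat \<Rightarrow> (nat \<Rightarrow> ('v::finite, 'k::field) mpoly) \<Rightarrow> nat \<Rightarrow> ('v, 'k) mpoly set set" where
  "quot_grading N f d = (\<lambda>p. forms_ideal N f +>\<^bsub>mpoly_ring\<^esub> p) ` forms d"

text \<open>
  The quotient by \<open>f 0, \<dots>, f (N - 1)\<close> is of type \<open>(N;2)\<close>, with these quadratic forms as a minimal
  system of generators of the ideal.
\<close>

definition of_type_N2 :: "nat \<Rightarrow> (nat \<Rightarrow> ('v::finite, 'k::field) mpoly) \<Rightarrow> bool" where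
  "of_type_N2 N f \<longleftrightarrow> (\<forall>i<N. f i \<in> forms 2) \<and>
     (\<forall>J. J \<subset> {..<N} \<longrightarrow> genideal mpoly_ring (f ` J) \<noteq> forms_ideal N f)"


section \<open>Zariski open subsets of the space of tuples of quadratic forms\<close>

text \<open>
  Polynomials over \<open>'k\<close> in the coefficients of an \<open>N\<close>-tuple of quadratic forms: the variable
  \<open>(i, u)\<close> stands for the coefficient of the monomial \<open>u\<close> in the \<open>i\<close>-th form. Closed subsets of
  the \<open>N\<close>-fold product of the projective space of quadratic forms are the zero loci of sets of
  polynomials that are homogeneous in each of the \<open>N\<close> groups of variables.
\<close>

type_synonym ('v, 'k) coeff_poly = "(nat \<times> ('v \<Rightarrow>\<^sub>0 nat), 'k) mpoly"

definition multihomogeneous :: "nat \<Rightarrow> ('v::finite, 'k::field) coeff_poly \<Rightarrow> bool" where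
  "multihomogeneous N P \<longleftrightarrow>
     (\<forall>m\<in>Poly_Mapping.keys P. \<forall>(i, u)\<in>Poly_Mapping.keys m. i < N \<and> mdeg u = 2) \<and>
     (\<exists>e. \<forall>m\<in>Poly_Mapping.keys P. \<forall>i<N.
        (\<Sum>v\<in>{v \<in> Poly_Mapping.keys m. fst v = i}. Poly_Mapping.lookup m v) = e i)"

definition eval_coeffs ::
  "('k::field \<Rightarrow> 'l::field) \<Rightarrow> ('v, 'k) coeff_poly \<Rightarrow> (nat \<Rightarrow> ('v::finite, 'l) mpoly) \<Rightarrow> 'l" where
  "eval_coeffs \<phi> P f =
     (\<Sum>m\<in>Poly_Mapping.keys P. \<phi> (Poly_Mapping.lookup P m) *
        (\<Prod>(i, u)\<in>Poly_Mapping.keys m.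
            Poly_Mapping.lookup (f i) u ^ Poly_Mapping.lookup m (i, u)))"

text \<open>
  The points, with coordinates in the extension field \<open>'l\<close> of \<open>'k\<close> given by the embedding \<open>\<phi>\<close>, of
  the open subset (defined over \<open>'k\<close>) that is the complement of the zero locus of \<open>E\<close>. Points are
  given by homogeneous coordinates, that is, by tuples of nonzero quadratic forms over \<open>'l\<close>.
\<close>

definition open_points ::
  "nat \<Rightarrow> ('k::field \<Rightarrow> 'l::field) \<Rightarrow> ('v::finite, 'k) coeff_poly set \<Rightarrow>
   (nat \<Rightarrow> ('v, 'l) mpoly) set" where
  "open_points N \<phi> E =
     {f. (\<forall>i<N. f i \<in> forms 2 \<and> f i \<noteq> 0) \<and> (\<exists>P\<in>E. eval_coeffs \<phi> P f \<noteq> 0)}"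

end

theory Submission
  imports Defs "Jordan_Normal_Form.Determinant" "HOL-Library.Function_Algebras" "HOL-Library.Z2"
begin

text \<open>
  Two open conditions suffice: the \<open>N\<close> quadratic forms are linearly independent, and their multiples
  by linear forms span all cubic forms. Both are nonvanishing conditions on minors.

  If they hold, then \<open>R\<^sub>3 = 0\<close>. A chase through an arbitrary graded resolution of \<open>k\<close>, using only
  \<open>R\<^sub>3 = 0\<close> and the exactness of the Koszul relations among the variables, shows that degrees can
  exceed the homological degree only once in every three steps: \<open>Tor\<^sub>i\<close> vanishes above degree
  \<open>i + i div 3\<close>. Conversely, the upper bound on \<open>N\<close> is exactly the numerical condition under which a
  system of linear equations has more unknowns than equations; a nonzero solution is a functional on
  \<open>\<Lambda>\<^sup>2 R\<^sub>1 \<otimes> R\<^sub>2\<close> detecting a nonzero class in \<open>Tor\<^sub>3\<close> of degree 4. The values \<open>3/2\<close> and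
  \<open>4/3\<close> are thus attained at \<open>i = 3\<close> and are never exceeded.

  It remains to find one good tuple of forms over the algebraic closure. In characteristic \<open>p\<close> we
  count pairs consisting of a tuple of forms over a large finite field \<open>K\<close> and a functional on cubic
  forms that annihilates their multiples, sorting the functionals by a maximal set of variables with
  independent contractions. The lower bound on \<open>N\<close> shows that there are fewer such pairs than
  tuples times \<open>card K - 1\<close>, so not every tuple is bad. In characteristic 0, write the coefficients
  of a good tuple in characteristic 2 as powers of a generator of the cyclic group of units of \<open>K\<close>
  and replace the generator by a general element: the minors lift to nonzero integer polynomials.
\<close>

section \<open>Linear systems and minors\<close>

text \<open>The lower bound on \<open>N\<close> is the condition \<open>n * N \<ge> dim S_3\<close>,
  which is necessary for \<open>R_3 = 0\<close>, and it leaves no slack: at equality, functionals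
  with independent contractions already amount to about one per tuple, so charging a bad tuple with
  a single functional cannot suffice. A bad tuple, however, carries all nonzero multiples of its
  functional, at least \<open>card K - 1\<close> of them, whereas each nonempty set of variables
  accounts for at most one pair per tuple on average. More than \<open>2 ^ n + 1\<close> elements in
  \<open>K\<close> are therefore enough. Counting replaces explicit tuples, which would be needed
  for every \<open>n\<close>, \<open>N\<close> and characteristic.

  Why degree 4 appears in \<open>Tor\<^sub>3\<close>: as \<open>R_3 = 0\<close>, all of
  \<open>\<Lambda>\<^sup>2 R_1 \<otimes> R_2\<close> consists of Koszul cycles. The boundaries and
  the products of two degree one cycles span a proper subspace when the count holds. A cycle outside
  it is a second Koszul homology class that is no sum of products, and such a class survives to
  \<open>Tor\<^sub>3\<close>.\<close>

lemma underdetermined_system: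
  fixes a :: "'e \<Rightarrow> 'x \<Rightarrow> 'k::field"
  assumes "finite E" "finite Y" "card E < card Y"
  shows "\<exists>c. (\<exists>x\<in>Y. c x \<noteq> 0) \<and> (\<forall>e\<in>E. (\<Sum>x\<in>Y. a e x * c x) = 0)"
  using assms
proof (induction E arbitrary: Y a rule: finite_induct)
  case empty
  then obtain x where "x \<in> Y" by fastforce
  then show ?case by (intro exI[of _ "\<lambda>_. 1"]) auto
next
  case (insert e E)
  show ?case
  proof (cases "\<forall>x\<in>Y. a e x = 0")
    case True
    have "card E < card Y" using insert by simp
    from insert.IH[OF insert.prems(1) this, of a] obtain c where
      "\<exists>x\<in>Y. c x \<noteq> 0" "\<forall>e\<in>E. (\<Sum>x\<in>Y. a e x * c x) = 0" by blast
    then show ?thesis using True by (intro exI[of _ c]) simp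
  next
    case False
    then obtain y where y: "y \<in> Y" "a e y \<noteq> 0" by blast
    define Y' where "Y' = Y - {y}"
    have Y: "finite Y'" "Y = insert y Y'" "y \<notin> Y'" using y insert.prems by (auto simp: Y'_def)
    then have "card E < card Y'" using insert by simp
    \<comment> \<open>Gaussian elimination: equation \<open>e\<close> is solved for the unknown
      \<open>y\<close> and substituted into the others.\<close>
    from insert.IH[OF Y(1) this, of "\<lambda>e' x. a e' x - a e' y * a e x / a e y"] obtain c where
      c: "\<exists>x\<in>Y'. c x \<noteq> 0"
         "\<And>e'. e' \<in> E \<Longrightarrow> (\<Sum>x\<in>Y'. (a e' x - a e' y * a e x / a e y) * c x) = 0" by blast
    define c' where "c' = c(y := - (\<Sum>x\<in>Y'. a e x * c x) / a e y)"
    have s: "(\<Sum>x\<in>Y. a e' x * c' x) = a e' y * c' y + (\<Sum>x\<in>Y'. a e' x * c x)" for e'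
    proof -
      have "(\<Sum>x\<in>Y'. a e' x * c' x) = (\<Sum>x\<in>Y'. a e' x * c x)"
        using Y(3) by (intro sum.cong) (auto simp: c'_def)
      then show ?thesis using Y by simp
    qed
    have "(\<Sum>x\<in>Y. a e' x * c' x) = 0" if "e' \<in> insert e E" for e'
    proof (cases "e' = e")
      case True then show ?thesis using y by (simp add: s) (simp add: c'_def)
    next
      case False
      then have "e' \<in> E" using that by simp
      from c(2)[OF this] have "(\<Sum>x\<in>Y'. a e' x * c x) = (\<Sum>x\<in>Y'. a e' y / a e y * (a e x * c x))"
        by (simp add: left_diff_distrib sum_subtractf mult.assoc)
      also have "\<dots> = a e' y / a e y * (\<Sum>x\<in>Y'. a e x * c x)" by (simp add: sum_distrib_left)
      finally show ?thesis unfolding s by (simp add: c'_def)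
    qed
    moreover have "\<exists>x\<in>Y. c' x \<noteq> 0" using c(1) Y by (auto simp: c'_def)
    ultimately show ?thesis by blast
  qed
qed

text \<open>Injectivity of the matrix on vectors supported on \<open>Y\<close>. Rows and columns are
  indexed by arbitrary sets, because the matrices met below have pairs and monomials as
  indices.\<close>

definition indep_cols :: "('e \<Rightarrow> 'x \<Rightarrow> 'k::field) \<Rightarrow> 'e set \<Rightarrow> 'x set \<Rightarrow> bool" where
  "indep_cols a E Y \<longleftrightarrow> (\<forall>c. (\<forall>e\<in>E. (\<Sum>x\<in>Y. a e x * c x) = 0) \<longrightarrow> (\<forall>x\<in>Y. c x = 0))"

lemma indep_cols_card_le:
  assumes "finite E" "finite Y" "indep_cols a E Y" shows "card Y \<le> card E"
  using underdetermined_system[OF assms(1,2), of a] assms(3) unfolding indep_cols_def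
  by (meson not_le_imp_less)

text \<open>If the rows had a dependency \<open>c\<close> with \<open>c e0\<close> nonzero, drop row
  \<open>e0\<close>: fewer equations than unknowns remain, so some nonzero \<open>d\<close>
  satisfies all of them. Pairing \<open>c\<close> with the values of the rows at \<open>d\<close>
  shows that \<open>d\<close> satisfies row \<open>e0\<close> as well.\<close>

lemma indep_cols_transpose:
  fixes a :: "'e \<Rightarrow> 'x \<Rightarrow> 'k::field"
  assumes fin: "finite E" "finite Y" and ind: "indep_cols a E Y" and card: "card E = card Y"
  shows "indep_cols (\<lambda>x e. a e x) Y E"
proof (rule ccontr)
  assume "\<not> ?thesis"
  then obtain c e0 where c: "\<And>x. x \<in> Y \<Longrightarrow> (\<Sum>e\<in>E. a e x * c e) = 0" and e0: "e0 \<in> E" "c e0 \<noteq> 0"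
    unfolding indep_cols_def by blast
  have "card (E - {e0}) < card Y" using card e0 fin by (metis card_Diff1_less)
  from underdetermined_system[OF _ fin(2) this, of a] fin obtain d where
    d: "\<exists>x\<in>Y. d x \<noteq> 0" "\<And>e. e \<in> E - {e0} \<Longrightarrow> (\<Sum>x\<in>Y. a e x * d x) = 0" by blast
  have "(\<Sum>e\<in>E. c e * (\<Sum>x\<in>Y. a e x * d x)) = (\<Sum>x\<in>Y. d x * (\<Sum>e\<in>E. a e x * c e))"
    by (simp add: sum_distrib_left, subst sum.swap, simp add: mult_ac)
  also have "\<dots> = 0" using c by simp
  finally have "c e0 * (\<Sum>x\<in>Y. a e0 x * d x) = 0"
    using d(2) e0 fin by (subst (asm) sum.remove[of _ e0]) auto
  then have "(\<Sum>x\<in>Y. a e0 x * d x) = 0" using e0 by simp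
  with d ind show False unfolding indep_cols_def by blast
qed

text \<open>Take a row set of least size that still gives independent columns. By minimality each
  row \<open>j\<close> has a vector with value 1 at \<open>j\<close> and 0 at the other chosen rows;
  these dual vectors bound the number of rows by that of the columns.\<close>

lemma indep_cols_square_subset:
  fixes a :: "'e \<Rightarrow> 'x \<Rightarrow> 'k::field"
  assumes fin: "finite E" "finite Y" and ind: "indep_cols a E Y"
  obtains J where "J \<subseteq> E" "card J = card Y" "indep_cols a J Y"
proof -
  let ?P = "\<lambda>J. J \<subseteq> E \<and> indep_cols a J Y"
  obtain J where J: "?P J" and min: "\<And>J'. ?P J' \<Longrightarrow> card J \<le> card J'"
    using ex_has_least_nat[of ?P E card] ind by blast
  have finJ: "finite J" using J fin finite_subset by blast
  have "\<exists>v. (\<Sum>x\<in>Y. a j x * v x) = 1 \<and> (\<forall>e\<in>J - {j}. (\<Sum>x\<in>Y. a e x * v x) = 0)" if "j \<in> J" for j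
  proof -
    have "\<not> ?P (J - {j})" using min[of "J - {j}"] that finJ by (meson card_Diff1_less not_le)
    then obtain v x where v: "\<forall>e\<in>J - {j}. (\<Sum>x\<in>Y. a e x * v x) = 0" "x \<in> Y" "v x \<noteq> 0"
      using J unfolding indep_cols_def by blast
    then have nz: "(\<Sum>x\<in>Y. a j x * v x) \<noteq> 0" using J unfolding indep_cols_def by blast
    show ?thesis
      using v(1) nz
      by (intro exI[of _ "\<lambda>x. v x / (\<Sum>x\<in>Y. a j x * v x)"])
         (simp add: sum_divide_distrib[symmetric])
  qed
  then obtain v where v: "\<And>j. j \<in> J \<Longrightarrow> (\<Sum>x\<in>Y. a j x * v j x) = 1"
     "\<And>j e. j \<in> J \<Longrightarrow> e \<in> J \<Longrightarrow> e \<noteq> j \<Longrightarrow> (\<Sum>x\<in>Y. a e x * v j x) = 0" by (metis DiffI singletonD)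
  have "indep_cols (\<lambda>x j. v j x) Y J"
    unfolding indep_cols_def
  proof (intro allI impI ballI)
    fix c j assume c: "\<forall>x\<in>Y. (\<Sum>j\<in>J. v j x * c j) = 0" and j: "j \<in> J"
    have "(\<Sum>i\<in>J. c i * (\<Sum>x\<in>Y. a j x * v i x)) = (\<Sum>x\<in>Y. a j x * (\<Sum>i\<in>J. v i x * c i))"
      by (simp add: sum_distrib_left, subst sum.swap, simp add: mult_ac)
    also have "\<dots> = 0" using c by simp
    finally have "c j + (\<Sum>i\<in>J - {j}. c i * (\<Sum>x\<in>Y. a j x * v i x)) = 0"
      using v j finJ by (subst (asm) sum.remove[of _ j]) auto
    moreover have "(\<Sum>i\<in>J - {j}. c i * (\<Sum>x\<in>Y. a j x * v i x)) = 0"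
      using v(2) j by (intro sum.neutral) auto
    ultimately show "c j = 0" by simp
  qed
  then have "card J \<le> card Y" using indep_cols_card_le fin finJ by blast
  moreover have "card Y \<le> card J" using indep_cols_card_le fin finJ J by blast
  ultimately show ?thesis using J that by (meson le_antisym)
qed

text \<open>The target \<open>t\<close> is treated as one further vector, so that the homogeneous
  system has one unknown too many. In a nonzero solution the coefficient of \<open>t\<close> cannot
  vanish, since the transposed square system is injective.\<close>

lemma indep_cols_square_solve:
  fixes a :: "'e \<Rightarrow> 'x \<Rightarrow> 'k::field"
  assumes fin: "finite E" "finite Y" and ind: "indep_cols a E Y" and card: "card E = card Y"
  obtains c where "\<And>x. x \<in> Y \<Longrightarrow> (\<Sum>e\<in>E. c e * a e x) = t x"
proof -
  define a' where "a' = (\<lambda>x (e :: 'e option). case e of None \<Rightarrow> t x | Some e \<Rightarrow> a e x)"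
  have cd: "card Y < card (insert None (Some ` E))"
    using fin card by (simp add: card_image)
  from underdetermined_system[OF fin(2) _ this, of a'] fin obtain c where
    c: "\<exists>e\<in>insert None (Some ` E). c e \<noteq> 0"
       "\<And>x. x \<in> Y \<Longrightarrow> (\<Sum>e\<in>insert None (Some ` E). a' x e * c e) = 0" by blast
  have s: "t x * c None + (\<Sum>e\<in>E. a e x * c (Some e)) = 0" if "x \<in> Y" for x
    using c(2)[OF that] fin by (subst (asm) sum.insert) (auto simp: a'_def sum.reindex)
  have "c None \<noteq> 0"
  proof
    assume 0: "c None = 0"
    then have "\<forall>e\<in>E. c (Some e) = 0"
      using indep_cols_transpose[OF fin ind card, unfolded indep_cols_def,
          THEN spec, of "\<lambda>e. c (Some e)"] s by simp
    with 0 c(1) show False by auto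
  qed
  show ?thesis
  proof (rule that[of "\<lambda>e. - c (Some e) / c None"])
    fix x assume "x \<in> Y"
    have "(\<Sum>e\<in>E. - c (Some e) / c None * a e x) = - (\<Sum>e\<in>E. a e x * c (Some e)) / c None"
      by (simp add: sum_divide_distrib sum_negf mult.commute)
    also have "\<dots> = t x" using s[OF \<open>x \<in> Y\<close>] \<open>c None \<noteq> 0\<close>
      by (simp add: field_simps add_eq_0_iff)
    finally show "(\<Sum>e\<in>E. - c (Some e) / c None * a e x) = t x" .
  qed
qed

text \<open>Links the set-indexed condition to determinants, which are polynomial in the entries.
  Other enumerations \<open>\<sigma>\<close> and \<open>\<tau>\<close> would change only the
  sign.\<close>

lemma det_nonzero_iff_indep_cols:
  fixes a :: "'e \<Rightarrow> 'x \<Rightarrow> 'k::field"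
  assumes \<sigma>: "bij_betw \<sigma> {..<d} E" and \<tau>: "bij_betw \<tau> {..<d} Y"
  shows "Determinant.det (Matrix.mat d d (\<lambda>(i, j). a (\<sigma> i) (\<tau> j))) \<noteq> 0 \<longleftrightarrow> indep_cols a E Y"
proof -
  let ?A = "Matrix.mat d d (\<lambda>(i, j). a (\<sigma> i) (\<tau> j))"
  have row: "vec_index (?A *\<^sub>v v) i = (\<Sum>j<d. a (\<sigma> i) (\<tau> j) * vec_index v j)" if "v \<in> carrier_vec d" "i < d" for v i
    using that by (simp add: scalar_prod_def lessThan_atLeast0)
  have re: "(\<Sum>x\<in>Y. g x) = (\<Sum>j<d. g (\<tau> j))" for g :: "'x \<Rightarrow> 'k"
    using sum.reindex_bij_betw[OF \<tau>, of g] by simp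
  have "Determinant.det ?A = 0 \<longleftrightarrow> (\<exists>v. v \<in> carrier_vec d \<and> v \<noteq> 0\<^sub>v d \<and> ?A *\<^sub>v v = 0\<^sub>v d)"
    by (rule det_0_iff_vec_prod_zero_field) simp
  also have "\<dots> \<longleftrightarrow> \<not> indep_cols a E Y"
  proof
    assume "\<exists>v. v \<in> carrier_vec d \<and> v \<noteq> 0\<^sub>v d \<and> ?A *\<^sub>v v = 0\<^sub>v d"
    then obtain v where v: "v \<in> carrier_vec d" "v \<noteq> 0\<^sub>v d" "?A *\<^sub>v v = 0\<^sub>v d" by blast
    from v(1,2) obtain j where j: "j < d" "vec_index v j \<noteq> 0" by (metis eq_vecI carrier_vecD index_zero_vec)
    define c where "c x = vec_index v (inv_into {..<d} \<tau> x)" for x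
    have ct: "c (\<tau> j) = vec_index v j" if "j < d" for j
      using \<tau> that by (simp add: c_def bij_betw_def inv_into_f_f)
    have "(\<Sum>x\<in>Y. a e x * c x) = 0" if "e \<in> E" for e
    proof -
      from that \<sigma> obtain i where i: "i < d" "e = \<sigma> i" unfolding bij_betw_def by auto
      have "(\<Sum>x\<in>Y. a e x * c x) = vec_index (?A *\<^sub>v v) i"
        unfolding re row[OF v(1) i(1)] i(2) by (intro sum.cong) (auto simp: ct)
      then show ?thesis using v(3) i by simp
    qed
    moreover have "\<tau> j \<in> Y" "c (\<tau> j) \<noteq> 0" using j ct \<tau> by (auto simp: bij_betw_def)
    ultimately show "\<not> indep_cols a E Y" unfolding indep_cols_def by blast
  next
    assume "\<not> indep_cols a E Y"
    then obtain c x where c: "\<And>e. e \<in> E \<Longrightarrow> (\<Sum>x\<in>Y. a e x * c x) = 0" "x \<in> Y" "c x \<noteq> 0"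
      unfolding indep_cols_def by blast
    define v where "v = Matrix.vec d (\<lambda>j. c (\<tau> j))"
    have v: "v \<in> carrier_vec d" by (simp add: v_def)
    obtain j where j: "j < d" "x = \<tau> j" using c(2) \<tau> unfolding bij_betw_def by auto
    have "v \<noteq> 0\<^sub>v d"
    proof
      assume "v = 0\<^sub>v d"
      then have "vec_index v j = 0" using j by simp
      then show False using j c by (simp add: v_def)
    qed
    moreover have "?A *\<^sub>v v = 0\<^sub>v d"
    proof (rule eq_vecI)
      fix i assume "i < dim_vec (0\<^sub>v d :: 'k Matrix.vec)"
      then have i: "i < d" by simp
      have "vec_index (?A *\<^sub>v v) i = (\<Sum>x\<in>Y. a (\<sigma> i) x * c x)"
        unfolding re row[OF v i] by (intro sum.cong) (auto simp: v_def)
      also have "\<dots> = 0" using c(1) \<sigma> i by (auto simp: bij_betw_def)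
      finally show "vec_index (?A *\<^sub>v v) i = vec_index (0\<^sub>v d) i" using i by simp
    qed simp
    ultimately show "\<exists>v. v \<in> carrier_vec d \<and> v \<noteq> 0\<^sub>v d \<and> ?A *\<^sub>v v = 0\<^sub>v d" using v by blast
  qed
  finally show ?thesis by blast
qed

section \<open>Homogeneous polynomials\<close>

abbreviation lk :: "('a \<Rightarrow>\<^sub>0 'b::zero) \<Rightarrow> 'a \<Rightarrow> 'b" where "lk \<equiv> Poly_Mapping.lookup"

definition cst :: "'k \<Rightarrow> ('v, 'k::field) mpoly" where
  "cst c = Poly_Mapping.single 0 c"

definition evar :: "'v \<Rightarrow> 'v \<Rightarrow>\<^sub>0 nat" where
  "evar v = Poly_Mapping.single v 1"

definition pvar :: "'v \<Rightarrow> ('v, 'k::field) mpoly" where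
  "pvar v = Poly_Mapping.single (evar v) 1"

lemma lk_evar: "lk (evar v) w = (if v = w then 1 else 0)"
  by (simp add: evar_def lookup_single when_def)

lemma lk_sum_fun: "lk (\<Sum>i\<in>A. f i) u = (\<Sum>i\<in>A. lk (f i) u)"
  by (rule lookup_sum)

lemma poly_mapping_expand:
  assumes "finite A" "Poly_Mapping.keys p \<subseteq> A"
  shows "p = (\<Sum>u\<in>A. Poly_Mapping.single u (lk p u))"
proof (rule poly_mapping_eqI)
  fix w
  have "lk (\<Sum>u\<in>A. Poly_Mapping.single u (lk p u)) w = (\<Sum>u\<in>A. if u = w then lk p u else 0)"
    by (auto simp: lookup_sum lookup_single when_def intro!: sum.cong)
  also have "\<dots> = lk p w" using assms by (auto simp: in_keys_iff)
  finally show "lk p w = lk (\<Sum>u\<in>A. Poly_Mapping.single u (lk p u)) w" ..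
qed

lemma cst_0 [simp]: "cst 0 = 0" and cst_1 [simp]: "cst 1 = 1"
  and cst_add: "cst (a + b) = cst a + cst b" and cst_mult: "cst (a * b) = cst a * cst b"
  and cst_uminus: "cst (- a) = - cst a"
  by (simp_all add: cst_def single_add mult_single single_uminus)

lemma cst_sum: "cst (\<Sum>i\<in>A. f i) = (\<Sum>i\<in>A. cst (f i))"
  by (induction A rule: infinite_finite_induct) (auto simp: cst_add)

lemma lk_cst_mult: "lk (cst c * p) u = c * lk p u"
  unfolding cst_def mult_map_scale_conv_mult[symmetric]
  by (simp add: Poly_Mapping.map.rep_eq when_def)

lemma single_conv_mult: "Poly_Mapping.single u c = cst c * Poly_Mapping.single u (1 :: 'k::field)"
  by (simp add: cst_def mult_single)

lemma single_mult_expand: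
  "Poly_Mapping.single m c * p = (\<Sum>u\<in>Poly_Mapping.keys p. Poly_Mapping.single (m + u) (c * lk p u))"
  for p :: "('v, 'k::field) mpoly"
  by (subst poly_mapping_expand[OF finite_keys subset_refl, of p])
     (simp add: sum_distrib_left mult_single)

lemma lk_single_mult:
  fixes p :: "('v, 'k::field) mpoly"
  shows "lk (Poly_Mapping.single m c * p) (m + u) = c * lk p u"
proof -
  have "lk (Poly_Mapping.single m c * p) (m + u)
      = (\<Sum>w\<in>Poly_Mapping.keys p. if w = u then c * lk p w else 0)"
    unfolding single_mult_expand lookup_sum
    by (intro sum.cong) (auto simp: lookup_single when_def)
  also have "\<dots> = c * lk p u" by (auto simp: in_keys_iff)
  finally show ?thesis .
qed

lemma lk_single_mult_outside:
  fixes p :: "('v, 'k::field) mpoly"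
  assumes "\<And>u. w \<noteq> m + u"
  shows "lk (Poly_Mapping.single m c * p) w = 0"
  unfolding single_mult_expand lookup_sum
  by (intro sum.neutral) (use assms in \<open>auto simp: lookup_single when_def\<close>)

lemma lk_pvar_mult [simp]: "lk (pvar v * p) (evar v + u) = lk p u"
  by (simp add: pvar_def lk_single_mult)

lemma evar_add_diff: "lk u v > 0 \<Longrightarrow> evar v + (u - evar v) = (u :: 'v \<Rightarrow>\<^sub>0 nat)"
  by (rule poly_mapping_eqI) (auto simp: lookup_add lookup_minus lk_evar)

lemma lk_pvar_mult':
  "lk (pvar v * p) w = (if lk w v > 0 then lk p (w - evar v) else 0)"
proof (cases "lk w v > 0")
  case True
  then show ?thesis using lk_pvar_mult[of v p "w - evar v"] evar_add_diff[OF True] by metis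
next
  case False
  have "w \<noteq> evar v + u" for u
  proof
    assume "w = evar v + u"
    then have "lk w v = Suc (lk u v)" by (simp add: lookup_add lk_evar)
    with False show False by simp
  qed
  then show ?thesis using False by (simp add: pvar_def lk_single_mult_outside)
qed

lemma mdeg_add [simp]: "mdeg (u + w) = mdeg u + mdeg w"
  by (simp add: mdeg_def lookup_add sum.distrib)

lemma mdeg_0 [simp]: "mdeg 0 = 0"
  by (simp add: mdeg_def)

lemma mdeg_evar [simp]: "mdeg (evar v) = 1"
  by (simp add: mdeg_def lk_evar)

lemma mdeg_eq_0_iff [simp]: "mdeg u = 0 \<longleftrightarrow> u = 0"
  by (auto simp: mdeg_def intro: poly_mapping_eqI)

lemma mdeg_pos_var: "mdeg u > 0 \<Longrightarrow> \<exists>v. lk u v > 0"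
  by (metis mdeg_eq_0_iff less_irrefl neq0_conv lookup_zero poly_mapping_eqI)

lemma mdeg_diff_evar: "lk u v > 0 \<Longrightarrow> Suc (mdeg (u - evar v)) = mdeg u"
  using mdeg_add[of "evar v" "u - evar v"] by (simp add: evar_add_diff)

lemma formsD: "p \<in> forms d \<Longrightarrow> mdeg u \<noteq> d \<Longrightarrow> lk p u = 0"
  by (auto simp: forms_def in_keys_iff)

lemma formsI: "(\<And>u. mdeg u \<noteq> d \<Longrightarrow> lk p u = 0) \<Longrightarrow> p \<in> forms d"
  by (auto simp: forms_def in_keys_iff)

lemma forms_0 [simp]: "0 \<in> forms d"
  by (simp add: forms_def)

lemma forms_add: "p \<in> forms d \<Longrightarrow> q \<in> forms d \<Longrightarrow> p + q \<in> forms d"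
  by (intro formsI) (simp add: lookup_add formsD)

lemma forms_uminus: "p \<in> forms d \<Longrightarrow> - p \<in> forms d"
  by (intro formsI) (simp add: formsD)

lemma forms_diff: "p \<in> forms d \<Longrightarrow> q \<in> forms d \<Longrightarrow> p - q \<in> forms d"
  by (intro formsI) (simp add: lookup_minus formsD)

lemma forms_sum: "(\<And>i. i \<in> A \<Longrightarrow> f i \<in> forms d) \<Longrightarrow> (\<Sum>i\<in>A. f i) \<in> forms d"
  by (induction A rule: infinite_finite_induct) (auto intro: forms_add)

lemma forms_mult: "p \<in> forms d \<Longrightarrow> q \<in> forms e \<Longrightarrow> p * q \<in> forms (d + e)"
  unfolding forms_def using keys_mult[of p q] by fastforce

lemma forms_single: "mdeg u = d \<Longrightarrow> Poly_Mapping.single u c \<in> forms d"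
  by (auto simp: forms_def split: if_splits)

lemma forms_cst [simp]: "cst c \<in> forms 0"
  by (simp add: cst_def forms_single)

lemma forms_pvar [simp]: "pvar v \<in> forms 1" "pvar v \<in> forms (Suc 0)"
  by (simp_all add: pvar_def forms_single)

lemma forms_cst_mult: "p \<in> forms d \<Longrightarrow> cst c * p \<in> forms d"
  using forms_mult[OF forms_cst, of p d c] by simp

lemma forms_pvar_mult: "p \<in> forms d \<Longrightarrow> pvar v * p \<in> forms (Suc d)"
  using forms_mult[OF forms_pvar(1), of p d v] by simp

lemma forms_0_eq_cst: "p \<in> forms 0 \<Longrightarrow> p = cst (lk p 0)"
proof (rule poly_mapping_eqI)
  fix u assume p: "p \<in> forms 0"
  show "lk p u = lk (cst (lk p 0)) u"
    using formsD[OF p, of u] by (cases "u = 0") (auto simp: cst_def lookup_single when_def)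
qed

section \<open>Homogeneous components\<close>

definition hcomp :: "nat \<Rightarrow> ('v::finite, 'k::field) mpoly \<Rightarrow> ('v, 'k) mpoly" where
  "hcomp e p = Poly_Mapping.mapp (\<lambda>u c. if mdeg u = e then c else 0) p"

lemma lk_hcomp: "lk (hcomp e p) u = (if mdeg u = e then lk p u else 0)"
  by (auto simp: hcomp_def lookup_mapp when_def in_keys_iff)

lemma hcomp_in_forms [simp]: "hcomp e p \<in> forms e"
  by (intro formsI) (simp add: lk_hcomp)

lemma hcomp_0 [simp]: "hcomp e 0 = 0"
  and hcomp_add: "hcomp e (p + q) = hcomp e p + hcomp e q"
  and hcomp_diff: "hcomp e (p - q) = hcomp e p - hcomp e q"
  and hcomp_uminus: "hcomp e (- p) = - hcomp e p"
  by (rule poly_mapping_eqI, simp add: lk_hcomp lookup_add lookup_minus)+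

lemma hcomp_sum: "hcomp e (\<Sum>i\<in>A. f i) = (\<Sum>i\<in>A. hcomp e (f i))"
  by (induction A rule: infinite_finite_induct) (auto simp: hcomp_add)

lemma hcomp_forms: "p \<in> forms d \<Longrightarrow> hcomp e p = (if e = d then p else 0)"
  by (rule poly_mapping_eqI) (auto simp: lk_hcomp dest: formsD)

lemma sum_hcomp:
  assumes "finite A" "mdeg ` Poly_Mapping.keys p \<subseteq> A"
  shows "(\<Sum>e\<in>A. hcomp e p) = p"
proof (rule poly_mapping_eqI)
  fix u
  have "lk (\<Sum>e\<in>A. hcomp e p) u = (\<Sum>e\<in>A. if e = mdeg u then lk p u else 0)"
    by (auto simp: lookup_sum lk_hcomp intro!: sum.cong)
  also have "\<dots> = lk p u"
  proof (cases "mdeg u \<in> A")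
    case False
    then have "u \<notin> Poly_Mapping.keys p" using assms by blast
    then show ?thesis using False assms by (simp add: in_keys_iff)
  qed (use assms in simp)
  finally show "lk (\<Sum>e\<in>A. hcomp e p) u = lk p u" .
qed

lemma hcomp_mult_forms:
  assumes "q \<in> forms d"
  shows "hcomp e (q * p) = (if d \<le> e then q * hcomp (e - d) p else 0)"
proof -
  have "q * p = (\<Sum>a\<in>mdeg ` Poly_Mapping.keys p. q * hcomp a p)"
    by (subst sum_hcomp[OF _ subset_refl, of p, symmetric]) (auto simp: sum_distrib_left)
  then have "hcomp e (q * p) = (\<Sum>a\<in>mdeg ` Poly_Mapping.keys p. hcomp e (q * hcomp a p))"
    by (simp add: hcomp_sum)
  also have "\<dots> = (\<Sum>a\<in>mdeg ` Poly_Mapping.keys p. if d + a = e then q * hcomp a p else 0)"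
    by (intro sum.cong refl) (auto simp: hcomp_forms[OF forms_mult[OF assms hcomp_in_forms]])
  also have "\<dots> = (if d \<le> e then q * hcomp (e - d) p else 0)"
  proof (cases "d \<le> e")
    case True
    have "(\<Sum>a\<in>mdeg ` Poly_Mapping.keys p. if d + a = e then q * hcomp a p else 0)
       = (\<Sum>a\<in>mdeg ` Poly_Mapping.keys p. if a = e - d then q * hcomp a p else 0)"
      using True by (intro sum.cong) auto
    also have "\<dots> = q * hcomp (e - d) p"
    proof -
      have "hcomp (e - d) p = 0" if "e - d \<notin> mdeg ` Poly_Mapping.keys p"
      proof (rule poly_mapping_eqI)
        fix u show "lk (hcomp (e - d) p) u = lk 0 u"
          using that by (auto simp: lk_hcomp) (metis imageI in_keys_iff)
      qed
      then show ?thesis by (auto simp: sum.delta)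
    qed
    finally show ?thesis using True by simp
  qed (auto intro!: sum.neutral)
  finally show ?thesis .
qed

lemma hcomp_cst_mult: "hcomp e (cst c * p) = cst c * hcomp e p"
  by (simp add: hcomp_mult_forms[OF forms_cst])

lemma hcomp_mult: "hcomp e (q * p) = (\<Sum>a\<le>e. hcomp a q * hcomp (e - a) p)"
proof -
  let ?A = "{..e} \<union> mdeg ` Poly_Mapping.keys q"
  have "q * p = (\<Sum>a\<in>?A. hcomp a q * p)"
    by (subst sum_hcomp[of ?A q, symmetric]) (auto simp: sum_distrib_right)
  then have "hcomp e (q * p) = (\<Sum>a\<in>?A. if a \<le> e then hcomp a q * hcomp (e - a) p else 0)"
    by (simp add: hcomp_sum hcomp_mult_forms[OF hcomp_in_forms])
  also have "\<dots> = (\<Sum>a\<in>{..e}. if a \<le> e then hcomp a q * hcomp (e - a) p else 0)"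
    by (rule sum.mono_neutral_right) auto
  finally show ?thesis by simp
qed

text \<open>Each monomial is charged to one variable \<open>\<phi> u\<close> of \<open>A\<close>
  that divides it, and \<open>h v\<close> collects the quotients charged to \<open>v\<close>. The
  second conclusion keeps track of the degree when \<open>p\<close> is homogeneous.\<close>

lemma split_by_variables:
  fixes p :: "('v::finite, 'k::field) mpoly"
  assumes "\<And>u. u \<in> Poly_Mapping.keys p \<Longrightarrow> \<exists>v\<in>A. lk u v > 0"
  obtains h where "p = (\<Sum>v\<in>A. pvar v * h v)" "\<And>e v. p \<in> forms (Suc e) \<Longrightarrow> h v \<in> forms e"
proof -
  obtain \<phi> where \<phi>: "\<And>u. u \<in> Poly_Mapping.keys p \<Longrightarrow> \<phi> u \<in> A \<and> lk u (\<phi> u) > 0"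
    using assms by metis
  define h where "h v = (\<Sum>u\<in>{u\<in>Poly_Mapping.keys p. \<phi> u = v}. Poly_Mapping.single (u - evar v) (lk p u))" for v
  have "pvar v * h v = (\<Sum>u\<in>{u\<in>Poly_Mapping.keys p. \<phi> u = v}. Poly_Mapping.single u (lk p u))" for v
    unfolding h_def sum_distrib_left
    by (intro sum.cong) (use \<phi> in \<open>auto simp: pvar_def mult_single evar_add_diff\<close>)
  then have "(\<Sum>v\<in>A. pvar v * h v)
      = (\<Sum>v\<in>A. \<Sum>u\<in>{u\<in>Poly_Mapping.keys p. \<phi> u = v}. Poly_Mapping.single u (lk p u))" by simp
  also have "\<dots> = (\<Sum>u\<in>Poly_Mapping.keys p. Poly_Mapping.single u (lk p u))"
    by (rule sum.group) (use \<phi> in auto)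
  also have "\<dots> = p" using poly_mapping_expand[OF finite_keys subset_refl, of p] by simp
  finally have 1: "p = (\<Sum>v\<in>A. pvar v * h v)" by simp
  have 2: "h v \<in> forms e" if "p \<in> forms (Suc e)" for e v
    unfolding h_def
  proof (intro forms_sum forms_single)
    fix u assume u: "u \<in> {u \<in> Poly_Mapping.keys p. \<phi> u = v}"
    then have "mdeg u = Suc e" using that by (auto simp: forms_def)
    then show "mdeg (u - evar v) = e" using mdeg_diff_evar[of u v] \<phi> u by auto
  qed
  show ?thesis using that 1 2 by blast
qed

lemma expand_forms_Suc:
  fixes p :: "('v::finite, 'k::field) mpoly"
  assumes "lk p 0 = 0"
  obtains h where "p = (\<Sum>v\<in>UNIV. pvar v * h v)" "\<And>e v. p \<in> forms (Suc e) \<Longrightarrow> h v \<in> forms e"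
proof -
  have "\<exists>v\<in>UNIV. lk u v > 0" if "u \<in> Poly_Mapping.keys p" for u
    using that assms mdeg_pos_var[of u] by (metis UNIV_I gr0I in_keys_iff mdeg_eq_0_iff)
  from split_by_variables[OF this] that show ?thesis by blast
qed

lemma forms_1_expand:
  assumes "p \<in> forms 1" shows "p = (\<Sum>v\<in>UNIV. cst (lk p (evar v)) * pvar v)"
proof -
  obtain h where h: "p = (\<Sum>v\<in>UNIV. pvar v * h v)" "\<And>e v. p \<in> forms (Suc e) \<Longrightarrow> h v \<in> forms e"
    using expand_forms_Suc[of p] formsD[OF assms, of 0] by auto
  have hv: "h v = cst (lk (h v) 0)" for v using h(2)[of 0 v] assms forms_0_eq_cst by simp
  have "lk p (evar w) = lk (h w) 0" for w
  proof -
    have "lk p (evar w) = (\<Sum>v\<in>UNIV. lk (pvar v * h v) (evar w))"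
      by (subst h(1)) (simp add: lookup_sum)
    also have "\<dots> = (\<Sum>v\<in>UNIV. if v = w then lk (h v) 0 else 0)"
      by (intro sum.cong) (auto simp: lk_pvar_mult' lk_evar)
    finally show ?thesis by simp
  qed
  then show ?thesis using h(1) hv by (metis (no_types, lifting) mult.commute sum.cong)
qed

text \<open>Induction on the variables. Modulo the variables in \<open>A\<close> the relation reads
  \<open>s a * pvar a = 0\<close>, so \<open>s a\<close> lies in their ideal, say with coefficients
  \<open>h\<close>; moving \<open>h v * pvar a\<close> into \<open>s v\<close> leaves a relation
  among the variables of \<open>A\<close> alone. The diagonal of \<open>\<kappa>\<close> is
  mentioned separately, because antisymmetry does not make it vanish in characteristic 2.\<close>

lemma koszul_relation:
  fixes s :: "'v::finite \<Rightarrow> ('v, 'k::field) mpoly"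
  assumes "finite A" "(\<Sum>v\<in>A. s v * pvar v) = 0"
  shows "\<exists>\<kappa>. (\<forall>v\<in>A. s v = (\<Sum>w\<in>A. \<kappa> v w * pvar w)) \<and>
    (\<forall>v w. \<kappa> v w = - \<kappa> w v) \<and> (\<forall>v. \<kappa> v v = 0) \<and>
    (\<forall>e. (\<forall>v\<in>A. s v \<in> forms (Suc e)) \<longrightarrow> (\<forall>v w. \<kappa> v w \<in> forms e))"
  using assms
proof (induction A arbitrary: s rule: finite_induct)
  case empty
  show ?case by (intro exI[of _ "\<lambda>_ _. 0"]) auto
next
  case (insert a A)
  have rel: "s a * pvar a = - (\<Sum>v\<in>A. s v * pvar v)"
    using insert.prems insert.hyps by (simp add: eq_neg_iff_add_eq_0)
  have "\<exists>v\<in>A. lk u v > 0" if u: "u \<in> Poly_Mapping.keys (s a)" for u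
  proof (rule ccontr)
    assume "\<not> ?thesis"
    then have 0: "lk u v = 0" if "v \<in> A" for v using that by auto
    \<comment> \<open>A monomial of \<open>s a\<close> free of the variables in \<open>A\<close>
      stays free of them after multiplication by \<open>pvar a\<close>, so no other summand can
      cancel it.\<close>
    have "lk (s v * pvar v) (evar a + u) = 0" if "v \<in> A" for v
    proof -
      have "v \<noteq> a" using that insert.hyps by auto
      then have "\<not> lk (evar a + u) v > 0" using 0[OF that] by (simp add: lookup_add lk_evar)
      then show ?thesis by (simp add: lk_pvar_mult' mult.commute[of "s v"])
    qed
    then have "lk (s a * pvar a) (evar a + u) = 0"
      unfolding rel by (simp add: lookup_sum)
    then show False using u by (simp add: mult.commute[of "s a"] in_keys_iff)
  qed
  from split_by_variables[OF this] obtain h where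
    h: "s a = (\<Sum>v\<in>A. pvar v * h v)" "\<And>e v. s a \<in> forms (Suc e) \<Longrightarrow> h v \<in> forms e" by blast
  have "(\<Sum>v\<in>A. (s v + h v * pvar a) * pvar v)
      = (\<Sum>v\<in>A. s v * pvar v) + (\<Sum>v\<in>A. pvar v * h v) * pvar a"
    by (simp add: algebra_simps sum.distrib sum_distrib_left)
  also have "\<dots> = 0" using rel h(1) by simp
  finally have rel': "(\<Sum>v\<in>A. (s v + h v * pvar a) * pvar v) = 0" .
  from insert.IH[OF rel'] obtain \<kappa> where \<kappa>:
    "\<forall>v\<in>A. s v + h v * pvar a = (\<Sum>w\<in>A. \<kappa> v w * pvar w)"
    "\<forall>v w. \<kappa> v w = - \<kappa> w v" "\<forall>v. \<kappa> v v = 0"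
    "\<forall>e. (\<forall>v\<in>A. s v + h v * pvar a \<in> forms (Suc e)) \<longrightarrow> (\<forall>v w. \<kappa> v w \<in> forms e)"
    by blast
  define \<kappa>' where "\<kappa>' v w = (if v = a \<and> w \<in> A then h w else if w = a \<and> v \<in> A then - h v
      else if v \<in> A \<and> w \<in> A then \<kappa> v w else 0)" for v w
  show ?case
  proof (intro exI[of _ \<kappa>'] conjI ballI allI impI)
    fix v assume v: "v \<in> insert a A"
    show "s v = (\<Sum>w\<in>insert a A. \<kappa>' v w * pvar w)"
    proof (cases "v = a")
      case True
      have "(\<Sum>w\<in>A. \<kappa>' v w * pvar w) = (\<Sum>w\<in>A. pvar w * h w)"
        using True by (intro sum.cong) (auto simp: \<kappa>'_def mult.commute)
      moreover have "\<kappa>' v a = 0" using True insert.hyps by (simp add: \<kappa>'_def)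
      ultimately show ?thesis using True h(1) insert.hyps by simp
    next
      case False
      then have vA: "v \<in> A" using v by simp
      have "(\<Sum>w\<in>A. \<kappa>' v w * pvar w) = (\<Sum>w\<in>A. \<kappa> v w * pvar w)"
        using False vA insert.hyps by (intro sum.cong) (auto simp: \<kappa>'_def)
      then have "(\<Sum>w\<in>insert a A. \<kappa>' v w * pvar w) = - h v * pvar a + (s v + h v * pvar a)"
        using insert.hyps False vA by (simp add: \<kappa>(1)[rule_format, OF vA, symmetric]) (simp add: \<kappa>'_def)
      then show ?thesis by simp
    qed
  next
    fix v w show "\<kappa>' v w = - \<kappa>' w v" using insert.hyps by (simp add: \<kappa>'_def) (metis \<kappa>(2) add.inverse_inverse)
  next
    fix v show "\<kappa>' v v = 0" using \<kappa>(3) insert.hyps by (auto simp: \<kappa>'_def)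
  next
    fix e v w assume f: "\<forall>v\<in>insert a A. s v \<in> forms (Suc e)"
    then have h': "h v \<in> forms e" for v using h(2) by simp
    have "h v * pvar a \<in> forms (Suc e)" for v
      using forms_pvar_mult[OF h', of a v] by (simp add: mult.commute)
    then have "s v + h v * pvar a \<in> forms (Suc e)" if "v \<in> A" for v
      using that f by (intro forms_add) auto
    then have "\<kappa> v w \<in> forms e" using \<kappa>(4) by blast
    with h' show "\<kappa>' v w \<in> forms e" by (auto simp: \<kappa>'_def forms_uminus)
  qed
qed

section \<open>Monomials of a given degree in a given set of variables\<close>

definition mons :: "'v set \<Rightarrow> nat \<Rightarrow> ('v::finite \<Rightarrow>\<^sub>0 nat) set" where
  "mons P d = {u. Poly_Mapping.keys u \<subseteq> P \<and> mdeg u = d}"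

lemma mons_iff: "u \<in> mons P d \<longleftrightarrow> (\<forall>x. x \<notin> P \<longrightarrow> lk u x = 0) \<and> mdeg u = d"
  by (auto simp: mons_def in_keys_iff)

text \<open>Pascal's rule: a monomial of degree \<open>Suc d\<close> in \<open>insert a P\<close>
  either avoids \<open>a\<close> or is \<open>a\<close> times one of degree \<open>d\<close>.
  Truncated subtraction gives the right value for empty \<open>P\<close>, namely 1 in degree 0 and 0
  above.\<close>

lemma finite_card_mons:
  fixes P :: "'v::finite set"
  shows "finite (mons P d) \<and> card (mons P d) = (card P + d - 1) choose d"
proof -
  have "finite P" by simp
  then show ?thesis
  proof (induction P arbitrary: d rule: finite_induct)
    case empty
    have k: "Poly_Mapping.keys u \<subseteq> {} \<longleftrightarrow> u = 0" for u :: "'v \<Rightarrow>\<^sub>0 nat"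
    proof
      assume "Poly_Mapping.keys u \<subseteq> {}"
      then have "lk u x = lk 0 x" for x by (metis empty_iff in_keys_iff lookup_zero subsetD)
      then show "u = 0" by (rule poly_mapping_eqI)
    qed simp
    have "mons {} d = (if d = 0 then {0 :: 'v \<Rightarrow>\<^sub>0 nat} else {})"
      unfolding mons_def k by auto
    then show ?case by (cases d) auto
  next
    case (insert a P)
    show ?case
    proof (induction d)
      case 0
      have "mons (insert a P) 0 = {0}" by (auto simp: mons_iff)
      then show ?case by simp
    next
      case (Suc d)
      have eq: "mons (insert a P) (Suc d) = mons P (Suc d) \<union> (\<lambda>u. evar a + u) ` mons (insert a P) d"
      proof (intro equalityI subsetI)
        fix u assume u: "u \<in> mons (insert a P) (Suc d)"
        show "u \<in> mons P (Suc d) \<union> (\<lambda>u. evar a + u) ` mons (insert a P) d"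
        proof (cases "lk u a > 0")
          case True
          have "u - evar a \<in> mons (insert a P) d"
            using u mdeg_diff_evar[OF True] by (auto simp: mons_iff lookup_minus lk_evar split: if_splits)
          then show ?thesis using evar_add_diff[OF True] by (metis UnI2 image_eqI)
        next
          case False
          then have "u \<in> mons P (Suc d)" using u unfolding mons_iff by (metis insertE gr0I)
          then show ?thesis by simp
        qed
      next
        fix u assume "u \<in> mons P (Suc d) \<union> (\<lambda>u. evar a + u) ` mons (insert a P) d"
        then show "u \<in> mons (insert a P) (Suc d)"
          by (auto simp: mons_iff lookup_add lk_evar split: if_splits)
      qed
      have dis: "mons P (Suc d) \<inter> (\<lambda>u. evar a + u) ` mons (insert a P) d = {}"
        using insert.hyps by (auto simp: mons_iff lookup_add lk_evar dest!: spec[of _ a])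
      have inj: "inj_on (\<lambda>u. evar a + u) (mons (insert a P) d)" by (auto simp: inj_on_def)
      show ?case
        unfolding eq
        using insert.IH[of "Suc d"] Suc.IH insert.hyps
        by (simp add: card_Un_disjoint[OF _ _ dis] card_image[OF inj])
    qed
  qed
qed

lemma finite_mons [simp]: "finite (mons P d)" and card_mons: "card (mons P d) = (card P + d - 1) choose d"
  using finite_card_mons by blast+

lemma forms_eq_sum_mons:
  assumes "p \<in> forms d"
  shows "p = (\<Sum>u\<in>mons UNIV d. cst (lk p u) * Poly_Mapping.single u 1)"
proof -
  have "p = (\<Sum>u\<in>mons UNIV d. Poly_Mapping.single u (lk p u))"
    by (rule poly_mapping_expand[OF finite_mons]) (use assms in \<open>auto simp: mons_iff forms_def\<close>)
  also have "\<dots> = (\<Sum>u\<in>mons UNIV d. cst (lk p u) * Poly_Mapping.single u 1)"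
    by (intro sum.cong refl single_conv_mult)
  finally show ?thesis .
qed

section \<open>Quadratic algebras with vanishing cubic part\<close>

locale quadrics =
  fixes N :: nat and f :: "nat \<Rightarrow> ('v::finite, 'k::field) mpoly"
  assumes f_forms: "i < N \<Longrightarrow> f i \<in> forms 2"
    and cubics: "p \<in> forms 3 \<Longrightarrow> \<exists>l. (\<forall>i<N. l i \<in> forms 1) \<and> p = (\<Sum>i<N. l i * f i)"
begin

definition V :: "('v, 'k) mpoly set" where
  "V = {\<Sum>i<N. cst (c i) * f i | c. True}"

text \<open>The ideal of the forms, read off degree by degree: by \<open>cubics\<close> it contains
  all forms of degree 3 and more, so only components of degree at most 2 carry a condition.
  Membership becomes linear algebra; \<open>forms_ideal_eq_QI\<close> justifies the
  description.\<close>

definition QI :: "('v, 'k) mpoly set" where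
  "QI = {p. hcomp 0 p = 0 \<and> hcomp 1 p = 0 \<and> hcomp 2 p \<in> V}"

lemma V_I: "p = (\<Sum>i<N. cst (c i) * f i) \<Longrightarrow> p \<in> V"
  by (auto simp: V_def)

lemma V_0 [simp]: "0 \<in> V"
  unfolding V_def by (auto intro!: exI[of _ "\<lambda>_. 0"])

lemma V_add: "p \<in> V \<Longrightarrow> q \<in> V \<Longrightarrow> p + q \<in> V"
proof -
  assume "p \<in> V" "q \<in> V"
  then obtain c d where "p = (\<Sum>i<N. cst (c i) * f i)" "q = (\<Sum>i<N. cst (d i) * f i)"
    by (auto simp: V_def)
  then have "p + q = (\<Sum>i<N. cst (c i + d i) * f i)"
    by (simp add: cst_add distrib_right sum.distrib)
  then show ?thesis by (rule V_I)
qed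

lemma V_cst_mult: "p \<in> V \<Longrightarrow> cst a * p \<in> V"
proof -
  assume "p \<in> V"
  then obtain c where "p = (\<Sum>i<N. cst (c i) * f i)" by (auto simp: V_def)
  then have "cst a * p = (\<Sum>i<N. cst (a * c i) * f i)"
    by (simp add: cst_mult sum_distrib_left mult.assoc)
  then show ?thesis by (rule V_I)
qed

lemma V_uminus: "p \<in> V \<Longrightarrow> - p \<in> V"
  using V_cst_mult[of p "-1"] by (simp add: cst_uminus)

lemma V_diff: "p \<in> V \<Longrightarrow> q \<in> V \<Longrightarrow> p - q \<in> V"
  using V_add[OF _ V_uminus] by fastforce

lemma V_sum: "(\<And>i. i \<in> A \<Longrightarrow> g i \<in> V) \<Longrightarrow> (\<Sum>i\<in>A. g i) \<in> V"
  by (induction A rule: infinite_finite_induct) (auto intro: V_add)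

lemma f_in_V: "i < N \<Longrightarrow> f i \<in> V"
proof -
  assume i: "i < N"
  have "(\<Sum>j<N. cst (if j = i then 1 else 0) * f j) = (\<Sum>j<N. if j = i then f j else 0)"
    by (intro sum.cong) auto
  then have "f i = (\<Sum>j<N. cst (if j = i then 1 else 0) * f j)" using i by simp
  then show ?thesis by (rule V_I)
qed

lemma V_forms: "p \<in> V \<Longrightarrow> p \<in> forms 2"
  unfolding V_def by (auto intro!: forms_sum forms_cst_mult f_forms)

lemma QI_0 [simp]: "0 \<in> QI"
  by (simp add: QI_def)

lemma QI_add: "p \<in> QI \<Longrightarrow> q \<in> QI \<Longrightarrow> p + q \<in> QI"
  and QI_diff: "p \<in> QI \<Longrightarrow> q \<in> QI \<Longrightarrow> p - q \<in> QI"
  and QI_uminus: "p \<in> QI \<Longrightarrow> - p \<in> QI"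
  by (auto simp: QI_def hcomp_add hcomp_diff hcomp_uminus intro: V_add V_diff V_uminus)

lemma QI_sum: "(\<And>i. i \<in> A \<Longrightarrow> g i \<in> QI) \<Longrightarrow> (\<Sum>i\<in>A. g i) \<in> QI"
  by (induction A rule: infinite_finite_induct) (auto intro: QI_add)

lemma QI_mult: assumes "p \<in> QI" shows "q * p \<in> QI"
proof -
  have c: "hcomp 0 q = cst (lk (hcomp 0 q) 0)" by (rule forms_0_eq_cst) simp
  have p: "hcomp 0 p = 0" "hcomp 1 p = 0" "hcomp 2 p \<in> V" using assms by (auto simp: QI_def)
  \<comment> \<open>Only the constant term of \<open>q\<close> contributes, as \<open>p\<close>
    starts in degree 2.\<close>
  have "hcomp 2 (q * p) = hcomp 0 q * hcomp 2 p"
    using p by (simp add: hcomp_mult numeral_2_eq_2)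
  then have "hcomp 2 (q * p) \<in> V" using p(3) c V_cst_mult by metis
  then show ?thesis using p by (simp add: QI_def hcomp_mult)
qed

lemma QI_mult': "p \<in> QI \<Longrightarrow> p * q \<in> QI"
  using QI_mult[of p q] by (simp add: mult.commute)

lemma V_QI: "p \<in> V \<Longrightarrow> p \<in> QI"
  by (simp add: QI_def hcomp_forms[OF V_forms])

lemma QI_forms_2_iff: "p \<in> forms 2 \<Longrightarrow> p \<in> QI \<longleftrightarrow> p \<in> V"
  by (auto simp: QI_def hcomp_forms)

lemma QI_forms_ge3: "p \<in> forms d \<Longrightarrow> 3 \<le> d \<Longrightarrow> p \<in> QI"
  by (simp add: QI_def hcomp_forms)

lemma QI_hcomp: "p \<in> QI \<Longrightarrow> hcomp e p \<in> QI"
  by (auto simp: QI_def hcomp_forms[OF hcomp_in_forms] V_forms)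

definition J :: "('v, 'k) mpoly set" where
  "J = {\<Sum>i<N. h i * f i | h. True}"

lemma J_I: "p = (\<Sum>i<N. h i * f i) \<Longrightarrow> p \<in> J"
  by (auto simp: J_def)

lemma J_0: "0 \<in> J"
  unfolding J_def by (auto intro!: exI[of _ "\<lambda>_. 0"])

lemma J_add: "p \<in> J \<Longrightarrow> q \<in> J \<Longrightarrow> p + q \<in> J"
proof -
  assume "p \<in> J" "q \<in> J"
  then obtain c d where "p = (\<Sum>i<N. c i * f i)" "q = (\<Sum>i<N. d i * f i)"
    by (auto simp: J_def)
  then have "p + q = (\<Sum>i<N. (c i + d i) * f i)"
    by (simp add: distrib_right sum.distrib)
  then show ?thesis by (rule J_I)
qed

lemma J_mult: "p \<in> J \<Longrightarrow> q * p \<in> J"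
proof -
  assume "p \<in> J"
  then obtain c where "p = (\<Sum>i<N. c i * f i)" by (auto simp: J_def)
  then have "q * p = (\<Sum>i<N. (q * c i) * f i)"
    by (simp add: sum_distrib_left mult.assoc)
  then show ?thesis by (rule J_I)
qed

lemma J_sum: "(\<And>i. i \<in> A \<Longrightarrow> g i \<in> J) \<Longrightarrow> (\<Sum>i\<in>A. g i) \<in> J"
  by (induction A rule: infinite_finite_induct) (auto intro: J_add J_0)

text \<open>The locale speaks of cubics only; a form of higher degree is a combination of variables
  with forms of one degree less as coefficients.\<close>

lemma forms_ge3_J: "p \<in> forms (3 + d) \<Longrightarrow> p \<in> J"
proof (induction d arbitrary: p)
  case 0
  then show ?case using cubics[of p] unfolding J_def by auto
next
  case (Suc d)
  have "lk p 0 = 0" using formsD[OF Suc.prems, of 0] by simp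
  then obtain h where h: "p = (\<Sum>v\<in>UNIV. pvar v * h v)" "\<And>e v. p \<in> forms (Suc e) \<Longrightarrow> h v \<in> forms e"
    by (rule expand_forms_Suc) blast
  have "h v \<in> J" for v using Suc.IH h(2)[of "3 + d" v] Suc.prems by simp
  then show ?case by (subst h(1)) (auto intro: J_sum J_mult)
qed

lemma QI_generated:
  assumes "p \<in> QI" obtains h where "p = (\<Sum>i<N. h i * f i)"
proof -
  have "hcomp e p \<in> J" for e
  proof -
    consider "e = 0" | "e = 1" | "e = 2" | "3 \<le> e" by linarith
    then show ?thesis
    proof cases
      case 3
      then have "hcomp e p \<in> V" using assms by (simp add: QI_def)
      then obtain c where "hcomp e p = (\<Sum>i<N. cst (c i) * f i)" by (auto simp: V_def)
      then show ?thesis by (rule J_I)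
    next
      case 4
      then show ?thesis using forms_ge3_J[of "hcomp e p" "e - 3"] by simp
    qed (use assms in \<open>auto simp: QI_def J_0\<close>)
  qed
  then have "(\<Sum>e\<in>mdeg ` Poly_Mapping.keys p. hcomp e p) \<in> J" by (rule J_sum)
  then have "p \<in> J" by (subst (asm) sum_hcomp) auto
  then show ?thesis using that by (auto simp: J_def)
qed

section \<open>Comparison of \<open>QI\<close> with the generated ideal\<close>

lemma cring_mpoly: "cring (mpoly_ring :: ('v, 'k) mpoly ring)"
  by (rule cring_from_type_algebra)

lemma ideal_QI: "ideal QI mpoly_ring"
proof (rule idealI)
  show "ring (mpoly_ring :: ('v, 'k) mpoly ring)" by (rule ring_from_type_algebra)
  then interpret R: ring "mpoly_ring :: ('v, 'k) mpoly ring" .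
  have inv: "\<ominus>\<^bsub>mpoly_ring\<^esub> x = - x" for x :: "('v, 'k) mpoly"
    by (rule R.minus_equality) (auto simp: ring_of_type_algebra_def)
  show "subgroup QI (add_monoid mpoly_ring)"
    by (rule R.add.subgroupI) (auto simp: ring_of_type_algebra_def QI_add inv[unfolded ring_of_type_algebra_def] QI_uminus intro: QI_0)
qed (auto simp: ring_of_type_algebra_def QI_mult QI_mult')

lemma forms_ideal_eq_QI: "forms_ideal N f = QI"
proof
  interpret R: cring "mpoly_ring :: ('v, 'k) mpoly ring" by (rule cring_mpoly)
  show "forms_ideal N f \<subseteq> QI"
    unfolding forms_ideal_def
    by (rule R.genideal_minimal[OF ideal_QI]) (auto intro: V_QI f_in_V)
  interpret I: ideal "forms_ideal N f" mpoly_ring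
    unfolding forms_ideal_def by (rule R.genideal_ideal) (auto simp: ring_of_type_algebra_def)
  have 0: "0 \<in> forms_ideal N f" using I.zero_closed by (simp add: ring_of_type_algebra_def)
  have add: "p + q \<in> forms_ideal N f" if "p \<in> forms_ideal N f" "q \<in> forms_ideal N f" for p q
    using I.a_closed[OF that] by (simp add: ring_of_type_algebra_def)
  have mult: "q * p \<in> forms_ideal N f" if "p \<in> forms_ideal N f" for p q
    using I.I_l_closed[OF that, of q] by (simp add: ring_of_type_algebra_def)
  have gen: "f i \<in> forms_ideal N f" if "i < N" for i
    unfolding forms_ideal_def using R.genideal_self[of "f ` {..<N}"] that
    by (auto simp: ring_of_type_algebra_def)
  have s: "(\<Sum>i\<in>A. g i) \<in> forms_ideal N f" if "\<And>i. i \<in> A \<Longrightarrow> g i \<in> forms_ideal N f" for A :: "nat set" and g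
    using that by (induction A rule: infinite_finite_induct) (auto intro: add 0)
  show "QI \<subseteq> forms_ideal N f"
  proof
    fix p assume "p \<in> QI"
    then obtain h where "p = (\<Sum>i<N. h i * f i)" by (rule QI_generated)
    then show "p \<in> forms_ideal N f" by (auto intro!: s mult gen)
  qed
qed

end

text \<open>A set of quadratic monomials whose residue classes form a basis of \<open>R\<^sub>2\<close>.\<close>

definition (in quadrics) std_basis :: "('v \<Rightarrow>\<^sub>0 nat) set \<Rightarrow> (('v \<Rightarrow>\<^sub>0 nat) \<Rightarrow> ('v \<Rightarrow>\<^sub>0 nat) \<Rightarrow> 'k) \<Rightarrow> bool" where
  "std_basis B \<gamma> \<longleftrightarrow> B \<subseteq> mons UNIV 2 \<and>
     (\<forall>c. (\<Sum>b\<in>B. cst (c b) * Poly_Mapping.single b 1) \<in> V \<longrightarrow> (\<forall>b\<in>B. c b = 0)) \<and>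
     (\<forall>u\<in>mons UNIV 2. Poly_Mapping.single u 1 - (\<Sum>b\<in>B. cst (\<gamma> u b) * Poly_Mapping.single b 1) \<in> V)"

text \<open>Take a largest set of quadratic monomials independent modulo \<open>V\<close>. Adding
  another monomial \<open>u\<close> creates a relation in which \<open>u\<close> has a nonzero
  coefficient, and dividing by that coefficient expresses \<open>u\<close> through
  \<open>B\<close>.\<close>

lemma (in quadrics) std_basis_exists: "\<exists>B \<gamma>. std_basis B \<gamma>"
proof -
  define ind where "ind B \<longleftrightarrow> B \<subseteq> mons UNIV 2 \<and>
     (\<forall>c. (\<Sum>b\<in>B. cst (c b) * Poly_Mapping.single b 1) \<in> V \<longrightarrow> (\<forall>b\<in>B. c b = 0))" for B
  have bound: "\<forall>B. ind B \<longrightarrow> card B < Suc (card (mons (UNIV :: 'v set) 2))"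
    by (simp add: ind_def card_mono le_imp_less_Suc)
  have "ind {}" by (simp add: ind_def)
  from ex_has_greatest_nat[of ind "{}" card, OF this bound]
  obtain B where indB': "ind B \<and> (\<forall>B'. ind B' \<longrightarrow> card B' \<le> card B)" by (rule exE)
  then have indB: "ind B" by (rule conjunct1)
  have max: "card B' \<le> card B" if "ind B'" for B'
    using indB' that by simp
  have B: "B \<subseteq> mons UNIV 2 \<and>
     (\<forall>c. (\<Sum>b\<in>B. cst (c b) * Poly_Mapping.single b 1) \<in> V \<longrightarrow> (\<forall>b\<in>B. c b = 0))"
    using indB unfolding ind_def .
  have finB: "finite B" by (rule finite_subset[OF conjunct1[OF B] finite_mons])
  have "\<exists>g. Poly_Mapping.single u 1 - (\<Sum>b\<in>B. cst (g b) * Poly_Mapping.single b 1) \<in> V"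
    if u: "u \<in> mons UNIV 2" for u
  proof (cases "u \<in> B")
    case True
    have "(\<Sum>b\<in>B. cst (if b = u then 1 else 0) * Poly_Mapping.single b (1::'k))
       = (\<Sum>b\<in>B. if b = u then Poly_Mapping.single b 1 else 0)" by (intro sum.cong) auto
    then show ?thesis using True finB
      by (intro exI[of _ "\<lambda>b. if b = u then 1 else 0"]) simp
  next
    case False
    have "\<not> ind (insert u B)" using max[of "insert u B"] False finB by auto
    then obtain c where c: "(\<Sum>b\<in>insert u B. cst (c b) * Poly_Mapping.single b 1) \<in> V"
        "\<exists>b\<in>insert u B. c b \<noteq> 0" using B u unfolding ind_def by auto
    have "c u \<noteq> 0" using c B False finB by auto
    have "cst (1 / c u) * (\<Sum>b\<in>insert u B. cst (c b) * Poly_Mapping.single b 1) \<in> V"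
      using c V_cst_mult by blast
    moreover have "cst (1 / c u) * (\<Sum>b\<in>insert u B. cst (c b) * Poly_Mapping.single b 1)
        = Poly_Mapping.single u 1 - (\<Sum>b\<in>B. cst (- c b / c u) * Poly_Mapping.single b 1)"
      using False finB \<open>c u \<noteq> 0\<close>
      by (simp add: distrib_left sum_distrib_left mult.assoc[symmetric] flip: cst_mult)
         (simp add: cst_uminus sum_negf)
    ultimately show ?thesis by auto
  qed
  then have ex: "\<forall>u\<in>mons UNIV 2. \<exists>g.
      Poly_Mapping.single u 1 - (\<Sum>b\<in>B. cst (g b) * Poly_Mapping.single b 1) \<in> V" by simp
  from bchoice[OF ex] obtain \<gamma> where \<gamma>: "\<forall>u\<in>mons UNIV 2.
      Poly_Mapping.single u 1 - (\<Sum>b\<in>B. cst (\<gamma> u b) * Poly_Mapping.single b 1) \<in> V" by (rule exE)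
  show ?thesis
    unfolding std_basis_def by (rule exI[of _ B], rule exI[of _ \<gamma>]) (use B \<gamma> in simp)
qed

locale std_quadrics = quadrics +
  fixes B \<gamma>
  assumes std: "std_basis B \<gamma>"
begin

abbreviation mon :: "('a \<Rightarrow>\<^sub>0 nat) \<Rightarrow> ('a, 'b) mpoly" where "mon b \<equiv> Poly_Mapping.single b 1"

text \<open>A linear projection with kernel \<open>QI\<close> (\<open>nf_eq_0_iff\<close>). It picks
  one representative of each residue class, so that equations in R become equations between
  polynomials.\<close>

definition nf :: "('a, 'b) mpoly \<Rightarrow> ('a, 'b) mpoly" where
  "nf p = hcomp 0 p + hcomp 1 p + (\<Sum>u\<in>mons UNIV 2. cst (lk p u) * (\<Sum>b\<in>B. cst (\<gamma> u b) * mon b))"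

lemma B_sub: "B \<subseteq> mons UNIV 2" and finB [simp]: "finite B"
  and B_indep: "(\<Sum>b\<in>B. cst (c b) * mon b) \<in> V \<Longrightarrow> b \<in> B \<Longrightarrow> c b = 0"
  and B_span: "u \<in> mons UNIV 2 \<Longrightarrow> mon u - (\<Sum>b\<in>B. cst (\<gamma> u b) * mon b) \<in> V"
  using std unfolding std_basis_def by (auto intro: finite_subset)

lemma mon_B_forms [simp]: "b \<in> B \<Longrightarrow> mon b \<in> forms 2"
  using B_sub by (auto intro!: forms_single simp: mons_iff)

lemma nf_add: "nf (p + q) = nf p + nf q"
  by (simp add: nf_def hcomp_add lookup_add cst_add distrib_right sum.distrib)

lemma nf_cst: "nf (cst c * p) = cst c * nf p"
  by (simp add: nf_def hcomp_cst_mult lk_cst_mult cst_mult distrib_left sum_distrib_left mult.assoc)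

lemma nf_0 [simp]: "nf 0 = 0"
  by (simp add: nf_def)

lemma nf_uminus: "nf (- p) = - nf p"
  using nf_cst[of "-1" p] by (simp add: cst_uminus)

lemma nf_diff: "nf (p - q) = nf p - nf q"
  using nf_add[of p "- q"] by (simp add: nf_uminus)

lemma nf_sum: "nf (\<Sum>i\<in>A. g i) = (\<Sum>i\<in>A. nf (g i))"
  by (induction A rule: infinite_finite_induct) (auto simp: nf_add)

lemma hcomp2_nf: "hcomp 2 (nf p) = (\<Sum>u\<in>mons UNIV 2. cst (lk p u) * (\<Sum>b\<in>B. cst (\<gamma> u b) * mon b))"
proof -
  have "(\<Sum>u\<in>mons UNIV 2. cst (lk p u) * (\<Sum>b\<in>B. cst (\<gamma> u b) * mon b)) \<in> forms 2"
    by (intro forms_sum forms_cst_mult) simp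
  then show ?thesis by (simp add: nf_def hcomp_add hcomp_forms[OF hcomp_in_forms] hcomp_forms)
qed

lemma hcomp_nf_01: "hcomp 0 (nf p) = hcomp 0 p" "hcomp (Suc 0) (nf p) = hcomp (Suc 0) p"
proof -
  have *: "(\<Sum>u\<in>mons UNIV 2. cst (lk p u) * (\<Sum>b\<in>B. cst (\<gamma> u b) * mon b)) \<in> forms 2"
    by (intro forms_sum forms_cst_mult) simp
  show "hcomp 0 (nf p) = hcomp 0 p" "hcomp (Suc 0) (nf p) = hcomp (Suc 0) p"
    by (simp_all add: nf_def hcomp_add hcomp_forms[OF hcomp_in_forms] hcomp_forms[OF *])
qed

lemma diff_nf_QI: "p - nf p \<in> QI"
proof -
  have "hcomp 2 p = (\<Sum>u\<in>mons UNIV 2. cst (lk p u) * mon u)"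
    by (subst forms_eq_sum_mons[of _ 2]) (auto intro!: sum.cong simp: lk_hcomp mons_iff)
  then have "hcomp 2 (p - nf p) = (\<Sum>u\<in>mons UNIV 2. cst (lk p u) * (mon u - (\<Sum>b\<in>B. cst (\<gamma> u b) * mon b)))"
    by (simp add: hcomp_diff hcomp2_nf right_diff_distrib sum_subtractf)
  then have "hcomp 2 (p - nf p) \<in> V"
    by (simp only:) (intro V_sum V_cst_mult B_span)
  then show ?thesis
    by (simp add: QI_def hcomp_diff hcomp_nf_01)
qed

lemma hcomp2_nf_B: "\<exists>c. hcomp 2 (nf p) = (\<Sum>b\<in>B. cst (c b) * mon b)"
proof -
  have "hcomp 2 (nf p) = (\<Sum>b\<in>B. cst (\<Sum>u\<in>mons UNIV 2. lk p u * \<gamma> u b) * mon b)"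
    unfolding hcomp2_nf sum_distrib_left cst_sum sum_distrib_right
    by (subst sum.swap) (simp add: cst_mult mult.assoc)
  then show ?thesis by (rule exI[of _ "\<lambda>b. \<Sum>u\<in>mons UNIV 2. lk p u * \<gamma> u b"])
qed

lemma nf_eq_0_iff: "nf p = 0 \<longleftrightarrow> p \<in> QI"
proof
  assume "nf p = 0" then show "p \<in> QI" using diff_nf_QI[of p] by simp
next
  assume p: "p \<in> QI"
  then have q: "nf p \<in> QI" using QI_diff[OF p diff_nf_QI[of p]] by simp
  obtain c where c: "hcomp 2 (nf p) = (\<Sum>b\<in>B. cst (c b) * mon b)" using hcomp2_nf_B by blast
  then have "\<forall>b\<in>B. c b = 0" using q B_indep[of c] unfolding QI_def by auto
  then have "hcomp 2 (nf p) = 0" using c by simp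
  then show "nf p = 0" using p unfolding hcomp2_nf by (simp add: nf_def QI_def)
qed

lemma nf_eq_iff: "nf p = nf q \<longleftrightarrow> p - q \<in> QI"
  using nf_eq_0_iff[of "p - q"] by (simp add: nf_diff)

lemma nf_nf [simp]: "nf (nf p) = nf p"
  using diff_nf_QI[of p] nf_eq_iff[of p "nf p"] by simp

lemma nf_mult_right: "nf (p * nf q) = nf (p * q)"
  unfolding nf_eq_iff right_diff_distrib[symmetric]
  using QI_mult[OF QI_uminus[OF diff_nf_QI[of q]]] by simp

lemma nf_forms: "p \<in> forms d \<Longrightarrow> nf p \<in> forms d"
proof -
  assume p: "p \<in> forms d"
  consider "d = 0 \<or> d = 1" | "d = 2" | "d \<ge> 3" by linarith
  then show ?thesis
  proof cases
    case 1
    then have "lk p u = 0" if "u \<in> mons UNIV 2" for u using that p by (intro formsD[of p d]) (auto simp: mons_iff simp del: mdeg_eq_0_iff)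
    then have "nf p = hcomp 0 p + hcomp 1 p" by (simp add: nf_def)
    then show ?thesis using 1 p by (auto simp: hcomp_forms)
  next
    case 2
    then show ?thesis using p
      by (auto simp: nf_def hcomp_forms intro!: forms_sum forms_cst_mult)
  next
    case 3
    then have "nf p = 0" using nf_eq_0_iff QI_forms_ge3[OF p] by blast
    then show ?thesis by simp
  qed
qed

lemma nf_forms_1: "p \<in> forms 1 \<Longrightarrow> nf p = p"
proof -
  assume p: "p \<in> forms 1"
  then have "lk p u = 0" if "u \<in> mons UNIV 2" for u using that p by (intro formsD[of p 1]) (auto simp: mons_iff simp del: mdeg_eq_0_iff)
  then show ?thesis using p by (simp add: nf_def hcomp_forms)
qed

lemma nf_forms_2: "p \<in> forms 2 \<Longrightarrow> \<exists>c. nf p = (\<Sum>b\<in>B. cst (c b) * mon b)"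
  using hcomp2_nf_B[of p] nf_forms[of p 2] by (simp add: hcomp_forms)

end

section \<open>Upper bound for the degrees of Tor\<close>

text \<open>
  \<open>F i j\<close> is the degree \<open>j\<close> component of the \<open>i\<close>-th free module of a resolution of \<open>k\<close> over \<open>R\<close>,
  \<open>M\<close> and \<open>M2\<close> stand for \<open>m F\<close> and \<open>m\<^sup>2 F\<close>, and \<open>S\<close> is a set of quadratic forms that is a basis
  of \<open>R\<^sub>2\<close>. The assumptions \<open>indep1\<close> and \<open>indep2\<close> express that \<open>F\<close> is free, and \<open>quadratic\<close> that
  \<open>R\<close> has no cubic relations.
\<close>

locale graded_resolution_chase =
  fixes act :: "('v::finite, 'k::field) mpoly \<Rightarrow> 'f::ab_group_add \<Rightarrow> 'f"
    and F M M2 :: "nat \<Rightarrow> nat \<Rightarrow> 'f set"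
    and d :: "nat \<Rightarrow> 'f \<Rightarrow> 'f"
    and S V :: "('v, 'k) mpoly set"
  assumes act_add: "act p (x + y) = act p x + act p y"
    and act_add_left: "act (p + q) x = act p x + act q x"
    and act_act: "act p (act q x) = act (p * q) x"
    and act_V: "p \<in> V \<Longrightarrow> act p x = 0"
    and act_cubic: "p \<in> forms 3 \<Longrightarrow> act p x = 0"
    and F_0: "0 \<in> F i j"
    and F_diff: "x \<in> F i j \<Longrightarrow> y \<in> F i j \<Longrightarrow> x - y \<in> F i j"
    and F_act1: "p \<in> forms 1 \<Longrightarrow> x \<in> F i j \<Longrightarrow> act p x \<in> F i (Suc j)"
    and M_0: "0 \<in> M i j"
    and M_diff: "x \<in> M i j \<Longrightarrow> y \<in> M i j \<Longrightarrow> x - y \<in> M i j"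
    and M2_0: "0 \<in> M2 i j"
    and M2_diff: "x \<in> M2 i j \<Longrightarrow> y \<in> M2 i j \<Longrightarrow> x - y \<in> M2 i j"
    and M2_M: "x \<in> M2 i j \<Longrightarrow> x \<in> M i j"
    and M_F: "x \<in> M i j \<Longrightarrow> x \<in> F i j"
    and act1_M: "p \<in> forms 1 \<Longrightarrow> x \<in> F i j \<Longrightarrow> act p x \<in> M i (Suc j)"
    and act1_M2: "p \<in> forms 1 \<Longrightarrow> x \<in> M i j \<Longrightarrow> act p x \<in> M2 i (Suc j)"
    and act2_M2: "p \<in> forms 2 \<Longrightarrow> x \<in> F i j \<Longrightarrow> act p x \<in> M2 i (Suc (Suc j))"
    and M_deg0: "x \<in> M i 0 \<Longrightarrow> x = 0"
    and M2_deg1: "x \<in> M2 i (Suc 0) \<Longrightarrow> x = 0"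
    and M_split: "x \<in> M i (Suc j) \<Longrightarrow> \<exists>y. (\<forall>v. y v \<in> F i j) \<and> x = (\<Sum>v\<in>UNIV. act (pvar v) (y v))"
    and M2_split: "x \<in> M2 i (Suc (Suc j)) \<Longrightarrow> \<exists>y. (\<forall>s\<in>S. y s \<in> F i j) \<and> x = (\<Sum>s\<in>S. act s (y s))"
    and S_forms: "s \<in> S \<Longrightarrow> s \<in> forms 2"
    and indep1: "\<And>y. (\<And>v. y v \<in> F i j) \<Longrightarrow> (\<Sum>v\<in>UNIV. act (pvar v) (y v)) \<in> M2 i (Suc j) \<Longrightarrow> y v \<in> M i j"
    and indep2: "\<And>y. (\<And>s. s \<in> S \<Longrightarrow> y s \<in> F i j) \<Longrightarrow> (\<Sum>s\<in>S. act s (y s)) = 0 \<Longrightarrow> s \<in> S \<Longrightarrow> y s \<in> M i j"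
    and d_add: "d i (x + y) = d i x + d i y"
    and d_act: "d i (act p x) = act p (d i x)"
    and d_F: "x \<in> F (Suc i) j \<Longrightarrow> d i x \<in> F i j"
    and d_d: "x \<in> F (Suc (Suc i)) j \<Longrightarrow> d i (d (Suc i) x) = 0"
    and d_exact: "x \<in> F (Suc i) j \<Longrightarrow> d i x = 0 \<Longrightarrow> \<exists>w\<in>F (Suc (Suc i)) j. d (Suc i) w = x"
    and d_exact0: "x \<in> M 0 j \<Longrightarrow> \<exists>w\<in>F (Suc 0) j. d 0 w = x"
    and F0_M: "x \<in> F 0 (Suc j) \<Longrightarrow> x \<in> M 0 (Suc j)"
    and quadratic: "q \<in> forms 2 \<Longrightarrow> \<exists>(T :: (nat + 'v \<times> 'v) set) g h. (\<forall>t\<in>T. g t \<in> forms 1 \<and> (\<forall>l. h t l \<in> forms 1) \<and>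
       (\<Sum>l\<in>UNIV. h t l * pvar l) \<in> V) \<and> (\<forall>l. (if l = m then q else 0) - (\<Sum>t\<in>T. g t * h t l) \<in> V)"
begin

lemma act_0 [simp]: "act p 0 = 0"
  using act_add[of p 0 0] by simp

lemma act_0_left [simp]: "act 0 x = 0"
  using act_add_left[of 0 0 x] by simp

lemma d_0 [simp]: "d i 0 = 0"
  using d_add[of i 0 0] by simp

lemma act_diff: "act p (x - y) = act p x - act p y"
  using act_add[of p "x - y" y] by (simp add: algebra_simps)

lemma act_diff_left: "act (p - q) x = act p x - act q x"
  using act_add_left[of "p - q" q x] by (simp add: algebra_simps)

lemma d_diff: "d i (x - y) = d i x - d i y"
  using d_add[of i "x - y" y] by (simp add: algebra_simps)

lemma act_sum: "act p (\<Sum>i\<in>A. g i) = (\<Sum>i\<in>A. act p (g i))"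
  by (induction A rule: infinite_finite_induct) (auto simp: act_add)

lemma act_sum_left: "act (\<Sum>i\<in>A. g i) x = (\<Sum>i\<in>A. act (g i) x)"
  by (induction A rule: infinite_finite_induct) (auto simp: act_add_left)

lemma d_sum: "d i (\<Sum>l\<in>A. g l) = (\<Sum>l\<in>A. d i (g l))"
  by (induction A rule: infinite_finite_induct) (auto simp: d_add)

lemma F_add: "x \<in> F i j \<Longrightarrow> y \<in> F i j \<Longrightarrow> x + y \<in> F i j"
  using F_diff[OF _ F_diff[OF F_0, of y]] by fastforce

lemma M_add: "x \<in> M i j \<Longrightarrow> y \<in> M i j \<Longrightarrow> x + y \<in> M i j"
  using M_diff[OF _ M_diff[OF M_0, of y]] by fastforce

lemma M2_add: "x \<in> M2 i j \<Longrightarrow> y \<in> M2 i j \<Longrightarrow> x + y \<in> M2 i j"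
  using M2_diff[OF _ M2_diff[OF M2_0, of y]] by fastforce

lemma F_sum: "(\<And>l. l \<in> A \<Longrightarrow> g l \<in> F i j) \<Longrightarrow> (\<Sum>l\<in>A. g l) \<in> F i j"
  by (induction A rule: infinite_finite_induct) (auto intro: F_add F_0)

lemma M_sum: "(\<And>l. l \<in> A \<Longrightarrow> g l \<in> M i j) \<Longrightarrow> (\<Sum>l\<in>A. g l) \<in> M i j"
  by (induction A rule: infinite_finite_induct) (auto intro: M_add M_0)

lemma M2_sum: "(\<And>l. l \<in> A \<Longrightarrow> g l \<in> M2 i j) \<Longrightarrow> (\<Sum>l\<in>A. g l) \<in> M2 i j"
  by (induction A rule: infinite_finite_induct) (auto intro: M2_add M2_0)

text \<open>An element of \<open>m F\<close> is a sum of multiples of variables, and a quadratic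
  form times a variable is a cubic, which acts as 0.\<close>

lemma act2_M:
  assumes "q \<in> forms 2" "x \<in> M i j" shows "act q x = 0"
proof (cases j)
  case 0
  then show ?thesis using M_deg0[of x i] assms by simp
next
  case (Suc j')
  obtain y where y: "x = (\<Sum>v\<in>UNIV. act (pvar v) (y v))"
    using M_split[OF assms(2)[unfolded Suc]] by blast
  have "q * pvar v \<in> forms 3" for v using forms_mult[OF assms(1) forms_pvar(1), of v] by simp
  then show ?thesis by (simp add: y act_sum act_act act_cubic)
qed

lemma act1_M2_eq_0:
  assumes "p \<in> forms 1" "x \<in> M2 i j" shows "act p x = 0"
proof -
  consider "j = 0" | "j = Suc 0" | j' where "j = Suc (Suc j')" by (metis not0_implies_Suc)
  then show ?thesis
  proof cases
    case 1 then show ?thesis using M_deg0[of x i] M2_M[OF assms(2)] by simp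
  next
    case 2 then show ?thesis using M2_deg1[of x i] assms(2) by simp
  next
    case (3 j')
    obtain y where y: "x = (\<Sum>s\<in>S. act s (y s))"
      using M2_split[OF assms(2)[unfolded 3]] by blast
    have "p * s \<in> forms 3" if "s \<in> S" for s
      using forms_mult[OF assms(1) S_forms[OF that]] by (simp add: numeral_3_eq_3)
    then show ?thesis by (simp add: y act_sum act_act act_cubic)
  qed
qed

text \<open>Lifts of the cycles of the complex tensored with k: the differential sends
  \<open>z\<close> into \<open>m F\<close>. In homological degree 0 there is no condition.\<close>

definition cyc :: "nat \<Rightarrow> nat \<Rightarrow> 'f \<Rightarrow> bool" where
  "cyc i j z \<longleftrightarrow> z \<in> F i j \<and> (\<forall>i'. i = Suc i' \<longrightarrow> d i' z \<in> M i' j)"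

text \<open>Tor of k and k is 0 in homological degree \<open>i\<close> and internal degree
  \<open>j\<close>, expressed on lifts to the resolution.\<close>

definition vanish :: "nat \<Rightarrow> nat \<Rightarrow> bool" where
  "vanish i j \<longleftrightarrow> (\<forall>z. cyc i j z \<longrightarrow> (\<exists>w\<in>F (Suc i) j. z - d i w \<in> M i j))"

text \<open>Since the differential of \<open>d i z\<close> is 0, the boundaries of the
  \<open>y v\<close> satisfy a relation with the variables as coefficients; freeness
  (\<open>indep1\<close>) forces them into \<open>m F\<close>.\<close>

lemma boundary_split:
  assumes "z \<in> F (Suc i) (Suc j)" "d i z \<in> M i (Suc j)"
  obtains y where "d i z = (\<Sum>v\<in>UNIV. act (pvar v) (y v))" "\<And>v. cyc i j (y v)"
proof -
  obtain y where y: "\<And>v. y v \<in> F i j" "d i z = (\<Sum>v\<in>UNIV. act (pvar v) (y v))"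
    using M_split[OF assms(2)] by blast
  have "d i' (y v) \<in> M i' j" if i: "i = Suc i'" for i' v
  proof -
    have "(\<Sum>v\<in>UNIV. act (pvar v) (d i' (y v))) = d i' (d i z)"
      by (simp add: y(2) d_sum d_act)
    also have "\<dots> = 0" using d_d[of z i' "Suc j"] assms(1) i by simp
    finally have "(\<Sum>v\<in>UNIV. act (pvar v) (d i' (y v))) \<in> M2 i' (Suc j)" by (simp add: M2_0)
    then show ?thesis using d_F[OF y(1)[unfolded i]] by (intro indep1[of "\<lambda>v. d i' (y v)"])
  qed
  then have "cyc i j (y v)" for v using y(1) by (simp add: cyc_def)
  with y(2) show ?thesis by (rule that)
qed

text \<open>The argument of \<open>boundary_split\<close>, with the basis \<open>S\<close> of
  quadratic forms and \<open>indep2\<close> in place of the variables and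
  \<open>indep1\<close>.\<close>

lemma M2_cycle_split:
  assumes "x \<in> M2 i (Suc (Suc j))" "\<And>i'. i = Suc i' \<Longrightarrow> d i' x = 0"
  obtains y where "x = (\<Sum>s\<in>S. act s (y s))" "\<And>s. s \<in> S \<Longrightarrow> cyc i j (y s)"
proof -
  obtain y where y: "\<And>s. s \<in> S \<Longrightarrow> y s \<in> F i j" "x = (\<Sum>s\<in>S. act s (y s))"
    using M2_split[OF assms(1)] by blast
  have "d i' (y s) \<in> M i' j" if i: "i = Suc i'" and s: "s \<in> S" for i' s
  proof -
    have "(\<Sum>s\<in>S. act s (d i' (y s))) = 0"
      using assms(2)[OF i] by (simp add: y(2) d_sum d_act)
    then show ?thesis
      using d_F y(1) i s by (intro indep2[of "\<lambda>s. d i' (y s)" _ _ s]) auto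
  qed
  then have "cyc i j (y s)" if "s \<in> S" for s using y(1) that by (simp add: cyc_def)
  with y(2) show ?thesis by (rule that)
qed

text \<open>Surjectivity of the connecting map \<open>R\<^sub>1 \<otimes> Tor\<^sub>i\<^sub>+\<^sub>1 \<rightarrow> R\<^sub>2 \<otimes> Tor\<^sub>i\<close> onto degree \<open>j + 2\<close>.\<close>

definition onto :: "nat \<Rightarrow> nat \<Rightarrow> bool" where
  "onto i j \<longleftrightarrow> (\<forall>q y. q \<in> forms 2 \<longrightarrow> cyc i j y \<longrightarrow> (\<exists>v\<in>M (Suc i) (Suc (Suc j)). d i v = act q y))"

text \<open>Linear multiples of a cycle are boundaries up to an error in \<open>m\<^sup>2 F\<close>.
  The error is harmless, as linear forms kill \<open>m\<^sup>2 F\<close>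
  (\<open>act1_M2_eq_0\<close>).\<close>

definition liftable :: "nat \<Rightarrow> nat \<Rightarrow> bool" where
  "liftable i j \<longleftrightarrow> (\<forall>p y. p \<in> forms 1 \<longrightarrow> cyc i j y \<longrightarrow>
     (\<exists>v\<in>F (Suc i) (Suc j). d i v - act p y \<in> M2 i (Suc j)))"

text \<open>The cycle \<open>z\<close> is corrected within \<open>m F\<close> until its differential
  is 0, whence it is a boundary. The first hypothesis moves \<open>d i z\<close> from
  \<open>m F\<close> into \<open>m\<^sup>2 F\<close>, the second removes the rest.\<close>

lemma vanish_Suc:
  assumes "\<And>j1. j = Suc j1 \<Longrightarrow> vanish i j1" "\<And>j2. j = Suc (Suc j2) \<Longrightarrow> onto i j2"
  shows "vanish (Suc i) j"
  unfolding vanish_def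
proof (intro allI impI)
  fix z assume "cyc (Suc i) j z"
  then have z: "z \<in> F (Suc i) j" "d i z \<in> M i j" by (auto simp: cyc_def)
  show "\<exists>w\<in>F (Suc (Suc i)) j. z - d (Suc i) w \<in> M (Suc i) j"
  proof (cases j)
    case 0
    then have "d i z = 0" using z M_deg0[of "d i z" i] by simp
    then obtain w where "w \<in> F (Suc (Suc i)) j" "d (Suc i) w = z" using d_exact[OF z(1)] by blast
    then show ?thesis using M_0 by (intro bexI[of _ w]) auto
  next
    case (Suc j1)
    obtain y where y: "d i z = (\<Sum>v\<in>UNIV. act (pvar v) (y v))" "\<And>v. cyc i j1 (y v)"
      by (rule boundary_split[OF z[unfolded Suc]], rule that)
    have "\<forall>v. \<exists>w. w \<in> F (Suc i) j1 \<and> y v - d i w \<in> M i j1"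
      using assms(1)[OF Suc] y(2) unfolding vanish_def by blast
    then obtain w where w: "\<And>v. w v \<in> F (Suc i) j1" "\<And>v. y v - d i (w v) \<in> M i j1" by metis
    \<comment> \<open>Subtracting \<open>t\<close> replaces each coefficient \<open>y v\<close> of
      \<open>d i z\<close> by an element of \<open>m F\<close>.\<close>
    define t where "t = (\<Sum>v\<in>UNIV. act (pvar v) (w v))"
    have tM: "t \<in> M (Suc i) j" unfolding t_def Suc by (intro M_sum act1_M) (auto simp: w)
    have dz: "d i (z - t) = (\<Sum>v\<in>UNIV. act (pvar v) (y v - d i (w v)))"
      by (simp add: d_diff y(1) t_def d_sum d_act act_diff sum_subtractf)
    have dzM2: "d i (z - t) \<in> M2 i j"
      unfolding dz Suc by (intro M2_sum act1_M2 w) simp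
    have "\<exists>v\<in>M (Suc i) j. d i v = d i (z - t)"
    proof (cases j1)
      case 0
      then have "d i (z - t) = 0" using dzM2 M2_deg1[of "d i (z - t)" i] Suc by simp
      then show ?thesis using M_0 by (intro bexI[of _ 0]) auto
    next
      case (Suc j2)
      with \<open>j = Suc j1\<close> have j: "j = Suc (Suc j2)" by simp
      have dd: "d i' (d i (z - t)) = 0" if "i = Suc i'" for i'
        using d_d[of "z - t" i' j] that F_diff[OF z(1) M_F[OF tM]] by simp
      obtain u where u: "d i (z - t) = (\<Sum>s\<in>S. act s (u s))" "\<And>s. s \<in> S \<Longrightarrow> cyc i j2 (u s)"
        by (rule M2_cycle_split[OF dzM2[unfolded j] dd], assumption, rule that)
      have "\<forall>s\<in>S. \<exists>v. v \<in> M (Suc i) j \<and> d i v = act s (u s)"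
        using assms(2)[OF j] u(2) S_forms unfolding onto_def j by blast
      then obtain v where v: "\<And>s. s \<in> S \<Longrightarrow> v s \<in> M (Suc i) j" "\<And>s. s \<in> S \<Longrightarrow> d i (v s) = act s (u s)"
        by metis
      have "d i (\<Sum>s\<in>S. v s) = d i (z - t)" by (simp add: d_sum v(2) u(1))
      then show ?thesis using M_sum[of S v] v(1) by blast
    qed
    then obtain v where v: "v \<in> M (Suc i) j" "d i v = d i (z - t)" by blast
    have "d i (z - t - v) = 0" using v(2) by (simp add: d_diff)
    moreover have "z - t - v \<in> F (Suc i) j" by (rule F_diff[OF F_diff[OF z(1) M_F[OF tM]] M_F[OF v(1)]])
    ultimately obtain w' where "w' \<in> F (Suc (Suc i)) j" "d (Suc i) w' = z - t - v" using d_exact[of "z - t - v" i j] by blast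
    moreover have "z - (z - t - v) \<in> M (Suc i) j" using M_add[OF tM v(1)] by (simp add: algebra_simps)
    ultimately show ?thesis by (intro bexI[of _ w']) auto
  qed
qed

text \<open>If \<open>y\<close> is the boundary of \<open>w\<close> modulo \<open>m F\<close>, then
  \<open>act q y\<close> is exactly the boundary of \<open>act q w\<close>, because \<open>q\<close>
  kills \<open>m F\<close>.\<close>

lemma onto_vanish:
  assumes "vanish i j" shows "onto i j"
  unfolding onto_def
proof (intro allI impI)
  fix q :: "('v, 'k) mpoly" and y assume q: "q \<in> forms 2" and y: "cyc i j y"
  then obtain w where w: "w \<in> F (Suc i) j" "y - d i w \<in> M i j" using assms unfolding vanish_def by blast
  have "act q (y - d i w) = 0" by (rule act2_M[OF q w(2)])
  then have "d i (act q w) = act q y" by (simp add: act_diff d_act)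
  then show "\<exists>v\<in>M (Suc i) (Suc (Suc j)). d i v = act q y"
    using M2_M[OF act2_M2[OF q w(1)]] by blast
qed

lemma forms_2_split:
  assumes "q \<in> forms 2"
  obtains h where "q = (\<Sum>v\<in>UNIV. pvar v * h v)" "\<And>v. h v \<in> forms 1"
proof -
  have "lk q 0 = 0" using formsD[OF assms, of 0] by simp
  then obtain h where "q = (\<Sum>v\<in>UNIV. pvar v * h v)" "\<And>e v. q \<in> forms (Suc e) \<Longrightarrow> h v \<in> forms e"
    by (rule expand_forms_Suc) blast
  then show ?thesis using that assms by (metis Suc_1)
qed

text \<open>The differential sends \<open>act p y\<close> into \<open>m\<^sup>2 F\<close>, and the
  coefficients there are cycles of homological degree \<open>i - 1\<close> and internal degree
  \<open>j - 1\<close>. If these are boundaries modulo \<open>m F\<close>, some \<open>t\<close> in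
  \<open>m\<^sup>2 F\<close> has the same differential as \<open>act p y\<close>, and exactness
  applies to the difference.\<close>

lemma liftable_if:
  assumes "\<And>i' j'. i = Suc i' \<Longrightarrow> j = Suc j' \<Longrightarrow> vanish i' j'"
  shows "liftable i j"
  unfolding liftable_def
proof (intro allI impI)
  fix p :: "('v, 'k) mpoly" and y assume p: "p \<in> forms 1" and y: "cyc i j y"
  have py: "act p y \<in> M i (Suc j)" using act1_M[OF p] y by (auto simp: cyc_def)
  show "\<exists>v\<in>F (Suc i) (Suc j). d i v - act p y \<in> M2 i (Suc j)"
  proof (cases i)
    case 0
    then obtain v where "v \<in> F (Suc i) (Suc j)" "d i v = act p y"
      using d_exact0[of "act p y" "Suc j"] py by auto
    then show ?thesis using M2_0 by (intro bexI[of _ v]) auto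
  next
    case (Suc i')
    have dy: "d i' y \<in> M i' j" using y Suc by (simp add: cyc_def)
    have "\<exists>t\<in>M2 i (Suc j). d i' t = d i' (act p y)"
    proof (cases j)
      case 0
      then have "d i' y = 0" using dy M_deg0[of "d i' y" i'] by simp
      then show ?thesis using M2_0 by (intro bexI[of _ 0]) (auto simp: d_act)
    next
      case (Suc j')
      have "d i' (act p y) \<in> M2 i' (Suc j)" unfolding d_act by (rule act1_M2[OF p dy])
      moreover have "d i'' (d i' (act p y)) = 0" if "i' = Suc i''" for i''
        using d_d[of "act p y" i'' "Suc j"] M_F[OF py] that \<open>i = Suc i'\<close> by simp
      ultimately obtain u where u: "d i' (act p y) = (\<Sum>s\<in>S. act s (u s))" "\<And>s. s \<in> S \<Longrightarrow> cyc i' j' (u s)"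
        using M2_cycle_split[of "d i' (act p y)" i' j'] unfolding Suc by metis
      have "\<forall>s\<in>S. \<exists>w. w \<in> F (Suc i') j' \<and> u s - d i' w \<in> M i' j'"
        using assms[OF \<open>i = Suc i'\<close> Suc] u(2) unfolding vanish_def by blast
      then obtain w where w: "\<And>s. s \<in> S \<Longrightarrow> w s \<in> F (Suc i') j'" "\<And>s. s \<in> S \<Longrightarrow> u s - d i' (w s) \<in> M i' j'"
        by metis
      have "act s (u s) = act s (d i' (w s))" if "s \<in> S" for s
        using act2_M[OF S_forms[OF that] w(2)[OF that]] by (simp add: act_diff)
      then have "d i' (\<Sum>s\<in>S. act s (w s)) = d i' (act p y)"
        by (simp add: u(1)[unfolded d_act] d_sum d_act)
      moreover have "(\<Sum>s\<in>S. act s (w s)) \<in> M2 i (Suc j)"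
        unfolding Suc \<open>i = Suc i'\<close> by (intro M2_sum act2_M2 S_forms w)
      ultimately show ?thesis by blast
    qed
    then obtain t where t: "t \<in> M2 i (Suc j)" "d i' t = d i' (act p y)" by blast
    have "act p y - t \<in> F (Suc i') (Suc j)" using F_diff[OF M_F[OF py] M_F[OF M2_M[OF t(1)]]] Suc by simp
    moreover have "d i' (act p y - t) = 0" using t(2) by (simp add: d_diff)
    ultimately obtain v where v: "v \<in> F (Suc i) (Suc j)" "d i v = act p y - t"
      using d_exact[of "act p y - t" i' "Suc j"] unfolding Suc by blast
    have "d i v - act p y \<in> M2 i (Suc j)" using M2_diff[OF M2_0 t(1)] v(2) by simp
    then show ?thesis using v(1) by blast
  qed
qed

text \<open>Write \<open>q\<close> as a sum of products of two linear forms, lift the multiples of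
  \<open>y\<close> by one factor, and multiply by the other, which kills the error in
  \<open>m\<^sup>2 F\<close>.\<close>

lemma onto_liftable:
  assumes "liftable i j" shows "onto i j"
  unfolding onto_def
proof (intro allI impI)
  fix q :: "('v, 'k) mpoly" and y assume q: "q \<in> forms 2" and y: "cyc i j y"
  obtain h where h: "q = (\<Sum>v\<in>UNIV. pvar v * h v)" "\<And>v. h v \<in> forms 1" using forms_2_split[OF q] by blast
  have "\<forall>v. \<exists>u. u \<in> F (Suc i) (Suc j) \<and> d i u - act (h v) y \<in> M2 i (Suc j)"
    using assms h(2) y unfolding liftable_def by blast
  then obtain u where u: "\<And>v. u v \<in> F (Suc i) (Suc j)" "\<And>v. d i (u v) - act (h v) y \<in> M2 i (Suc j)" by metis
  have e: "act (pvar v) (d i (u v)) = act (pvar v * h v) y" for v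
    using act1_M2_eq_0[OF _ u(2), of "pvar v" v] by (simp add: act_diff act_act)
  have "d i (\<Sum>v\<in>UNIV. act (pvar v) (u v)) = act q y"
    by (simp add: d_sum d_act e h(1) act_sum_left)
  moreover have "(\<Sum>v\<in>UNIV. act (pvar v) (u v)) \<in> M (Suc i) (Suc (Suc j))"
    by (intro M_sum act1_M u) simp
  ultimately show "\<exists>v\<in>M (Suc i) (Suc (Suc j)). d i v = act q y" by blast
qed

text \<open>If the differential of \<open>y\<close> lies in \<open>m\<^sup>2 F\<close>, already
  every linear multiple of \<open>y\<close> has differential 0 and is a boundary; \<open>q\<close>
  is a combination of variables with linear coefficients.\<close>

lemma cycle_mult_boundary:
  assumes y: "y \<in> F (Suc i) j" "d i y \<in> M2 i j" and q: "q \<in> forms 2"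
  shows "\<exists>v\<in>M (Suc (Suc i)) (Suc (Suc j)). d (Suc i) v = act q y"
proof -
  obtain h where h: "q = (\<Sum>v\<in>UNIV. pvar v * h v)" "\<And>v. h v \<in> forms 1" using forms_2_split[OF q] by blast
  have "d i (act (h v) y) = 0" for v using act1_M2_eq_0[OF h(2) y(2)] by (simp add: d_act)
  then have "\<forall>v. \<exists>w. w \<in> F (Suc (Suc i)) (Suc j) \<and> d (Suc i) w = act (h v) y"
    using d_exact[OF F_act1[OF h(2) y(1)]] by blast
  then obtain w where w: "\<And>v. w v \<in> F (Suc (Suc i)) (Suc j)" "\<And>v. d (Suc i) (w v) = act (h v) y" by metis
  have "d (Suc i) (\<Sum>v\<in>UNIV. act (pvar v) (w v)) = act q y"
    by (simp add: d_sum d_act w(2) act_act h(1) act_sum_left)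
  moreover have "(\<Sum>v\<in>UNIV. act (pvar v) (w v)) \<in> M (Suc (Suc i)) (Suc (Suc j))"
    by (intro M_sum act1_M w) simp
  ultimately show ?thesis by blast
qed

text \<open>The \<open>u l\<close> lift the multiples of one cycle \<open>y\<close> by the
  variables. A linear syzygy of the variables modulo \<open>V\<close>, applied to the
  \<open>u l\<close>, yields an element with differential 0. By \<open>quadratic\<close>, the vector
  with single entry \<open>q\<close> at \<open>m\<close> is a combination of such syzygies with
  linear coefficients.\<close>

lemma lift_mult_boundary:
  assumes u: "\<And>l. u l \<in> F (Suc i) (Suc j)" "\<And>l. d i (u l) - act (pvar l) y \<in> M2 i (Suc j)"
    and q: "q \<in> forms 2"
  shows "\<exists>v\<in>M (Suc (Suc i)) (Suc (Suc (Suc j))). d (Suc i) v = act q (u m)"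
proof -
  obtain T :: "(nat + 'v \<times> 'v) set" and g h where
    T: "\<And>t. t \<in> T \<Longrightarrow> g t \<in> forms 1" "\<And>t l. t \<in> T \<Longrightarrow> h t l \<in> forms 1"
       "\<And>t. t \<in> T \<Longrightarrow> (\<Sum>l\<in>UNIV. h t l * pvar l) \<in> V"
       "\<And>l. (if l = m then q else 0) - (\<Sum>t\<in>T. g t * h t l) \<in> V"
    using quadratic[OF q, of m] by blast
  define e where "e t = (\<Sum>l\<in>UNIV. act (h t l) (u l))" for t
  have "d i (e t) = 0" if t: "t \<in> T" for t
  proof -
    have "act (h t l) (d i (u l)) = act (h t l * pvar l) y" for l
      using act1_M2_eq_0[OF T(2)[OF t] u(2)] by (simp add: act_diff act_act)
    then have "d i (e t) = act (\<Sum>l\<in>UNIV. h t l * pvar l) y"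
      by (simp add: e_def d_sum d_act act_sum_left)
    then show ?thesis using T(3)[OF t] act_V by simp
  qed
  moreover have "e t \<in> F (Suc i) (Suc (Suc j))" if "t \<in> T" for t
    unfolding e_def by (intro F_sum F_act1 T(2)[OF that] u)
  ultimately have "\<forall>t\<in>T. \<exists>w. w \<in> F (Suc (Suc i)) (Suc (Suc j)) \<and> d (Suc i) w = e t"
    using d_exact[of "e _" i "Suc (Suc j)"] by blast
  then obtain w where w: "\<And>t. t \<in> T \<Longrightarrow> w t \<in> F (Suc (Suc i)) (Suc (Suc j))" "\<And>t. t \<in> T \<Longrightarrow> d (Suc i) (w t) = e t"
    by metis
  have "act q (u m) = (\<Sum>l\<in>UNIV. act (if l = m then q else 0) (u l))"
  proof -
    have "(\<Sum>l\<in>UNIV. act (if l = m then q else 0) (u l)) = (\<Sum>l\<in>UNIV. if l = m then act q (u l) else 0)"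
      by (intro sum.cong) auto
    then show ?thesis by simp
  qed
  also have "\<dots> = (\<Sum>l\<in>UNIV. act (\<Sum>t\<in>T. g t * h t l) (u l))"
    using act_V[OF T(4)] by (intro sum.cong refl) (simp add: act_diff_left)
  also have "\<dots> = (\<Sum>t\<in>T. act (g t) (e t))"
    unfolding act_sum_left e_def act_sum act_act by (rule sum.swap)
  also have "\<dots> = d (Suc i) (\<Sum>t\<in>T. act (g t) (w t))"
    by (simp add: d_sum d_act w(2))
  finally have "d (Suc i) (\<Sum>t\<in>T. act (g t) (w t)) = act q (u m)" ..
  moreover have "(\<Sum>t\<in>T. act (g t) (w t)) \<in> M (Suc (Suc i)) (Suc (Suc (Suc j)))"
    by (intro M_sum act1_M T(1) w(1))
  ultimately show ?thesis by blast
qed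

text \<open>Lifting the summands \<open>act (pvar v) (z v)\<close> of \<open>d i y\<close> splits
  \<open>y\<close> into the lifts \<open>u v v\<close> and a remainder \<open>y'\<close> with
  differential in \<open>m\<^sup>2 F\<close>; \<open>lift_mult_boundary\<close> treats the former
  and \<open>cycle_mult_boundary\<close> the latter.\<close>

lemma onto_Suc:
  assumes "liftable i j" shows "onto (Suc i) (Suc j)"
  unfolding onto_def
proof (intro allI impI)
  fix q :: "('v, 'k) mpoly" and y assume q: "q \<in> forms 2" and y: "cyc (Suc i) (Suc j) y"
  have yF: "y \<in> F (Suc i) (Suc j)" "d i y \<in> M i (Suc j)" using y by (auto simp: cyc_def)
  obtain z where z: "d i y = (\<Sum>v\<in>UNIV. act (pvar v) (z v))" "\<And>v. cyc i j (z v)"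
    using boundary_split[OF yF] by blast
  have "\<forall>v l. \<exists>u. u \<in> F (Suc i) (Suc j) \<and> d i u - act (pvar l) (z v) \<in> M2 i (Suc j)"
    using assms z(2) forms_pvar unfolding liftable_def by blast
  then obtain u where u: "\<And>v l. u v l \<in> F (Suc i) (Suc j)"
      "\<And>v l. d i (u v l) - act (pvar l) (z v) \<in> M2 i (Suc j)" by metis
  define y' where "y' = y - (\<Sum>v\<in>UNIV. u v v)"
  have "d i y' = - (\<Sum>v\<in>UNIV. d i (u v v) - act (pvar v) (z v))"
    by (simp add: y'_def d_diff z(1) d_sum sum_subtractf)
  moreover have "(\<Sum>v\<in>UNIV. d i (u v v) - act (pvar v) (z v)) \<in> M2 i (Suc j)"
    by (intro M2_sum u)
  ultimately have "d i y' \<in> M2 i (Suc j)" using M2_diff[OF M2_0] by simp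
  moreover have "y' \<in> F (Suc i) (Suc j)" unfolding y'_def by (intro F_diff yF F_sum u)
  ultimately obtain v0 where v0: "v0 \<in> M (Suc (Suc i)) (Suc (Suc (Suc j)))" "d (Suc i) v0 = act q y'"
    using cycle_mult_boundary[of y' i "Suc j", OF _ _ q] by blast
  have "\<forall>m. \<exists>v. v \<in> M (Suc (Suc i)) (Suc (Suc (Suc j))) \<and> d (Suc i) v = act q (u m m)"
    using lift_mult_boundary[OF u q] by blast
  then obtain v where v: "\<And>m. v m \<in> M (Suc (Suc i)) (Suc (Suc (Suc j)))" "\<And>m. d (Suc i) (v m) = act q (u m m)"
    by metis
  have "d (Suc i) (v0 + (\<Sum>m\<in>UNIV. v m)) = act q y"
    by (simp add: d_add d_sum v v0 y'_def act_diff act_sum)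
  moreover have "v0 + (\<Sum>m\<in>UNIV. v m) \<in> M (Suc (Suc i)) (Suc (Suc (Suc j)))"
    by (intro M_add M_sum v v0)
  ultimately show "\<exists>v\<in>M (Suc (Suc i)) (Suc (Suc (Suc j))). d (Suc i) v = act q y" by blast
qed

theorem vanish_above:
  assumes "i + i div 3 < j" shows "vanish i j"
  using assms
proof (induction i arbitrary: j rule: less_induct)
  case (less i)
  \<comment> \<open>At a positive multiple of 3 the bound drops by two in passing to
    \<open>i0 - 1\<close>, so vanishing there reaches the degree that \<open>liftable_if\<close>
    asks for.\<close>
  have lift: "liftable i0 (i0 + i0 div 3)" if "i0 < i" "i0 mod 3 = 0" for i0
  proof (rule liftable_if)
    fix i' j' assume ij: "i0 = Suc i'" "i0 + i0 div 3 = Suc j'"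
    have "i' div 3 < i0 div 3" using ij(1) that(2) by presburger
    then show "vanish i' j'" using less.IH[of i' j'] ij that by simp
  qed
  show ?case
  proof (cases i)
    case 0
    then obtain j' where j: "j = Suc j'" using less.prems by (cases j) auto
    show ?thesis unfolding vanish_def
    proof (intro allI impI)
      fix z assume "cyc i j z"
      then have "z \<in> M i j" using F0_M j 0 by (auto simp: cyc_def)
      then show "\<exists>w\<in>F (Suc i) j. z - d i w \<in> M i j" using F_0 by (intro bexI[of _ 0]) auto
    qed
  next
    case (Suc i0)
    show ?thesis
      unfolding Suc
    proof (rule vanish_Suc)
      fix j1 assume "j = Suc j1"
      moreover have "i0 div 3 \<le> Suc i0 div 3" by (simp add: div_le_mono)
      ultimately show "vanish i0 j1" using less.IH[of i0 j1] less.prems Suc by simp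
    next
      fix j2 assume j: "j = Suc (Suc j2)"
      show "onto i0 j2"
      proof (cases "i0 + i0 div 3 < j2")
        case True
        then show ?thesis using less.IH[of i0 j2] Suc onto_vanish by simp
      next
        case False
        have le: "i0 div 3 \<le> Suc i0 div 3" by (simp add: div_le_mono)
        \<comment> \<open>The induction hypothesis misses just one degree, and only if the quotient
          by 3 does not jump from \<open>i0\<close> to \<open>Suc i0\<close>; this excludes residue
          2.\<close>
        then have eq: "j2 = i0 + i0 div 3" "Suc i0 div 3 = i0 div 3"
          using False j less.prems Suc by simp_all
        then have "i0 mod 3 = 0 \<or> i0 mod 3 = 1" by presburger
        then show ?thesis
        proof
          assume "i0 mod 3 = 0"
          then show ?thesis using lift[of i0] Suc eq(1) onto_liftable by simp
        next
          assume 2: "i0 mod 3 = 1"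
          then obtain i1 where i1: "i0 = Suc i1" by (cases i0) auto
          then have m: "i1 mod 3 = 0" "i1 div 3 = i0 div 3"
            using 2 by presburger+
          then have "j2 = Suc (i1 + i1 div 3)" using eq(1) i1 by simp
          then show ?thesis using onto_Suc[OF lift[of i1]] i1 m Suc by simp
        qed
      qed
    qed
  qed
qed

end

section \<open>Lifting resolutions over the quotient ring to matrices of polynomials\<close>

definition app :: "nat \<Rightarrow> (nat \<Rightarrow> nat \<Rightarrow> 'r) \<Rightarrow> (nat \<Rightarrow> 'r) \<Rightarrow> nat \<Rightarrow> 'r::comm_ring_1" where
  "app q A v r = (\<Sum>c<q. A r c * v c)"

text \<open>Counterpart of \<open>twist\<close> for polynomials.\<close>

definition tw :: "nat \<Rightarrow> nat \<Rightarrow> ('v::finite, 'k::field) mpoly set" where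
  "tw a j = (if a \<le> j then forms (j - a) else {0})"

context quadrics
begin

definition proj :: "('v, 'k) mpoly \<Rightarrow> ('v, 'k) mpoly set" where
  "proj p = forms_ideal N f +>\<^bsub>mpoly_ring\<^esub> p"

definition pvec :: "nat \<Rightarrow> (nat \<Rightarrow> ('v, 'k) mpoly) \<Rightarrow> nat \<Rightarrow> ('v, 'k) mpoly set" where
  "pvec n v = (\<lambda>c\<in>{..<n}. proj (v c))"

abbreviation "R \<equiv> quot_ring N f"
abbreviation "G \<equiv> quot_grading N f"

lemma proj_eq: "proj p = (\<lambda>h. h + p) ` QI"
  by (auto simp: proj_def forms_ideal_eq_QI a_r_coset_def' ring_of_type_algebra_def)

lemma proj_eq_iff: "proj p = proj q \<longleftrightarrow> p - q \<in> QI"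
proof
  assume "proj p = proj q"
  moreover have "p \<in> proj p" unfolding proj_eq by (rule image_eqI[of _ _ 0]) auto
  ultimately have "p \<in> (\<lambda>h. h + q) ` QI" by (simp add: proj_eq)
  then show "p - q \<in> QI" by auto
next
  assume d: "p - q \<in> QI"
  show "proj p = proj q"
  proof (intro equalityI subsetI)
    fix x assume "x \<in> proj p"
    then obtain h where "h \<in> QI" "x = h + p" by (auto simp: proj_eq)
    then have "x = (h + (p - q)) + q" "h + (p - q) \<in> QI" using d by (auto intro: QI_add)
    then show "x \<in> proj q" unfolding proj_eq by blast
  next
    fix x assume "x \<in> proj q"
    then obtain h where "h \<in> QI" "x = h + q" by (auto simp: proj_eq)
    then have "x = (h - (p - q)) + p" "h - (p - q) \<in> QI" using d by (auto intro: QI_diff)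
    then show "x \<in> proj p" unfolding proj_eq by blast
  qed
qed

lemma cring_R: "cring R"
  unfolding quot_ring_def forms_ideal_eq_QI
  by (rule ideal.quotient_is_cring[OF ideal_QI cring_mpoly])

lemma proj_hom: "proj \<in> Ring.ring_hom mpoly_ring R"
  unfolding quot_ring_def proj_def[abs_def] forms_ideal_eq_QI
  by (rule ideal.rcos_ring_hom[OF ideal_QI])

lemma proj_carrier [simp]: "proj p \<in> carrier R"
  using ring_hom_closed[OF proj_hom, of p] by (simp add: ring_of_type_algebra_def)

lemma proj_mult: "proj (p * q) = proj p \<otimes>\<^bsub>R\<^esub> proj q"
  using ring_hom_mult[OF proj_hom, of p q] by (simp add: ring_of_type_algebra_def)

lemma proj_add: "proj (p + q) = proj p \<oplus>\<^bsub>R\<^esub> proj q"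
  using ring_hom_add[OF proj_hom, of p q] by (simp add: ring_of_type_algebra_def)

lemma proj_0: "proj 0 = \<zero>\<^bsub>R\<^esub>"
proof -
  interpret R: cring R by (rule cring_R)
  have "proj 0 \<oplus>\<^bsub>R\<^esub> proj 0 = proj 0" using proj_add[of 0 0] by simp
  then show ?thesis by (metis R.add.r_cancel_one proj_carrier)
qed

lemma proj_diff: "proj p \<ominus>\<^bsub>R\<^esub> proj q = proj (p - q)"
proof -
  interpret R: cring R by (rule cring_R)
  have "proj (p - q) \<oplus>\<^bsub>R\<^esub> proj q = proj p" using proj_add[of "p - q" q] by simp
  then have "proj p \<ominus>\<^bsub>R\<^esub> proj q = (proj (p - q) \<oplus>\<^bsub>R\<^esub> proj q) \<ominus>\<^bsub>R\<^esub> proj q" by simp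
  then show ?thesis by (simp add: R.minus_eq R.a_assoc R.r_neg)
qed

lemma carrier_R: "carrier R = range proj"
  by (auto simp: quot_ring_def FactRing_def A_RCOSETS_def' proj_def[abs_def] ring_of_type_algebra_def)

lemma proj_finsum:
  "finite A \<Longrightarrow> finsum R (\<lambda>c. proj (g c)) A = proj (\<Sum>c\<in>A. g c)"
proof (induction A rule: finite_induct)
  case empty
  interpret R: cring R by (rule cring_R)
  show ?case by (simp add: proj_0)
next
  case (insert x A)
  interpret R: cring R by (rule cring_R)
  show ?case using insert by (simp add: R.finsum_insert proj_add)
qed

lemma finsum_R_cong:
  fixes q :: nat
  assumes "\<And>c. c < q \<Longrightarrow> g c = proj (h c)"
  shows "finsum R g {..<q} = proj (\<Sum>c<q. h c)"
proof -
  interpret R: cring R by (rule cring_R)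
  have "finsum R g {..<q} = finsum R (\<lambda>c. proj (h c)) {..<q}"
    by (rule R.finsum_cong') (use assms in auto)
  also have "\<dots> = proj (\<Sum>c<q. h c)" by (rule proj_finsum) simp
  finally show ?thesis .
qed

lemma QI_const: "p \<in> QI \<Longrightarrow> lk p 0 = 0"
proof -
  assume "p \<in> QI"
  then have "hcomp 0 p = 0" by (simp add: QI_def)
  then have "lk (hcomp 0 p) 0 = 0" by simp
  then show ?thesis by (simp add: lk_hcomp)
qed

lemma lk_mult_0: "lk (p * q) 0 = lk p 0 * lk q 0" for p q :: "('v, 'k) mpoly"
proof -
  have "lk (p * q) 0 = lk (hcomp 0 (p * q)) 0" by (simp add: lk_hcomp)
  also have "\<dots> = lk (hcomp 0 p * hcomp 0 q) 0" by (simp add: hcomp_mult)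
  also have "\<dots> = lk (cst (lk p 0) * hcomp 0 q) 0"
    using forms_0_eq_cst[of "hcomp 0 p"] by (simp add: lk_hcomp)
  finally show ?thesis by (simp add: lk_cst_mult lk_hcomp)
qed

text \<open>The polynomials without constant term map onto an ideal that contains all components of
  positive degree; conversely each of them is a combination of variables.\<close>

lemma irrelevant_eq: "irrelevant_ideal R G = proj ` {p. lk p 0 = 0}"
proof
  interpret R: cring R by (rule cring_R)
  have sub: "(\<Union>d\<in>{1..}. G d) \<subseteq> proj ` {p. lk p 0 = 0}"
    by (auto simp: quot_grading_def proj_def[symmetric] dest!: formsD[of _ _ 0])
  have idl: "ideal (proj ` {p. lk p 0 = 0}) R"
  proof (rule idealI[OF R.ring_axioms])
    show "subgroup (proj ` {p. lk p 0 = 0}) (add_monoid R)"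
    proof (rule R.add.subgroupI)
      show "proj ` {p. lk p 0 = 0} \<subseteq> carrier R" by auto
      show "proj ` {p. lk p 0 = 0} \<noteq> {}" by (auto intro!: exI[of _ 0])
    next
      fix x assume "x \<in> proj ` {p. lk p 0 = 0}"
      then obtain p where p: "x = proj p" "lk p 0 = 0" by blast
      have "\<ominus>\<^bsub>R\<^esub> x = proj (- p)"
        using proj_diff[of 0 p] by (simp add: p(1) proj_0 R.minus_eq)
      then show "\<ominus>\<^bsub>R\<^esub> x \<in> proj ` {p. lk p 0 = 0}"
        using p(2) by auto
    next
      fix x y assume "x \<in> proj ` {p. lk p 0 = 0}" "y \<in> proj ` {p. lk p 0 = 0}"
      then obtain p q where p: "x = proj p" "lk p 0 = 0" and q: "y = proj q" "lk q 0 = 0" by blast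
      then have "x \<oplus>\<^bsub>R\<^esub> y = proj (p + q)" "lk (p + q) 0 = 0" by (auto simp: proj_add lookup_add)
      then show "x \<oplus>\<^bsub>R\<^esub> y \<in> proj ` {p. lk p 0 = 0}" by auto
    qed
  next
    fix a x assume "a \<in> proj ` {p. lk p 0 = 0}" "x \<in> carrier R"
    then obtain p q where p: "a = proj p" "lk p 0 = 0" and q: "x = proj q"
      unfolding carrier_R by blast
    then have *: "x \<otimes>\<^bsub>R\<^esub> a = proj (q * p)" "a \<otimes>\<^bsub>R\<^esub> x = proj (q * p)" "lk (q * p) 0 = 0"
      unfolding p(1) q by (simp_all add: proj_mult[symmetric] lk_mult_0 mult.commute)
    show "x \<otimes>\<^bsub>R\<^esub> a \<in> proj ` {p. lk p 0 = 0}" "a \<otimes>\<^bsub>R\<^esub> x \<in> proj ` {p. lk p 0 = 0}"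
      using * by auto
  qed
  show "irrelevant_ideal R G \<subseteq> proj ` {p. lk p 0 = 0}"
    unfolding irrelevant_ideal_def by (rule R.genideal_minimal[OF idl sub])
  have subc: "(\<Union>d\<in>{1..}. G d) \<subseteq> carrier R" using sub by auto
  interpret I: ideal "irrelevant_ideal R G" R
    unfolding irrelevant_ideal_def by (rule R.genideal_ideal[OF subc])
  have gen: "proj (pvar v) \<in> irrelevant_ideal R G" for v
  proof -
    have "proj (pvar v) \<in> G 1" by (auto simp: quot_grading_def proj_def[symmetric])
    then show ?thesis unfolding irrelevant_ideal_def using R.genideal_self[OF subc] by auto
  qed
  show "proj ` {p. lk p 0 = 0} \<subseteq> irrelevant_ideal R G"
  proof clarify
    fix p :: "('v, 'k) mpoly" assume "lk p 0 = 0"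
    then obtain h where h: "p = (\<Sum>v\<in>UNIV. pvar v * h v)" by (rule expand_forms_Suc) blast
    have "proj (\<Sum>v\<in>A. pvar v * h v) \<in> irrelevant_ideal R G" if "finite A" for A
      using that
    proof (induction A rule: finite_induct)
      case empty
      then show ?case using I.zero_closed by (simp add: proj_0)
    next
      case (insert x A)
      then show ?case
        by (simp add: proj_add proj_mult I.a_closed I.I_r_closed[OF gen proj_carrier])
    qed
    then show "proj p \<in> irrelevant_ideal R G" using h by simp
  qed
qed

lemma proj_irrelevant_iff: "proj p \<in> irrelevant_ideal R G \<longleftrightarrow> lk p 0 = 0"
proof
  assume "proj p \<in> irrelevant_ideal R G"
  then obtain q where q: "lk q 0 = 0" "proj p = proj q" unfolding irrelevant_eq by blast
  then have "p - q \<in> QI" by (simp add: proj_eq_iff)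
  from QI_const[OF this] show "lk p 0 = 0" using q by (simp add: lookup_minus)
qed (auto simp: irrelevant_eq)

lemma twist_iff: "x \<in> twist R G a j \<longleftrightarrow> (\<exists>p\<in>tw a j. x = proj p)"
  by (auto simp: twist_def tw_def quot_grading_def proj_def[symmetric] proj_0)

lemma vecs_eq: "vecs (carrier R) n = range (pvec n)"
proof (intro equalityI subsetI)
  fix x assume x: "x \<in> vecs (carrier R) n"
  then have "\<forall>c. \<exists>p. c < n \<longrightarrow> x c = proj p" by (auto simp: carrier_R PiE_def Pi_def)
  then obtain v where v: "\<And>c. c < n \<Longrightarrow> x c = proj (v c)" by metis
  then have "x = pvec n v" using x by (auto simp: pvec_def PiE_def extensional_def fun_eq_iff)
  then show "x \<in> range (pvec n)" by simp
qed (auto simp: pvec_def)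

lemma pvec_eq_iff: "pvec n v = pvec n w \<longleftrightarrow> (\<forall>c<n. v c - w c \<in> QI)"
  by (auto simp: pvec_def fun_eq_iff restrict_def proj_eq_iff)

lemma pvec_cong: "(\<And>c. c < n \<Longrightarrow> v c = w c) \<Longrightarrow> pvec n v = pvec n w"
  unfolding pvec_def by (rule restrict_ext) simp

lemma mat_apply_pvec:
  assumes "\<And>r c. r < p \<Longrightarrow> c < q \<Longrightarrow> A r c = proj (D r c)"
  shows "mat_apply R p q A (pvec q v) = pvec p (app q D v)"
  unfolding mat_apply_def pvec_def app_def
proof (rule restrict_ext)
  fix r assume "r \<in> {..<p}"
  then show "finsum R (\<lambda>c. A r c \<otimes>\<^bsub>R\<^esub> (\<lambda>c\<in>{..<q}. proj (v c)) c) {..<q} = proj (\<Sum>c<q. D r c * v c)"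
    by (intro finsum_R_cong) (simp add: assms proj_mult)
qed

text \<open>\<open>graded_free_resolution\<close> for matrices of homogeneous polynomials, with
  equations modulo \<open>QI\<close>. The index is shifted: \<open>D i\<close> lifts
  \<open>d (Suc i)\<close>. Membership in the maximal ideal becomes vanishing of the constant
  term.\<close>

definition lifted_resolution ::
  "(nat \<Rightarrow> nat) \<Rightarrow> (nat \<Rightarrow> nat \<Rightarrow> nat) \<Rightarrow> (nat \<Rightarrow> nat \<Rightarrow> nat \<Rightarrow> ('v, 'k) mpoly) \<Rightarrow> bool" where
  "lifted_resolution b a D \<longleftrightarrow>
     b 0 = 1 \<and> a 0 0 = 0 \<and>
     (\<forall>i. \<forall>r<b i. \<forall>c<b (Suc i). D i r c \<in> tw (a i r) (a (Suc i) c)) \<and>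
     (\<forall>v. lk (app (b (Suc 0)) (D 0) v 0) 0 = 0) \<and>
     (\<forall>p. lk p 0 = 0 \<longrightarrow> (\<exists>v. p - app (b (Suc 0)) (D 0) v 0 \<in> QI)) \<and>
     (\<forall>i v. \<forall>r<b i. app (b (Suc i)) (D i) (app (b (Suc (Suc i))) (D (Suc i)) v) r \<in> QI) \<and>
     (\<forall>i v. (\<forall>r<b i. app (b (Suc i)) (D i) v r \<in> QI) \<longrightarrow>
        (\<exists>w. \<forall>c<b (Suc i). v c - app (b (Suc (Suc i))) (D (Suc i)) w c \<in> QI))"

lemma app_cong_QI:
  assumes "\<And>c. c < q \<Longrightarrow> v c - w c \<in> QI"
  shows "app q A v r - app q A w r \<in> QI"
proof -
  have "app q A v r - app q A w r = (\<Sum>c<q. A r c * (v c - w c))"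
    by (simp add: app_def sum_subtractf right_diff_distrib)
  also have "\<dots> \<in> QI" using assms by (intro QI_sum QI_mult) auto
  finally show ?thesis .
qed

text \<open>Each equality of an image with a kernel or with the maximal ideal splits into two
  inclusions, and these do not depend on the representatives modulo \<open>QI\<close>.\<close>

lemma graded_free_resolution_iff:
  assumes lift: "\<And>i r c. r < b i \<Longrightarrow> c < b (Suc i) \<Longrightarrow> d (Suc i) r c = proj (D i r c)"
    and tw: "\<And>i r c. r < b i \<Longrightarrow> c < b (Suc i) \<Longrightarrow> D i r c \<in> tw (a i r) (a (Suc i) c)"
  shows "graded_free_resolution R G b a d \<longleftrightarrow> lifted_resolution b a D"
proof -
  have ma: "mat_apply R (b i) (b (Suc i)) (d (Suc i)) (pvec (b (Suc i)) v) = pvec (b i) (app (b (Suc i)) (D i) v)" for i v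
    by (rule mat_apply_pvec) (rule lift)
  have 1: "(\<forall>i. \<forall>r<b i. \<forall>c<b (Suc i). d (Suc i) r c \<in> twist R G (a i r) (a (Suc i) c))"
    using lift tw by (auto simp: twist_iff)
  have 2: "mat_apply R (b 0) (b 1) (d 1) ` vecs (carrier R) (b 1) = vecs (irrelevant_ideal R G) (b 0) \<longleftrightarrow>
     (\<forall>v. lk (app (b (Suc 0)) (D 0) v 0) 0 = 0) \<and>
     (\<forall>p. lk p 0 = 0 \<longrightarrow> (\<exists>v. p - app (b (Suc 0)) (D 0) v 0 \<in> QI))" if b0: "b 0 = 1"
  proof -
    have img: "mat_apply R (b 0) (b 1) (d 1) ` vecs (carrier R) (b 1)
       = (\<lambda>v. pvec 1 (app (b (Suc 0)) (D 0) v)) ` UNIV"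
      using ma[of 0] b0 by (simp add: vecs_eq image_image)
    have irr: "vecs (irrelevant_ideal R G) (b 0) = (\<lambda>p. pvec 1 (\<lambda>_. p)) ` {p. lk p 0 = 0}"
    proof (intro equalityI subsetI)
      fix x assume x: "x \<in> vecs (irrelevant_ideal R G) (b 0)"
      then have "x 0 \<in> irrelevant_ideal R G" using b0 by auto
      then obtain p where p: "lk p 0 = 0" "x 0 = proj p" unfolding irrelevant_eq by blast
      have "x = pvec 1 (\<lambda>_. p)" using x p b0
        by (auto simp: pvec_def PiE_def extensional_def fun_eq_iff)
      then show "x \<in> (\<lambda>p. pvec 1 (\<lambda>_. p)) ` {p. lk p 0 = 0}" using p by blast
    qed (auto simp: pvec_def proj_irrelevant_iff b0)
    have eq: "pvec 1 v = pvec 1 (\<lambda>_. v 0)" for v by (rule pvec_cong) simp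
    have eqi: "pvec 1 (\<lambda>_. p) = pvec 1 v \<longleftrightarrow> p - v 0 \<in> QI" for p v by (simp add: pvec_eq_iff)
    have mem: "pvec 1 (\<lambda>_. p) \<in> (\<lambda>p. pvec 1 (\<lambda>_. p)) ` {p. lk p 0 = 0} \<longleftrightarrow> lk p 0 = 0" for p
    proof
      assume "pvec 1 (\<lambda>_. p) \<in> (\<lambda>p. pvec 1 (\<lambda>_. p)) ` {p. lk p 0 = 0}"
      then obtain q where "pvec 1 (\<lambda>_. p) = pvec 1 (\<lambda>_. q)" and q: "lk q 0 = 0" by blast
      then have "p - q \<in> QI" using eqi[of p "\<lambda>_. q"] by blast
      with q show "lk p 0 = 0" using QI_const[of "p - q"] by (simp add: lookup_minus)
    qed auto
    show ?thesis
      unfolding img irr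
    proof
      assume e: "range (\<lambda>v. pvec 1 (app (b (Suc 0)) (D 0) v)) = (\<lambda>p. pvec 1 (\<lambda>_. p)) ` {p. lk p 0 = 0}"
      have "lk (app (b (Suc 0)) (D 0) v 0) 0 = 0" for v
      proof -
        have "pvec 1 (app (b (Suc 0)) (D 0) v) \<in> (\<lambda>p. pvec 1 (\<lambda>_. p)) ` {p. lk p 0 = 0}"
          unfolding e[symmetric] by (rule rangeI)
        then show ?thesis unfolding eq[of "app (b (Suc 0)) (D 0) v"] mem .
      qed
      moreover have "\<exists>v. p - app (b (Suc 0)) (D 0) v 0 \<in> QI" if "lk p 0 = 0" for p
      proof -
        have "pvec 1 (\<lambda>_. p) \<in> range (\<lambda>v. pvec 1 (app (b (Suc 0)) (D 0) v))" unfolding e mem by (rule that)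
        then obtain v where "pvec 1 (\<lambda>_. p) = pvec 1 (app (b (Suc 0)) (D 0) v)" by blast
        then show ?thesis using eqi by blast
      qed
      ultimately show "(\<forall>v. lk (app (b (Suc 0)) (D 0) v 0) 0 = 0) \<and>
         (\<forall>p. lk p 0 = 0 \<longrightarrow> (\<exists>v. p - app (b (Suc 0)) (D 0) v 0 \<in> QI))" by blast
    next
      assume e: "(\<forall>v. lk (app (b (Suc 0)) (D 0) v 0) 0 = 0) \<and>
         (\<forall>p. lk p 0 = 0 \<longrightarrow> (\<exists>v. p - app (b (Suc 0)) (D 0) v 0 \<in> QI))"
      show "range (\<lambda>v. pvec 1 (app (b (Suc 0)) (D 0) v)) = (\<lambda>p. pvec 1 (\<lambda>_. p)) ` {p. lk p 0 = 0}"
      proof (intro equalityI subsetI)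
        fix x assume "x \<in> range (\<lambda>v. pvec 1 (app (b (Suc 0)) (D 0) v))"
        then obtain v where v: "x = pvec 1 (app (b (Suc 0)) (D 0) v)" by blast
        have "x = pvec 1 (\<lambda>_. app (b (Suc 0)) (D 0) v 0)" unfolding v by (rule eq)
        then show "x \<in> (\<lambda>p. pvec 1 (\<lambda>_. p)) ` {p. lk p 0 = 0}" using e mem by simp
      next
        fix x assume "x \<in> (\<lambda>p. pvec 1 (\<lambda>_. p)) ` {p. lk p 0 = 0}"
        then obtain p where p: "lk p 0 = 0" "x = pvec 1 (\<lambda>_. p)" by blast
        then obtain v where "p - app (b (Suc 0)) (D 0) v 0 \<in> QI" using e by blast
        then have "x = pvec 1 (app (b (Suc 0)) (D 0) v)" unfolding p eqi .
        then show "x \<in> range (\<lambda>v. pvec 1 (app (b (Suc 0)) (D 0) v))" by blast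
      qed
    qed
  qed
  have 3: "(mat_apply R (b (Suc i)) (b (Suc (Suc i))) (d (Suc (Suc i)))
             ` vecs (carrier R) (b (Suc (Suc i))) =
          {v \<in> vecs (carrier R) (b (Suc i)).
             \<forall>r<b i. mat_apply R (b i) (b (Suc i)) (d (Suc i)) v r = \<zero>\<^bsub>R\<^esub>}) \<longleftrightarrow>
     (\<forall>v. \<forall>r<b i. app (b (Suc i)) (D i) (app (b (Suc (Suc i))) (D (Suc i)) v) r \<in> QI) \<and>
     (\<forall>v. (\<forall>r<b i. app (b (Suc i)) (D i) v r \<in> QI) \<longrightarrow>
        (\<exists>w. \<forall>c<b (Suc i). v c - app (b (Suc (Suc i))) (D (Suc i)) w c \<in> QI))" for i
  proof -
    let ?n = "b (Suc i)" and ?A = "app (b (Suc (Suc i))) (D (Suc i))" and ?B = "app (b (Suc i)) (D i)"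
    let ?I = "range (\<lambda>v. pvec ?n (?A v))" and ?K = "{pvec ?n v | v. \<forall>r<b i. ?B v r \<in> QI}"
    have img: "mat_apply R (b (Suc i)) (b (Suc (Suc i))) (d (Suc (Suc i)))
             ` vecs (carrier R) (b (Suc (Suc i))) = ?I"
      using ma[of "Suc i"] by (simp add: vecs_eq image_image)
    have z: "(\<forall>r<b i. mat_apply R (b i) (b (Suc i)) (d (Suc i)) (pvec ?n v) r = \<zero>\<^bsub>R\<^esub>) \<longleftrightarrow>
        (\<forall>r<b i. ?B v r \<in> QI)" for v
      unfolding ma using proj_eq_iff[of _ 0] by (auto simp: pvec_def proj_0)
    have ker: "{v \<in> vecs (carrier R) (b (Suc i)).
             \<forall>r<b i. mat_apply R (b i) (b (Suc i)) (d (Suc i)) v r = \<zero>\<^bsub>R\<^esub>} = ?K"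
      unfolding vecs_eq using z by auto
    have mem: "pvec ?n v \<in> ?K \<longleftrightarrow> (\<forall>r<b i. ?B v r \<in> QI)" for v
    proof
      assume "pvec ?n v \<in> ?K"
      then obtain w where w: "\<And>c. c < ?n \<Longrightarrow> v c - w c \<in> QI" "\<And>r. r < b i \<Longrightarrow> ?B w r \<in> QI"
        by (auto simp: pvec_eq_iff)
      have d: "?B v r - ?B w r \<in> QI" for r by (rule app_cong_QI) (rule w(1))
      show "\<forall>r<b i. ?B v r \<in> QI"
      proof (intro allI impI)
        fix r assume "r < b i"
        from QI_add[OF d[of r] w(2)[OF this]] show "?B v r \<in> QI" by simp
      qed
    qed auto
    show ?thesis
      unfolding img ker
    proof
      assume e: "?I = ?K"
      have "\<forall>r<b i. ?B (?A v) r \<in> QI" for v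
      proof -
        have "pvec ?n (?A v) \<in> ?K" unfolding e[symmetric] by (rule rangeI)
        then show ?thesis by (rule iffD1[OF mem])
      qed
      moreover have "\<exists>w. \<forall>c<b (Suc i). v c - ?A w c \<in> QI" if "\<forall>r<b i. ?B v r \<in> QI" for v
      proof -
        have "pvec ?n v \<in> ?I" unfolding e mem by (rule that)
        then obtain w where "pvec ?n v = pvec ?n (?A w)" unfolding image_iff by (elim bexE)
        then have "\<forall>c<b (Suc i). v c - ?A w c \<in> QI" unfolding pvec_eq_iff .
        then show ?thesis by (intro exI[of _ w])
      qed
      ultimately show "(\<forall>v. \<forall>r<b i. ?B (?A v) r \<in> QI) \<and>
        (\<forall>v. (\<forall>r<b i. ?B v r \<in> QI) \<longrightarrow> (\<exists>w. \<forall>c<b (Suc i). v c - ?A w c \<in> QI))" by blast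
    next
      assume e: "(\<forall>v. \<forall>r<b i. ?B (?A v) r \<in> QI) \<and>
        (\<forall>v. (\<forall>r<b i. ?B v r \<in> QI) \<longrightarrow> (\<exists>w. \<forall>c<b (Suc i). v c - ?A w c \<in> QI))"
      show "?I = ?K"
      proof (intro equalityI subsetI)
        fix x assume "x \<in> ?I"
        then obtain v where v: "x = pvec ?n (?A v)" by (elim rangeE)
        show "x \<in> ?K" unfolding v mem by (rule spec[OF conjunct1[OF e]])
      next
        fix x assume "x \<in> ?K"
        then obtain v where v: "x = pvec ?n v" "\<forall>r<b i. ?B v r \<in> QI" by blast
        have "\<exists>w. \<forall>c<b (Suc i). v c - ?A w c \<in> QI" by (rule spec[OF conjunct2[OF e], THEN mp, OF v(2)])
        then obtain w where "\<forall>c<b (Suc i). v c - ?A w c \<in> QI" by (rule exE)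
        then have "x = pvec ?n (?A w)" unfolding v(1) pvec_eq_iff .
        then show "x \<in> ?I" by simp
      qed
    qed
  qed
  have tw': "\<forall>i. \<forall>r<b i. \<forall>c<b (Suc i). D i r c \<in> tw (a i r) (a (Suc i) c)"
    using tw by simp
  show ?thesis
  proof (cases "b 0 = 1")
    case True
    show ?thesis
      unfolding graded_free_resolution_def lifted_resolution_def 3 2[OF True] all_conj_distrib
      by (simp only: eqTrueI[OF 1] eqTrueI[OF tw'] True simp_thms conj_assoc)
  next
    case False
    then show ?thesis unfolding graded_free_resolution_def lifted_resolution_def by simp
  qed
qed

text \<open>The vector \<open>v\<close> represents a cycle of the tensored complex that is no
  boundary. Elements of \<open>m F\<close> are recognised by entries with constant term 0.\<close>

definition tor_nz ::
  "(nat \<Rightarrow> nat) \<Rightarrow> (nat \<Rightarrow> nat \<Rightarrow> nat) \<Rightarrow> (nat \<Rightarrow> nat \<Rightarrow> nat \<Rightarrow> ('v, 'k) mpoly) \<Rightarrow> nat \<Rightarrow> nat \<Rightarrow> bool" where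
  "tor_nz b a D i j \<longleftrightarrow> (\<exists>v. (\<forall>c<b i. v c \<in> tw (a i c) j) \<and>
     (\<forall>i'. i = Suc i' \<longrightarrow> (\<forall>r<b i'. lk (app (b i) (D i') v r) 0 = 0)) \<and>
     (\<forall>w. \<exists>c<b i. lk (v c - app (b (Suc i)) (D i) w c) 0 \<noteq> 0))"

lemma tor_nz_iff:
  assumes lift: "\<And>i r c. r < b i \<Longrightarrow> c < b (Suc i) \<Longrightarrow> d (Suc i) r c = proj (D i r c)"
  shows "\<not> tor_cycles R G b a d i j \<subseteq> tor_boundaries R G b a d i j \<longleftrightarrow> tor_nz b a D i j"
proof -
  have ma: "mat_apply R (b i) (b (Suc i)) (d (Suc i)) (pvec (b (Suc i)) v) = pvec (b i) (app (b (Suc i)) (D i) v)" for i v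
    by (rule mat_apply_pvec) (rule lift)
  have cyc: "pvec (b i) v \<in> tor_cycles R G b a d i j" if "\<forall>c<b i. v c \<in> tw (a i c) j"
     "\<forall>i'. i = Suc i' \<longrightarrow> (\<forall>r<b i'. lk (app (b i) (D i') v r) 0 = 0)" for v
    using that vecs_eq[of "b i"]
    by (cases i) (auto simp: tor_cycles_def twist_iff ma, auto simp: pvec_def proj_irrelevant_iff)
  have cycE: "\<exists>v. z = pvec (b i) v \<and> (\<forall>c<b i. v c \<in> tw (a i c) j) \<and>
     (\<forall>i'. i = Suc i' \<longrightarrow> (\<forall>r<b i'. lk (app (b i) (D i') v r) 0 = 0))"
    if z: "z \<in> tor_cycles R G b a d i j" for z
  proof -
    have "\<forall>c. \<exists>p. c < b i \<longrightarrow> p \<in> tw (a i c) j \<and> z c = proj p" using z by (auto simp: tor_cycles_def twist_iff)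
    then obtain v where v: "\<And>c. c < b i \<Longrightarrow> v c \<in> tw (a i c) j \<and> z c = proj (v c)" by metis
    have zv: "z = pvec (b i) v" using z v
      by (auto simp: tor_cycles_def pvec_def PiE_def extensional_def fun_eq_iff)
    have "lk (app (b i) (D i') v r) 0 = 0" if "i = Suc i'" "r < b i'" for i' r
    proof -
      have "pvec (b i') (app (b i) (D i') v) \<in> vecs (irrelevant_ideal R G) (b i')"
        using z that(1) unfolding zv by (simp add: tor_cycles_def ma)
      then have "pvec (b i') (app (b i) (D i') v) r \<in> irrelevant_ideal R G" using that(2) by auto
      then show ?thesis using that(2) by (simp add: pvec_def proj_irrelevant_iff)
    qed
    then show ?thesis using zv v by blast
  qed
  have bd: "pvec (b i) v \<in> tor_boundaries R G b a d i j \<longleftrightarrow>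
      (\<exists>w. \<forall>c<b i. lk (v c - app (b (Suc i)) (D i) w c) 0 = 0)" if v: "\<forall>c<b i. v c \<in> tw (a i c) j" for v
  proof -
    have e: "(pvec (b i) v c \<ominus>\<^bsub>R\<^esub> mat_apply R (b i) (b (Suc i)) (d (Suc i)) (pvec (b (Suc i)) w) c
        \<in> irrelevant_ideal R G) \<longleftrightarrow> lk (v c - app (b (Suc i)) (D i) w c) 0 = 0" if "c < b i" for c w
      using that by (simp add: ma) (simp add: pvec_def proj_diff proj_irrelevant_iff)
    have "\<forall>c<b i. pvec (b i) v c \<in> twist R G (a i c) j" using v by (auto simp: pvec_def twist_iff)
    then show ?thesis
      unfolding tor_boundaries_def vecs_eq using e by auto
  qed
  show ?thesis
  proof
    assume "\<not> tor_cycles R G b a d i j \<subseteq> tor_boundaries R G b a d i j"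
    then obtain z where z: "z \<in> tor_cycles R G b a d i j" "z \<notin> tor_boundaries R G b a d i j" by blast
    from cycE[OF z(1)] obtain v where v: "z = pvec (b i) v" "\<forall>c<b i. v c \<in> tw (a i c) j"
      "\<forall>i'. i = Suc i' \<longrightarrow> (\<forall>r<b i'. lk (app (b i) (D i') v r) 0 = 0)" by blast
    then show "tor_nz b a D i j" unfolding tor_nz_def using z(2) bd[OF v(2)] by blast
  next
    assume "tor_nz b a D i j"
    then obtain v where v: "\<forall>c<b i. v c \<in> tw (a i c) j"
      "\<forall>i'. i = Suc i' \<longrightarrow> (\<forall>r<b i'. lk (app (b i) (D i') v r) 0 = 0)"
      "\<forall>w. \<exists>c<b i. lk (v c - app (b (Suc i)) (D i) w c) 0 \<noteq> 0" unfolding tor_nz_def by blast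
    then show "\<not> tor_cycles R G b a d i j \<subseteq> tor_boundaries R G b a d i j"
      using cyc[OF v(1,2)] bd[OF v(1)] by blast
  qed
qed

text \<open>Homogeneous elements of R have homogeneous polynomials as representatives, so
  resolutions can be lifted and pushed down again.\<close>

lemma tor_nonzero_iff:
  "tor_nonzero R G i j \<longleftrightarrow> (\<exists>b a D. lifted_resolution b a D \<and> tor_nz b a D i j)"
proof
  assume "tor_nonzero R G i j"
  then obtain b a d where r: "graded_free_resolution R G b a d"
    and t: "\<not> tor_cycles R G b a d i j \<subseteq> tor_boundaries R G b a d i j"
    unfolding tor_nonzero_def by (elim exE conjE) (rule that)
  have ex: "\<forall>i r c. \<exists>p. r < b i \<longrightarrow> c < b (Suc i) \<longrightarrow> p \<in> tw (a i r) (a (Suc i) c) \<and> d (Suc i) r c = proj p"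
  proof -
    have "\<forall>i. \<forall>r<b i. \<forall>c<b (Suc i). d (Suc i) r c \<in> twist R G (a i r) (a (Suc i) c)"
      using r unfolding graded_free_resolution_def by (elim conjE)
    then show ?thesis unfolding twist_iff by (simp add: Bex_def)
  qed
  define D where "D i r c = (SOME p. p \<in> tw (a i r) (a (Suc i) c) \<and> d (Suc i) r c = proj p)" for i r c
  have D: "D i r c \<in> tw (a i r) (a (Suc i) c) \<and> d (Suc i) r c = proj (D i r c)"
    if "r < b i" "c < b (Suc i)" for i r c
    unfolding D_def using ex that by (intro someI_ex[of "\<lambda>p. p \<in> tw (a i r) (a (Suc i) c) \<and> d (Suc i) r c = proj p"]) simp
  have "lifted_resolution b a D" using r graded_free_resolution_iff[of b d D a] D by simp
  moreover have "tor_nz b a D i j" using t tor_nz_iff[of b d D a i j] D by simp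
  ultimately show "\<exists>b a D. lifted_resolution b a D \<and> tor_nz b a D i j" by (intro exI conjI)
next
  assume "\<exists>b a D. lifted_resolution b a D \<and> tor_nz b a D i j"
  then obtain b a D where r: "lifted_resolution b a D" and t: "tor_nz b a D i j"
    by (elim exE conjE) (rule that)
  define d where "d i r c = proj (D (i - 1) r c)" for i r c
  have tw: "D i r c \<in> tw (a i r) (a (Suc i) c)" if "r < b i" "c < b (Suc i)" for i r c
    using r that unfolding lifted_resolution_def by simp
  have "graded_free_resolution R G b a d"
    using r graded_free_resolution_iff[of b d D a] tw by (simp add: d_def)
  moreover have "\<not> tor_cycles R G b a d i j \<subseteq> tor_boundaries R G b a d i j"
    using t tor_nz_iff[of b d D a i j] by (simp add: d_def)
  ultimately show "tor_nonzero R G i j" unfolding tor_nonzero_def by (intro exI conjI)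
qed

end

text \<open>An arbitrary total order on the variables, used to select one ordering of each
  pair.\<close>

definition rk :: "'v::finite \<Rightarrow> nat" where
  "rk = (SOME g. bij_betw g UNIV {..<CARD('v)})"

lemma bij_rk: "bij_betw (rk :: 'v::finite \<Rightarrow> nat) UNIV {..<CARD('v)}"
proof -
  have "\<exists>g. bij_betw g (UNIV :: 'v set) {0..<CARD('v)}" by (rule ex_bij_betw_finite_nat) simp
  then show ?thesis unfolding rk_def lessThan_atLeast0 by (rule someI_ex)
qed

lemma rk_eq_iff [simp]: "rk k = rk l \<longleftrightarrow> k = l"
  using bij_rk unfolding bij_betw_def inj_def by blast

section \<open>Homogeneous components with respect to twists\<close>

lemma tw_0 [simp]: "0 \<in> tw a j"
  by (simp add: tw_def)

lemma tw_add: "x \<in> tw a j \<Longrightarrow> y \<in> tw a j \<Longrightarrow> x + y \<in> tw a j"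
  and tw_diff: "x \<in> tw a j \<Longrightarrow> y \<in> tw a j \<Longrightarrow> x - y \<in> tw a j"
  by (auto simp: tw_def forms_add forms_diff split: if_splits)

lemma tw_sum: "(\<And>i. i \<in> A \<Longrightarrow> g i \<in> tw a j) \<Longrightarrow> (\<Sum>i\<in>A. g i) \<in> tw a j"
  by (induction A rule: infinite_finite_induct) (auto intro: tw_add)

lemma tw_mult_forms: "q \<in> forms e \<Longrightarrow> x \<in> tw a j \<Longrightarrow> q * x \<in> tw a (j + e)"
  using forms_mult[of q e x "j - a"] by (auto simp: tw_def add.commute split: if_splits)

lemma tw_mult: "q \<in> tw a b \<Longrightarrow> x \<in> tw b j \<Longrightarrow> q * x \<in> tw a j"
  using forms_mult[of q "b - a" x "j - b"] by (auto simp: tw_def split: if_splits)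

lemma tw_gt: "x \<in> tw a j \<Longrightarrow> j < a \<Longrightarrow> x = 0"
  by (simp add: tw_def)

lemma tw_const: "x \<in> tw a j \<Longrightarrow> a \<noteq> j \<Longrightarrow> lk x 0 = 0"
  using formsD[of x "j - a" 0] by (auto simp: tw_def split: if_splits)

definition htw :: "nat \<Rightarrow> nat \<Rightarrow> ('v::finite, 'k::field) mpoly \<Rightarrow> ('v, 'k) mpoly" where
  "htw a j p = (if a \<le> j then hcomp (j - a) p else 0)"

lemma htw_in_tw [simp]: "htw a j p \<in> tw a j"
  by (simp add: htw_def tw_def)

lemma htw_tw: "p \<in> tw a j \<Longrightarrow> htw a j p = p"
  by (auto simp: htw_def tw_def hcomp_forms split: if_splits)

lemma htw_diff: "htw a j (p - q) = htw a j p - htw a j q"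
  by (simp add: htw_def hcomp_diff)

lemma htw_sum: "htw a j (\<Sum>i\<in>A. g i) = (\<Sum>i\<in>A. htw a j (g i))"
  by (simp add: htw_def hcomp_sum)

lemma htw_mult:
  assumes "q \<in> tw a b" shows "htw a j (q * p) = q * htw b j p"
proof (cases "a \<le> b")
  case True
  then have "q \<in> forms (b - a)" using assms by (simp add: tw_def)
  then show ?thesis using True by (auto simp: htw_def hcomp_mult_forms)
next
  case False
  then have "q = 0" using assms by (simp add: tw_def)
  then show ?thesis by (simp add: htw_def)
qed

lemma htw_app:
  assumes "\<And>c. c < q \<Longrightarrow> A r c \<in> tw (\<alpha> r) (\<beta> c)"
  shows "app q A (\<lambda>c. htw (\<beta> c) j (w c)) r = htw (\<alpha> r) j (app q A w r)"
  unfolding app_def htw_sum by (intro sum.cong refl) (simp add: htw_mult[OF assms])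

lemma app_diff: "app q A v r - app q A w r = app q A (\<lambda>c. v c - w c) r"
  by (simp add: app_def sum_subtractf right_diff_distrib)

lemma app_mult: "app q A (\<lambda>c. p * v c) r = p * app q A v r"
  by (simp add: app_def sum_distrib_left mult_ac)

lemma sum_pairs_antisym:
  fixes g :: "'v::finite \<Rightarrow> 'v \<Rightarrow> 'a::ab_group_add"
  assumes "\<And>k. g k k = 0"
  shows "(\<Sum>k\<in>UNIV. \<Sum>l\<in>UNIV. g k l) = (\<Sum>(k, l)\<in>{(k, l). rk k < rk l}. g k l + g l k)"
proof -
  let ?P = "{(k, l). rk k < rk l} :: ('v \<times> 'v) set"
  let ?Q = "{(k, l). rk l < rk k} :: ('v \<times> 'v) set"
  have "(\<Sum>k\<in>UNIV. \<Sum>l\<in>UNIV. g k l) = (\<Sum>(k, l)\<in>UNIV. g k l)"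
    by (simp add: sum.cartesian_product)
  also have "\<dots> = (\<Sum>(k, l)\<in>?P \<union> ?Q. g k l)"
  proof (rule sum.mono_neutral_right)
    show "\<forall>i\<in>UNIV - (?P \<union> ?Q). (case i of (k, l) \<Rightarrow> g k l) = 0"
    proof
      fix i assume "i \<in> UNIV - (?P \<union> ?Q)"
      then have "rk (fst i) = rk (snd i)" by (cases i) auto
      then show "(case i of (k, l) \<Rightarrow> g k l) = 0" using assms by (simp add: case_prod_unfold)
    qed
  qed auto
  also have "\<dots> = (\<Sum>(k, l)\<in>?P. g k l) + (\<Sum>(k, l)\<in>?Q. g k l)"
    by (rule sum.union_disjoint) auto
  also have "(\<Sum>(k, l)\<in>?Q. g k l) = (\<Sum>(k, l)\<in>?P. g l k)"
    by (rule sum.reindex_bij_witness[of _ "\<lambda>(k, l). (l, k)" "\<lambda>(k, l). (l, k)"]) auto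
  finally show ?thesis by (simp add: sum.distrib[symmetric] case_prod_unfold)
qed

lemma sum_antisym_eq_0:
  fixes g :: "'v::finite \<Rightarrow> 'v \<Rightarrow> 'a::ab_group_add"
  assumes "\<And>k. g k k = 0" "\<And>k l. g k l = - g l k"
  shows "(\<Sum>k\<in>UNIV. \<Sum>l\<in>UNIV. g k l) = 0"
proof -
  have "g k l + g l k = 0" for k l using assms(2)[of k l] by simp
  then show ?thesis unfolding sum_pairs_antisym[OF assms(1)] by (intro sum.neutral) auto
qed

context quadrics
begin

lemma lin_parts:
  obtains z where "\<And>i l. i < N \<Longrightarrow> z i l \<in> forms 1" "\<And>i. i < N \<Longrightarrow> f i = (\<Sum>l\<in>UNIV. z i l * pvar l)"
proof -
  have "\<exists>h. (\<forall>l. h l \<in> forms 1) \<and> f i = (\<Sum>l\<in>UNIV. h l * pvar l)" if "i < N" for i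
  proof -
    have "lk (f i) 0 = 0" using formsD[OF f_forms[OF that], of 0] by simp
    then obtain h where h: "f i = (\<Sum>v\<in>UNIV. pvar v * h v)" "\<And>e v. f i \<in> forms (Suc e) \<Longrightarrow> h v \<in> forms e"
      by (rule expand_forms_Suc) blast
    have "h l \<in> forms 1" for l using h(2)[of 1 l] f_forms[OF that] by (simp add: numeral_2_eq_2)
    then show ?thesis using h(1) by (intro exI[of _ h]) (simp add: mult.commute)
  qed
  then have "\<forall>i. \<exists>h. i < N \<longrightarrow> (\<forall>l. h l \<in> forms 1) \<and> f i = (\<Sum>l\<in>UNIV. h l * pvar l)" by simp
  from choice[OF this] obtain z where
    "\<forall>i. i < N \<longrightarrow> (\<forall>l. z i l \<in> forms 1) \<and> f i = (\<Sum>l\<in>UNIV. z i l * pvar l)" by (rule exE)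
  then show ?thesis by (intro that[of z]) auto
qed

text \<open>The Koszul syzygy of the variables that belongs to the pair \<open>t\<close>, as a
  column vector.\<close>

definition kpair :: "'v \<times> 'v \<Rightarrow> 'v \<Rightarrow> ('v, 'k) mpoly" where
  "kpair t l = (if l = fst t then pvar (snd t) else if l = snd t then - pvar (fst t) else 0)"

lemma kpair_forms [simp]: "kpair t l \<in> forms 1"
  by (simp add: kpair_def forms_uminus)

lemma kpair_rel: assumes "fst t \<noteq> snd t" shows "(\<Sum>l\<in>UNIV. kpair t l * pvar l) = 0"
proof -
  have "(\<Sum>l\<in>UNIV. kpair t l * pvar l)
    = (\<Sum>l\<in>UNIV. (if l = fst t then pvar (snd t) * pvar (fst t) else 0)
        + (if l = snd t then - pvar (fst t) * pvar (snd t) else 0))"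
    using assms by (intro sum.cong) (auto simp: kpair_def)
  then show ?thesis by (simp add: sum.distrib mult.commute)
qed

lemma kpair_sum:
  assumes "\<And>v w. \<kappa> v w = - \<kappa> w v" "\<And>v. \<kappa> v v = 0"
  shows "(\<Sum>t\<in>{(k, l). rk k < rk l}. \<kappa> (fst t) (snd t) * kpair t l) = (\<Sum>w\<in>UNIV. \<kappa> l w * pvar w)"
proof -
  define g where "g k w = (if k = l then \<kappa> l w * pvar w else 0)" for k w
  have "(\<Sum>w\<in>UNIV. \<kappa> l w * pvar w) = (\<Sum>k\<in>UNIV. \<Sum>w\<in>UNIV. g k w)"
  proof -
    have "(\<Sum>w\<in>UNIV. g k w) = (if k = l then (\<Sum>w\<in>UNIV. \<kappa> l w * pvar w) else 0)" for k
      by (simp add: g_def)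
    then show ?thesis by simp
  qed
  also have "\<dots> = (\<Sum>(k, w)\<in>{(k, w). rk k < rk w}. g k w + g w k)"
    by (rule sum_pairs_antisym) (simp add: g_def assms(2))
  also have "\<dots> = (\<Sum>t\<in>{(k, l). rk k < rk l}. \<kappa> (fst t) (snd t) * kpair t l)"
  proof (rule sum.cong[OF refl], clarsimp)
    fix k w :: 'v assume "rk k < rk w"
    then have "k \<noteq> w" by auto
    then show "g k w + g w k = \<kappa> k w * kpair (k, w) l"
      using assms(1)[of w k] by (auto simp: g_def kpair_def)
  qed
  finally show ?thesis ..
qed

text \<open>Provides the assumption \<open>quadratic\<close> of the chase. By \<open>cubics\<close>,
  \<open>q * pvar m\<close> is a combination of the \<open>f i\<close> with linear coefficients
  \<open>y i\<close>, so subtracting the multiples \<open>y i\<close> of the \<open>z i\<close> from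
  the vector \<open>q\<close> at \<open>m\<close> leaves a syzygy of the variables, a combination of
  Koszul syzygies. \<open>T\<close> indexes both kinds of linear syzygies.\<close>

lemma no_cubic_relations:
  assumes q: "q \<in> forms 2"
  shows "\<exists>(T :: (nat + 'v \<times> 'v) set) g h. (\<forall>t\<in>T. g t \<in> forms 1 \<and> (\<forall>l. h t l \<in> forms 1) \<and>
       (\<Sum>l\<in>UNIV. h t l * pvar l) \<in> V) \<and> (\<forall>l. (if l = m then q else 0) - (\<Sum>t\<in>T. g t * h t l) \<in> V)"
proof -
  obtain z where z: "\<And>i l. i < N \<Longrightarrow> z i l \<in> forms 1" "\<And>i. i < N \<Longrightarrow> f i = (\<Sum>l\<in>UNIV. z i l * pvar l)"
    by (rule lin_parts) (rule that)
  have "q * pvar m \<in> forms 3" using forms_mult[OF q forms_pvar(1), of m] by simp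
  from cubics[OF this] obtain y where y: "\<forall>i<N. y i \<in> forms 1" "q * pvar m = (\<Sum>i<N. y i * f i)"
    by (elim exE conjE)
  define s where "s l = (if l = m then q else 0) - (\<Sum>i<N. y i * z i l)" for l
  have "y i * z i l \<in> forms 2" if "i < N" for i l
    using forms_mult[of "y i" 1 "z i l" 1] y(1) z(1)[OF that] that by (simp add: numeral_2_eq_2)
  then have "s l \<in> forms 2" for l
    unfolding s_def using q by (intro forms_diff forms_sum) auto
  then have s2: "s l \<in> forms (Suc 1)" for l by (simp add: numeral_2_eq_2)
  have "(\<Sum>l\<in>UNIV. s l * pvar l) = (\<Sum>l\<in>UNIV. if l = m then q * pvar m else 0) - (\<Sum>l\<in>UNIV. \<Sum>i<N. y i * (z i l * pvar l))"
    unfolding s_def left_diff_distrib sum_subtractf sum_distrib_right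
    by (intro arg_cong2[of _ _ _ _ "(-)"] sum.cong) (auto simp: mult.assoc)
  also have "\<dots> = q * pvar m - (\<Sum>i<N. y i * f i)"
    by (subst sum.swap) (simp add: z(2) sum_distrib_left)
  finally have "(\<Sum>l\<in>UNIV. s l * pvar l) = 0" using y(2) by simp
  from koszul_relation[OF finite this] obtain \<kappa> where \<kappa>: "\<forall>v\<in>UNIV. s v = (\<Sum>w\<in>UNIV. \<kappa> v w * pvar w)"
    "\<forall>v w. \<kappa> v w = - \<kappa> w v" "\<forall>v. \<kappa> v v = 0"
    "\<forall>e. (\<forall>v\<in>UNIV. s v \<in> forms (Suc e)) \<longrightarrow> (\<forall>v w. \<kappa> v w \<in> forms e)"
    by (elim exE conjE)
  have \<kappa>1: "\<kappa> v w \<in> forms 1" for v w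
    using \<kappa>(4)[rule_format, of 1] s2 by simp
  define T where "T = (Inl ` {..<N} \<union> Inr ` {(k, l). rk k < rk l} :: (nat + 'v \<times> 'v) set)"
  define g where "g t = (case t of Inl i \<Rightarrow> y i | Inr (v, w) \<Rightarrow> \<kappa> v w)" for t
  define h where "h t l = (case t of Inl i \<Rightarrow> z i l | Inr p \<Rightarrow> kpair p l)" for t l
  have 1: "g t \<in> forms 1 \<and> (\<forall>l. h t l \<in> forms 1) \<and> (\<Sum>l\<in>UNIV. h t l * pvar l) \<in> V" if "t \<in> T" for t
  proof (cases t)
    case (Inl i)
    then have "i < N" using that by (auto simp: T_def)
    then show ?thesis using Inl y(1) z f_in_V by (auto simp: g_def h_def z(2)[symmetric])
  next
    case (Inr p)
    then have "rk (fst p) < rk (snd p)" using that by (auto simp: T_def)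
    then have "fst p \<noteq> snd p" by auto
    then show ?thesis using Inr \<kappa>1 kpair_forms by (simp add: g_def h_def kpair_rel case_prod_unfold)
  qed
  have 2: "(if l = m then q else 0) - (\<Sum>t\<in>T. g t * h t l) \<in> V" for l
  proof -
    have "(\<Sum>t\<in>T. g t * h t l) = (\<Sum>t\<in>Inl ` {..<N}. g t * h t l) + (\<Sum>t\<in>Inr ` {(k, l). rk k < rk l}. g t * h t l)"
      unfolding T_def by (rule sum.union_disjoint) auto
    also have "(\<Sum>t\<in>Inl ` {..<N}. g t * h t l) = (\<Sum>i<N. y i * z i l)"
      by (simp add: sum.reindex g_def h_def o_def)
    also have "(\<Sum>t\<in>Inr ` {(k, l). rk k < rk l}. g t * h t l)
        = (\<Sum>t\<in>{(k, l). rk k < rk l}. \<kappa> (fst t) (snd t) * kpair t l)"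
      by (simp add: sum.reindex g_def h_def o_def case_prod_unfold)
    also have "\<dots> = (\<Sum>w\<in>UNIV. \<kappa> l w * pvar w)"
      by (rule kpair_sum) (rule spec[OF spec[OF \<kappa>(2)]], rule spec[OF \<kappa>(3)])
    also have "\<dots> = s l" by (rule bspec[OF \<kappa>(1) UNIV_I, symmetric])
    finally show ?thesis by (simp add: s_def)
  qed
  show ?thesis by (rule exI[of _ T], rule exI[of _ g], rule exI[of _ h])
    (rule conjI, rule ballI, rule 1, assumption, rule allI, rule 2)
qed

end

section \<open>The chase applied to a given resolution\<close>

context std_quadrics
begin

context
  fixes b :: "nat \<Rightarrow> nat" and a :: "nat \<Rightarrow> nat \<Rightarrow> nat" and D :: "nat \<Rightarrow> nat \<Rightarrow> nat \<Rightarrow> ('a, 'b) mpoly"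
  assumes res: "lifted_resolution b a D"
begin

text \<open>Entries in normal form and zeros beyond the rank make the representation by functions
  unique, so that the pointwise group structure of functions can serve for the free module.\<close>

definition resF :: "nat \<Rightarrow> nat \<Rightarrow> (nat \<Rightarrow> ('a, 'b) mpoly) set" where
  "resF i j = {v. (\<forall>c<b i. v c \<in> tw (a i c) j \<and> nf (v c) = v c) \<and> (\<forall>c\<ge>b i. v c = 0)}"

definition resM :: "nat \<Rightarrow> nat \<Rightarrow> (nat \<Rightarrow> ('a, 'b) mpoly) set" where
  "resM i j = {v \<in> resF i j. \<forall>c<b i. a i c = j \<longrightarrow> v c = 0}"

text \<open>A nonzero entry at \<open>c\<close> has degree \<open>j - a i c\<close>; it is allowed
  here if that degree is at least 2, and in \<open>resM\<close> if it is at least 1.\<close>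

definition resM2 :: "nat \<Rightarrow> nat \<Rightarrow> (nat \<Rightarrow> ('a, 'b) mpoly) set" where
  "resM2 i j = {v \<in> resF i j. \<forall>c<b i. j \<le> Suc (a i c) \<longrightarrow> v c = 0}"

definition ract :: "('a, 'b) mpoly \<Rightarrow> (nat \<Rightarrow> ('a, 'b) mpoly) \<Rightarrow> nat \<Rightarrow> ('a, 'b) mpoly" where
  "ract p v = (\<lambda>c. nf (p * v c))"

definition resd :: "nat \<Rightarrow> (nat \<Rightarrow> ('a, 'b) mpoly) \<Rightarrow> nat \<Rightarrow> ('a, 'b) mpoly" where
  "resd i v = (\<lambda>r. if r < b i then nf (app (b (Suc i)) (D i) v r) else 0)"

lemma res_tw: "r < b i \<Longrightarrow> c < b (Suc i) \<Longrightarrow> D i r c \<in> tw (a i r) (a (Suc i) c)"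
  and res_b0: "b 0 = 1" and res_a0: "a 0 0 = 0"
  and res_ex0: "lk p 0 = 0 \<Longrightarrow> \<exists>v. p - app (b (Suc 0)) (D 0) v 0 \<in> QI"
  and res_dd: "r < b i \<Longrightarrow> app (b (Suc i)) (D i) (app (b (Suc (Suc i))) (D (Suc i)) v) r \<in> QI"
  and res_ex: "\<forall>r<b i. app (b (Suc i)) (D i) v r \<in> QI \<Longrightarrow>
        \<exists>w. \<forall>c<b (Suc i). v c - app (b (Suc (Suc i))) (D (Suc i)) w c \<in> QI"
  using res unfolding lifted_resolution_def by simp_all

lemma nf_tw: "x \<in> tw e j \<Longrightarrow> nf x \<in> tw e j"
  by (auto simp: tw_def nf_forms split: if_splits)

lemma QI_htw: "p \<in> QI \<Longrightarrow> htw e j p \<in> QI"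
  by (simp add: htw_def QI_hcomp)

lemma nf_app_nf: "nf (app q A (\<lambda>c. nf (v c)) r) = nf (app q A v r)"
  by (simp add: app_def nf_sum nf_mult_right)

lemma resd_cong: "(\<And>c. c < b (Suc i) \<Longrightarrow> nf (v c) = nf (w c)) \<Longrightarrow> resd i v = resd i w"
proof
  fix r assume e: "\<And>c. c < b (Suc i) \<Longrightarrow> nf (v c) = nf (w c)"
  have "app (b (Suc i)) (D i) (\<lambda>c. nf (v c)) r = app (b (Suc i)) (D i) (\<lambda>c. nf (w c)) r"
    by (simp add: app_def e)
  then show "resd i v r = resd i w r"
    by (simp add: resd_def) (metis nf_app_nf)
qed

lemma resF_I:
  assumes "\<And>c. c < b i \<Longrightarrow> x c \<in> tw (a i c) j"
  shows "(\<lambda>c. if c < b i then nf (x c) else 0) \<in> resF i j"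
  using assms by (auto simp: resF_def nf_tw)

text \<open>A preimage may be replaced by its homogeneous part, since homogeneous matrices commute
  with taking components (\<open>htw_app\<close>).\<close>

lemma lift_homogeneous:
  assumes x: "\<And>c. c < n \<Longrightarrow> x c \<in> tw (\<alpha> c) j"
    and A: "\<And>r c. r < n \<Longrightarrow> c < b (Suc i) \<Longrightarrow> D i r c \<in> tw (\<alpha> r) (a (Suc i) c)"
    and w: "\<And>r. r < n \<Longrightarrow> x r - app (b (Suc i)) (D i) w r \<in> QI" and r: "r < n"
  shows "x r - app (b (Suc i)) (D i) (\<lambda>c. htw (a (Suc i) c) j (w c)) r \<in> QI"
proof -
  have "app (b (Suc i)) (D i) (\<lambda>c. htw (a (Suc i) c) j (w c)) r = htw (\<alpha> r) j (app (b (Suc i)) (D i) w r)"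
    by (rule htw_app) (rule A[OF r])
  then have "x r - app (b (Suc i)) (D i) (\<lambda>c. htw (a (Suc i) c) j (w c)) r
      = htw (\<alpha> r) j (x r - app (b (Suc i)) (D i) w r)"
    using htw_tw[OF x[OF r]] by (simp add: htw_diff)
  then show ?thesis using QI_htw[OF w[OF r]] by simp
qed

lemma resd_lift:
  assumes x: "x \<in> resF i j" and w: "\<And>r. r < b i \<Longrightarrow> x r - app (b (Suc i)) (D i) w r \<in> QI"
  shows "\<exists>w\<in>resF (Suc i) j. resd i w = x"
proof -
  define w' where "w' = (\<lambda>c. if c < b (Suc i) then nf (htw (a (Suc i) c) j (w c)) else 0)"
  have "w' \<in> resF (Suc i) j" unfolding w'_def by (rule resF_I) simp
  moreover have "resd i w' = x"
  proof
    fix r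
    show "resd i w' r = x r"
    proof (cases "r < b i")
      case True
      have e: "resd i w' = resd i (\<lambda>c. htw (a (Suc i) c) j (w c))"
        by (rule resd_cong) (simp add: w'_def)
      have "x r - app (b (Suc i)) (D i) (\<lambda>c. htw (a (Suc i) c) j (w c)) r \<in> QI"
        by (rule lift_homogeneous[of "b i" x "a i"]) (use x w True res_tw in \<open>auto simp: resF_def\<close>)
      then have "nf (x r) = nf (app (b (Suc i)) (D i) (\<lambda>c. htw (a (Suc i) c) j (w c)) r)"
        by (simp add: nf_eq_iff)
      then show ?thesis unfolding e using True x by (simp add: resd_def resF_def)
    next
      case False
      then show ?thesis using x by (simp add: resd_def resF_def)
    qed
  qed
  ultimately show ?thesis by blast
qed

lemma inj_mon: "inj_on (\<lambda>u. mon u :: ('a, 'b) mpoly) B"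
  by (intro inj_onI) (metis lookup_single_eq lookup_single_not_eq zero_neq_one)

lemma chase: "graded_resolution_chase ract resF resM resM2 resd (mon ` B) V"
proof
  fix p q x y show "ract p (x + y) = ract p x + ract p y" "ract (p + q) x = ract p x + ract q x"
    by (auto simp: ract_def fun_eq_iff nf_add distrib_left distrib_right)
  show "ract p (ract q x) = ract (p * q) x"
    by (auto simp: ract_def fun_eq_iff nf_mult_right mult.assoc)
next
  fix p x assume "p \<in> V"
  then show "ract p x = 0" by (simp add: ract_def fun_eq_iff nf_eq_0_iff QI_mult'[OF V_QI])
next
  fix p :: "('a, 'b) mpoly" and x assume "p \<in> forms 3"
  then show "ract p x = 0" by (simp add: ract_def fun_eq_iff nf_eq_0_iff QI_mult'[OF QI_forms_ge3])
next
  fix i j show "0 \<in> resF i j" "0 \<in> resM i j" "0 \<in> resM2 i j"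
    by (auto simp: resF_def resM_def resM2_def)
  fix x y show "x \<in> resF i j \<Longrightarrow> y \<in> resF i j \<Longrightarrow> x - y \<in> resF i j"
    by (auto simp: resF_def nf_diff tw_diff)
  then show "x \<in> resM i j \<Longrightarrow> y \<in> resM i j \<Longrightarrow> x - y \<in> resM i j"
    "x \<in> resM2 i j \<Longrightarrow> y \<in> resM2 i j \<Longrightarrow> x - y \<in> resM2 i j"
    by (auto simp: resM_def resM2_def)
  show "x \<in> resM2 i j \<Longrightarrow> x \<in> resM i j" "x \<in> resM i j \<Longrightarrow> x \<in> resF i j"
    by (auto simp: resM_def resM2_def)
next
  fix p :: "('a, 'b) mpoly" and x i j
  have F: "ract p x \<in> resF i (j + e)" if "p \<in> forms e" "x \<in> resF i j" for e
    using that by (auto simp: resF_def ract_def nf_tw tw_mult_forms)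
  show F1: "p \<in> forms 1 \<Longrightarrow> x \<in> resF i j \<Longrightarrow> ract p x \<in> resF i (Suc j)"
    using F[of 1] by simp
  have 0: "x \<in> resF i j \<Longrightarrow> c < b i \<Longrightarrow> j < a i c \<Longrightarrow> x c = 0" for c
    by (auto simp: resF_def dest: tw_gt)
  show "p \<in> forms 1 \<Longrightarrow> x \<in> resF i j \<Longrightarrow> ract p x \<in> resM i (Suc j)"
    using F1 0 by (auto simp: resM_def ract_def)
  show "p \<in> forms 1 \<Longrightarrow> x \<in> resM i j \<Longrightarrow> ract p x \<in> resM2 i (Suc j)"
  proof -
    assume p: "p \<in> forms 1" and x: "x \<in> resM i j"
    have "x c = 0" if "c < b i" "j \<le> a i c" for c
      using x 0 that by (cases "a i c = j") (auto simp: resM_def)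
    then show "ract p x \<in> resM2 i (Suc j)" using F1 p x by (auto simp: resM_def resM2_def ract_def)
  qed
  show "p \<in> forms 2 \<Longrightarrow> x \<in> resF i j \<Longrightarrow> ract p x \<in> resM2 i (Suc (Suc j))"
    using F[of 2] 0 by (auto simp: resM2_def ract_def)
next
  fix x i assume x: "x \<in> resM i 0"
  show "x = 0"
  proof
    fix c show "x c = 0 c"
      using x tw_gt[of "x c" "a i c" 0] by (cases "c < b i"; cases "a i c = 0") (auto simp: resM_def resF_def)
  qed
next
  fix x i assume x: "x \<in> resM2 i (Suc 0)"
  show "x = 0"
  proof
    fix c show "x c = 0 c" using x by (cases "c < b i") (auto simp: resM2_def resF_def)
  qed
next
  fix x i j assume x: "x \<in> resM i (Suc j)"
  have "\<exists>h. (\<forall>v. h v \<in> tw (a i c) j) \<and> x c = (\<Sum>v\<in>UNIV. pvar v * h v)" if c: "c < b i" for c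
  proof (cases "a i c \<le> j")
    case True
    then have xc: "x c \<in> forms (Suc (j - a i c))" using x c by (auto simp: resM_def resF_def tw_def Suc_diff_le)
    then have "lk (x c) 0 = 0" using formsD[of "x c" _ 0] by simp
    then obtain h where h: "x c = (\<Sum>v\<in>UNIV. pvar v * h v)" "\<And>e v. x c \<in> forms (Suc e) \<Longrightarrow> h v \<in> forms e"
      by (rule expand_forms_Suc) blast
    show ?thesis using h xc True by (intro exI[of _ h]) (auto simp: tw_def)
  next
    case False
    then have "x c = 0" using x c tw_gt[of "x c" "a i c" "Suc j"]
      by (cases "a i c = Suc j") (auto simp: resM_def resF_def)
    then show ?thesis by (intro exI[of _ "\<lambda>_. 0"]) simp
  qed
  then have "\<forall>c. \<exists>h. c < b i \<longrightarrow> (\<forall>v. h v \<in> tw (a i c) j) \<and> x c = (\<Sum>v\<in>UNIV. pvar v * h v)" by simp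
  from choice[OF this] obtain h where h: "\<forall>c. c < b i \<longrightarrow> (\<forall>v. h c v \<in> tw (a i c) j) \<and> x c = (\<Sum>v\<in>UNIV. pvar v * h c v)"
    by (rule exE)
  define y where "y v = (\<lambda>c. if c < b i then nf (h c v) else 0)" for v
  have "y v \<in> resF i j" for v unfolding y_def by (rule resF_I) (use h in auto)
  moreover have "x = (\<Sum>v\<in>UNIV. ract (pvar v) (y v))"
  proof
    fix c
    have s: "(\<Sum>v\<in>UNIV. ract (pvar v) (y v)) c = (\<Sum>v\<in>UNIV. ract (pvar v) (y v) c)"
      by (induction rule: infinite_finite_induct) auto
    show "x c = (\<Sum>v\<in>UNIV. ract (pvar v) (y v)) c"
    proof (cases "c < b i")
      case True
      have "(\<Sum>v\<in>UNIV. ract (pvar v) (y v) c) = nf (\<Sum>v\<in>UNIV. pvar v * h c v)"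
        using True by (simp add: ract_def y_def nf_mult_right nf_sum)
      also have "\<dots> = x c" using h True x by (auto simp: resM_def resF_def)
      finally show ?thesis using s by simp
    next
      case False
      then show ?thesis unfolding s using x by (simp add: ract_def y_def resM_def resF_def)
    qed
  qed
  ultimately show "\<exists>y. (\<forall>v. y v \<in> resF i j) \<and> x = (\<Sum>v\<in>UNIV. ract (pvar v) (y v))"
    by (intro exI[of _ y]) simp
next
  fix x i j assume x: "x \<in> resM2 i (Suc (Suc j))"
  have ex: "\<exists>g. (\<forall>u. (cst (g u) :: ('a, 'b) mpoly) \<in> tw (a i c) j) \<and> x c = (\<Sum>u\<in>B. cst (g u) * mon u)" if c: "c < b i" for c
  proof (cases "a i c = j")
    case True
    have "x c \<in> tw (a i c) (Suc (Suc j))" and nfx: "nf (x c) = x c" using x c by (auto simp: resM2_def resF_def)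
    then have "x c \<in> forms 2" using True by (simp add: tw_def numeral_2_eq_2 Suc_diff_le)
    with nf_forms_2[of "x c"] nfx obtain g where "x c = (\<Sum>u\<in>B. cst (g u) * mon u)" by auto
    then show ?thesis using True by (intro exI[of _ g]) (simp add: tw_def)
  next
    case False
    \<comment> \<open>Entries of degree 3 and more vanish in normal form, those of degree at most 1
      by definition of \<open>resM2\<close>.\<close>
    have "x c = 0"
    proof (cases "a i c < j")
      case True
      then have "x c \<in> forms (Suc (Suc j) - a i c)" "3 \<le> Suc (Suc j) - a i c"
        using x c by (auto simp: resM2_def resF_def tw_def)
      then have "nf (x c) = 0" using QI_forms_ge3 nf_eq_0_iff by blast
      then show ?thesis using x c by (simp add: resM2_def resF_def)
    qed (use False x c in \<open>auto simp: resM2_def\<close>)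
    then show ?thesis by (intro exI[of _ "\<lambda>_. 0"]) simp
  qed
  have "\<forall>c. \<exists>g. c < b i \<longrightarrow> (\<forall>u. (cst (g u) :: ('a, 'b) mpoly) \<in> tw (a i c) j) \<and> x c = (\<Sum>u\<in>B. cst (g u) * mon u)"
  proof
    fix c show "\<exists>g. c < b i \<longrightarrow> (\<forall>u. (cst (g u) :: ('a, 'b) mpoly) \<in> tw (a i c) j) \<and> x c = (\<Sum>u\<in>B. cst (g u) * mon u)"
      using ex[of c] by (cases "c < b i") simp_all
  qed
  from choice[OF this] obtain g where
    g: "\<forall>c. c < b i \<longrightarrow> (\<forall>u. (cst (g c u) :: ('a, 'b) mpoly) \<in> tw (a i c) j) \<and> x c = (\<Sum>u\<in>B. cst (g c u) * mon u)"
    by (rule exE)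
  \<comment> \<open>The chase indexes coefficients by the forms \<open>s\<close> themselves, so the
    monomial is recovered from \<open>s\<close>.\<close>
  define y where "y s = (\<lambda>c. if c < b i then nf (cst (g c (inv_into B mon s))) else 0)" for s
  have gt: "(cst (g c u) :: ('a, 'b) mpoly) \<in> tw (a i c) j" if "c < b i" for c u using g that by simp
  have "y s \<in> resF i j" for s unfolding y_def by (rule resF_I) (rule gt)
  moreover have "x = (\<Sum>s\<in>mon ` B. ract s (y s))"
  proof
    fix c
    have s: "(\<Sum>s\<in>mon ` B. ract s (y s)) c = (\<Sum>s\<in>mon ` B. ract s (y s) c)"
      by (induction rule: infinite_finite_induct) auto
    show "x c = (\<Sum>s\<in>mon ` B. ract s (y s)) c"
    proof (cases "c < b i")
      case True
      have "(\<Sum>s\<in>mon ` B. ract s (y s) c) = (\<Sum>u\<in>B. nf (mon u * cst (g c u)))"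
        using True by (subst sum.reindex[OF inj_mon])
          (auto simp: ract_def y_def nf_mult_right inv_into_f_f[OF inj_mon] intro!: sum.cong)
      also have "\<dots> = nf (x c)" using g True by (simp add: nf_sum mult.commute)
      also have "\<dots> = x c" using True x by (auto simp: resM2_def resF_def)
      finally show ?thesis using s by simp
    next
      case False
      then show ?thesis unfolding s using x by (simp add: ract_def y_def resM2_def resF_def)
    qed
  qed
  ultimately show "\<exists>y. (\<forall>s\<in>mon ` B. y s \<in> resF i j) \<and> x = (\<Sum>s\<in>mon ` B. ract s (y s))"
    by (intro exI[of _ y]) simp
next
  fix s :: "('a, 'b) mpoly" assume "s \<in> mon ` B" then show "s \<in> forms 2" by auto
next
  fix i j v and y :: "'a \<Rightarrow> nat \<Rightarrow> ('a, 'b) mpoly"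
  assume y: "\<And>v. y v \<in> resF i j" and s: "(\<Sum>v\<in>UNIV. ract (pvar v) (y v)) \<in> resM2 i (Suc j)"
  \<comment> \<open>Only generators of degree \<open>j\<close> matter. There the coefficients are
    constants, and the variables are linearly independent in R.\<close>
  have "y v c = 0" if c: "c < b i" "a i c = j" for c
  proof -
    have yc: "y w c \<in> forms 0" for w using y[of w] c by (auto simp: resF_def tw_def)
    have "(\<Sum>w\<in>UNIV. ract (pvar w) (y w)) c = 0" using s c by (auto simp: resM2_def)
    also have "(\<Sum>w\<in>UNIV. ract (pvar w) (y w)) c = (\<Sum>w\<in>UNIV. ract (pvar w) (y w) c)"
      by (induction rule: infinite_finite_induct) auto
    also have "\<dots> = nf (\<Sum>w\<in>UNIV. pvar w * y w c)" by (simp add: ract_def nf_sum)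
    also have "\<dots> = (\<Sum>w\<in>UNIV. pvar w * y w c)"
      using forms_pvar_mult[OF yc] by (intro nf_forms_1 forms_sum) simp
    finally have "lk (\<Sum>w\<in>UNIV. pvar w * y w c) (evar v) = 0" by simp
    also have "lk (\<Sum>w\<in>UNIV. pvar w * y w c) (evar v) = (\<Sum>w\<in>UNIV. if w = v then lk (y w c) 0 else 0)"
      unfolding lookup_sum by (intro sum.cong) (auto simp: lk_pvar_mult' lk_evar)
    finally have "lk (y v c) 0 = 0" by simp
    then show ?thesis using forms_0_eq_cst[OF yc[of v]] by simp
  qed
  then show "y v \<in> resM i j" using y by (auto simp: resM_def)
next
  fix i j s and y :: "('a, 'b) mpoly \<Rightarrow> nat \<Rightarrow> ('a, 'b) mpoly"
  assume y: "\<And>s. s \<in> mon ` B \<Longrightarrow> y s \<in> resF i j" and s0: "(\<Sum>s\<in>mon ` B. ract s (y s)) = 0" and s: "s \<in> mon ` B"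
  have "y s c = 0" if c: "c < b i" "a i c = j" for c
  proof -
    have yc: "y (mon u) c \<in> forms 0" if "u \<in> B" for u using y[of "mon u"] c that by (auto simp: resF_def tw_def)
    have "0 = (\<Sum>s\<in>mon ` B. ract s (y s)) c" using s0 by simp
    also have "\<dots> = (\<Sum>s\<in>mon ` B. ract s (y s) c)"
      by (induction rule: infinite_finite_induct) auto
    also have "\<dots> = nf (\<Sum>u\<in>B. mon u * y (mon u) c)"
      by (subst sum.reindex[OF inj_mon]) (simp add: ract_def nf_sum)
    also have "(\<Sum>u\<in>B. mon u * y (mon u) c) = (\<Sum>u\<in>B. cst (lk (y (mon u) c) 0) * mon u)"
    proof (intro sum.cong refl)
      fix u assume "u \<in> B"
      then have "y (mon u) c = cst (lk (y (mon u) c) 0)" by (intro forms_0_eq_cst yc)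
      then show "mon u * y (mon u) c = cst (lk (y (mon u) c) 0) * mon u" by (metis mult.commute)
    qed
    finally have e: "0 = nf (\<Sum>u\<in>B. cst (lk (y (mon u) c) 0) * mon u)" .
    have q: "(\<Sum>u\<in>B. cst (lk (y (mon u) c) 0) * mon u) \<in> QI"
      by (rule iffD1[OF nf_eq_0_iff e[symmetric]])
    have "(\<Sum>u\<in>B. cst (lk (y (mon u) c) 0) * mon u) \<in> forms 2"
      by (intro forms_sum forms_cst_mult) simp
    then have "(\<Sum>u\<in>B. cst (lk (y (mon u) c) 0) * mon u) \<in> V" using q QI_forms_2_iff by simp
    note z = B_indep[OF this]
    obtain u where u: "u \<in> B" "s = mon u" using s by blast
    then show ?thesis using z[OF u(1)] forms_0_eq_cst[OF yc[OF u(1)]] by simp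
  qed
  then show "y s \<in> resM i j" using y s by (auto simp: resM_def)
next
  fix i x y show "resd i (x + y) = resd i x + resd i y"
    by (auto simp: resd_def fun_eq_iff app_def distrib_left sum.distrib nf_add)
next
  fix i p x show "resd i (ract p x) = ract p (resd i x)"
  proof
    fix r
    have "nf (app (b (Suc i)) (D i) (ract p x) r) = nf (app (b (Suc i)) (D i) (\<lambda>c. p * x c) r)"
      unfolding ract_def by (rule nf_app_nf)
    then show "resd i (ract p x) r = ract p (resd i x) r"
      by (simp add: resd_def app_mult) (simp add: ract_def nf_mult_right)
  qed
next
  fix x i j assume x: "x \<in> resF (Suc i) j"
  have "app (b (Suc i)) (D i) x r \<in> tw (a i r) j" if "r < b i" for r
    unfolding app_def by (intro tw_sum tw_mult[OF res_tw[OF that]]) (use x in \<open>auto simp: resF_def\<close>)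
  then show "resd i x \<in> resF i j" unfolding resd_def by (intro resF_I) simp
next
  fix x i j
  show "resd i (resd (Suc i) x) = 0"
  proof
    fix r
    have "resd i (resd (Suc i) x) = resd i (app (b (Suc (Suc i))) (D (Suc i)) x)"
      by (rule resd_cong) (simp add: resd_def)
    then show "resd i (resd (Suc i) x) r = 0 r"
      using res_dd[of r i x] by (simp add: resd_def nf_eq_0_iff)
  qed
next
  fix x i j assume x: "x \<in> resF (Suc i) j" "resd i x = 0"
  have "app (b (Suc i)) (D i) x r \<in> QI" if "r < b i" for r
    using fun_cong[OF x(2), of r] that by (simp add: resd_def nf_eq_0_iff)
  then have "\<forall>r<b i. app (b (Suc i)) (D i) x r \<in> QI" by simp
  from res_ex[OF this] obtain w where w: "\<forall>c<b (Suc i). x c - app (b (Suc (Suc i))) (D (Suc i)) w c \<in> QI"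
    by (rule exE)
  show "\<exists>w\<in>resF (Suc (Suc i)) j. resd (Suc i) w = x"
    by (rule resd_lift[OF x(1), of w]) (use w in simp)
next
  fix x j assume x: "x \<in> resM 0 j"
  have "lk (x 0) 0 = 0"
  proof (cases "j = 0")
    case True
    then show ?thesis using x res_b0 res_a0 by (simp add: resM_def)
  next
    case False
    then show ?thesis using x res_b0 res_a0 tw_const[of "x 0" 0 j] by (auto simp: resM_def resF_def)
  qed
  from res_ex0[OF this] obtain w where w: "x 0 - app (b (Suc 0)) (D 0) w 0 \<in> QI" by (rule exE)
  show "\<exists>w\<in>resF (Suc 0) j. resd 0 w = x"
    by (rule resd_lift[of _ _ _ w]) (use w x res_b0 in \<open>auto simp: resM_def\<close>)
next
  fix x j assume "x \<in> resF 0 (Suc j)"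
  then show "x \<in> resM 0 (Suc j)" using res_b0 res_a0 by (auto simp: resM_def)
next
  fix q :: "('a, 'b) mpoly" and m assume "q \<in> forms 2"
  then show "\<exists>(T :: (nat + 'a \<times> 'a) set) g h. (\<forall>t\<in>T. g t \<in> forms 1 \<and> (\<forall>l. h t l \<in> forms 1) \<and>
       (\<Sum>l\<in>UNIV. h t l * pvar l) \<in> V) \<and> (\<forall>l. (if l = m then q else 0) - (\<Sum>t\<in>T. g t * h t l) \<in> V)"
    by (rule no_cubic_relations)
qed

text \<open>The given cycle is replaced by its normal form; this changes entries by elements of
  \<open>QI\<close>, which have no constant term.\<close>

lemma not_tor_nz: assumes "i + i div 3 < j" shows "\<not> tor_nz b a D i j"
proof
  interpret graded_resolution_chase ract resF resM resM2 resd "mon ` B" V by (rule chase)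
  assume "tor_nz b a D i j"
  then obtain v where v: "\<forall>c<b i. v c \<in> tw (a i c) j"
    "\<forall>i'. i = Suc i' \<longrightarrow> (\<forall>r<b i'. lk (app (b i) (D i') v r) 0 = 0)"
    "\<forall>w. \<exists>c<b i. lk (v c - app (b (Suc i)) (D i) w c) 0 \<noteq> 0"
    unfolding tor_nz_def by (elim exE conjE)
  define v' where "v' = (\<lambda>c. if c < b i then nf (v c) else 0)"
  have v'F: "v' \<in> resF i j" unfolding v'_def by (rule resF_I) (use v(1) in simp)
  have "resd i' v' \<in> resM i' j" if i: "i = Suc i'" for i'
  proof -
    have F: "resd i' v' \<in> resF i' j" using d_F v'F i by simp
    have e: "resd i' v' = resd i' v" by (rule resd_cong) (simp add: v'_def i)
    have "resd i' v' r = 0" if r: "r < b i'" "a i' r = j" for r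
    proof -
      have "nf (app (b i) (D i') v r) - app (b i) (D i') v r \<in> QI"
        using QI_uminus[OF diff_nf_QI] by simp
      from QI_const[OF this] have "lk (resd i' v' r) 0 = 0"
        using v(2) i r unfolding e by (simp add: resd_def lookup_minus)
      moreover have "resd i' v' r \<in> forms 0" using F r by (auto simp: resF_def tw_def)
      ultimately show ?thesis using forms_0_eq_cst[of "resd i' v' r"] by simp
    qed
    then show ?thesis using F by (simp add: resM_def)
  qed
  then have "cyc i j v'" using v'F by (simp add: cyc_def)
  then obtain w where w: "w \<in> resF (Suc i) j" "v' - resd i w \<in> resM i j"
    using vanish_above[OF assms, unfolded vanish_def, THEN spec, of v'] by auto
  have lk0: "lk (v c - app (b (Suc i)) (D i) w c) 0 = 0" if c: "c < b i" for c
  proof -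
    let ?e = "(v' - resd i w) c"
    have "lk ?e 0 = 0"
    proof (cases "a i c = j")
      case True
      then show ?thesis using w(2) c by (simp add: resM_def)
    next
      case False
      moreover have "?e \<in> tw (a i c) j" using w(2) c unfolding resM_def resF_def by simp
      ultimately show ?thesis using tw_const[of ?e "a i c" j] by simp
    qed
    moreover have "(v c - app (b (Suc i)) (D i) w c) - ?e \<in> QI"
    proof -
      have "?e = nf (v c - app (b (Suc i)) (D i) w c)" using c by (simp add: v'_def resd_def nf_diff)
      then show ?thesis using diff_nf_QI by simp
    qed
    ultimately show ?thesis
      using QI_const[of "(v c - app (b (Suc i)) (D i) w c) - ?e"] by (simp only: lookup_minus diff_0_right simp_thms)
  qed
  from spec[OF v(3), of w] lk0 show False by auto
qed

end

end

lemma (in quadrics) tor_nonzero_bound: "tor_nonzero R G i j \<Longrightarrow> j \<le> i + i div 3"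
proof -
  assume "tor_nonzero R G i j"
  then obtain b a D where r: "lifted_resolution b a D" "tor_nz b a D i j"
    unfolding tor_nonzero_iff by (elim exE conjE)
  obtain B \<gamma> where "std_basis B \<gamma>" using std_basis_exists by (elim exE)
  then interpret std_quadrics N f B \<gamma> by unfold_locales
  show "j \<le> i + i div 3" using not_tor_nz[OF r(1)] r(2) by (meson not_le)
qed

section \<open>A nonzero class of degree four in the third Tor\<close>

text \<open>\<open>underdetermined_system\<close> for equations given as linear maps: their
  coefficients are the values at unit vectors.\<close>

lemma underdetermined_functionals:
  fixes L :: "'e \<Rightarrow> ('x \<Rightarrow> 'k::field) \<Rightarrow> 'k"
  assumes fin: "finite E" "finite Y" "card E < card Y"
    and add: "\<And>e c d. L e (\<lambda>y. c y + d y) = L e c + L e d"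
    and scale: "\<And>e c t. L e (\<lambda>y. t * c y) = t * L e c"
  obtains c where "\<exists>y\<in>Y. c y \<noteq> 0" "\<And>e. e \<in> E \<Longrightarrow> L e c = 0"
proof -
  define \<delta> where "\<delta> x = (\<lambda>y. if y = x then 1 else 0 :: 'k)" for x :: 'x
  have zero: "L e (\<lambda>_. 0) = 0" for e using scale[of e 0 "\<lambda>_. 0"] by simp
  have lin: "L e (\<lambda>y. \<Sum>x\<in>A. c x * \<delta> x y) = (\<Sum>x\<in>A. L e (\<delta> x) * c x)" if "finite A" for A c e
    using that by (induction A rule: finite_induct) (simp_all add: zero add scale mult.commute)
  from underdetermined_system[OF fin, of "\<lambda>e x. L e (\<delta> x)"] obtain c where
    c: "\<exists>x\<in>Y. c x \<noteq> 0" "\<forall>e\<in>E. (\<Sum>x\<in>Y. L e (\<delta> x) * c x) = 0" by (elim exE conjE)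
  have v: "(\<Sum>x\<in>Y. c x * \<delta> x y) = (if y \<in> Y then c y else 0)" for y
  proof -
    have "(\<Sum>x\<in>Y. c x * \<delta> x y) = (\<Sum>x\<in>Y. if x = y then c x else 0)"
      by (intro sum.cong) (auto simp: \<delta>_def)
    then show ?thesis using fin by simp
  qed
  show ?thesis
  proof (rule that[of "\<lambda>y. \<Sum>x\<in>Y. c x * \<delta> x y"])
    show "\<exists>y\<in>Y. (\<Sum>x\<in>Y. c x * \<delta> x y) \<noteq> 0" using c(1) unfolding v by auto
    show "L e (\<lambda>y. \<Sum>x\<in>Y. c x * \<delta> x y) = 0" if "e \<in> E" for e
      using lin[OF fin(2), of e c] c(2) that by simp
  qed
qed

section \<open>Numbers of unknowns and equations\<close>

lemma card_chains:
  fixes n :: nat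
  shows "finite {(a, b). a < b \<and> b < n} \<and> card {(a, b). a < b \<and> b < n} = n choose 2"
    and "finite {(a, b, c). a < b \<and> b < c \<and> c < n} \<and> card {(a, b, c). a < b \<and> b < c \<and> c < n} = n choose 3"
    and "finite {(a, b, c, d). a < b \<and> b < c \<and> c < d \<and> d < n} \<and>
      card {(a, b, c, d). a < b \<and> b < c \<and> c < d \<and> d < n} = n choose 4"
proof -
  show 2: "finite {(a, b). a < b \<and> b < n} \<and> card {(a, b). a < b \<and> b < n} = n choose 2" for n :: nat
  proof (induction n)
    case (Suc n)
    have e: "{(a, b). a < b \<and> b < Suc n} = {(a, b). a < b \<and> b < n} \<union> (\<lambda>a. (a, n)) ` {..<n}"
      by (auto simp: less_Suc_eq)
    have "card {(a, b). a < b \<and> b < Suc n} = card {(a, b). a < b \<and> b < n} + card ((\<lambda>a. (a, n)) ` {..<n})"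
      unfolding e by (rule card_Un_disjoint) (use Suc in auto)
    also have "card ((\<lambda>a. (a, n)) ` {..<n}) = n" by (subst card_image) (auto simp: inj_on_def)
    finally show ?case using Suc unfolding e by (simp add: numeral_2_eq_2)
  qed simp
  show 3: "finite {(a, b, c). a < b \<and> b < c \<and> c < n} \<and> card {(a, b, c). a < b \<and> b < c \<and> c < n} = n choose 3" for n :: nat
  proof (induction n)
    case (Suc n)
    have e: "{(a, b, c). a < b \<and> b < c \<and> c < Suc n} = {(a, b, c). a < b \<and> b < c \<and> c < n} \<union> (\<lambda>(a, b). (a, b, n)) ` {(a, b). a < b \<and> b < n}"
      by (auto simp: less_Suc_eq)
    have "card {(a, b, c). a < b \<and> b < c \<and> c < Suc n} = card {(a, b, c). a < b \<and> b < c \<and> c < n}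
        + card ((\<lambda>(a, b). (a, b, n)) ` {(a, b). a < b \<and> b < n})"
      unfolding e by (rule card_Un_disjoint) (use Suc 2[of n] in auto)
    also have "card ((\<lambda>(a, b). (a, b, n)) ` {(a, b). a < b \<and> b < n}) = n choose 2"
      by (subst card_image) (auto simp: inj_on_def 2)
    finally show ?case using Suc 2[of n] unfolding e by (simp add: numeral_2_eq_2 numeral_3_eq_3)
  qed simp
  show "finite {(a, b, c, d). a < b \<and> b < c \<and> c < d \<and> d < n} \<and>
      card {(a, b, c, d). a < b \<and> b < c \<and> c < d \<and> d < n} = n choose 4"
  proof (induction n)
    case (Suc n)
    have e: "{(a, b, c, d). a < b \<and> b < c \<and> c < d \<and> d < Suc n} = {(a, b, c, d). a < b \<and> b < c \<and> c < d \<and> d < n}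
        \<union> (\<lambda>(a, b, c). (a, b, c, n)) ` {(a, b, c). a < b \<and> b < c \<and> c < n}"
      by (auto simp: less_Suc_eq image_iff)
    have "card {(a, b, c, d). a < b \<and> b < c \<and> c < d \<and> d < Suc n} = card {(a, b, c, d). a < b \<and> b < c \<and> c < d \<and> d < n}
        + card ((\<lambda>(a, b, c). (a, b, c, n)) ` {(a, b, c). a < b \<and> b < c \<and> c < n})"
      unfolding e by (rule card_Un_disjoint) (use Suc 3[of n] in auto)
    also have "card ((\<lambda>(a, b, c). (a, b, c, n)) ` {(a, b, c). a < b \<and> b < c \<and> c < n}) = n choose 3"
      by (subst card_image) (auto simp: inj_on_def 3)
    finally show ?case using Suc 3[of n] unfolding e by (simp add: eval_nat_numeral)
  qed simp
qed

definition pairs :: "('v::finite \<times> 'v) set" where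
  "pairs = {(k, l). rk k < rk l}"

definition quads :: "('v::finite \<times> 'v \<times> 'v \<times> 'v) set" where
  "quads = {(m, a, b, c). rk a < rk b \<and> rk b < rk c \<and> \<not> rk m < rk a}"

lemma rk_less: "rk (v :: 'v::finite) < CARD('v)"
  using bij_rk unfolding bij_betw_def by blast

lemma rk_surj: "i < CARD('v) \<Longrightarrow> \<exists>v :: 'v::finite. i = rk v"
  using bij_rk[where 'v = 'v] unfolding bij_betw_def by blast

lemma card_pairs: "card (pairs :: ('v::finite \<times> 'v) set) = CARD('v) choose 2"
proof -
  have "bij_betw (\<lambda>(k, l). (rk k, rk l)) (pairs :: ('v \<times> 'v) set) {(a, b). a < b \<and> b < CARD('v)}"
    unfolding bij_betw_def
  proof
    show "(\<lambda>(k, l). (rk k, rk l)) ` (pairs :: ('v \<times> 'v) set) = {(a, b). a < b \<and> b < CARD('v)}"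
    proof (intro equalityI subsetI)
      fix x assume "x \<in> {(a, b). a < b \<and> b < CARD('v)}"
      then obtain a b where x: "x = (a, b)" "a < b" "b < CARD('v)" by blast
      then obtain k l :: 'v where "a = rk k" "b = rk l" using rk_surj[of a] rk_surj[of b] by force
      then show "x \<in> (\<lambda>(k, l). (rk k, rk l)) ` (pairs :: ('v \<times> 'v) set)"
        using x by (intro image_eqI[of _ _ "(k, l)"]) (auto simp: pairs_def)
    qed (auto simp: pairs_def rk_less)
  qed (auto simp: inj_on_def)
  from bij_betw_same_card[OF this] show ?thesis using card_chains(1) by simp
qed

lemma card_quads:
  "card (quads :: ('v::finite \<times> 'v \<times> 'v \<times> 'v) set)
     = CARD('v) * (CARD('v) choose 3) - (CARD('v) choose 4)"
proof -
  let ?T = "{(a, b, c). rk a < rk b \<and> rk b < rk c} :: ('v \<times> 'v \<times> 'v) set"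
  let ?Q = "{(m, a, b, c). rk m < rk a \<and> rk a < rk b \<and> rk b < rk c} :: ('v \<times> 'v \<times> 'v \<times> 'v) set"
  have "bij_betw (\<lambda>(a, b, c). (rk a, rk b, rk c)) ?T {(a, b, c). a < b \<and> b < c \<and> c < CARD('v)}"
    unfolding bij_betw_def
  proof
    show "(\<lambda>(a, b, c). (rk a, rk b, rk c)) ` ?T = {(a, b, c). a < b \<and> b < c \<and> c < CARD('v)}"
    proof (intro equalityI subsetI)
      fix x assume "x \<in> {(a, b, c). a < b \<and> b < c \<and> c < CARD('v)}"
      then obtain a b c where x: "x = (a, b, c)" "a < b" "b < c" "c < CARD('v)" by blast
      then obtain k l m :: 'v where "a = rk k" "b = rk l" "c = rk m"
        using rk_surj[of a] rk_surj[of b] rk_surj[of c] by force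
      then show "x \<in> (\<lambda>(a, b, c). (rk a, rk b, rk c)) ` ?T"
        using x by (intro image_eqI[of _ _ "(k, l, m)"]) auto
    qed (auto simp: rk_less)
  qed (auto simp: inj_on_def)
  from bij_betw_same_card[OF this] have T: "card ?T = CARD('v) choose 3" using card_chains(2) by simp
  have "bij_betw (\<lambda>(m, a, b, c). (rk m, rk a, rk b, rk c)) ?Q {(m, a, b, c). m < a \<and> a < b \<and> b < c \<and> c < CARD('v)}"
    unfolding bij_betw_def
  proof
    show "(\<lambda>(m, a, b, c). (rk m, rk a, rk b, rk c)) ` ?Q = {(m, a, b, c). m < a \<and> a < b \<and> b < c \<and> c < CARD('v)}"
    proof (intro equalityI subsetI)
      fix x assume "x \<in> {(m, a, b, c). m < a \<and> a < b \<and> b < c \<and> c < CARD('v)}"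
      then obtain m a b c where x: "x = (m, a, b, c)" "m < a" "a < b" "b < c" "c < CARD('v)" by blast
      then obtain m' a' b' c' :: 'v where "m = rk m'" "a = rk a'" "b = rk b'" "c = rk c'"
        using rk_surj[of m] rk_surj[of a] rk_surj[of b] rk_surj[of c] by force
      then show "x \<in> (\<lambda>(m, a, b, c). (rk m, rk a, rk b, rk c)) ` ?Q"
        using x by (intro image_eqI[of _ _ "(m', a', b', c')"]) auto
    qed (auto simp: rk_less)
  qed (auto simp: inj_on_def)
  from bij_betw_same_card[OF this] have Q: "card ?Q = CARD('v) choose 4" using card_chains(3) by simp
  have "quads = UNIV \<times> ?T - ?Q" by (auto simp: quads_def)
  moreover have "card (UNIV \<times> ?T - ?Q) = card (UNIV \<times> ?T :: ('v \<times> 'v \<times> 'v \<times> 'v) set) - card ?Q"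
    by (rule card_Diff_subset) auto
  moreover have "card (UNIV \<times> ?T :: ('v \<times> 'v \<times> 'v \<times> 'v) set) = CARD('v) * card ?T"
    by (rule card_cartesian_product)
  ultimately show ?thesis by (simp only: T Q)
qed

text \<open>\<open>\<Phi> k l u\<close> is the value of a functional at \<open>e_k\<close> wedge
  \<open>e_l\<close> tensor the monomial \<open>u\<close>; the extension to polynomials sees only
  their quadratic part.\<close>

definition ph :: "('v::finite \<Rightarrow> 'v \<Rightarrow> ('v \<Rightarrow>\<^sub>0 nat) \<Rightarrow> 'k::field) \<Rightarrow> 'v \<Rightarrow> 'v \<Rightarrow> ('v, 'k) mpoly \<Rightarrow> 'k" where
  "ph \<Phi> k l p = (\<Sum>u\<in>mons UNIV 2. \<Phi> k l u * lk p u)"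

lemma ph_add: "ph \<Phi> k l (p + q) = ph \<Phi> k l p + ph \<Phi> k l q"
  by (simp add: ph_def lookup_add distrib_left sum.distrib)

lemma ph_cst: "ph \<Phi> k l (cst c * p) = c * ph \<Phi> k l p"
  by (simp add: ph_def lk_cst_mult sum_distrib_left mult.left_commute)

lemma ph_0 [simp]: "ph \<Phi> k l 0 = 0"
  by (simp add: ph_def)

lemma ph_uminus: "ph \<Phi> k l (- p) = - ph \<Phi> k l p"
  by (simp add: ph_def sum_negf)

lemma ph_sum: "ph \<Phi> k l (\<Sum>i\<in>A. g i) = (\<Sum>i\<in>A. ph \<Phi> k l (g i))"
  by (induction A rule: infinite_finite_induct) (auto simp: ph_add)

lemma ph_hcomp: "ph \<Phi> k l (hcomp 2 p) = ph \<Phi> k l p"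
  unfolding ph_def by (intro sum.cong) (auto simp: lk_hcomp mons_iff)

text \<open>The alternating extension of freely chosen values on ordered pairs. The diagonal is set
  to 0, which antisymmetry does not enforce in characteristic 2.\<close>

definition alt_ext :: "(('v::finite \<times> 'v) \<times> ('v \<Rightarrow>\<^sub>0 nat) \<Rightarrow> 'k::field) \<Rightarrow> 'v \<Rightarrow> 'v \<Rightarrow> ('v \<Rightarrow>\<^sub>0 nat) \<Rightarrow> 'k" where
  "alt_ext c k l u = (if rk k < rk l then c ((k, l), u) else if rk l < rk k then - c ((l, k), u) else 0)"

lemma ph_alt_ext_add: "ph (alt_ext (\<lambda>y. c y + d y)) k l p = ph (alt_ext c) k l p + ph (alt_ext d) k l p"
  unfolding ph_def sum.distrib[symmetric] by (intro sum.cong) (auto simp: alt_ext_def algebra_simps)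

lemma ph_alt_ext_scale: "ph (alt_ext (\<lambda>y. t * c y)) k l p = t * ph (alt_ext c) k l p"
  unfolding ph_def sum_distrib_left by (intro sum.cong) (auto simp: alt_ext_def algebra_simps)

text \<open>The functional at \<open>x_m\<close> times the Koszul boundary of \<open>e_a\<close>,
  \<open>e_b\<close>, \<open>e_c\<close>. Its vanishing for all indices says that
  \<open>\<Phi>\<close> kills the Koszul boundaries of degree 4.\<close>

definition cocyc :: "('v::finite \<Rightarrow> 'v \<Rightarrow> ('v \<Rightarrow>\<^sub>0 nat) \<Rightarrow> 'k::field) \<Rightarrow> 'v \<Rightarrow> 'v \<Rightarrow> 'v \<Rightarrow> 'v \<Rightarrow> 'k" where
  "cocyc \<Phi> m a b c = ph \<Phi> b c (pvar m * pvar a) - ph \<Phi> a c (pvar m * pvar b) + ph \<Phi> a b (pvar m * pvar c)"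

text \<open>The double boundary of the wedge of \<open>e_m\<close>, \<open>e_a\<close>,
  \<open>e_b\<close>, \<open>e_c\<close> is 0; this expresses the condition for
  \<open>m < a < b < c\<close> through three conditions indexed by \<open>quads\<close>. Other
  orders and repetitions of \<open>a\<close>, \<open>b\<close>, \<open>c\<close> reduce to the
  ordered case, as \<open>cocyc\<close> is alternating in them.\<close>

lemma cocyc_all:
  assumes anti: "\<And>k l p. ph \<Phi> k l p = - ph \<Phi> l k p" "\<And>k p. ph \<Phi> k k p = 0"
    and q: "\<And>m a b c. (m, a, b, c) \<in> quads \<Longrightarrow> cocyc \<Phi> m a b c = 0"
  shows "cocyc \<Phi> m a b c = 0"
proof -
  have mc: "pvar x * pvar y = pvar y * pvar x" for x y :: 'a by (rule mult.commute)
  have sorted: "cocyc \<Phi> m a b c = 0" if abc: "rk a < rk b" "rk b < rk c" for a b c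
  proof (cases "rk m < rk a")
    case False
    then show ?thesis using q[of m a b c] abc by (simp add: quads_def)
  next
    case True
    have "cocyc \<Phi> a m b c = 0" "cocyc \<Phi> b m a c = 0" "cocyc \<Phi> c m a b = 0"
      using q[of a m b c] q[of b m a c] q[of c m a b] abc True by (simp_all add: quads_def)
    moreover have "cocyc \<Phi> m a b c = cocyc \<Phi> a m b c - cocyc \<Phi> b m a c + cocyc \<Phi> c m a b"
      unfolding cocyc_def mc[of a m] mc[of b m] mc[of c m] mc[of b a] mc[of c a] mc[of c b]
      by (simp add: algebra_simps)
    ultimately show ?thesis by simp
  qed
  have sw1: "cocyc \<Phi> m b a c = - cocyc \<Phi> m a b c" for a b c
    unfolding cocyc_def using anti(1)[of b a "pvar m * pvar c"] by simp
  have sw2: "cocyc \<Phi> m a c b = - cocyc \<Phi> m a b c" for a b c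
    unfolding cocyc_def using anti(1)[of c b "pvar m * pvar a"] by simp
  have eq1: "cocyc \<Phi> m a a c = 0" for a c unfolding cocyc_def using anti(2) by simp
  have eq2: "cocyc \<Phi> m a c c = 0" for a c unfolding cocyc_def using anti(2) by simp
  have eq3: "cocyc \<Phi> m a c a = 0" for a c using sw1[of c a a] eq2[of c a] by simp
  show ?thesis
  proof (cases "a = b \<or> b = c \<or> a = c")
    case True
    then show ?thesis using eq1 eq2 eq3 by auto
  next
    case False
    then have "rk a \<noteq> rk b" "rk b \<noteq> rk c" "rk a \<noteq> rk c" by auto
    then consider "rk a < rk b" "rk b < rk c" | "rk a < rk c" "rk c < rk b" | "rk b < rk a" "rk a < rk c"
      | "rk b < rk c" "rk c < rk a" | "rk c < rk a" "rk a < rk b" | "rk c < rk b" "rk b < rk a"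
      by linarith
    then show ?thesis
    proof cases
      case 1 then show ?thesis by (rule sorted)
    next
      case 2 show ?thesis using sorted[OF 2] sw2[of a b c] by simp
    next
      case 3 show ?thesis using sorted[OF 3] sw1[of a b c] by simp
    next
      case 4 show ?thesis using sorted[OF 4] sw1[of a b c] sw2[of b a c] by simp
    next
      case 5 show ?thesis using sorted[OF 5] sw1[of a c b] sw2[of a b c] by simp
    next
      case 6 show ?thesis using sorted[OF 6] sw1[of a b c] sw2[of b a c] sw1[of b c a] by simp
    qed
  qed
qed

text \<open>
  The inequality \<open>count\<close> says that the unknowns outnumber the equations for a functional on
  \<open>\<Lambda>\<^sup>2 S\<^sub>1 \<otimes> R\<^sub>2\<close> that vanishes on the boundaries of the Koszul complex of \<open>R\<close> and on the products of
  its degree one cycles. The cocycle conditions for \<open>m < a < b < c\<close> follow from the others.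
\<close>

locale many_syzygies = quadrics N f for N and f :: "nat \<Rightarrow> ('v::finite, 'k::field) mpoly" +
  fixes z
  assumes z_forms: "i < N \<Longrightarrow> z i l \<in> forms 1"
    and f_eq: "i < N \<Longrightarrow> f i = (\<Sum>l\<in>UNIV. z i l * pvar l)"
    and count: "(CARD('v) choose 2) * N + (CARD('v) * (CARD('v) choose 3) - (CARD('v) choose 4)) + (N choose 2)
      < (CARD('v) choose 2) * (Suc (CARD('v)) choose 2)"
begin

lemma functional_exists:
  "\<exists>\<Phi>. (\<forall>k l p. ph \<Phi> k l p = - ph \<Phi> l k p) \<and> (\<forall>k p. ph \<Phi> k k p = 0) \<and>
     (\<forall>k l i. i < N \<longrightarrow> ph \<Phi> k l (f i) = 0) \<and> (\<forall>m a b c. cocyc \<Phi> m a b c = 0) \<and>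
     (\<forall>i j. i < N \<longrightarrow> j < N \<longrightarrow> (\<Sum>a\<in>UNIV. \<Sum>l\<in>UNIV. ph \<Phi> a l (z j a * z i l)) = 0) \<and>
     (\<exists>k l u. (k, l) \<in> pairs \<and> u \<in> mons UNIV 2 \<and> \<Phi> k l u \<noteq> 0)"
proof -
  \<comment> \<open>Three families of equations: vanishing on \<open>V\<close> for each pair, the
    cocycle conditions, and vanishing on the product of the cycles \<open>z i\<close> and
    \<open>z j\<close> for \<open>i < j\<close>. The remaining products follow because
    \<open>\<Phi>\<close> is alternating.\<close>
  define E :: "(('v \<times> 'v) \<times> nat + ('v \<times> 'v \<times> 'v \<times> 'v) + nat \<times> nat) set" where
    "E = Inl ` (pairs \<times> {..<N}) \<union> (Inr ` (Inl ` quads) \<union> Inr ` (Inr ` {(i, j). i < j \<and> j < N}))"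
  define L where "L e c = (case e of Inl p \<Rightarrow> ph (alt_ext c) (fst (fst p)) (snd (fst p)) (f (snd p))
      | Inr (Inl (m, a, b, d)) \<Rightarrow> cocyc (alt_ext c) m a b d
      | Inr (Inr p) \<Rightarrow> (\<Sum>a\<in>UNIV. \<Sum>l\<in>UNIV. ph (alt_ext c) a l (z (snd p) a * z (fst p) l)))"
    for e :: "('v \<times> 'v) \<times> nat + ('v \<times> 'v \<times> 'v \<times> 'v) + nat \<times> nat" and c :: "('v \<times> 'v) \<times> ('v \<Rightarrow>\<^sub>0 nat) \<Rightarrow> 'k"
  let ?Y = "(pairs :: ('v \<times> 'v) set) \<times> mons (UNIV :: 'v set) 2"
  note ch = card_chains(1)[of N]
  have finE: "finite E" unfolding E_def using ch by simp
  have "card E \<le> card (Inl ` (pairs \<times> {..<N}) :: (('v \<times> 'v) \<times> nat + ('v \<times> 'v \<times> 'v \<times> 'v) + nat \<times> nat) set)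
     + (card (Inr ` (Inl ` quads) :: (('v \<times> 'v) \<times> nat + ('v \<times> 'v \<times> 'v \<times> 'v) + nat \<times> nat) set)
     + card (Inr ` (Inr ` {(i, j). i < j \<and> j < N}) :: (('v \<times> 'v) \<times> nat + ('v \<times> 'v \<times> 'v \<times> 'v) + nat \<times> nat) set))"
    unfolding E_def by (rule order_trans[OF card_Un_le add_left_mono[OF card_Un_le]])
  also have "\<dots> = (CARD('v) choose 2) * N + ((CARD('v) * (CARD('v) choose 3) - (CARD('v) choose 4)) + (N choose 2))"
    by (simp add: card_image card_cartesian_product card_pairs card_quads ch)
  also have "\<dots> < (CARD('v) choose 2) * (Suc (CARD('v)) choose 2)" using count by simp
  also have "\<dots> = card ?Y" by (simp add: card_cartesian_product card_pairs card_mons)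
  finally have card: "card E < card ?Y" .
  obtain c where c: "\<exists>y\<in>?Y. c y \<noteq> 0" "\<And>e. e \<in> E \<Longrightarrow> L e c = 0"
  proof (rule underdetermined_functionals[OF finE _ card, of L])
    show "finite ?Y" by simp
    fix e c d t
    show "L e (\<lambda>y. c y + d y) = L e c + L e d"
      by (auto simp: L_def cocyc_def ph_alt_ext_add sum.distrib split: sum.split)
    show "L e (\<lambda>y. t * c y) = t * L e c"
      by (auto simp: L_def cocyc_def ph_alt_ext_scale sum_distrib_left algebra_simps split: sum.split)
  qed (rule that)
  let ?\<Phi> = "alt_ext c"
  have anti: "ph ?\<Phi> k l p = - ph ?\<Phi> l k p" for k l p
    unfolding ph_def sum_negf[symmetric] by (intro sum.cong) (auto simp: alt_ext_def)
  have diag: "ph ?\<Phi> k k p = 0" for k p by (simp add: ph_def alt_ext_def)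
  have V0: "ph ?\<Phi> k l (f i) = 0" if i: "i < N" for k l i
  proof -
    have *: "ph ?\<Phi> k l (f i) = 0" if "rk k < rk l" for k l
      using c(2)[of "Inl ((k, l), i)"] i that by (simp add: E_def L_def pairs_def)
    consider "rk k < rk l" | "rk l < rk k" | "rk k = rk l" by linarith
    then show ?thesis
    proof cases
      case 1 then show ?thesis by (rule *)
    next
      case 2 then show ?thesis using *[OF 2] anti[of k l] by simp
    next
      case 3 then show ?thesis using diag by simp
    qed
  qed
  have coc: "cocyc ?\<Phi> m a b d = 0" for m a b d
  proof (rule cocyc_all[OF anti diag])
    fix m a b d assume "(m, a, b, d) \<in> (quads :: ('v \<times> 'v \<times> 'v \<times> 'v) set)"
    then show "cocyc ?\<Phi> m a b d = 0" using c(2)[of "Inr (Inl (m, a, b, d))"] by (simp add: E_def L_def image_iff)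
  qed
  have P: "(\<Sum>a\<in>UNIV. \<Sum>l\<in>UNIV. ph ?\<Phi> a l (z j a * z i l)) = 0" if ij: "i < N" "j < N" for i j
  proof -
    have *: "(\<Sum>a\<in>UNIV. \<Sum>l\<in>UNIV. ph ?\<Phi> a l (z j a * z i l)) = 0" if "i < j" "j < N" for i j
      using c(2)[of "Inr (Inr (i, j))"] that by (simp add: E_def L_def image_iff)
    consider "i < j" | "j < i" | "i = j" by linarith
    then show ?thesis
    proof cases
      case 1 then show ?thesis using * ij by simp
    next
      case 2
      have "(\<Sum>a\<in>UNIV. \<Sum>l\<in>UNIV. ph ?\<Phi> a l (z j a * z i l)) = (\<Sum>l\<in>UNIV. \<Sum>a\<in>UNIV. - ph ?\<Phi> l a (z i l * z j a))"
      proof (subst sum.swap, intro sum.cong refl)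
        fix l a
        show "ph ?\<Phi> a l (z j a * z i l) = - ph ?\<Phi> l a (z i l * z j a)"
          unfolding mult.commute[of "z j a"] by (rule anti)
      qed
      also have "\<dots> = - (\<Sum>l\<in>UNIV. \<Sum>a\<in>UNIV. ph ?\<Phi> l a (z i l * z j a))" by (simp add: sum_negf)
      also have "\<dots> = 0" using *[OF 2 ij(1)] by simp
      finally show ?thesis .
    next
      case 3
      show ?thesis
        unfolding 3
      proof (rule sum_antisym_eq_0)
        fix a l
        show "ph ?\<Phi> a l (z j a * z j l) = - ph ?\<Phi> l a (z j l * z j a)"
          unfolding mult.commute[of "z j a"] by (rule anti)
      qed (rule diag)
    qed
  qed
  obtain k l u where "(k, l) \<in> pairs" "u \<in> mons UNIV 2" "c ((k, l), u) \<noteq> 0" using c(1) by auto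
  then have nz: "(k, l) \<in> pairs \<and> u \<in> mons UNIV 2 \<and> ?\<Phi> k l u \<noteq> 0" by (simp add: alt_ext_def pairs_def)
  show ?thesis
    by (rule exI[of _ ?\<Phi>], intro conjI allI impI anti diag V0 coc P)
       (assumption | rule exI[of _ k] exI[of _ l] exI[of _ u] nz)+
qed

end

section \<open>Continuing a resolution by one step\<close>

lemma sum_lessThan_add: "(\<Sum>c<m + n. g c) = (\<Sum>c<m. g c) + (\<Sum>i<n. g (m + i))"
  for g :: "nat \<Rightarrow> 'b::comm_monoid_add"
  by (induction n) (simp_all add: add.assoc)

definition vscale :: "'k \<Rightarrow> (nat \<Rightarrow> ('v::finite, 'k::field) mpoly) \<Rightarrow> nat \<Rightarrow> ('v, 'k) mpoly" where
  "vscale c v = (\<lambda>i. cst c * v i)"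

interpretation vec: vector_space "vscale :: 'k::field \<Rightarrow> (nat \<Rightarrow> ('v::finite, 'k) mpoly) \<Rightarrow> _"
  by unfold_locales
    (auto simp: vscale_def fun_eq_iff distrib_left distrib_right cst_add cst_mult mult.assoc)

lemma sum_fun_apply: "(\<Sum>i\<in>A. g i) x = (\<Sum>i\<in>A. g i x)"
  for g :: "'i \<Rightarrow> 'x \<Rightarrow> 'b::comm_monoid_add"
  by (induction A rule: infinite_finite_induct) auto

text \<open>Vectors with \<open>m\<close> entries of degree at most 2 form a finite-dimensional
  space, and a basis of the span of \<open>U\<close> can be chosen inside \<open>U\<close>.\<close>

lemma finite_spanning:
  fixes U :: "(nat \<Rightarrow> ('v::finite, 'k::field) mpoly) set"
  assumes U: "\<And>v c. v \<in> U \<Longrightarrow> m \<le> c \<Longrightarrow> v c = 0" "\<And>v c u. v \<in> U \<Longrightarrow> mdeg u > 2 \<Longrightarrow> lk (v c) u = 0"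
  shows "\<exists>Bs. finite Bs \<and> Bs \<subseteq> U \<and> (\<forall>v\<in>U. \<exists>c. \<forall>i. v i = (\<Sum>g\<in>Bs. cst (c g) * g i))"
proof -
  let ?St = "(\<Union>e\<in>{..2}. mons UNIV e) :: ('v \<Rightarrow>\<^sub>0 nat) set"
  define \<delta> where "\<delta> c u = (\<lambda>i. if i = c then Poly_Mapping.single u (1 :: 'k) else 0)"
    for c :: nat and u :: "'v \<Rightarrow>\<^sub>0 nat"
  let ?T = "(\<lambda>(c, u). \<delta> c u :: nat \<Rightarrow> ('v, 'k) mpoly) ` ({..<m} \<times> ?St)"
  have finT: "finite ?T" by simp
  have sub: "U \<subseteq> vec.span ?T"
  proof
    fix v assume v: "v \<in> U"
    have vi: "v i = (\<Sum>c<m. \<Sum>u\<in>?St. vscale (lk (v c) u) (\<delta> c u) i)" for i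
    proof -
      have k: "Poly_Mapping.keys (v c) \<subseteq> ?St" for c
      proof
        fix u assume "u \<in> Poly_Mapping.keys (v c)"
        then have "\<not> mdeg u > 2" using U(2)[OF v, of u c] by (auto simp: in_keys_iff)
        then show "u \<in> ?St" by (auto simp: mons_iff)
      qed
      have "(\<Sum>c<m. \<Sum>u\<in>?St. vscale (lk (v c) u) (\<delta> c u) i) = (\<Sum>c<m. if c = i then (\<Sum>u\<in>?St. cst (lk (v c) u) * Poly_Mapping.single u 1) else 0)"
        by (intro sum.cong refl) (auto simp: vscale_def \<delta>_def)
      also have "\<dots> = (if i < m then (\<Sum>u\<in>?St. cst (lk (v i) u) * Poly_Mapping.single u 1) else 0)"
        by simp
      also have "\<dots> = v i"
      proof (cases "i < m")
        case True
        have "v i = (\<Sum>u\<in>?St. Poly_Mapping.single u (lk (v i) u))" by (rule poly_mapping_expand[OF _ k]) simp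
        also have "\<dots> = (\<Sum>u\<in>?St. cst (lk (v i) u) * Poly_Mapping.single u 1)"
          by (intro sum.cong refl single_conv_mult)
        finally show ?thesis using True by simp
      qed (use U(1)[OF v] in simp)
      finally show ?thesis ..
    qed
    have "v = (\<Sum>c<m. \<Sum>u\<in>?St. vscale (lk (v c) u) (\<delta> c u))"
    proof
      fix i show "v i = (\<Sum>c<m. \<Sum>u\<in>?St. vscale (lk (v c) u) (\<delta> c u)) i"
        by (simp only: sum_fun_apply vi[of i])
    qed
    also have "\<dots> \<in> vec.span ?T"
      by (intro vec.span_sum vec.span_scale vec.span_base) auto
    finally show "v \<in> vec.span ?T" .
  qed
  obtain Bs where Bs: "Bs \<subseteq> U" "vec.independent Bs" "U \<subseteq> vec.span Bs"
    using vec.maximal_independent_subset[of U] by auto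
  have fin: "finite Bs" using vec.independent_span_bound[OF finT Bs(2)] Bs(1) sub by auto
  have "\<exists>c. \<forall>i. v i = (\<Sum>g\<in>Bs. cst (c g) * g i)" if "v \<in> U" for v
  proof -
    have "v \<in> range (\<lambda>u. \<Sum>g\<in>Bs. vscale (u g) g)" using that Bs(3) vec.span_finite[OF fin] by auto
    then obtain c where c: "v = (\<Sum>g\<in>Bs. vscale (c g) g)" by auto
    show ?thesis by (rule exI[of _ c]) (simp add: c sum_fun_apply vscale_def)
  qed
  then show ?thesis using fin Bs(1) by auto
qed

context std_quadrics
begin

text \<open>The columns of the next matrix are finite spanning sets of the homogeneous parts
  \<open>U j\<close> of the kernel. As normal forms have degree at most 2, each part is
  finite-dimensional and finitely many \<open>j\<close> suffice.\<close>

lemma extend_resolution: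
  fixes A :: "nat \<Rightarrow> nat \<Rightarrow> ('a, 'b) mpoly"
  assumes A: "\<And>r c. r < n \<Longrightarrow> c < m \<Longrightarrow> A r c \<in> tw (\<alpha> r) (\<beta> c)"
  shows "\<exists>m' \<beta>' A'. (\<forall>c<m. \<forall>e<m'. A' c e \<in> tw (\<beta> c) (\<beta>' e)) \<and>
    (\<forall>v. \<forall>r<n. app m A (app m' A' v) r \<in> QI) \<and>
    (\<forall>v. (\<forall>r<n. app m A v r \<in> QI) \<longrightarrow> (\<exists>w. \<forall>c<m. v c - app m' A' w c \<in> QI))"
proof -
  define U where "U j = {v. (\<forall>c<m. v c \<in> tw (\<beta> c) j \<and> nf (v c) = v c) \<and> (\<forall>c\<ge>m. v c = 0) \<and> (\<forall>r<n. app m A v r \<in> QI)}" for j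
  have U0: "lk (v c) u = 0" if v: "v \<in> U j" and u: "mdeg u > 2" for v c u j
  proof (cases "c < m")
    case True
    then have t: "v c \<in> tw (\<beta> c) j" "nf (v c) = v c" using v by (auto simp: U_def)
    show ?thesis
    proof (cases "\<beta> c \<le> j")
      case le: True
      then have f: "v c \<in> forms (j - \<beta> c)" using t by (simp add: tw_def)
      show ?thesis
      proof (cases "mdeg u = j - \<beta> c")
        case True
        then have "v c \<in> QI" using u QI_forms_ge3[OF f] by simp
        then have "v c = 0" using t(2) nf_eq_0_iff[of "v c"] by simp
        then show ?thesis by simp
      qed (use formsD[OF f, of u] in simp)
    qed (use t in \<open>simp add: tw_def\<close>)
  qed (use v in \<open>simp add: U_def\<close>)
  have "\<exists>Bs. finite Bs \<and> Bs \<subseteq> U j \<and> (\<forall>v\<in>U j. \<exists>c. \<forall>i. v i = (\<Sum>g\<in>Bs. cst (c g) * g i))" for j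
    by (rule finite_spanning[of _ m]) (auto simp: U_def intro: U0[of _ j, unfolded U_def])
  then have "\<forall>j. \<exists>Bs. finite Bs \<and> Bs \<subseteq> U j \<and> (\<forall>v\<in>U j. \<exists>c. \<forall>i. v i = (\<Sum>g\<in>Bs. cst (c g) * g i))" by simp
  from choice[OF this] obtain Bs where
    Bs: "\<forall>j. finite (Bs j) \<and> Bs j \<subseteq> U j \<and> (\<forall>v\<in>U j. \<exists>c. \<forall>i. v i = (\<Sum>g\<in>Bs j. cst (c g) * g i))" by (rule exE)
  \<comment> \<open>A normal form at entry \<open>c\<close> has internal degrees from
    \<open>\<beta> c\<close> to \<open>\<beta> c + 2\<close>; \<open>jm\<close> bounds all of
    them.\<close>
  define jm where "jm = Suc (Suc (\<Sum>c<m. \<beta> c))"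
  have jm: "\<beta> c + 2 \<le> jm" if "c < m" for c
    using member_le_sum[of c "{..<m}" \<beta>] that by (simp add: jm_def)
  define Gs where "Gs = Sigma {..jm} Bs"
  have finGs: "finite Gs" unfolding Gs_def by (rule finite_SigmaI) (use Bs in auto)
  obtain en where en: "bij_betw en {..<card Gs} Gs"
    using ex_bij_betw_nat_finite[OF finGs] by (auto simp: lessThan_atLeast0)
  define \<beta>' where "\<beta>' e = fst (en e)" for e
  define A' where "A' c e = snd (en e) c" for c e
  have enU: "snd (en e) \<in> U (\<beta>' e)" if "e < card Gs" for e
  proof -
    have "en e \<in> Gs" using en that by (auto simp: bij_betw_def)
    then have "snd (en e) \<in> Bs (fst (en e))" by (auto simp: Gs_def)
    then show ?thesis using Bs by (auto simp: \<beta>'_def)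
  qed
  have 1: "A' c e \<in> tw (\<beta> c) (\<beta>' e)" if "c < m" "e < card Gs" for c e
    using enU[OF that(2)] that(1) by (simp add: U_def A'_def)
  have 2: "app m A (app (card Gs) A' v) r \<in> QI" if "r < n" for v r
  proof -
    have "app m A (app (card Gs) A' v) r = (\<Sum>e<card Gs. v e * app m A (snd (en e)) r)"
      unfolding app_def sum_distrib_left by (subst sum.swap) (simp add: A'_def mult_ac)
    also have "\<dots> \<in> QI" using enU that by (intro QI_sum QI_mult) (simp add: U_def)
    finally show ?thesis .
  qed
  have 3: "\<exists>w. \<forall>c<m. v c - app (card Gs) A' w c \<in> QI" if v: "\<forall>r<n. app m A v r \<in> QI" for v
  proof -
    define vj where "vj j = (\<lambda>c. if c < m then nf (htw (\<beta> c) j (v c)) else 0)" for j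
    have "vj j \<in> U j" for j
    proof -
      have "app m A (vj j) r \<in> QI" if r: "r < n" for r
      proof -
        have "app m A (vj j) r = app m A (\<lambda>c. nf (htw (\<beta> c) j (v c))) r" by (simp add: app_def vj_def)
        then have "nf (app m A (vj j) r) = nf (app m A (\<lambda>c. htw (\<beta> c) j (v c)) r)"
          by (simp add: app_def nf_sum nf_mult_right)
        also have "app m A (\<lambda>c. htw (\<beta> c) j (v c)) r = htw (\<alpha> r) j (app m A v r)"
          by (rule htw_app) (rule A[OF r])
        also have "nf \<dots> = 0" using v r by (simp add: nf_eq_0_iff htw_def QI_hcomp)
        finally show ?thesis by (simp add: nf_eq_0_iff)
      qed
      moreover have "nf (htw (\<beta> c) j (v c)) \<in> tw (\<beta> c) j" for c
        by (simp add: htw_def tw_def nf_forms)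
      ultimately show ?thesis by (simp add: U_def vj_def)
    qed
    then have "\<forall>j. \<exists>c. \<forall>i. vj j i = (\<Sum>g\<in>Bs j. cst (c g) * g i)" using Bs by simp
    from choice[OF this] obtain cf where cf: "\<forall>j i. vj j i = (\<Sum>g\<in>Bs j. cst (cf j g) * g i)" by (rule exE)
    define w where "w e = (cst (cf (fst (en e)) (snd (en e))) :: ('a, 'b) mpoly)" for e
    have "v c - app (card Gs) A' w c \<in> QI" if c: "c < m" for c
    proof -
      have "app (card Gs) A' w c = (\<Sum>e<card Gs. cst (cf (fst (en e)) (snd (en e))) * snd (en e) c)"
        by (simp add: app_def A'_def w_def mult.commute)
      also have "\<dots> = (\<Sum>p\<in>Gs. cst (cf (fst p) (snd p)) * snd p c)"
        by (rule sum.reindex_bij_betw[OF en])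
      also have "\<dots> = (\<Sum>j\<le>jm. \<Sum>g\<in>Bs j. cst (cf j g) * g c)"
        unfolding Gs_def by (subst sum.Sigma) (use Bs in \<open>auto simp: case_prod_unfold\<close>)
      also have "\<dots> = (\<Sum>j\<le>jm. vj j c)" using cf by simp
      also have "\<dots> = nf (\<Sum>j\<le>jm. htw (\<beta> c) j (v c))"
        using c by (simp add: vj_def nf_sum)
      finally have e: "app (card Gs) A' w c = nf (\<Sum>j\<le>jm. htw (\<beta> c) j (v c))" .
      have h: "hcomp e (\<Sum>j\<le>jm. htw (\<beta> c) j (v c)) = hcomp e (v c)" if "e \<le> 2" for e
      proof -
        have "hcomp e (\<Sum>j\<le>jm. htw (\<beta> c) j (v c)) = (\<Sum>j\<le>jm. if j = \<beta> c + e then hcomp e (v c) else 0)"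
          unfolding hcomp_sum
          by (intro sum.cong refl) (auto simp: htw_def hcomp_forms[OF hcomp_in_forms])
        then show ?thesis using jm[OF c] that by simp
      qed
      have "v c - (\<Sum>j\<le>jm. htw (\<beta> c) j (v c)) \<in> QI"
        unfolding QI_def mem_Collect_eq hcomp_diff using h by simp
      from QI_add[OF this diff_nf_QI[of "\<Sum>j\<le>jm. htw (\<beta> c) j (v c)"]] show ?thesis
        unfolding e by simp
    qed
    then show ?thesis by (intro exI[of _ w]) simp
  qed
  show ?thesis
    by (rule exI[of _ "card Gs"], rule exI[of _ \<beta>'], rule exI[of _ A']) (simp add: 1 2 3)
qed

end

section \<open>A functional on the second module of the resolution\<close>

context many_syzygies
begin

abbreviation vr :: "nat \<Rightarrow> 'v" where "vr \<equiv> inv_into UNIV rk"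

lemma vr_bij: "bij_betw vr {..<CARD('v)} UNIV"
  using bij_betw_inv_into[OF bij_rk] .

lemma sum_vr: "(\<Sum>r<CARD('v). g (vr r)) = (\<Sum>l\<in>UNIV. g l)"
  by (rule sum.reindex_bij_betw[OF vr_bij])

definition np :: nat where "np = card (pairs :: ('v \<times> 'v) set)"

definition pe :: "nat \<Rightarrow> 'v \<times> 'v" where
  "pe = (SOME g. bij_betw g {..<np} pairs)"

lemma pe_bij: "bij_betw pe {..<np} pairs"
proof -
  have "finite (pairs :: ('v \<times> 'v) set)" by simp
  from ex_bij_betw_nat_finite[OF this] have "\<exists>g. bij_betw g {..<np} (pairs :: ('v \<times> 'v) set)"
    by (simp add: np_def lessThan_atLeast0)
  then show ?thesis unfolding pe_def by (rule someI_ex)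
qed

definition b2 :: nat where "b2 = np + N"

text \<open>The second differential: Koszul relations between the variables, and one relation for every \<open>f i\<close>.\<close>

definition D1 :: "nat \<Rightarrow> nat \<Rightarrow> ('v, 'k) mpoly" where
  "D1 r c = (if c < np then kpair (pe c) (vr r) else z (c - np) (vr r))"

lemma D1_forms: "c < b2 \<Longrightarrow> D1 r c \<in> forms 1"
  unfolding D1_def b2_def using kpair_forms z_forms by (simp add: less_diff_conv2)

lemma sum_b2: "(\<Sum>c<b2. g c) = (\<Sum>c<np. g c) + (\<Sum>i<N. g (np + i))"
  unfolding b2_def by (rule sum_lessThan_add)

definition D1v :: "'v \<Rightarrow> nat \<Rightarrow> ('v, 'k) mpoly" where
  "D1v l c = (if c < np then kpair (pe c) l else z (c - np) l)"

lemma D1_eq: "D1 r c = D1v (vr r) c"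
  by (simp add: D1_def D1v_def)

lemma D1v_forms: "c < b2 \<Longrightarrow> D1v l c \<in> forms 1"
  unfolding D1v_def b2_def using kpair_forms z_forms by (simp add: less_diff_conv2)

lemma pe_pairs: "c < np \<Longrightarrow> pe c \<in> pairs"
  using pe_bij by (auto simp: bij_betw_def)

lemma D1v_rel: "c < b2 \<Longrightarrow> (\<Sum>l\<in>UNIV. D1v l c * pvar l) \<in> QI"
proof (cases "c < np")
  case True
  then have "fst (pe c) \<noteq> snd (pe c)" using pe_pairs[OF True] by (auto simp: pairs_def)
  then show ?thesis using True by (simp add: D1v_def kpair_rel)
next
  case False
  assume "c < b2"
  then have "c - np < N" using False by (simp add: b2_def)
  then show ?thesis using False f_eq[of "c - np"] V_QI[OF f_in_V, of "c - np"] by (simp add: D1v_def)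
qed

context
  fixes \<Phi> :: "'v \<Rightarrow> 'v \<Rightarrow> ('v \<Rightarrow>\<^sub>0 nat) \<Rightarrow> 'k"
  assumes anti: "\<And>k l p. ph \<Phi> k l p = - ph \<Phi> l k p"
    and V0: "\<And>k l i. i < N \<Longrightarrow> ph \<Phi> k l (f i) = 0"
    and coc: "\<And>m a b c. cocyc \<Phi> m a b c = 0"
    and prod0: "\<And>i j. i < N \<Longrightarrow> j < N \<Longrightarrow> (\<Sum>a\<in>UNIV. \<Sum>l\<in>UNIV. ph \<Phi> a l (z j a * z i l)) = 0"
begin

lemma ph_lin: assumes "r \<in> forms 1"
  shows "ph \<Phi> k l (r * p) = (\<Sum>m\<in>UNIV. lk r (evar m) * ph \<Phi> k l (pvar m * p))"
proof -
  have "r * p = (\<Sum>m\<in>UNIV. cst (lk r (evar m)) * (pvar m * p))"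
    by (subst forms_1_expand[OF assms]) (simp add: sum_distrib_right mult.assoc)
  then show ?thesis by (simp add: ph_sum ph_cst)
qed

lemma coc_lin: assumes "r \<in> forms 1"
  shows "ph \<Phi> b c (r * pvar a) - ph \<Phi> a c (r * pvar b) + ph \<Phi> a b (r * pvar c) = 0"
proof -
  have "ph \<Phi> b c (r * pvar a) - ph \<Phi> a c (r * pvar b) + ph \<Phi> a b (r * pvar c)
      = (\<Sum>m\<in>UNIV. lk r (evar m) * cocyc \<Phi> m a b c)"
    unfolding ph_lin[OF assms] cocyc_def
    by (simp add: sum_subtractf[symmetric] sum.distrib[symmetric] algebra_simps)
  then show ?thesis using coc by simp
qed

text \<open>By the cocycle condition with multiplier \<open>z i l\<close>, summed over
  \<open>l\<close>, the two sides differ by the value of \<open>ph \<Phi> b a\<close> at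
  \<open>f i\<close>, which is 0.\<close>

lemma pairing_sym: assumes i: "i < N"
  shows "(\<Sum>l\<in>UNIV. ph \<Phi> a l (z i l * pvar b)) = (\<Sum>l\<in>UNIV. ph \<Phi> b l (z i l * pvar a))"
proof -
  have "(\<Sum>l\<in>UNIV. ph \<Phi> a l (z i l * pvar b)) - (\<Sum>l\<in>UNIV. ph \<Phi> b l (z i l * pvar a)) + (\<Sum>l\<in>UNIV. ph \<Phi> b a (z i l * pvar l))
     = (\<Sum>l\<in>UNIV. ph \<Phi> a l (z i l * pvar b) - ph \<Phi> b l (z i l * pvar a) + ph \<Phi> b a (z i l * pvar l))"
    by (simp add: sum_subtractf sum.distrib)
  also have "\<dots> = 0" using coc_lin[OF z_forms[OF i]] by simp
  finally show ?thesis using V0[OF i, of b a] by (simp add: f_eq[OF i] ph_sum)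
qed

text \<open>The value at the generator of \<open>f i\<close> times a quadratic monomial, designed
  for \<open>Psi_var_lin\<close>. The choice of a factorisation into two variables is harmless by
  \<open>pairing_sym\<close>.\<close>

definition pval :: "nat \<Rightarrow> ('v \<Rightarrow>\<^sub>0 nat) \<Rightarrow> 'k" where
  "pval i u = (let p = (SOME p. u = evar (fst p) + evar (snd p))
     in \<Sum>l\<in>UNIV. ph \<Phi> (fst p) l (z i l * pvar (snd p)))"

definition pv :: "nat \<Rightarrow> ('v, 'k) mpoly \<Rightarrow> 'k" where
  "pv i p = (\<Sum>u\<in>mons UNIV 2. pval i u * lk p u)"

lemma pv_add: "pv i (p + q) = pv i p + pv i q"
  by (simp add: pv_def lookup_add distrib_left sum.distrib)

lemma pv_cst: "pv i (cst c * p) = c * pv i p"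
  by (simp add: pv_def lk_cst_mult sum_distrib_left mult.left_commute)

lemma pv_0 [simp]: "pv i 0 = 0"
  by (simp add: pv_def)

lemma pv_sum: "pv i (\<Sum>j\<in>A. g j) = (\<Sum>j\<in>A. pv i (g j))"
  by (induction A rule: infinite_finite_induct) (auto simp: pv_add)

lemma pv_hcomp: "pv i (hcomp 2 p) = pv i p"
  unfolding pv_def by (intro sum.cong) (auto simp: lk_hcomp mons_iff)

lemma pv_vars: assumes i: "i < N"
  shows "pv i (pvar a * pvar b) = (\<Sum>l\<in>UNIV. ph \<Phi> a l (z i l * pvar b))"
proof -
  let ?u = "evar a + evar b"
  define p where "p = (SOME p. ?u = evar (fst p) + evar (snd p))"
  have "?u = evar (fst (a, b)) + evar (snd (a, b))" by simp
  then have p: "?u = evar (fst p) + evar (snd p)" unfolding p_def by (rule someI)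
  have e: "(if a = x then 1 else 0) + (if b = x then 1 else 0) = ((if fst p = x then 1 else 0) + (if snd p = x then 1 else 0) :: nat)" for x
    using arg_cong[OF p, of "\<lambda>w. lk w x"] by (simp add: lookup_add lk_evar)
  \<comment> \<open>Unique factorisation of a quadratic monomial, read off the exponents of
    \<open>a\<close> and \<open>b\<close>.\<close>
  have "(fst p = a \<and> snd p = b) \<or> (fst p = b \<and> snd p = a)"
  proof (cases "fst p = a")
    case True
    then show ?thesis using e[of b] by (simp split: if_splits)
  next
    case False
    then have "snd p = a" using e[of a] by (simp split: if_splits)
    then show ?thesis using e[of b] by (simp split: if_splits)
  qed
  then have v: "pval i ?u = (\<Sum>l\<in>UNIV. ph \<Phi> a l (z i l * pvar b))"
    unfolding pval_def Let_def p_def[symmetric] using pairing_sym[OF i, of a b] by auto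
  have m: "?u \<in> mons UNIV 2" by (simp add: mons_iff)
  have "pvar a * pvar b = Poly_Mapping.single ?u (1 :: 'k)" by (simp add: pvar_def mult_single)
  then have "pv i (pvar a * pvar b) = (\<Sum>u\<in>mons UNIV 2. if u = ?u then pval i u else 0)"
    unfolding pv_def by (intro sum.cong) (auto simp: lookup_single when_def)
  then show ?thesis using m v by simp
qed

lemma pv_lin: assumes i: "i < N" and q: "q \<in> forms 1"
  shows "pv i (pvar a * q) = (\<Sum>l\<in>UNIV. ph \<Phi> a l (z i l * q))"
proof -
  have "pvar a * q = (\<Sum>m\<in>UNIV. cst (lk q (evar m)) * (pvar a * pvar m))"
    by (subst forms_1_expand[OF q]) (simp add: sum_distrib_left mult_ac)
  then have "pv i (pvar a * q) = (\<Sum>m\<in>UNIV. lk q (evar m) * (\<Sum>l\<in>UNIV. ph \<Phi> a l (z i l * pvar m)))"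
    by (simp add: pv_sum pv_cst pv_vars[OF i])
  also have "\<dots> = (\<Sum>l\<in>UNIV. \<Sum>m\<in>UNIV. lk q (evar m) * ph \<Phi> a l (pvar m * z i l))"
    unfolding sum_distrib_left by (subst sum.swap) (simp add: mult.commute)
  also have "\<dots> = (\<Sum>l\<in>UNIV. ph \<Phi> a l (q * z i l))" by (simp add: ph_lin[OF q])
  finally show ?thesis by (simp add: mult.commute)
qed

lemma ph_QI: assumes "p \<in> QI" shows "ph \<Phi> k l p = 0"
proof -
  obtain c where "hcomp 2 p = (\<Sum>i<N. cst (c i) * f i)" using assms by (auto simp: QI_def V_def)
  then have "ph \<Phi> k l (hcomp 2 p) = 0" by (simp add: ph_sum ph_cst V0)
  then show ?thesis by (simp add: ph_hcomp)
qed

text \<open>The value at \<open>f j\<close> is that of \<open>\<Phi>\<close> at the product of the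
  degree one cycles \<open>z j\<close> and \<open>z i\<close>.\<close>

lemma pv_f: assumes "i < N" "j < N" shows "pv i (f j) = 0"
proof -
  have "pv i (f j) = (\<Sum>a\<in>UNIV. pv i (pvar a * z j a))"
    by (simp add: f_eq[OF assms(2)] pv_sum mult.commute)
  also have "\<dots> = (\<Sum>a\<in>UNIV. \<Sum>l\<in>UNIV. ph \<Phi> a l (z j a * z i l))"
    by (simp add: pv_lin[OF assms(1) z_forms[OF assms(2)]] mult.commute)
  finally show ?thesis using prod0[OF assms] by simp
qed

lemma pv_QI: assumes "i < N" "p \<in> QI" shows "pv i p = 0"
proof -
  obtain c where "hcomp 2 p = (\<Sum>i<N. cst (c i) * f i)" using assms by (auto simp: QI_def V_def)
  then have "pv i (hcomp 2 p) = 0" by (simp add: pv_sum pv_cst pv_f assms)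
  then show ?thesis by (simp add: pv_hcomp)
qed

text \<open>Extends \<open>- \<Phi>\<close> from the Koszul generators to those of the
  \<open>f i\<close>. It is made to kill the maximal ideal times the kernel of \<open>D1\<close>
  (\<open>Psi_max_ideal\<close>), and thus to detect minimal generators of that kernel.\<close>

definition Psi :: "(nat \<Rightarrow> ('v, 'k) mpoly) \<Rightarrow> 'k" where
  "Psi v = (\<Sum>i<N. pv i (v (np + i))) - (\<Sum>c<np. ph \<Phi> (fst (pe c)) (snd (pe c)) (v c))"

lemma Psi_add: "Psi (\<lambda>c. v c + w c) = Psi v + Psi w"
  by (simp add: Psi_def ph_add pv_add sum.distrib)

lemma Psi_sum: "finite A \<Longrightarrow> Psi (\<lambda>c. \<Sum>i\<in>A. g i c) = (\<Sum>i\<in>A. Psi (g i))"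
  by (induction A rule: finite_induct) (simp add: Psi_def, simp add: Psi_add)

lemma Psi_QI: "(\<And>c. c < b2 \<Longrightarrow> v c \<in> QI) \<Longrightarrow> Psi v = 0"
  by (simp add: Psi_def b2_def ph_QI pv_QI)

text \<open>Apply \<open>ph \<Phi> m l\<close> to the relation of row \<open>l\<close> and sum over
  \<open>l\<close>. By the cocycle condition a Koszul column contributes minus the value of
  \<open>\<Phi>\<close> at its pair, and the other columns contribute \<open>pv\<close>; the total
  is \<open>Psi\<close> of \<open>pvar m * v\<close>.\<close>

lemma Psi_var_lin:
  assumes v: "\<And>c. c < b2 \<Longrightarrow> v c \<in> forms 1" and rel: "\<And>l. (\<Sum>c<b2. D1v l c * v c) \<in> QI"
  shows "Psi (\<lambda>c. pvar m * v c) = 0"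
proof -
  have k: "(\<Sum>l\<in>UNIV. ph \<Phi> m l (kpair t l * q)) = - ph \<Phi> (fst t) (snd t) (pvar m * q)"
    if q: "q \<in> forms 1" and t: "t \<in> pairs" for t q
  proof -
    have ne: "fst t \<noteq> snd t" using t by (auto simp: pairs_def)
    have "(\<Sum>l\<in>UNIV. ph \<Phi> m l (kpair t l * q)) = (\<Sum>l\<in>UNIV. (if l = fst t then ph \<Phi> m l (q * pvar (snd t)) else 0)
       - (if l = snd t then ph \<Phi> m l (q * pvar (fst t)) else 0))"
      using ne by (intro sum.cong refl) (auto simp: kpair_def ph_uminus mult.commute)
    also have "\<dots> = ph \<Phi> m (fst t) (q * pvar (snd t)) - ph \<Phi> m (snd t) (q * pvar (fst t))"
      by (simp add: sum_subtractf)
    also have "\<dots> = - ph \<Phi> (fst t) (snd t) (q * pvar m)"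
      using coc_lin[OF q, of "fst t" "snd t" m] by (simp add: algebra_simps)
    finally show ?thesis by (simp add: mult.commute)
  qed
  have "0 = (\<Sum>l\<in>UNIV. ph \<Phi> m l (\<Sum>c<b2. D1v l c * v c))" using ph_QI[OF rel] by simp
  also have "\<dots> = (\<Sum>l\<in>UNIV. (\<Sum>c<np. ph \<Phi> m l (kpair (pe c) l * v c)) + (\<Sum>i<N. ph \<Phi> m l (z i l * v (np + i))))"
    by (simp add: sum_b2 ph_add ph_sum D1v_def)
  also have "\<dots> = (\<Sum>c<np. \<Sum>l\<in>UNIV. ph \<Phi> m l (kpair (pe c) l * v c)) + (\<Sum>i<N. \<Sum>l\<in>UNIV. ph \<Phi> m l (z i l * v (np + i)))"
    unfolding sum.distrib by (intro arg_cong2[of _ _ _ _ "(+)"] sum.swap)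
  also have "\<dots> = (\<Sum>c<np. - ph \<Phi> (fst (pe c)) (snd (pe c)) (pvar m * v c)) + (\<Sum>i<N. pv i (pvar m * v (np + i)))"
    using v by (intro arg_cong2[of _ _ _ _ "(+)"] sum.cong refl) (simp_all add: k pe_pairs pv_lin b2_def)
  also have "\<dots> = Psi (\<lambda>c. pvar m * v c)" by (simp add: Psi_def sum_negf)
  finally show ?thesis ..
qed

text \<open>\<open>Psi\<close> sees quadratic parts only, so \<open>v\<close> may be replaced by its
  linear part, which satisfies the same relations as \<open>QI\<close> is homogeneous.\<close>

lemma Psi_var: assumes rel: "\<And>l. (\<Sum>c<b2. D1v l c * v c) \<in> QI"
  shows "Psi (\<lambda>c. pvar m * v c) = 0"
proof -
  have h: "hcomp 2 (pvar m * q) = hcomp 2 (pvar m * hcomp 1 q)" for q :: "('v, 'k) mpoly"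
    by (simp add: hcomp_mult_forms[OF forms_pvar(1)] hcomp_forms[OF hcomp_in_forms])
  have "Psi (\<lambda>c. pvar m * v c) = Psi (\<lambda>c. pvar m * hcomp 1 (v c))"
    unfolding Psi_def ph_hcomp[symmetric, of _ _ _ "pvar m * _"] pv_hcomp[symmetric, of _ "pvar m * _"]
    by (simp only: h[symmetric])
  also have "\<dots> = 0"
  proof (rule Psi_var_lin)
    fix l
    have "(\<Sum>c<b2. D1v l c * hcomp 1 (v c)) = hcomp 2 (\<Sum>c<b2. D1v l c * v c)"
      unfolding hcomp_sum by (intro sum.cong refl) (simp add: hcomp_mult_forms[OF D1v_forms])
    then show "(\<Sum>c<b2. D1v l c * hcomp 1 (v c)) \<in> QI" using QI_hcomp[OF rel] by simp
  qed simp
  finally show ?thesis .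
qed

lemma Psi_max_ideal:
  assumes rel: "\<And>l. (\<Sum>c<b2. D1v l c * v c) \<in> QI" and p: "lk p 0 = 0"
  shows "Psi (\<lambda>c. p * v c) = 0"
proof -
  obtain h where h: "p = (\<Sum>m\<in>UNIV. pvar m * h m)" using p by (rule expand_forms_Suc) blast
  have "(\<lambda>c. p * v c) = (\<lambda>c. \<Sum>m\<in>UNIV. pvar m * (h m * v c))"
    by (subst h) (simp add: sum_distrib_right mult.assoc)
  then have "Psi (\<lambda>c. p * v c) = (\<Sum>m\<in>UNIV. Psi (\<lambda>c. pvar m * (h m * v c)))"
    by (simp add: Psi_sum)
  also have "\<dots> = 0"
  proof (intro sum.neutral ballI Psi_var)
    fix m l
    have "(\<Sum>c<b2. D1v l c * (h m * v c)) = h m * (\<Sum>c<b2. D1v l c * v c)"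
      by (simp add: sum_distrib_left mult_ac)
    then show "(\<Sum>c<b2. D1v l c * (h m * v c)) \<in> QI" using QI_mult[OF rel] by simp
  qed
  finally show ?thesis .
qed

lemma Psi_witness:
  assumes "(k, l) \<in> pairs" "u \<in> mons UNIV 2" "\<Phi> k l u \<noteq> 0"
  obtains c where "c < b2" "Psi (\<lambda>e. if e = c then Poly_Mapping.single u 1 else 0) \<noteq> 0"
proof -
  have "(k, l) \<in> pe ` {..<np}" using assms(1) pe_bij by (simp add: bij_betw_def)
  then obtain c where "(k, l) = pe c" "c \<in> {..<np}" by (rule imageE)
  then have c: "c < np" "pe c = (k, l)" by simp_all
  have 1: "(\<Sum>i<N. pv i (if np + i = c then Poly_Mapping.single u 1 else 0)) = 0"
    using c by (intro sum.neutral) simp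
  have 2: "(\<Sum>e<np. ph \<Phi> (fst (pe e)) (snd (pe e)) (if e = c then Poly_Mapping.single u 1 else 0))
     = (\<Sum>e<np. if e = c then ph \<Phi> k l (Poly_Mapping.single u 1) else 0)"
    by (intro sum.cong refl) (simp add: c)
  have "Psi (\<lambda>e. if e = c then Poly_Mapping.single u 1 else 0)
     = - (\<Sum>e<np. if e = c then ph \<Phi> k l (Poly_Mapping.single u 1) else 0)"
    unfolding Psi_def 1 2 by simp
  also have "\<dots> = - ph \<Phi> k l (Poly_Mapping.single u 1)" using c by simp
  also have "ph \<Phi> k l (Poly_Mapping.single u 1) = (\<Sum>w\<in>mons UNIV 2. if w = u then \<Phi> k l w else 0)"
    unfolding ph_def by (intro sum.cong) (auto simp: lookup_single when_def)
  also have "\<dots> = \<Phi> k l u" using assms(2) by simp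
  finally have "Psi (\<lambda>e. if e = c then Poly_Mapping.single u 1 else 0) \<noteq> 0" using assms(3) by simp
  moreover have "c < b2" using c by (simp add: b2_def)
  ultimately show ?thesis by (intro that)
qed

end

end

section \<open>A resolution with prescribed start, and the class of degree 4\<close>

context many_syzygies
begin

definition D0 :: "nat \<Rightarrow> nat \<Rightarrow> ('v, 'k) mpoly" where
  "D0 r c = pvar (vr c)"

lemma app_D0: "app (CARD('v)) D0 v 0 = (\<Sum>l\<in>UNIV. pvar l * v (rk l))"
proof -
  have "app (CARD('v)) D0 v 0 = (\<Sum>r<CARD('v). pvar (vr r) * v (rk (vr r)))"
    unfolding app_def D0_def
  proof (intro sum.cong refl)
    fix r assume "r \<in> {..<CARD('v)}"
    then have "rk (vr r) = r" using bij_rk[where 'v = 'v] by (simp add: bij_betw_def f_inv_into_f)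
    then show "pvar (vr r) * v r = pvar (vr r) * v (rk (vr r))" by simp
  qed
  also have "\<dots> = (\<Sum>l\<in>UNIV. pvar l * v (rk l))" by (rule sum_vr)
  finally show ?thesis .
qed

lemma vr_rk [simp]: "vr (rk l) = l"
  using bij_rk[where 'v = 'v] by (simp add: bij_betw_def inv_into_f_f)

lemma app_D1: "app b2 D1 w r = (\<Sum>c<b2. D1v (vr r) c * w c)"
  by (simp add: app_def D1_eq)

text \<open>Write the element of \<open>QI\<close> as a combination of the \<open>f i\<close> with
  coefficients \<open>h i\<close> and subtract the same combination of the \<open>z i\<close> from
  \<open>v\<close>; a syzygy of the variables remains, which is Koszul.\<close>

lemma D1_exact:
  assumes "app (CARD('v)) D0 v 0 \<in> QI"
  shows "\<exists>w. \<forall>r<CARD('v). v r - app b2 D1 w r \<in> QI"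
proof -
  obtain h where h: "app (CARD('v)) D0 v 0 = (\<Sum>i<N. h i * f i)" using assms by (rule QI_generated)
  define s where "s l = v (rk l) - (\<Sum>i<N. h i * z i l)" for l
  have "(\<Sum>l\<in>UNIV. s l * pvar l) = (\<Sum>l\<in>UNIV. pvar l * v (rk l)) - (\<Sum>l\<in>UNIV. \<Sum>i<N. h i * (z i l * pvar l))"
    unfolding s_def left_diff_distrib sum_subtractf sum_distrib_right by (simp add: mult_ac)
  also have "\<dots> = (\<Sum>l\<in>UNIV. pvar l * v (rk l)) - (\<Sum>i<N. h i * f i)"
    by (subst sum.swap) (simp add: f_eq sum_distrib_left)
  also have "\<dots> = 0" using h by (simp add: app_D0)
  finally have "(\<Sum>l\<in>UNIV. s l * pvar l) = 0" .
  from koszul_relation[OF finite this] obtain \<kappa> where \<kappa>: "\<forall>v\<in>UNIV. s v = (\<Sum>w\<in>UNIV. \<kappa> v w * pvar w)"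
    "\<forall>v w. \<kappa> v w = - \<kappa> w v" "\<forall>v. \<kappa> v v = 0" by (elim exE conjE)
  define w where "w c = (if c < np then \<kappa> (fst (pe c)) (snd (pe c)) else h (c - np))" for c
  have e: "(\<Sum>c<b2. D1v l c * w c) = v (rk l)" for l
  proof -
    have "(\<Sum>c<np. \<kappa> (fst (pe c)) (snd (pe c)) * kpair (pe c) l) = (\<Sum>t\<in>pairs. \<kappa> (fst t) (snd t) * kpair t l)"
      by (rule sum.reindex_bij_betw[OF pe_bij])
    also have "\<dots> = (\<Sum>w\<in>UNIV. \<kappa> l w * pvar w)"
      unfolding pairs_def by (rule kpair_sum) (rule spec[OF spec[OF \<kappa>(2)]], rule spec[OF \<kappa>(3)])
    also have "\<dots> = s l" by (rule bspec[OF \<kappa>(1) UNIV_I, symmetric])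
    finally have k: "(\<Sum>c<np. kpair (pe c) l * \<kappa> (fst (pe c)) (snd (pe c))) = s l" by (simp only: mult.commute)
    have "(\<Sum>c<b2. D1v l c * w c) = (\<Sum>c<np. kpair (pe c) l * \<kappa> (fst (pe c)) (snd (pe c))) + (\<Sum>i<N. z i l * h i)"
      unfolding sum_b2 by (simp add: D1v_def w_def)
    also have "\<dots> = v (rk l)" unfolding k by (simp add: s_def mult.commute)
    finally show ?thesis .
  qed
  have "v r - app b2 D1 w r \<in> QI" if "r < CARD('v)" for r
  proof -
    have "rk (vr r) = r" using bij_rk[where 'v = 'v] that by (simp add: bij_betw_def f_inv_into_f)
    then show ?thesis unfolding app_D1 e by simp
  qed
  then show ?thesis by (intro exI[of _ w]) simp
qed

lemma D0_D1: "app (CARD('v)) D0 (app b2 D1 v) 0 \<in> QI"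
proof -
  have "app (CARD('v)) D0 (app b2 D1 v) 0 = (\<Sum>l\<in>UNIV. \<Sum>c<b2. v c * (D1v l c * pvar l))"
    by (simp add: app_D0 app_D1 sum_distrib_left mult_ac)
  also have "\<dots> = (\<Sum>c<b2. v c * (\<Sum>l\<in>UNIV. D1v l c * pvar l))"
    by (subst sum.swap) (simp add: sum_distrib_left)
  also have "\<dots> \<in> QI" by (intro QI_sum QI_mult D1v_rel) simp
  finally show ?thesis .
qed

text \<open>The first two differentials are prescribed, since \<open>Psi\<close> refers to them; the
  later ones come from \<open>extend_resolution\<close> by dependent choice.\<close>

lemma resolution_exists:
  "\<exists>b a D. lifted_resolution b a D \<and> b 1 = CARD('v) \<and> b 2 = b2 \<and> a 2 = (\<lambda>_. 2) \<and> D 1 = D1"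
proof -
  obtain B \<gamma> where "std_basis B \<gamma>" using std_basis_exists by (elim exE)
  then interpret std_quadrics N f B \<gamma> by unfold_locales
  \<comment> \<open>A state lists the number of columns, their degrees, the number of rows, their
    degrees, and the matrix.\<close>
  define P where "P k s = ((\<forall>r<fst (snd (snd s)). \<forall>c<fst s. snd (snd (snd (snd s))) r c \<in> tw (fst (snd (snd (snd s))) r) (fst (snd s) c)) \<and>
      (k = 0 \<longrightarrow> s = (b2, (\<lambda>_. 2), CARD('v), (\<lambda>_. 1), D1)))"
    for k :: nat and s :: "nat \<times> (nat \<Rightarrow> nat) \<times> nat \<times> (nat \<Rightarrow> nat) \<times> (nat \<Rightarrow> nat \<Rightarrow> ('v, 'k) mpoly)"
  define Q where "Q s s' = (fst (snd (snd s')) = fst s \<and> fst (snd (snd (snd s'))) = fst (snd s) \<and>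
     (\<forall>v. \<forall>r<fst (snd (snd s)). app (fst s) (snd (snd (snd (snd s)))) (app (fst s') (snd (snd (snd (snd s')))) v) r \<in> QI) \<and>
     (\<forall>v. (\<forall>r<fst (snd (snd s)). app (fst s) (snd (snd (snd (snd s)))) v r \<in> QI) \<longrightarrow>
        (\<exists>w. \<forall>c<fst s. v c - app (fst s') (snd (snd (snd (snd s')))) w c \<in> QI)))"
    for s s' :: "nat \<times> (nat \<Rightarrow> nat) \<times> nat \<times> (nat \<Rightarrow> nat) \<times> (nat \<Rightarrow> nat \<Rightarrow> ('v, 'k) mpoly)"
  have "\<exists>st. \<forall>k. P k (st k) \<and> Q (st k) (st (Suc k))"
  proof (rule dependent_nat_choice)
    have "D1 r c \<in> tw 1 2" if "c < b2" for r c
      using D1_forms[OF that] by (simp add: tw_def)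
    then show "\<exists>s. P 0 s" by (intro exI[of _ "(b2, (\<lambda>_. 2), CARD('v), (\<lambda>_. 1), D1)"]) (simp add: P_def)
  next
    fix s k assume "P k s"
    obtain m \<beta> n \<alpha> A where s: "s = (m, \<beta>, n, \<alpha>, A)" by (cases s) auto
    have A: "A r c \<in> tw (\<alpha> r) (\<beta> c)" if "r < n" "c < m" for r c
      using \<open>P k s\<close> that by (simp add: P_def s)
    have "\<exists>m' \<beta>' A'. (\<forall>c<m. \<forall>e<m'. A' c e \<in> tw (\<beta> c) (\<beta>' e)) \<and>
      (\<forall>v. \<forall>r<n. app m A (app m' A' v) r \<in> QI) \<and>
      (\<forall>v. (\<forall>r<n. app m A v r \<in> QI) \<longrightarrow> (\<exists>w. \<forall>c<m. v c - app m' A' w c \<in> QI))"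
      by (rule extend_resolution[of n m A \<alpha> \<beta>]) (rule A)
    then obtain m' \<beta>' A' where
      e: "\<forall>c<m. \<forall>e<m'. A' c e \<in> tw (\<beta> c) (\<beta>' e)"
      "\<forall>v. \<forall>r<n. app m A (app m' A' v) r \<in> QI"
      "\<forall>v. (\<forall>r<n. app m A v r \<in> QI) \<longrightarrow> (\<exists>w. \<forall>c<m. v c - app m' A' w c \<in> QI)"
      by (elim exE conjE)
    show "\<exists>s'. P (Suc k) s' \<and> Q s s'"
      by (rule exI[of _ "(m', \<beta>', m, \<beta>, A')"]) (use e in \<open>simp add: P_def Q_def s\<close>)
  qed
  then obtain st where st: "\<forall>k. P k (st k) \<and> Q (st k) (st (Suc k))" by (rule exE)
  have st0: "st 0 = (b2, (\<lambda>_. 2), CARD('v), (\<lambda>_. 1), D1)" using st by (simp add: P_def)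
  define b where "b i = (case i of 0 \<Rightarrow> 1 | Suc j \<Rightarrow> (case j of 0 \<Rightarrow> CARD('v) | Suc k \<Rightarrow> fst (st k)))" for i
  define a where "a i = (case i of 0 \<Rightarrow> (\<lambda>_. 0) | Suc j \<Rightarrow> (case j of 0 \<Rightarrow> (\<lambda>_. 1) | Suc k \<Rightarrow> fst (snd (st k))))" for i :: nat
  define D where "D i = (case i of 0 \<Rightarrow> D0 | Suc k \<Rightarrow> snd (snd (snd (snd (st k)))))" for i
  have bs [simp]: "b 0 = 1" "b (Suc 0) = CARD('v)" "b (Suc (Suc k)) = fst (st k)" for k
    by (simp_all add: b_def)
  have as [simp]: "a 0 = (\<lambda>_. 0)" "a (Suc 0) = (\<lambda>_. 1)" "a (Suc (Suc k)) = fst (snd (st k))" for k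
    by (simp_all add: a_def)
  have Ds [simp]: "D 0 = D0" "D (Suc k) = snd (snd (snd (snd (st k))))" for k
    by (simp_all add: D_def)
  have nb: "fst (snd (snd (st k))) = b (Suc k)" "fst (snd (snd (snd (st k)))) = a (Suc k)" for k
  proof (induction k)
    case 0
    { case 1 then show ?case by (simp add: st0) }
    { case 2 then show ?case by (simp add: st0) }
  next
    case (Suc k)
    { case 1 then show ?case using st by (simp add: Q_def) }
    { case 2 then show ?case using st by (simp add: Q_def) }
  qed
  have "lifted_resolution b a D"
    unfolding lifted_resolution_def
  proof (intro conjI allI impI)
    fix i r c assume r: "r < b i" and c: "c < b (Suc i)"
    show "D i r c \<in> tw (a i r) (a (Suc i) c)"
    proof (cases i)
      case 0
      then show ?thesis by (simp add: D0_def tw_def)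
    next
      case (Suc k)
      have "P k (st k)" using st by simp
      then have "snd (snd (snd (snd (st k)))) r c \<in> tw (fst (snd (snd (snd (st k)))) r) (fst (snd (st k)) c)"
        unfolding P_def using r c Suc by (simp add: nb)
      then show ?thesis by (simp add: Suc nb)
    qed
  next
    fix v :: "nat \<Rightarrow> ('v, 'k) mpoly"
    have p0: "lk (pvar l :: ('v, 'k) mpoly) 0 = 0" for l
      by (rule formsD[OF forms_pvar(1)]) simp
    show "lk (app (b (Suc 0)) (D 0) v 0) 0 = 0"
      by (simp add: app_D0 lookup_sum lk_mult_0 p0)
  next
    fix p :: "('v, 'k) mpoly" assume "lk p 0 = 0"
    then obtain h where h: "p = (\<Sum>v\<in>UNIV. pvar v * h v)" by (rule expand_forms_Suc) blast
    show "\<exists>v. p - app (b (Suc 0)) (D 0) v 0 \<in> QI"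
      by (rule exI[of _ "\<lambda>r. h (vr r)"]) (simp add: app_D0 h)
  next
    fix i v r assume r: "r < b i"
    show "app (b (Suc i)) (D i) (app (b (Suc (Suc i))) (D (Suc i)) v) r \<in> QI"
    proof (cases i)
      case 0
      then show ?thesis using r D0_D1[of v] by (simp add: st0)
    next
      case (Suc k)
      have "Q (st k) (st (Suc k))" using st by simp
      then show ?thesis using r unfolding Q_def Suc by (simp add: nb)
    qed
  next
    fix i v assume e: "\<forall>r<b i. app (b (Suc i)) (D i) v r \<in> QI"
    show "\<exists>w. \<forall>c<b (Suc i). v c - app (b (Suc (Suc i))) (D (Suc i)) w c \<in> QI"
    proof (cases i)
      case 0
      then have "app (CARD('v)) D0 v 0 \<in> QI" using e by simp
      from D1_exact[OF this] show ?thesis using 0 by (simp add: st0)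
    next
      case (Suc k)
      have "Q (st k) (st (Suc k))" using st by simp
      then have "(\<forall>r<b (Suc k). app (b (Suc (Suc k))) (D (Suc k)) v r \<in> QI) \<longrightarrow>
        (\<exists>w. \<forall>c<b (Suc (Suc k)). v c - app (b (Suc (Suc (Suc k)))) (D (Suc (Suc k))) w c \<in> QI)"
        unfolding Q_def by (simp add: nb)
      then show ?thesis using e unfolding Suc by simp
    qed
  qed simp_all
  then show ?thesis
    by (intro exI[of _ b] exI[of _ a] exI[of _ D]) (simp add: st0 numeral_2_eq_2)
qed

text \<open>The vector \<open>y\<close> with a quadratic monomial as its only entry is in the kernel
  of \<open>D1\<close> because cubics vanish in R, but \<open>Psi\<close> does not kill it; so it is
  not in the maximal ideal times the kernel. A homogeneous preimage in the third module then
  represents a nonzero class, of degree 2 + 2.\<close>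

lemma tor_nonzero_3_4: "tor_nonzero R G 3 4"
proof -
  obtain b a D where res: "lifted_resolution b a D" and b1: "b 1 = CARD('v)" and b2: "b 2 = b2"
    and a2: "a 2 = (\<lambda>_. 2)" and D1: "D 1 = D1"
    using resolution_exists by (elim exE conjE)
  obtain B \<gamma> where "std_basis B \<gamma>" using std_basis_exists by (elim exE)
  then interpret std_quadrics N f B \<gamma> by unfold_locales
  from functional_exists obtain \<Phi> k l u where anti: "\<forall>k l p. ph \<Phi> k l p = - ph \<Phi> l k p"
    and V0: "\<forall>k l i. i < N \<longrightarrow> ph \<Phi> k l (f i) = 0" and coc: "\<forall>m a b c. cocyc \<Phi> m a b c = 0"
    and P0: "\<forall>i j. i < N \<longrightarrow> j < N \<longrightarrow> (\<Sum>a\<in>UNIV. \<Sum>l\<in>UNIV. ph \<Phi> a l (z j a * z i l)) = 0"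
    and klu: "(k, l) \<in> pairs" "u \<in> mons UNIV 2" "\<Phi> k l u \<noteq> 0"
    by (elim exE conjE)
  note hyps = spec[OF spec[OF spec[OF anti]]] V0[rule_format] spec[OF spec[OF spec[OF spec[OF coc]]]] P0[rule_format]
  let ?Psi = "Psi \<Phi>"
  obtain c0 where c0: "c0 < b2" "?Psi (\<lambda>e. if e = c0 then Poly_Mapping.single u 1 else 0) \<noteq> 0"
    by (rule Psi_witness[OF hyps klu])
  define y where "y = (\<lambda>e. if e = c0 then Poly_Mapping.single u 1 else 0 :: ('v, 'k) mpoly)"
  have s2: "Poly_Mapping.single u (1 :: 'k) \<in> forms 2" using klu(2) by (intro forms_single) (simp add: mons_iff)
  have s3: "Suc (Suc 0) = 2" "Suc 2 = 3" "Suc 3 = 4" by simp_all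
  have "app (b (Suc 1)) (D 1) y r \<in> QI" if "r < b 1" for r
    unfolding app_def
  proof (intro QI_sum)
    fix c assume "c \<in> {..<b (Suc 1)}"
    then have "D1 r c \<in> forms 1" using D1_forms b2 by (simp add: s3)
    from forms_mult[OF this s2] have "D1 r c * Poly_Mapping.single u 1 \<in> forms 3" by (simp add: numeral_3_eq_3)
    then show "D 1 r c * y c \<in> QI"
      using QI_forms_ge3[of "D1 r c * Poly_Mapping.single u 1" 3]
      by (cases "c = c0") (simp_all add: D1[simplified] y_def)
  qed
  then have "\<forall>r<b 1. app (b (Suc 1)) (D 1) y r \<in> QI" by simp
  from res_ex[OF res this] obtain w where
    w: "\<forall>c<b (Suc 1). y c - app (b (Suc (Suc 1))) (D (Suc 1)) w c \<in> QI" by (rule exE)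
  define w' where "w' = (\<lambda>c. htw (a (Suc 2) c) 4 (w c))"
  have yw: "y c - app (b 3) (D 2) w' c \<in> QI" if c: "c < b2" for c
  proof -
    have "y r - app (b (Suc 2)) (D 2) (\<lambda>c. htw (a (Suc 2) c) 4 (w c)) r \<in> QI" if "r < b2" for r
    proof (rule lift_homogeneous[OF res, of b2 y "\<lambda>_. 2" 4 2 w])
      show "y c \<in> tw 2 4" for c using s2 by (simp add: y_def tw_def)
      show "D 2 r c \<in> tw 2 (a (Suc 2) c)" if "r < b2" "c < b (Suc 2)" for r c
        using res_tw[OF res, of r 2 c] that b2 a2 by simp
      show "y r - app (b (Suc 2)) (D 2) w r \<in> QI" if "r < b2" for r
        using w that b2 by (simp add: s3)
      show "r < b2" by (rule that)
    qed
    then show ?thesis using c by (simp add: w'_def s3)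
  qed
  have Psi_cong: "?Psi v = ?Psi v'" if "\<And>c. c < b2 \<Longrightarrow> v c - v' c \<in> QI" for v v'
  proof -
    have "?Psi v = ?Psi (\<lambda>c. (v c - v' c) + v' c)" by simp
    also have "\<dots> = ?Psi (\<lambda>c. v c - v' c) + ?Psi v'" by (rule Psi_add[OF hyps])
    also have "?Psi (\<lambda>c. v c - v' c) = 0" by (rule Psi_QI[OF hyps that])
    finally show ?thesis by simp
  qed
  have "tor_nz b a D 3 4"
    unfolding tor_nz_def
  proof (rule exI[of _ w'], intro conjI allI impI)
    fix c show "w' c \<in> tw (a 3 c) 4" by (simp add: w'_def s3)
  next
    fix i' r assume i: "3 = Suc i'" and r: "r < b i'"
    then have i': "i' = 2" by simp
    then have "y r - app (b 3) (D 2) w' r \<in> QI" using yw r b2 by simp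
    from QI_const[OF this] have "lk (app (b 3) (D 2) w' r) 0 = lk (y r) 0" by (simp add: lookup_minus)
    also have "\<dots> = 0" using formsD[OF s2, of 0] by (simp add: y_def)
    finally show "lk (app (b 3) (D i') w' r) 0 = 0" by (simp add: i')
  next
    fix x
    show "\<exists>c<b 3. lk (w' c - app (b (Suc 3)) (D 3) x c) 0 \<noteq> 0"
    proof (rule ccontr)
      assume neg: "\<not> ?thesis"
      \<comment> \<open>If the class were a boundary, \<open>y\<close> would be the image of
        \<open>g\<close>, hence a combination of kernel elements with coefficients in the maximal
        ideal.\<close>
      define g where "g c = w' c - app (b (Suc 3)) (D 3) x c" for c
      have g0: "lk (g c) 0 = 0" if "c < b 3" for c using neg that by (auto simp: g_def)
      have dd: "app (b 3) (D 2) (app (b (Suc 3)) (D 3) x) c \<in> QI" if "c < b2" for c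
        using res_dd[OF res, of c 2 x] that b2 by (simp add: s3)
      have "?Psi y = ?Psi (app (b 3) (D 2) g)"
      proof (rule Psi_cong)
        fix c assume c: "c < b2"
        have g: "g = (\<lambda>c. w' c - app (b (Suc 3)) (D 3) x c)" by (simp add: g_def fun_eq_iff)
        have eg: "app (b 3) (D 2) g c = app (b 3) (D 2) w' c - app (b 3) (D 2) (app (b (Suc 3)) (D 3) x) c"
          unfolding g by (rule app_diff[symmetric])
        have "y c - app (b 3) (D 2) g c = (y c - app (b 3) (D 2) w' c) + app (b 3) (D 2) (app (b (Suc 3)) (D 3) x) c"
          unfolding eg by (simp only: diff_diff_eq2 diff_add_eq)
        then show "y c - app (b 3) (D 2) g c \<in> QI" using QI_add[OF yw[OF c] dd[OF c]] by (simp only:)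
      qed
      also have "app (b 3) (D 2) g = (\<lambda>c. \<Sum>e<b 3. g e * D 2 c e)"
        by (simp add: fun_eq_iff app_def mult.commute)
      also have "?Psi \<dots> = (\<Sum>e<b 3. ?Psi (\<lambda>c. g e * D 2 c e))" by (rule Psi_sum[OF hyps finite_lessThan])
      also have "\<dots> = 0"
      proof (intro sum.neutral ballI)
        fix e assume e: "e \<in> {..<b 3}"
        have "(\<Sum>c<b2. D1v l c * D 2 c e) \<in> QI" for l
        proof -
          have "app (b 3) (D 2) (\<lambda>x. if x = e then 1 else 0) = (\<lambda>c. D 2 c e)"
            using e by (auto simp: app_def fun_eq_iff if_distrib sum.delta cong: if_cong)
          then have "app b2 D1 (\<lambda>c. D 2 c e) (rk l) \<in> QI"
            using res_dd[OF res, of "rk l" 1 "\<lambda>x. if x = e then 1 else 0"] b1 b2 D1 rk_less[of l]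
            by (simp add: s3)
          then show ?thesis by (simp add: app_D1)
        qed
        then show "?Psi (\<lambda>c. g e * D 2 c e) = 0" using g0 e by (intro Psi_max_ideal[OF hyps]) auto
      qed
      finally show False using c0(2) by (simp add: y_def)
    qed
  qed
  then show ?thesis using res unfolding tor_nonzero_iff by (intro exI conjI)
qed

end

section \<open>Minors as multihomogeneous polynomials in the coefficients\<close>

definition meval :: "(nat \<Rightarrow> ('v::finite, 'l::field) mpoly) \<Rightarrow> ((nat \<times> ('v \<Rightarrow>\<^sub>0 nat)) \<Rightarrow>\<^sub>0 nat) \<Rightarrow> 'l" where
  "meval f m = (\<Prod>(i, u)\<in>Poly_Mapping.keys m. lk (f i) u ^ lk m (i, u))"

lemma meval_superset:
  assumes "finite A" "Poly_Mapping.keys m \<subseteq> A"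
  shows "meval f m = (\<Prod>(i, u)\<in>A. lk (f i) u ^ lk m (i, u))"
  unfolding meval_def
  by (rule prod.mono_neutral_left) (use assms in \<open>auto simp: in_keys_iff\<close>)

lemma meval_add: "meval f (m + m') = meval f m * meval f m'"
proof -
  let ?A = "Poly_Mapping.keys m \<union> Poly_Mapping.keys m'"
  have "Poly_Mapping.keys (m + m') \<subseteq> ?A" by (rule keys_add)
  then show ?thesis
    by (simp add: meval_superset[of ?A] lookup_add power_add prod.distrib[symmetric] case_prod_unfold)
qed

lemma eval_coeffs_superset:
  assumes "finite A" "Poly_Mapping.keys P \<subseteq> A" "\<phi> 0 = 0"
  shows "eval_coeffs \<phi> P f = (\<Sum>m\<in>A. \<phi> (lk P m) * meval f m)"
  unfolding eval_coeffs_def meval_def[symmetric]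
  by (rule sum.mono_neutral_left) (use assms in \<open>auto simp: in_keys_iff\<close>)

text \<open>A ring homomorphism commutes with determinants. The embedding \<open>\<phi>\<close> is
  kept general to cover points over the base field and over its algebraic closure.\<close>

lemma eval_coeffs_hom:
  fixes f :: "nat \<Rightarrow> ('v::finite, 'l::field) mpoly" and \<phi> :: "'k::field \<Rightarrow> 'l"
  assumes 0: "\<phi> 0 = 0" and 1: "\<phi> 1 = 1" and add: "\<And>x y. \<phi> (x + y) = \<phi> x + \<phi> y"
    and mult: "\<And>x y. \<phi> (x * y) = \<phi> x * \<phi> y"
  shows "comm_ring_hom (\<lambda>P :: ('v, 'k) coeff_poly. eval_coeffs \<phi> P f)"
proof -
  have zero: "eval_coeffs \<phi> 0 f = 0" by (simp add: eval_coeffs_def)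
  have ev_add: "eval_coeffs \<phi> (P + Q) f = eval_coeffs \<phi> P f + eval_coeffs \<phi> Q f" for P Q :: "('v, 'k) coeff_poly"
  proof -
    let ?A = "Poly_Mapping.keys P \<union> Poly_Mapping.keys Q"
    have "Poly_Mapping.keys (P + Q) \<subseteq> ?A" by (rule keys_add)
    then show ?thesis
      by (simp add: eval_coeffs_superset[of ?A _ \<phi>, OF _ _ 0] lookup_add add distrib_right sum.distrib)
  qed
  have single: "eval_coeffs \<phi> (Poly_Mapping.single m c) f = \<phi> c * meval f m" for m c
    by (subst eval_coeffs_superset[of "{m}" _ \<phi>, OF _ _ 0]) auto
  have ev_sum: "eval_coeffs \<phi> (\<Sum>i\<in>A. g i) f = (\<Sum>i\<in>A. eval_coeffs \<phi> (g i) f)" for A :: "'x set" and g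
    by (induction A rule: infinite_finite_induct) (auto simp: zero ev_add)
  have ev_mult: "eval_coeffs \<phi> (P * Q) f = eval_coeffs \<phi> P f * eval_coeffs \<phi> Q f" for P Q :: "('v, 'k) coeff_poly"
  proof -
    let ?k = Poly_Mapping.keys
    have "P * Q = (\<Sum>m\<in>?k P. \<Sum>m'\<in>?k Q. Poly_Mapping.single (m + m') (lk P m * lk Q m'))"
      by (subst poly_mapping_expand[OF finite_keys subset_refl, of P],
          subst poly_mapping_expand[OF finite_keys subset_refl, of Q])
         (simp add: sum_product mult_single)
    then have "eval_coeffs \<phi> (P * Q) f = (\<Sum>m\<in>?k P. \<Sum>m'\<in>?k Q. (\<phi> (lk P m) * meval f m) * (\<phi> (lk Q m') * meval f m'))"
      by (simp add: ev_sum single mult meval_add mult_ac)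
    also have "\<dots> = eval_coeffs \<phi> P f * eval_coeffs \<phi> Q f"
      unfolding eval_coeffs_def meval_def[symmetric] by (rule sum_product[symmetric])
    finally show ?thesis .
  qed
  have "eval_coeffs \<phi> 1 f = 1"
    using single[of 0 1] 1 by (simp add: meval_def)
  then show ?thesis by unfold_locales (simp_all add: zero ev_add ev_mult)
qed

definition wdeg :: "nat \<Rightarrow> ((nat \<times> ('v::finite \<Rightarrow>\<^sub>0 nat)) \<Rightarrow>\<^sub>0 nat) \<Rightarrow> nat" where
  "wdeg i m = (\<Sum>v\<in>{v \<in> Poly_Mapping.keys m. fst v = i}. lk m v)"

lemma wdeg_superset:
  assumes "finite A" "Poly_Mapping.keys m \<subseteq> A"
  shows "wdeg i m = (\<Sum>v\<in>{v \<in> A. fst v = i}. lk m v)"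
  unfolding wdeg_def
  by (rule sum.mono_neutral_left) (use assms in \<open>auto simp: in_keys_iff\<close>)

lemma wdeg_add: "wdeg i (m + m') = wdeg i m + wdeg i m'"
proof -
  let ?A = "Poly_Mapping.keys m \<union> Poly_Mapping.keys m'"
  have "Poly_Mapping.keys (m + m') \<subseteq> ?A" by (rule keys_add)
  then show ?thesis by (simp add: wdeg_superset[of ?A] lookup_add sum.distrib)
qed

text \<open>The multidegree \<open>e\<close> is made explicit, because it adds up under
  products.\<close>

definition mhom :: "nat \<Rightarrow> (nat \<Rightarrow> nat) \<Rightarrow> ('v::finite, 'k::field) coeff_poly set" where
  "mhom N e = {P. \<forall>m\<in>Poly_Mapping.keys P. (\<forall>(i, u)\<in>Poly_Mapping.keys m. i < N \<and> mdeg u = 2) \<and> (\<forall>i<N. wdeg i m = e i)}"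

lemma mhom_multihomogeneous: "P \<in> mhom N e \<Longrightarrow> multihomogeneous N P"
  unfolding mhom_def multihomogeneous_def wdeg_def by blast

lemma mhom_0 [simp]: "0 \<in> mhom N e"
  by (simp add: mhom_def)

lemma mhom_1: "1 \<in> mhom N (\<lambda>_. 0)"
  by (auto simp: mhom_def wdeg_def)

lemma mhom_add: "P \<in> mhom N e \<Longrightarrow> Q \<in> mhom N e \<Longrightarrow> P + Q \<in> mhom N e"
  unfolding mhom_def using keys_add[of P Q] by blast

lemma mhom_uminus: "P \<in> mhom N e \<Longrightarrow> - P \<in> mhom N e"
  by (auto simp: mhom_def in_keys_iff)

lemma mhom_sum: "(\<And>i. i \<in> A \<Longrightarrow> g i \<in> mhom N e) \<Longrightarrow> (\<Sum>i\<in>A. g i) \<in> mhom N e"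
  by (induction A rule: infinite_finite_induct) (auto intro: mhom_add)

lemma mhom_mult:
  assumes P: "P \<in> mhom N e" and Q: "Q \<in> mhom N e'"
  shows "P * Q \<in> mhom N (\<lambda>i. e i + e' i)"
  unfolding mhom_def mem_Collect_eq
proof
  fix m assume "m \<in> Poly_Mapping.keys (P * Q)"
  then obtain a b where m: "m = a + b" "a \<in> Poly_Mapping.keys P" "b \<in> Poly_Mapping.keys Q"
    using keys_mult[of P Q] by blast
  have k: "Poly_Mapping.keys m \<subseteq> Poly_Mapping.keys a \<union> Poly_Mapping.keys b"
    unfolding m by (rule keys_add)
  have a: "(\<forall>(i, u)\<in>Poly_Mapping.keys a. i < N \<and> mdeg u = 2)" "(\<forall>i<N. wdeg i a = e i)"
    and b: "(\<forall>(i, u)\<in>Poly_Mapping.keys b. i < N \<and> mdeg u = 2)" "(\<forall>i<N. wdeg i b = e' i)"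
    using P Q m by (auto simp: mhom_def)
  show "(\<forall>(i, u)\<in>Poly_Mapping.keys m. i < N \<and> mdeg u = 2) \<and> (\<forall>i<N. wdeg i m = e i + e' i)"
    using k a b by (auto simp: m wdeg_add)
qed

lemma mhom_prod:
  "finite A \<Longrightarrow> (\<And>r. r \<in> A \<Longrightarrow> g r \<in> mhom N (e r)) \<Longrightarrow> (\<Prod>r\<in>A. g r) \<in> mhom N (\<lambda>i. \<Sum>r\<in>A. e r i)"
proof (induction A rule: finite_induct)
  case empty
  then show ?case by (simp add: mhom_1)
next
  case (insert r A)
  then show ?case using mhom_mult[of "g r" N "e r" "\<Prod>r\<in>A. g r"] by simp
qed

definition cvar :: "nat \<Rightarrow> ('v \<Rightarrow>\<^sub>0 nat) \<Rightarrow> ('v::finite, 'k::field) coeff_poly" where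
  "cvar i u = Poly_Mapping.single (Poly_Mapping.single (i, u) 1) 1"

lemma cvar_mhom: "i < N \<Longrightarrow> mdeg u = 2 \<Longrightarrow> cvar i u \<in> mhom N (\<lambda>j. if j = i then 1 else 0)"
proof -
  have "wdeg j (Poly_Mapping.single (i, u) 1) = (if j = i then 1 else 0)" for j
  proof -
    have "{v \<in> {(i, u)}. fst v = j} = (if j = i then {(i, u)} else {})" by auto
    then show ?thesis by (simp add: wdeg_def)
  qed
  moreover assume "i < N" "mdeg u = 2"
  ultimately show ?thesis by (auto simp: mhom_def cvar_def)
qed

definition opt_mat :: "nat \<Rightarrow> (nat \<Rightarrow> nat \<Rightarrow> 'u option) \<Rightarrow> (nat \<Rightarrow> 'u \<Rightarrow> 'c::zero) \<Rightarrow> 'c Matrix.mat" where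
  "opt_mat d ent g = Matrix.mat d d (\<lambda>(r, s). case ent r s of None \<Rightarrow> 0 | Some u \<Rightarrow> g r u)"

text \<open>Row \<open>r\<close> contains only coefficients of the form with number
  \<open>\<iota> r\<close>, so every term of the determinant has the same multidegree.
  \<open>None\<close> marks entries that vanish identically.\<close>

definition minor_poly :: "nat \<Rightarrow> (nat \<Rightarrow> nat) \<Rightarrow> (nat \<Rightarrow> nat \<Rightarrow> ('v \<Rightarrow>\<^sub>0 nat) option) \<Rightarrow> ('v::finite, 'k::field) coeff_poly" where
  "minor_poly d \<iota> ent = Determinant.det (opt_mat d ent (\<lambda>r u. cvar (\<iota> r) u))"

lemma eval_minor_poly:
  fixes f :: "nat \<Rightarrow> ('v::finite, 'l::field) mpoly" and \<phi> :: "'k::field \<Rightarrow> 'l"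
  assumes "comm_ring_hom (\<lambda>P :: ('v, 'k) coeff_poly. eval_coeffs \<phi> P f)" "\<phi> 0 = 0" "\<phi> 1 = 1"
  shows "eval_coeffs \<phi> (minor_poly d \<iota> ent) f = Determinant.det (opt_mat d ent (\<lambda>r u. lk (f (\<iota> r)) u))"
proof -
  interpret comm_ring_hom "\<lambda>P :: ('v, 'k) coeff_poly. eval_coeffs \<phi> P f" by (rule assms)
  have c: "eval_coeffs \<phi> (cvar i u) f = lk (f i) u" for i u
    unfolding cvar_def
    by (subst eval_coeffs_superset[of "{Poly_Mapping.single (i, u) 1}" _ \<phi>, OF _ _ assms(2)])
       (auto simp: meval_def assms(3))
  have "map_mat (\<lambda>P. eval_coeffs \<phi> P f) (opt_mat d ent (\<lambda>r u. cvar (\<iota> r) u)) = opt_mat d ent (\<lambda>r u. lk (f (\<iota> r)) u)"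
    by (rule eq_matI) (auto simp: opt_mat_def c hom_zero split: option.split)
  then show ?thesis unfolding minor_poly_def using hom_det[of "opt_mat d ent (\<lambda>r u. cvar (\<iota> r) u)"] by simp
qed

lemma minor_poly_mhom:
  assumes "\<And>r. r < d \<Longrightarrow> \<iota> r < N" "\<And>r s u. r < d \<Longrightarrow> s < d \<Longrightarrow> ent r s = Some u \<Longrightarrow> mdeg u = 2"
  shows "minor_poly d \<iota> ent \<in> mhom N (\<lambda>i. \<Sum>r<d. if i = \<iota> r then 1 else 0)"
proof -
  let ?A = "opt_mat d ent (\<lambda>r u. cvar (\<iota> r) u) :: ('a, 'b) coeff_poly Matrix.mat"
  have A: "?A \<in> carrier_mat d d" by (simp add: opt_mat_def)
  have ent: "?A $$ (r, s) \<in> mhom N (\<lambda>i. if i = \<iota> r then 1 else 0)" if "r < d" "s < d" for r s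
    using that assms by (auto simp: opt_mat_def intro!: cvar_mhom split: option.split)
  have "signof \<pi> * (\<Prod>r = 0..<d. ?A $$ (r, \<pi> r)) \<in> mhom N (\<lambda>i. \<Sum>r = 0..<d. if i = \<iota> r then 1 else 0)"
    if \<pi>: "\<pi> permutes {0..<d}" for \<pi>
  proof -
    have "(\<Prod>r = 0..<d. ?A $$ (r, \<pi> r)) \<in> mhom N (\<lambda>i. \<Sum>r = 0..<d. if i = \<iota> r then 1 else 0)"
      by (rule mhom_prod) (use \<pi> permutes_in_image[OF \<pi>] ent in auto)
    then show ?thesis by (cases \<pi> rule: sign_cases) (auto intro: mhom_uminus)
  qed
  then show ?thesis
    unfolding minor_poly_def det_def'[OF A] lessThan_atLeast0 by (intro mhom_sum) simp
qed

section \<open>The two open conditions\<close>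

definition cubic_rows :: "nat \<Rightarrow> (nat \<times> 'v::finite) set" where
  "cubic_rows N = {..<N} \<times> UNIV"

text \<open>Row \<open>(i, v)\<close> lists the coefficients of \<open>x_v f_i\<close> at the cubic
  monomials.\<close>

definition cubic_mat :: "(nat \<Rightarrow> ('v::finite \<Rightarrow>\<^sub>0 nat) \<Rightarrow> 'c::zero) \<Rightarrow> nat \<times> 'v \<Rightarrow> ('v \<Rightarrow>\<^sub>0 nat) \<Rightarrow> 'c" where
  "cubic_mat g e u = (if lk u (snd e) > 0 then g (fst e) (u - evar (snd e)) else 0)"

text \<open>A matrix has independent columns exactly when its rows span. The first condition thus
  concerns the span of the products \<open>x_v f_i\<close>, whereas in the second the columns are
  the forms themselves.\<close>

definition good :: "nat \<Rightarrow> (nat \<Rightarrow> ('v::finite, 'l::field) mpoly) \<Rightarrow> bool" where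
  "good N f \<longleftrightarrow> (\<forall>i<N. f i \<in> forms 2) \<and>
     indep_cols (cubic_mat (\<lambda>i. lk (f i))) (cubic_rows N) (mons UNIV 3) \<and>
     indep_cols (\<lambda>u i. lk (f i) u) (mons UNIV 2) {..<N}"

lemma indep_cols_mono: "indep_cols a E Y \<Longrightarrow> E \<subseteq> E' \<Longrightarrow> indep_cols a E' Y"
  unfolding indep_cols_def by (meson subsetD)

text \<open>Choose square minors that do not vanish at \<open>f0\<close>. Their product is one
  multihomogeneous polynomial over the base field, and where it is nonzero both conditions hold,
  over either field.\<close>

theorem good_open:
  fixes f0 :: "nat \<Rightarrow> ('v::finite, 'k::field alg_closure) mpoly"
  assumes f0: "good N f0"
  shows "\<exists>E :: ('v, 'k) coeff_poly set. (\<forall>P\<in>E. multihomogeneous N P) \<and> open_points N to_ac E \<noteq> {} \<and>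
    (\<forall>f\<in>open_points N id E. good N f) \<and> (\<forall>f\<in>open_points N to_ac E. good N f)"
proof -
  let ?a = "\<lambda>g. cubic_mat (\<lambda>i. lk (g i))"
  have fin: "finite (cubic_rows N :: (nat \<times> 'v) set)" by (simp add: cubic_rows_def)
  have i1: "indep_cols (?a f0) (cubic_rows N) (mons UNIV 3)" and i2: "indep_cols (\<lambda>u i. lk (f0 i) u) (mons UNIV 2) {..<N}"
    and f02: "\<forall>i<N. f0 i \<in> forms 2"
    using f0 by (simp_all add: good_def)
  obtain J where J: "J \<subseteq> cubic_rows N" "card J = card (mons (UNIV :: 'v set) 3)" "indep_cols (?a f0) J (mons UNIV 3)"
    by (rule indep_cols_square_subset[OF fin finite_mons i1])
  obtain J2 where J2: "J2 \<subseteq> mons UNIV 2" "card J2 = card {..<N}" "indep_cols (\<lambda>u i. lk (f0 i) u) J2 {..<N}"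
    by (rule indep_cols_square_subset[OF finite_mons finite_lessThan i2])
  have finJ: "finite J" using J(1) fin finite_subset by blast
  have finJ2: "finite J2" using J2(1) finite_mons finite_subset by blast
  define d where "d = card (mons (UNIV :: 'v set) 3)"
  obtain \<sigma> where \<sigma>: "bij_betw \<sigma> {..<d} J"
    using ex_bij_betw_nat_finite[OF finJ] J(2) by (auto simp: d_def lessThan_atLeast0)
  obtain \<tau> where \<tau>: "bij_betw \<tau> {..<d} (mons (UNIV :: 'v set) 3)"
    using ex_bij_betw_nat_finite[OF finite_mons, of "UNIV :: 'v set" 3] by (auto simp: d_def lessThan_atLeast0)
  obtain \<rho> where \<rho>: "bij_betw \<rho> {..<N} J2"
    using ex_bij_betw_nat_finite[OF finJ2] J2(2) by (auto simp: lessThan_atLeast0)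
  define ent where "ent r s = (if lk (\<tau> s) (snd (\<sigma> r)) > 0 then Some (\<tau> s - evar (snd (\<sigma> r))) else None)" for r s
  \<comment> \<open>The forms are taken as rows, as multihomogeneity of \<open>minor_poly\<close>
    requires; this transposes the second condition of \<open>good\<close>.\<close>
  define ent2 where "ent2 r s = Some (\<rho> s)" for r s :: nat
  define P1 :: "('v, 'k) coeff_poly" where "P1 = minor_poly d (\<lambda>r. fst (\<sigma> r)) ent"
  define P2 :: "('v, 'k) coeff_poly" where "P2 = minor_poly N (\<lambda>r. r) ent2"
  have m1: "P1 \<in> mhom N (\<lambda>i. \<Sum>r<d. if i = fst (\<sigma> r) then 1 else 0)"
    unfolding P1_def
  proof (rule minor_poly_mhom)
    fix r assume r: "r < d"
    then have "\<sigma> r \<in> cubic_rows N" using \<sigma> J(1) by (auto simp: bij_betw_def)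
    then show "fst (\<sigma> r) < N" by (auto simp: cubic_rows_def)
    fix s u assume s: "s < d" and e: "ent r s = Some u"
    have "\<tau> s \<in> mons UNIV 3" using \<tau> s by (auto simp: bij_betw_def)
    then have "mdeg (\<tau> s) = 3" by (simp add: mons_iff)
    then show "mdeg u = 2" using e mdeg_diff_evar[of "\<tau> s" "snd (\<sigma> r)"] by (auto simp: ent_def split: if_splits)
  qed
  have m2: "P2 \<in> mhom N (\<lambda>i. \<Sum>r<N. if i = r then 1 else 0)"
    unfolding P2_def
  proof (rule minor_poly_mhom)
    fix r s u assume s: "s < N" and e: "ent2 r s = Some u"
    have "\<rho> s \<in> mons UNIV 2" using \<rho> s J2(1) by (auto simp: bij_betw_def)
    then show "mdeg u = 2" using e by (simp add: ent2_def mons_iff)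
  qed
  note mP = mhom_multihomogeneous[OF mhom_mult[OF m1 m2]]
  have om1: "opt_mat d ent (\<lambda>r u. lk (f (fst (\<sigma> r))) u) = Matrix.mat d d (\<lambda>(r, s). ?a f (\<sigma> r) (\<tau> s))"
    for f :: "nat \<Rightarrow> ('v, 'l::field) mpoly"
    by (rule eq_matI) (auto simp: opt_mat_def ent_def cubic_mat_def)
  have om2: "opt_mat N ent2 (\<lambda>r u. lk (f r) u) = Matrix.mat N N (\<lambda>(r, s). lk (f (id r)) (\<rho> s))"
    for f :: "nat \<Rightarrow> ('v, 'l::field) mpoly"
    by (rule eq_matI) (auto simp: opt_mat_def ent2_def)
  have bid: "bij_betw id {..<N} {..<N}" by simp
  have crit: "Determinant.det (opt_mat d ent (\<lambda>r u. lk (f (fst (\<sigma> r))) u)) \<noteq> 0 \<longleftrightarrow> indep_cols (?a f) J (mons UNIV 3)"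
    "Determinant.det (opt_mat N ent2 (\<lambda>r u. lk (f r) u)) \<noteq> 0 \<longleftrightarrow> indep_cols (\<lambda>i u. lk (f i) u) {..<N} J2"
    for f :: "nat \<Rightarrow> ('v, 'l::field) mpoly"
    unfolding om1 om2 by (rule det_nonzero_iff_indep_cols[OF \<sigma> \<tau>], rule det_nonzero_iff_indep_cols[OF bid \<rho>])
  have hom1: "eval_coeffs \<phi> (P1 * P2) f = Determinant.det (opt_mat d ent (\<lambda>r u. lk (f (fst (\<sigma> r))) u)) *
      Determinant.det (opt_mat N ent2 (\<lambda>r u. lk (f r) u))"
    if h: "comm_ring_hom (\<lambda>P :: ('v, 'k) coeff_poly. eval_coeffs \<phi> P f)" "\<phi> 0 = 0" "\<phi> 1 = 1"
    for f :: "nat \<Rightarrow> ('v, 'l::field) mpoly" and \<phi> :: "'k \<Rightarrow> 'l"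
  proof -
    interpret comm_ring_hom "\<lambda>P :: ('v, 'k) coeff_poly. eval_coeffs \<phi> P f" by (rule h)
    show ?thesis unfolding hom_mult P1_def P2_def by (simp only: eval_minor_poly[OF h])
  qed
  have key: "good N f"
    if f: "\<forall>i<N. f i \<in> forms 2" "eval_coeffs \<phi> (P1 * P2) f \<noteq> 0"
      and h: "comm_ring_hom (\<lambda>P :: ('v, 'k) coeff_poly. eval_coeffs \<phi> P f)" "\<phi> 0 = 0" "\<phi> 1 = 1"
    for f :: "nat \<Rightarrow> ('v, 'l::field) mpoly" and \<phi> :: "'k \<Rightarrow> 'l"
  proof -
    have 1: "indep_cols (?a f) J (mons UNIV 3)" and 2: "indep_cols (\<lambda>i u. lk (f i) u) {..<N} J2"
      using f(2) crit[of f] unfolding hom1[OF h] by auto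
    have "indep_cols (\<lambda>u i. lk (f i) u) J2 {..<N}"
      by (rule indep_cols_transpose[OF _ _ 2]) (use J2 finJ2 in auto)
    then show ?thesis unfolding good_def
      using f(1) indep_cols_mono[OF 1 J(1)] indep_cols_mono[OF _ J2(1)] by blast
  qed
  have h_id: "comm_ring_hom (\<lambda>P :: ('v, 'k) coeff_poly. eval_coeffs id P f)" for f :: "nat \<Rightarrow> ('v, 'k) mpoly"
    by (rule eval_coeffs_hom) auto
  have h_ac: "comm_ring_hom (\<lambda>P :: ('v, 'k) coeff_poly. eval_coeffs to_ac P f)" for f :: "nat \<Rightarrow> ('v, 'k alg_closure) mpoly"
    by (rule eval_coeffs_hom) auto
  have "indep_cols (\<lambda>i u. lk (f0 i) u) {..<N} J2"
    by (rule indep_cols_transpose[OF _ _ J2(3)]) (use J2 finJ2 in auto)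
  then have e0: "eval_coeffs to_ac (P1 * P2) f0 \<noteq> 0"
    using crit[of f0] J(3) by (simp add: hom1[OF h_ac])
  have "f0 i \<noteq> 0" if "i < N" for i
  proof
    assume "f0 i = 0"
    then have "(\<Sum>i'<N. lk (f0 i') u * (if i' = i then 1 else 0)) = 0" for u
      by (intro sum.neutral) auto
    with i2[unfolded indep_cols_def, rule_format, of "\<lambda>i'. if i' = i then 1 else 0" i] that show False by simp
  qed
  with f02 e0 have "f0 \<in> open_points N to_ac {P1 * P2}" by (simp add: open_points_def)
  then show ?thesis
    using mP key[OF _ _ h_id] key[OF _ _ h_ac]
    by (intro exI[of _ "{P1 * P2}"]) (auto simp: open_points_def)
qed

section \<open>Counting quadratic forms over a finite field\<close>

text \<open>A finite field \<open>K\<close> inside a larger field, cut out by an endomorphism; in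
  the application this is a power of Frobenius. Independence refers to the larger field, counting to
  \<open>K\<close>.\<close>

locale fixed_field =
  fixes fr :: "'l::field \<Rightarrow> 'l" and K :: "'l set"
  assumes fr_add: "fr (x + y) = fr x + fr y"
    and fr_mult: "fr (x * y) = fr x * fr y"
    and fr_1: "fr 1 = 1"
    and K_eq: "K = {x. fr x = x}"
    and finite_K: "finite K"
begin

lemma fr_0: "fr 0 = 0"
  using fr_add[of 0 0] by (simp only: add_0_left add_cancel_right_right)

lemma fr_uminus: "fr (- x) = - fr x"
  using fr_add[of x "- x"] by (simp add: fr_0 eq_neg_iff_add_eq_0 add.commute)

lemma fr_sum: "fr (\<Sum>i\<in>A. g i) = (\<Sum>i\<in>A. fr (g i))"
  by (induction A rule: infinite_finite_induct) (auto simp: fr_0 fr_add)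

lemma fr_inverse: "fr (inverse x) = inverse (fr x)"
proof (cases "x = 0")
  case False
  then have "fr x * fr (inverse x) = 1" by (simp add: fr_mult[symmetric] fr_1)
  then show ?thesis by (metis inverse_unique)
qed (simp add: fr_0)

lemma K_0 [simp]: "0 \<in> K" and K_1 [simp]: "1 \<in> K" and K_uminus: "x \<in> K \<Longrightarrow> - x \<in> K"
  and K_mult: "x \<in> K \<Longrightarrow> y \<in> K \<Longrightarrow> x * y \<in> K" and K_add: "x \<in> K \<Longrightarrow> y \<in> K \<Longrightarrow> x + y \<in> K"
  and K_inverse: "x \<in> K \<Longrightarrow> inverse x \<in> K" and K_divide: "x \<in> K \<Longrightarrow> y \<in> K \<Longrightarrow> x / y \<in> K"
  by (simp_all add: K_eq fr_0 fr_1 fr_uminus fr_mult fr_add fr_inverse divide_inverse)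

text \<open>Descent by minimal support: scale a solution of least support to have an entry 1.
  Applying \<open>fr\<close> and subtracting gives a solution of smaller support, hence 0, so all
  entries lie in \<open>K\<close>.\<close>

lemma rational_solution:
  fixes a :: "'e \<Rightarrow> 'y \<Rightarrow> 'l"
  assumes Y: "finite Y" and a: "\<And>e y. e \<in> E \<Longrightarrow> y \<in> Y \<Longrightarrow> a e y \<in> K" and dep: "\<not> indep_cols a E Y"
  shows "\<exists>c\<in>Y \<rightarrow>\<^sub>E K. (\<exists>y\<in>Y. c y \<noteq> 0) \<and> (\<forall>e\<in>E. (\<Sum>y\<in>Y. a e y * c y) = 0)"
proof -
  define S where "S c \<longleftrightarrow> (\<exists>y\<in>Y. c y \<noteq> 0) \<and> (\<forall>e\<in>E. (\<Sum>y\<in>Y. a e y * c y) = 0)" for c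
  obtain c0 where "S c0" using dep unfolding indep_cols_def S_def by auto
  from ex_has_least_nat[of S, OF this, of "\<lambda>c. card {y \<in> Y. c y \<noteq> 0}"]
  obtain c where c: "S c" and least: "\<And>c'. S c' \<Longrightarrow> card {y \<in> Y. c y \<noteq> 0} \<le> card {y \<in> Y. c' y \<noteq> 0}"
    by blast
  obtain y0 where y0: "y0 \<in> Y" "c y0 \<noteq> 0" using c by (auto simp: S_def)
  define c1 where "c1 y = c y / c y0" for y
  have c1: "(\<Sum>y\<in>Y. a e y * c1 y) = 0" if "e \<in> E" for e
  proof -
    have "(\<Sum>y\<in>Y. a e y * c1 y) = (\<Sum>y\<in>Y. a e y * c y) / c y0"
      by (simp add: c1_def sum_divide_distrib)
    then show ?thesis using c that by (simp add: S_def)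
  qed
  define d where "d y = fr (c1 y) - c1 y" for y
  have d: "(\<Sum>y\<in>Y. a e y * d y) = 0" if e: "e \<in> E" for e
  proof -
    have "(\<Sum>y\<in>Y. a e y * fr (c1 y)) = fr (\<Sum>y\<in>Y. a e y * c1 y)"
      unfolding fr_sum by (rule sum.cong) (use a[OF e] in \<open>auto simp: fr_mult K_eq\<close>)
    then show ?thesis using c1[OF e] by (simp add: d_def right_diff_distrib sum_subtractf fr_0)
  qed
  have "d y = 0" if "y \<in> Y" for y
  proof (rule ccontr)
    assume "d y \<noteq> 0"
    then have "S d" using d that by (auto simp: S_def)
    moreover have "{y \<in> Y. d y \<noteq> 0} \<subset> {y \<in> Y. c y \<noteq> 0}"
    proof
      show "{y \<in> Y. d y \<noteq> 0} \<subseteq> {y \<in> Y. c y \<noteq> 0}" by (auto simp: d_def c1_def fr_0)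
      have "d y0 = 0" using y0 by (simp add: d_def c1_def fr_1)
      then show "{y \<in> Y. d y \<noteq> 0} \<noteq> {y \<in> Y. c y \<noteq> 0}" using y0 by blast
    qed
    then have "card {y \<in> Y. d y \<noteq> 0} < card {y \<in> Y. c y \<noteq> 0}"
      using Y by (intro psubset_card_mono) auto
    ultimately show False using least by fastforce
  qed
  then have "restrict c1 Y \<in> Y \<rightarrow>\<^sub>E K" by (auto simp: K_eq d_def)
  moreover have "\<exists>y\<in>Y. restrict c1 Y y \<noteq> 0"
    using y0 by (intro bexI[of _ y0]) (auto simp: c1_def)
  moreover have "\<forall>e\<in>E. (\<Sum>y\<in>Y. a e y * restrict c1 Y y) = 0" using c1 by simp
  ultimately show ?thesis by blast
qed

text \<open>Each dependent \<open>g\<close> carries at least \<open>card K - 1\<close> solutions,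
  the nonzero multiples of one.\<close>

lemma dependent_count:
  fixes a :: "'g \<Rightarrow> 'e \<Rightarrow> 'y \<Rightarrow> 'l"
  assumes G: "finite G" and Y: "finite Y" and a: "\<And>g e y. g \<in> G \<Longrightarrow> e \<in> E \<Longrightarrow> y \<in> Y \<Longrightarrow> a g e y \<in> K"
  shows "(card K - 1) * card {g \<in> G. \<not> indep_cols (a g) E Y} \<le>
    card {(g, c). g \<in> G \<and> c \<in> Y \<rightarrow>\<^sub>E K \<and> (\<exists>y\<in>Y. c y \<noteq> 0) \<and> (\<forall>e\<in>E. (\<Sum>y\<in>Y. a g e y * c y) = 0)}"
    (is "_ * card ?B \<le> card ?W")
proof -
  have "\<forall>g\<in>?B. \<exists>c. c \<in> Y \<rightarrow>\<^sub>E K \<and> (\<exists>y\<in>Y. c y \<noteq> 0) \<and> (\<forall>e\<in>E. (\<Sum>y\<in>Y. a g e y * c y) = 0)"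
  proof
    fix g assume g: "g \<in> ?B"
    have "\<exists>c\<in>Y \<rightarrow>\<^sub>E K. (\<exists>y\<in>Y. c y \<noteq> 0) \<and> (\<forall>e\<in>E. (\<Sum>y\<in>Y. a g e y * c y) = 0)"
      by (rule rational_solution[OF Y]) (use a g in auto)
    then show "\<exists>c. c \<in> Y \<rightarrow>\<^sub>E K \<and> (\<exists>y\<in>Y. c y \<noteq> 0) \<and> (\<forall>e\<in>E. (\<Sum>y\<in>Y. a g e y * c y) = 0)"
      unfolding Bex_def .
  qed
  from bchoice[OF this] obtain c where
    c: "\<And>g. g \<in> ?B \<Longrightarrow> c g \<in> Y \<rightarrow>\<^sub>E K" "\<And>g. g \<in> ?B \<Longrightarrow> \<exists>y\<in>Y. c g y \<noteq> 0"
      "\<And>g e. g \<in> ?B \<Longrightarrow> e \<in> E \<Longrightarrow> (\<Sum>y\<in>Y. a g e y * c g y) = 0" by blast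
  define h where "h = (\<lambda>(g, k). (g, \<lambda>y\<in>Y. k * c g y))"
  have "inj_on h (?B \<times> (K - {0}))"
  proof (rule inj_onI)
    fix x x' assume x: "x \<in> ?B \<times> (K - {0})" and x': "x' \<in> ?B \<times> (K - {0})" and eq: "h x = h x'"
    obtain g k where gk: "x = (g, k)" "g \<in> ?B" using x by blast
    obtain g' k' where gk': "x' = (g', k')" using x' by blast
    have g: "g' = g" and e: "(\<lambda>y\<in>Y. k * c g y) = (\<lambda>y\<in>Y. k' * c g y)"
      using eq by (auto simp: h_def gk gk')
    obtain y where "y \<in> Y" "c g y \<noteq> 0" using c(2)[OF gk(2)] by blast
    then have "k = k'" using fun_cong[OF e, of y] by simp
    then show "x = x'" by (simp add: gk gk' g)
  qed
  moreover have "h ` (?B \<times> (K - {0})) \<subseteq> ?W"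
  proof
    fix z assume "z \<in> h ` (?B \<times> (K - {0}))"
    then obtain g k where z: "z = (g, \<lambda>y\<in>Y. k * c g y)" and gB: "g \<in> ?B" and k: "k \<in> K" "k \<noteq> 0"
      by (auto simp: h_def)
    have 1: "(\<lambda>y\<in>Y. k * c g y) \<in> Y \<rightarrow>\<^sub>E K" using c(1)[OF gB] k by (auto intro: K_mult)
    have 2: "\<exists>y\<in>Y. (\<lambda>y\<in>Y. k * c g y) y \<noteq> 0" using c(2)[OF gB] k by auto
    have 3: "(\<Sum>y\<in>Y. a g e y * (\<lambda>y\<in>Y. k * c g y) y) = 0" if "e \<in> E" for e
    proof -
      have "(\<Sum>y\<in>Y. a g e y * (\<lambda>y\<in>Y. k * c g y) y) = k * (\<Sum>y\<in>Y. a g e y * c g y)"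
        by (simp add: sum_distrib_left mult_ac)
      then show ?thesis using c(3)[OF gB that] by simp
    qed
    from 1 2 3 gB show "z \<in> ?W" unfolding z by blast
  qed
  moreover have "finite ?W"
    by (rule finite_subset[of _ "G \<times> (Y \<rightarrow>\<^sub>E K)"]) (use G Y finite_K in \<open>auto intro!: finite_PiE\<close>)
  ultimately have "card (?B \<times> (K - {0})) \<le> card ?W" by (rule card_inj_on_le)
  then show ?thesis by (simp add: card_cartesian_product finite_K mult.commute)
qed

lemma card_determined:
  assumes Y: "finite Y" and S: "S \<subseteq> Y \<rightarrow>\<^sub>E K" and B: "B \<subseteq> Y"
    and det: "\<And>g h y. g \<in> S \<Longrightarrow> h \<in> S \<Longrightarrow> (\<And>b. b \<in> B \<Longrightarrow> g b = h b) \<Longrightarrow> y \<in> Y \<Longrightarrow> g y = h y"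
  shows "card S \<le> card K ^ card B"
proof -
  have fB: "finite B" using B Y finite_subset by blast
  have "inj_on (\<lambda>g. restrict g B) S"
  proof (rule inj_onI)
    fix g h assume gh: "g \<in> S" "h \<in> S" "restrict g B = restrict h B"
    have "g b = h b" if "b \<in> B" for b using fun_cong[OF gh(3), of b] that by simp
    then show "g = h" using det[OF gh(1,2)] gh(1,2) S by (intro PiE_ext[of g Y _ h]) auto
  qed
  moreover have "(\<lambda>g. restrict g B) ` S \<subseteq> B \<rightarrow>\<^sub>E K" using S B by (force simp: subset_iff)
  moreover have "finite (B \<rightarrow>\<^sub>E K)" using fB finite_K by (simp add: finite_PiE)
  ultimately have "card S \<le> card (B \<rightarrow>\<^sub>E K)" by (rule card_inj_on_le)
  then show ?thesis by (simp add: card_funcsetE fB)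
qed

text \<open>For fixed nonzero \<open>c\<close>, the form with nonzero coefficient
  \<open>c i0\<close> is determined by the others. The at most \<open>card K ^ N\<close> choices of
  \<open>c\<close> are compensated by the \<open>card D\<close> coefficients saved, as
  \<open>N \<le> card D\<close>.\<close>

lemma dependent_tuples_count:
  fixes D :: "'u set"
  assumes D: "finite D" "N \<le> card D"
  defines "G \<equiv> ({..<N} \<times> D) \<rightarrow>\<^sub>E K"
  shows "card {(g, c). g \<in> G \<and> c \<in> {..<N} \<rightarrow>\<^sub>E K \<and> (\<exists>i\<in>{..<N}. c i \<noteq> 0) \<and>
    (\<forall>u\<in>D. (\<Sum>i\<in>{..<N}. g (i, u) * c i) = 0)} \<le> card K ^ (N * card D)" (is "card ?W \<le> _")
proof (cases "N = 0")
  case True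
  then have "?W = {}" by auto
  then show ?thesis by (simp only: card.empty)
next
  case False
  define C where "C = {c \<in> {..<N} \<rightarrow>\<^sub>E K. \<exists>i\<in>{..<N}. c i \<noteq> 0}"
  define Gc where "Gc c = {g \<in> G. \<forall>u\<in>D. (\<Sum>i\<in>{..<N}. g (i, u) * c i) = 0}" for c
  have finG: "finite G" unfolding G_def using D finite_K by (intro finite_PiE) auto
  have finC: "finite C" unfolding C_def using finite_K by (simp add: finite_PiE)
  have "card ?W = card (SIGMA c:C. Gc c)"
    by (rule bij_betw_same_card[of "\<lambda>(g, c). (c, g)"], rule bij_betw_byWitness[where f' = "\<lambda>(c, g). (g, c)"])
       (auto simp: C_def Gc_def)
  also have "\<dots> = (\<Sum>c\<in>C. card (Gc c))"
    using finC finG by (intro card_SigmaI) (auto simp: Gc_def)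
  also have "\<dots> \<le> (\<Sum>c\<in>C. card K ^ ((N - 1) * card D))"
  proof (rule sum_mono)
    fix c assume "c \<in> C"
    then obtain i0 where i0: "i0 < N" "c i0 \<noteq> 0" by (auto simp: C_def)
    have "card (Gc c) \<le> card K ^ card (({..<N} - {i0}) \<times> D)"
    proof (rule card_determined[of "{..<N} \<times> D"])
      fix g h y assume gh: "g \<in> Gc c" "h \<in> Gc c" and eq: "\<And>b. b \<in> ({..<N} - {i0}) \<times> D \<Longrightarrow> g b = h b"
        and y: "y \<in> {..<N} \<times> D"
      obtain i u where iu: "y = (i, u)" "i < N" "u \<in> D" using y by auto
      have "(\<Sum>i<N. g (i, u) * c i) = 0" "(\<Sum>i<N. h (i, u) * c i) = 0"
        using gh iu by (simp_all add: Gc_def)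
      then have "0 = (\<Sum>i<N. (g (i, u) - h (i, u)) * c i)"
        by (simp add: left_diff_distrib sum_subtractf)
      also have "\<dots> = (\<Sum>i\<in>{i0}. (g (i, u) - h (i, u)) * c i)"
        by (rule sum.mono_neutral_right) (use i0 eq iu in auto)
      finally have "g (i0, u) = h (i0, u)" using i0 by simp
      then show "g y = h y" using eq iu by (cases "i = i0") auto
    qed (use D in \<open>auto simp: Gc_def G_def\<close>)
    then show "card (Gc c) \<le> card K ^ ((N - 1) * card D)" using i0 by (simp add: card_cartesian_product)
  qed
  also have "\<dots> \<le> card K ^ N * card K ^ ((N - 1) * card D)"
  proof -
    have "card C \<le> card ({..<N} \<rightarrow>\<^sub>E K)"
      unfolding C_def using finite_K by (intro card_mono) (auto simp: finite_PiE)
    then show ?thesis by (simp add: card_funcsetE)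
  qed
  also have "\<dots> \<le> card K ^ (N * card D)"
  proof -
    have "N + (N - 1) * card D \<le> N * card D" 
    proof -
      obtain M where "N = Suc M" using False by (cases N) auto
      then show ?thesis using D(2) by simp
    qed
    moreover have "1 \<le> card K" using finite_K K_0 card_gt_0_iff[of K] by (auto simp: Suc_le_eq simp del: K_0)
    ultimately show ?thesis by (simp add: power_add[symmetric] power_increasing)
  qed
  finally show ?thesis .
qed

end

text \<open>A vector \<open>c\<close> indexed by cubic monomials is a functional on cubics. Its
  value at \<open>x_v f_i\<close> is the value at \<open>f_i\<close> of its contraction with
  \<open>v\<close>.\<close>

lemma sum_cubic_mat:
  fixes g :: "nat \<Rightarrow> ('v::finite \<Rightarrow>\<^sub>0 nat) \<Rightarrow> 'l::field"
  shows "(\<Sum>u\<in>mons UNIV 3. cubic_mat g (i, v) u * c u) = (\<Sum>w\<in>mons UNIV 2. g i w * c (evar v + w))"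
proof -
  have "(\<Sum>u\<in>mons UNIV 3. cubic_mat g (i, v) u * c u) =
      (\<Sum>u\<in>{u \<in> mons UNIV 3. lk u v > 0}. g i (u - evar v) * c u)"
    by (rule sum.mono_neutral_cong_right) (auto simp: cubic_mat_def)
  also have "\<dots> = (\<Sum>w\<in>mons UNIV 2. g i w * c (evar v + w))"
  proof (rule sum.reindex_bij_witness[where i = "\<lambda>w. evar v + w" and j = "\<lambda>u. u - evar v"])
    fix u assume u: "u \<in> {u \<in> mons UNIV 3. lk u v > 0}"
    then show "evar v + (u - evar v) = u" by (simp add: evar_add_diff)
    then show "g i (u - evar v) * c (evar v + (u - evar v)) = g i (u - evar v) * c u" by simp
    show "u - evar v \<in> mons UNIV 2" using u mdeg_diff_evar[of u v] by (simp add: mons_iff)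
  qed (auto simp: mons_iff lookup_add lk_evar)
  finally show ?thesis .
qed

text \<open>
  A functional on cubic forms whose contractions with the variables in \<open>P\<close> span all its contractions
  is determined by its restriction to the variables in \<open>P\<close> and by the matrix \<open>a\<close>.
\<close>

lemma restricted_functional_unique:
  fixes F F' :: "('v::finite \<Rightarrow>\<^sub>0 nat) \<Rightarrow> 'l::field"
  assumes F: "\<And>v w. v \<notin> P \<Longrightarrow> w \<in> mons UNIV 2 \<Longrightarrow> F (evar v + w) = (\<Sum>i\<in>P. a (v, i) * F (evar i + w))"
    and F': "\<And>v w. v \<notin> P \<Longrightarrow> w \<in> mons UNIV 2 \<Longrightarrow> F' (evar v + w) = (\<Sum>i\<in>P. a (v, i) * F' (evar i + w))"
    and eq: "\<And>u. u \<in> mons P 3 \<Longrightarrow> F u = F' u" and u: "u \<in> mons UNIV 3"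
  shows "F u = F' u"
  using u
\<comment> \<open>Induction on the degree in the variables outside \<open>P\<close>: the relation
  trades one of these for variables in \<open>P\<close>.\<close>
proof (induction "\<Sum>v\<in>- P. lk u v" arbitrary: u rule: less_induct)
  case less
  show ?case
  proof (cases "\<exists>v. v \<notin> P \<and> lk u v > 0")
    case False
    then have "u \<in> mons P 3" using less.prems by (auto simp: mons_iff)
    then show ?thesis by (rule eq)
  next
    case True
    then obtain v where v: "v \<notin> P" "lk u v > 0" by blast
    define w where "w = u - evar v"
    have uw: "u = evar v + w" using v by (simp add: w_def evar_add_diff)
    have w: "w \<in> mons UNIV 2" using less.prems mdeg_diff_evar[OF v(2)] by (simp add: mons_iff w_def)
    have "F (evar i + w) = F' (evar i + w)" if i: "i \<in> P" for i
    proof (rule less.hyps)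
      show "evar i + w \<in> mons UNIV 3" using w by (simp add: mons_iff)
      have "(\<Sum>x\<in>- P. lk (evar i + w) x) = (\<Sum>x\<in>- P. lk w x)"
        using i by (intro sum.cong) (auto simp: lookup_add lk_evar)
      also have "\<dots> < (\<Sum>x\<in>- P. lk u x)"
        using v(1) by (intro sum_strict_mono_ex1) (auto simp: uw lookup_add lk_evar)
      finally show "(\<Sum>x\<in>- P. lk (evar i + w) x) < (\<Sum>x\<in>- P. lk u x)" .
    qed
    then show ?thesis unfolding uw by (simp add: F[OF v(1) w] F'[OF v(1) w])
  qed
qed

lemma times_6_choose_3: "6 * ((r + 2) choose 3) = r * (r + 1) * (r + 2)"
proof (induction r)
  case (Suc r)
  have 2: "2 * ((r + 2) choose 2) = (r + 2) * (r + 1)" by (simp add: choose_two)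
  have "(Suc r + 2) choose 3 = ((r + 2) choose 2) + ((r + 2) choose 3)"
    by (simp add: numeral_3_eq_3 numeral_2_eq_2)
  then have "6 * ((Suc r + 2) choose 3) = 3 * (2 * ((r + 2) choose 2)) + 6 * ((r + 2) choose 3)" by simp
  then show ?case unfolding 2 Suc.IH by (simp add: algebra_simps)
qed (simp add: numeral_3_eq_3)

text \<open>Compares exponents: \<open>(n - r) * r\<close> matrix entries and the coefficients of a
  functional in \<open>r\<close> variables against \<open>N * r\<close> conditions on the forms. For
  \<open>r = n\<close> this is the lower bound on \<open>N\<close> itself.\<close>

lemma functional_count_le:
  assumes r: "1 \<le> r" "r \<le> n" and n: "2 \<le> n" and N: "(n + 1) * (n + 2) \<le> 6 * N"
  shows "(n - r) * r + ((r + 2) choose 3) \<le> N * (r :: nat)"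
proof -
  obtain k where k: "n = r + k" using r by (metis le_add_diff_inverse)
  have "6 * k + (r + 1) * (r + 2) \<le> (n + 1) * (n + 2)"
  proof -
    have "(n + 1) * (n + 2) = (r + 1) * (r + 2) + k * (2 * r + k + 3)"
      by (simp add: k algebra_simps)
    moreover have "k * 6 \<le> k * (2 * r + k + 3)" using r n k by (cases "k = 0") auto
    ultimately show ?thesis by simp
  qed
  with N have "(6 * k + (r + 1) * (r + 2)) * r \<le> 6 * N * r" by (intro mult_right_mono) auto
  moreover have "6 * (k * r + ((r + 2) choose 3)) = (6 * k + (r + 1) * (r + 2)) * r"
    unfolding add_mult_distrib2 times_6_choose_3 by (simp add: algebra_simps)
  ultimately show ?thesis by (simp add: k)
qed

context fixed_field
begin

text \<open>With \<open>r = card P\<close> there are \<open>card K ^ ((n - r) * r)\<close> matrices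
  \<open>a\<close>, for each at most \<open>card K ^ ((r + 2) choose 3)\<close> functionals, and
  each functional imposes \<open>N * r\<close> independent conditions on the tuple. So each nonempty
  \<open>P\<close> contributes at most as many pairs as there are tuples, and the empty set does not
  occur, as \<open>F\<close> is nonzero.\<close>

lemma dependent_cubics_count:
  fixes N :: nat
  assumes n: "2 \<le> CARD('v::finite)" and N: "(CARD('v) + 1) * (CARD('v) + 2) \<le> 6 * N"
  defines "G \<equiv> ({..<N} \<times> (mons UNIV 2 :: ('v \<Rightarrow>\<^sub>0 nat) set)) \<rightarrow>\<^sub>E K"
  shows "card {(g, c). g \<in> G \<and> c \<in> mons UNIV 3 \<rightarrow>\<^sub>E K \<and> (\<exists>u\<in>mons UNIV 3. c u \<noteq> 0) \<and>
      (\<forall>e\<in>cubic_rows N. (\<Sum>u\<in>mons UNIV 3. cubic_mat (\<lambda>i w. g (i, w)) e u * c u) = 0)}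
    \<le> (2 ^ CARD('v) - 1) * card K ^ (N * card (mons (UNIV :: 'v set) 2))" (is "card ?W \<le> _ * card K ^ (N * card ?D)")
proof -
  define FS where "FS P a = {F \<in> mons UNIV 3 \<rightarrow>\<^sub>E K. indep_cols (\<lambda>w v. F (evar v + w)) ?D P \<and>
      (\<forall>v. v \<notin> P \<longrightarrow> (\<forall>w\<in>?D. F (evar v + w) = (\<Sum>i\<in>P. a (v, i) * F (evar i + w))))}" for P :: "'v set" and a
  define GS where "GS P F = {g \<in> G. \<forall>i<N. \<forall>v\<in>P. (\<Sum>w\<in>?D. g (i, w) * F (evar v + w)) = 0}"
    for P :: "'v set" and F
  define AS where "AS P = ((- P) \<times> P) \<rightarrow>\<^sub>E K" for P :: "'v set"
  have q1: "1 \<le> card K" using finite_K K_0 card_gt_0_iff[of K] by (auto simp: Suc_le_eq simp del: K_0)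
  have finG: "finite G" unfolding G_def using finite_K by (intro finite_PiE) auto
  have finFS: "finite (FS P a)" for P a
    by (rule finite_subset[of _ "mons UNIV 3 \<rightarrow>\<^sub>E K"]) (use finite_K in \<open>auto simp: FS_def intro!: finite_PiE\<close>)
  have finGS: "finite (GS P F)" for P F using finG by (simp add: GS_def)
  have finAS: "finite (AS P)" for P unfolding AS_def using finite_K by (intro finite_PiE) auto
  have sub: "prod.swap ` ?W \<subseteq> (\<Union>P\<in>Pow UNIV - {{}}. \<Union>a\<in>AS P. SIGMA F:FS P a. GS P F)"
  proof
    fix z assume "z \<in> prod.swap ` ?W"
    then obtain y where y: "y \<in> ?W" "z = prod.swap y" by (elim imageE)
    obtain g F where gF: "y = (g, F)" by (cases y)
    have z: "z = (F, g)" by (simp add: y gF)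
    have "(g, F) \<in> ?W" using y(1) unfolding gF .
    then obtain u0 where g: "g \<in> G" and F: "F \<in> mons UNIV 3 \<rightarrow>\<^sub>E K" and u0: "u0 \<in> mons UNIV 3" "F u0 \<noteq> 0"
      and rel: "\<forall>e\<in>cubic_rows N. (\<Sum>u\<in>mons UNIV 3. cubic_mat (\<lambda>i w. g (i, w)) e u * F u) = 0"
      unfolding mem_Collect_eq case_prod_conv by (elim conjE bexE)
    let ?a = "\<lambda>w v. F (evar v + w)"
    let ?I = "\<lambda>P. indep_cols ?a ?D P"
    have FK: "F (evar v + w) \<in> K" if "w \<in> ?D" for v w
      using F that by (auto simp: mons_iff)
    have "?I {}" by (simp add: indep_cols_def)
    then obtain P where P: "?I P" and max: "\<And>P'. ?I P' \<Longrightarrow> card P' \<le> card P"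
      using ex_has_greatest_nat[of ?I "{}" card "Suc CARD('v)"] by (auto simp: card_mono less_Suc_eq_le)
    have ext: "\<not> ?I (insert v P)" if "v \<notin> P" for v
      using max[of "insert v P"] that by (auto simp: card_insert_disjoint)
    have "P \<noteq> {}"
    proof
      assume "P = {}"
      obtain v where v: "lk u0 v > 0" using mdeg_pos_var[of u0] u0 by (auto simp: mons_iff)
      have "u0 - evar v \<in> ?D" using u0 mdeg_diff_evar[OF v] by (simp add: mons_iff)
      moreover have "F (evar v + (u0 - evar v)) \<noteq> 0" using u0 v by (simp add: evar_add_diff)
      ultimately have "?I {v}" unfolding indep_cols_def by auto
      then show False using ext[of v] \<open>P = {}\<close> by simp
    qed
    have "\<exists>a. \<forall>i\<in>P. a i \<in> K \<and> (\<forall>w\<in>?D. F (evar v + w) = (\<Sum>i\<in>P. a i * F (evar i + w)))" if v: "v \<notin> P" for v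
    proof -
      \<comment> \<open>By maximality of \<open>P\<close> the contraction with \<open>v\<close>
        depends on those in \<open>P\<close>; the coefficients are taken in \<open>K\<close> so that
        they can be counted.\<close>
      obtain c where c: "c \<in> insert v P \<rightarrow>\<^sub>E K" "\<exists>y\<in>insert v P. c y \<noteq> 0"
        "\<forall>w\<in>?D. (\<Sum>y\<in>insert v P. ?a w y * c y) = 0"
        using rational_solution[OF _ _ ext[OF v]] FK by (elim meta_impE bexE conjE) auto
      have s: "F (evar v + w) * c v + (\<Sum>y\<in>P. ?a w y * c y) = 0" if "w \<in> ?D" for w
        using bspec[OF c(3) that] v by simp
      have cv: "c v \<noteq> 0"
      proof
        assume "c v = 0"
        then have "\<forall>w\<in>?D. (\<Sum>y\<in>P. ?a w y * c y) = 0" using s by simp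
        then have "\<forall>y\<in>P. c y = 0" using P unfolding indep_cols_def by blast
        then show False using c(2) \<open>c v = 0\<close> by blast
      qed
      have "F (evar v + w) = (\<Sum>i\<in>P. - (c i / c v) * F (evar i + w))" if "w \<in> ?D" for w
      proof -
        have "F (evar v + w) = - (\<Sum>y\<in>P. ?a w y * c y) / c v"
          using s[OF that] cv by (simp add: field_simps eq_neg_iff_add_eq_0)
        also have "\<dots> = (\<Sum>i\<in>P. - (c i / c v) * F (evar i + w))"
          by (simp add: sum_divide_distrib sum_negf mult.commute)
        finally show ?thesis .
      qed
      moreover have "- (c i / c v) \<in> K" if "i \<in> P" for i
        using c(1) that by (intro K_uminus K_divide) auto
      ultimately show ?thesis by (intro exI[of _ "\<lambda>i. - (c i / c v)"]) simp
    qed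
    then have "\<forall>v\<in>-P. \<exists>a. \<forall>i\<in>P. a i \<in> K \<and> (\<forall>w\<in>?D. F (evar v + w) = (\<Sum>i\<in>P. a i * F (evar i + w)))" by simp
    from bchoice[OF this] obtain a where
      a: "\<And>v i. v \<notin> P \<Longrightarrow> i \<in> P \<Longrightarrow> a v i \<in> K"
         "\<And>v i w. v \<notin> P \<Longrightarrow> i \<in> P \<Longrightarrow> w \<in> ?D \<Longrightarrow> F (evar v + w) = (\<Sum>i\<in>P. a v i * F (evar i + w))" by auto
    define a' where "a' = (\<lambda>(v, i)\<in>(- P) \<times> P. a v i)"
    have "a' \<in> AS P" using a(1) by (auto simp: AS_def a'_def)
    moreover have "F \<in> FS P a'"
      using F P a(2) \<open>P \<noteq> {}\<close> by (auto simp: FS_def a'_def intro!: sum.cong)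
    moreover have "g \<in> GS P F"
      using g rel by (auto simp: GS_def cubic_rows_def sum_cubic_mat)
    ultimately show "z \<in> (\<Union>P\<in>Pow UNIV - {{}}. \<Union>a\<in>AS P. SIGMA F:FS P a. GS P F)"
      unfolding z using \<open>P \<noteq> {}\<close> by auto
  qed
  have "card ?W = card (prod.swap ` ?W)" by (intro card_image[symmetric]) simp
  also have "\<dots> \<le> card (\<Union>P\<in>Pow UNIV - {{}}. \<Union>a\<in>AS P. SIGMA F:FS P a. GS P F)"
    by (rule card_mono[OF _ sub]) (auto simp: finAS finFS finGS)
  also have "\<dots> \<le> (\<Sum>P\<in>Pow UNIV - {{}}. card (\<Union>a\<in>AS P. SIGMA F:FS P a. GS P F))"
    by (rule card_UN_le) simp
  also have "\<dots> \<le> (\<Sum>P\<in>Pow (UNIV :: 'v set) - {{}}. card K ^ (N * card ?D))"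
  proof (rule sum_mono)
    fix P :: "'v set" assume "P \<in> Pow UNIV - {{}}"
    define r where "r = card P"
    have r: "1 \<le> r" "r \<le> CARD('v)"
      using \<open>P \<in> _\<close> by (auto simp: r_def card_mono Suc_le_eq card_gt_0_iff)
    have cF: "card (FS P a) \<le> card K ^ ((r + 2) choose 3)" for a
    proof -
      have "card (FS P a) \<le> card K ^ card (mons P 3)"
      proof (rule card_determined[of "mons (UNIV :: 'v set) 3"])
        fix F F' :: "('v \<Rightarrow>\<^sub>0 nat) \<Rightarrow> 'l" and u :: "'v \<Rightarrow>\<^sub>0 nat"
        assume "F \<in> FS P a" "F' \<in> FS P a" "\<And>b. b \<in> mons P 3 \<Longrightarrow> F b = F' b" "u \<in> mons UNIV 3"
        then show "F u = F' u"
          by (intro restricted_functional_unique[of P F a F' u]) (auto simp: FS_def)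
      qed (auto simp: FS_def mons_iff)
      then show ?thesis by (simp add: card_mons r_def)
    qed
    have cG: "r \<le> card ?D \<and> card (GS P F) \<le> card K ^ (N * (card ?D - r))" if F: "F \<in> FS P a" for F a
    proof -
      have ind: "indep_cols (\<lambda>w v. F (evar v + w)) ?D P" using F by (simp add: FS_def)
      obtain J where J: "J \<subseteq> ?D" "card J = card P" "indep_cols (\<lambda>w v. F (evar v + w)) J P"
        by (rule indep_cols_square_subset[OF finite_mons _ ind]) simp
      have finJ: "finite J" using J(1) finite_mons finite_subset by blast
      \<comment> \<open>On the square block \<open>J\<close> the coefficients of each form can be
        recovered from its coefficients outside \<open>J\<close>.\<close>
      have J': "indep_cols (\<lambda>v w. F (evar v + w)) P J"
        by (rule indep_cols_transpose[OF finJ _ J(3,2)]) simp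
      have "card (GS P F) \<le> card K ^ card ({..<N} \<times> (?D - J))"
      proof (rule card_determined[of "{..<N} \<times> ?D"])
        fix g h y assume gh: "g \<in> GS P F" "h \<in> GS P F" and eq: "\<And>b. b \<in> {..<N} \<times> (?D - J) \<Longrightarrow> g b = h b"
          and y: "y \<in> {..<N} \<times> ?D"
        obtain i u where iu: "y = (i, u)" "i < N" "u \<in> ?D" using y by auto
        have "(\<Sum>w\<in>J. F (evar v + w) * (g (i, w) - h (i, w))) = 0" if v: "v \<in> P" for v
        proof -
          have "(\<Sum>w\<in>?D. g (i, w) * F (evar v + w)) = 0" "(\<Sum>w\<in>?D. h (i, w) * F (evar v + w)) = 0"
            using gh iu v by (simp_all add: GS_def)
          then have "0 = (\<Sum>w\<in>?D. F (evar v + w) * (g (i, w) - h (i, w)))"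
            by (simp add: right_diff_distrib sum_subtractf mult.commute)
          also have "\<dots> = (\<Sum>w\<in>J. F (evar v + w) * (g (i, w) - h (i, w)))"
            by (rule sum.mono_neutral_right) (use J(1) eq iu in auto)
          finally show ?thesis by simp
        qed
        then have "\<forall>w\<in>J. g (i, w) - h (i, w) = 0"
          using J'[unfolded indep_cols_def, rule_format, of "\<lambda>w. g (i, w) - h (i, w)"] by blast
        then show "g y = h y" using eq[of "(i, u)"] iu by (cases "u \<in> J") auto
      qed (auto simp: GS_def G_def)
      moreover have "card (?D - J) = card ?D - r" using J finJ by (simp add: card_Diff_subset r_def)
      moreover have "r \<le> card ?D" using card_mono[OF finite_mons J(1)] J(2) by (simp add: r_def)
      ultimately show ?thesis by (simp add: card_cartesian_product)
    qed
    have "card (\<Union>a\<in>AS P. SIGMA F:FS P a. GS P F) \<le> (\<Sum>a\<in>AS P. card (SIGMA F:FS P a. GS P F))"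
      by (rule card_UN_le) (rule finAS)
    also have "\<dots> \<le> (\<Sum>a\<in>AS P. card K ^ (((r + 2) choose 3) + (N * card ?D - N * r)))"
    proof (rule sum_mono)
      fix a
      have "card (SIGMA F:FS P a. GS P F) = (\<Sum>F\<in>FS P a. card (GS P F))"
        using finFS finGS by simp
      also have "\<dots> \<le> (\<Sum>F\<in>FS P a. card K ^ (N * (card ?D - r)))"
        using cG by (intro sum_mono) blast
      also have "\<dots> \<le> card K ^ ((r + 2) choose 3) * card K ^ (N * (card ?D - r))"
        using cF[of a] by simp
      finally show "card (SIGMA F:FS P a. GS P F) \<le> card K ^ (((r + 2) choose 3) + (N * card ?D - N * r))"
        by (simp add: power_add diff_mult_distrib2)
    qed
    also have "\<dots> = card K ^ ((CARD('v) - r) * r) * card K ^ (((r + 2) choose 3) + (N * card ?D - N * r))"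
      by (simp add: AS_def card_funcsetE card_cartesian_product r_def card_Diff_subset Compl_eq_Diff_UNIV)
    finally have le: "card (\<Union>a\<in>AS P. SIGMA F:FS P a. GS P F) \<le>
        card K ^ ((CARD('v) - r) * r + ((r + 2) choose 3) + (N * card ?D - N * r))"
      by (simp add: power_add mult.assoc)
    show "card (\<Union>a\<in>AS P. SIGMA F:FS P a. GS P F) \<le> card K ^ (N * card ?D)"
    proof (cases "r \<le> card ?D")
      case True
      then have "N * r \<le> N * card ?D" by simp
      with functional_count_le[OF r n N]
      have "(CARD('v) - r) * r + ((r + 2) choose 3) + (N * card ?D - N * r) \<le> N * card ?D" by linarith
      then show ?thesis using le power_increasing[OF _ q1] by (meson le_trans)
    next
      case False
      then have "FS P a = {}" for a using cG by blast
      then show ?thesis by simp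
    qed
  qed
  also have "\<dots> = (2 ^ CARD('v) - 1) * card K ^ (N * card ?D)"
    by (simp add: card_Pow card_Diff_subset)
  finally show ?thesis .
qed

text \<open>Multiplied by \<open>card K - 1\<close>, the tuples failing the first condition number
  at most \<open>2 ^ CARD('v) - 1\<close> times all tuples, those failing the second at most all
  tuples. The bound on \<open>card K\<close> leaves a good one.\<close>

theorem independent_forms_exist:
  fixes N :: nat
  assumes n: "2 \<le> CARD('v::finite)" and N: "(CARD('v) + 1) * (CARD('v) + 2) \<le> 6 * N"
    and ND: "N \<le> card (mons (UNIV :: 'v set) 2)" and K: "2 ^ CARD('v) + 1 < card K"
  shows "\<exists>g :: nat \<Rightarrow> ('v \<Rightarrow>\<^sub>0 nat) \<Rightarrow> 'l. (\<forall>i<N. \<forall>u\<in>mons UNIV 2. g i u \<in> K) \<and>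
    indep_cols (cubic_mat g) (cubic_rows N) (mons UNIV 3) \<and> indep_cols (\<lambda>u i. g i u) (mons UNIV 2) {..<N}"
proof (rule ccontr)
  let ?D = "mons (UNIV :: 'v set) 2"
  let ?G = "({..<N} \<times> ?D) \<rightarrow>\<^sub>E K"
  let ?B1 = "{g \<in> ?G. \<not> indep_cols (cubic_mat (\<lambda>i w. g (i, w))) (cubic_rows N) (mons UNIV 3)}"
  let ?B2 = "{g \<in> ?G. \<not> indep_cols (\<lambda>u i. g (i, u)) ?D {..<N}}"
  assume none: "\<not> ?thesis"
  have finG: "finite ?G" using finite_K by (intro finite_PiE) auto
  have "?G \<subseteq> ?B1 \<union> ?B2"
  proof
    fix g assume g: "g \<in> ?G"
    then have "\<forall>i<N. \<forall>u\<in>?D. g (i, u) \<in> K" by auto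
    then show "g \<in> ?B1 \<union> ?B2" using none g by (auto dest: spec[of _ "\<lambda>i u. g (i, u)"])
  qed
  then have "card ?G \<le> card (?B1 \<union> ?B2)" using finG by (intro card_mono) auto
  then have "card ?G \<le> card ?B1 + card ?B2" using card_Un_le[of ?B1 ?B2] by linarith
  then have "(card K - 1) * card ?G \<le> (card K - 1) * card ?B1 + (card K - 1) * card ?B2"
    unfolding add_mult_distrib2[symmetric] by (rule mult_le_mono2)
  moreover have "(card K - 1) * card ?B1 \<le> (2 ^ CARD('v) - 1) * card K ^ (N * card ?D)"
  proof (rule order.trans[OF dependent_count dependent_cubics_count[OF n N]])
    fix g :: "nat \<times> ('v \<Rightarrow>\<^sub>0 nat) \<Rightarrow> 'l" and e :: "nat \<times> 'v" and u
    assume "g \<in> ?G" "e \<in> cubic_rows N" "u \<in> mons (UNIV :: 'v set) 3"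
    then show "cubic_mat (\<lambda>i w. g (i, w)) e u \<in> K"
      using mdeg_diff_evar[of u "snd e"] by (auto simp: cubic_mat_def cubic_rows_def mons_iff)
  qed (simp_all add: finG)
  moreover have "(card K - 1) * card ?B2 \<le> card K ^ (N * card ?D)"
    by (rule order.trans[OF dependent_count dependent_tuples_count[OF finite_mons ND]]) (use finG in auto)
  ultimately have "(card K - 1) * card ?G \<le> (2 ^ CARD('v) - 1) * card K ^ (N * card ?D) + card K ^ (N * card ?D)"
    by linarith
  also have "\<dots> = 2 ^ CARD('v) * card K ^ (N * card ?D)"
    by (simp add: diff_mult_distrib)
  also have "card K ^ (N * card ?D) = card ?G"
    by (simp add: card_funcsetE card_cartesian_product)
  finally have "card K - 1 \<le> 2 ^ CARD('v) \<or> card ?G = 0" by auto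
  moreover have "card ?G \<noteq> 0" using K by (simp add: card_funcsetE)
  ultimately show False using K by linarith
qed

end

section \<open>General quadratic forms over algebraically closed fields\<close>

text \<open>A root of multiplicity at least 2 would be a root of the derivative.\<close>

lemma card_roots_separable:
  fixes p :: "'l::alg_closed_field poly"
  assumes p: "p \<noteq> 0" and sep: "\<And>x. poly p x = 0 \<Longrightarrow> poly (pderiv p) x \<noteq> 0"
  shows "card {x. poly p x = 0} = Polynomial.degree p"
proof -
  obtain A where A: "size A = Polynomial.degree p" "p = Polynomial.smult (Polynomial.lead_coeff p) (\<Prod>x\<in>#A. [:- x, 1:])"
    using alg_closed_imp_factorization[OF p] by blast
  have lc: "Polynomial.lead_coeff p \<noteq> 0" using p by simp
  have roots: "{x. poly p x = 0} = set_mset A"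
    by (subst A(2)) (auto simp: lc p poly_prod_mset prod_mset_zero_iff)
  have "count A x = 1" if x: "x \<in># A" for x
  proof (rule ccontr)
    assume "count A x \<noteq> 1"
    obtain A' where A': "A = add_mset x A'" using multi_member_split[OF x] by blast
    with \<open>count A x \<noteq> 1\<close> have xA': "x \<in># A'" by (simp add: count_eq_zero_iff[symmetric])
    then obtain B where "A' = add_mset x B" using multi_member_split[OF xA'] by blast
    with A' have AB: "A = add_mset x (add_mset x B)" by simp
    obtain r where r: "r = (\<Prod>x\<in>#B. [:- x, 1:])" by blast
    have "p = Polynomial.smult (Polynomial.lead_coeff p) ([:- x, 1:] * ([:- x, 1:] * r))"
      by (subst A(2)) (simp only: AB r image_mset_add_mset prod_mset.add_mset)
    then have "pderiv p = Polynomial.smult (Polynomial.lead_coeff p) (pderiv ([:- x, 1:] * ([:- x, 1:] * r)))"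
      by (metis Polynomial.pderiv_smult)
    then have "poly (pderiv p) x = 0" by (simp only: pderiv_mult) simp
    moreover have "poly p x = 0" using x roots by auto
    ultimately show False using sep by blast
  qed
  then have "size A = card (set_mset A)" by (simp add: size_multiset_overloaded_eq)
  then show ?thesis using roots A by simp
qed

text \<open>\<open>X ^ q - X\<close> has derivative -1, hence q distinct roots, and raising to the
  power q is additive.\<close>

lemma frobenius_fixed_field:
  assumes p: "CHAR('l::alg_closed_field) > 0" and m: "m > 0"
  defines "q \<equiv> CHAR('l) ^ m"
  shows "fixed_field (\<lambda>x :: 'l. x ^ q) {x. x ^ q = x}" and "card {x :: 'l. x ^ q = x} = q"
proof -
  have prime: "Factorial_Ring.prime CHAR('l)" using prime_CHAR_semidom p by blast
  have q: "1 < q" unfolding q_def using prime m by (metis one_less_power prime_gt_1_nat)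
  define P :: "'l poly" where "P = Polynomial.monom 1 q - Polynomial.monom 1 1"
  have root: "poly P x = 0 \<longleftrightarrow> x ^ q = x" for x by (simp add: P_def poly_monom)
  have "Polynomial.coeff P q = 1" using q by (simp add: P_def)
  then have P0: "P \<noteq> 0" by auto
  have deg: "Polynomial.degree P = q"
  proof -
    have "Polynomial.degree (Polynomial.monom 1 q + Polynomial.monom (-1 :: 'l) 1) = Polynomial.degree (Polynomial.monom (1 :: 'l) q)"
      using q by (intro degree_add_eq_left) (simp add: degree_monom_eq)
    then show ?thesis by (simp add: P_def degree_monom_eq diff_conv_add_uminus minus_monom del: add_uminus_conv_diff)
  qed
  have q0: "(of_nat q :: 'l) = 0" using m by (simp add: q_def)
  have "pderiv P = - 1" by (simp add: P_def pderiv_diff pderiv_monom q0)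
  then have sep: "poly (pderiv P) x \<noteq> 0" for x by simp
  show card: "card {x :: 'l. x ^ q = x} = q"
    using card_roots_separable[OF P0 sep] by (simp only: root deg)
  show "fixed_field (\<lambda>x :: 'l. x ^ q) {x. x ^ q = x}"
  proof
    show "finite {x :: 'l. x ^ q = x}" using card q by (intro card_ge_0_finite) simp
    show "(x + y) ^ q = x ^ q + y ^ q" for x y :: 'l
      by (rule freshmans_dream'[OF prime q_def[unfolded atomize_eq]])
  qed (auto simp: power_mult_distrib)
qed

section \<open>Passage from finite fields to characteristic 0\<close>

context fixed_field
begin

text \<open>Presents the nonzero elements of \<open>K\<close> as powers of one element, the form in
  which they can be lifted.\<close>

lemma cyclic: "\<exists>\<theta>. \<forall>x\<in>K. x \<noteq> 0 \<longrightarrow> (\<exists>k. x = \<theta> ^ k)"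
proof -
  define R :: "'l ring" where "R = \<lparr>carrier = K, monoid.mult = (*), one = 1, ring.zero = 0, add = (+)\<rparr>"
  have R [simp]: "carrier R = K" "x \<otimes>\<^bsub>R\<^esub> y = x * y" "\<one>\<^bsub>R\<^esub> = 1" "\<zero>\<^bsub>R\<^esub> = 0" "x \<oplus>\<^bsub>R\<^esub> y = x + y" for x y
    by (simp_all add: R_def)
  have "cring R"
  proof (rule cringI)
    show "abelian_group R"
    proof (rule abelian_groupI)
      fix x assume "x \<in> carrier R"
      then show "\<exists>y\<in>carrier R. y \<oplus>\<^bsub>R\<^esub> x = \<zero>\<^bsub>R\<^esub>" by (intro bexI[of _ "- x"]) (auto simp: K_uminus)
    qed (auto simp: K_add algebra_simps)
    show "comm_monoid R" by (rule comm_monoidI) (auto simp: K_mult algebra_simps)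
  qed (auto simp: algebra_simps)
  then interpret cring R .
  have "Group.Units R = carrier R - {\<zero>\<^bsub>R\<^esub>}"
  proof (intro equalityI subsetI)
    fix x assume "x \<in> carrier R - {\<zero>\<^bsub>R\<^esub>}"
    then show "x \<in> Group.Units R" by (auto simp: Group.Units_def K_inverse intro!: bexI[of _ "inverse x"])
  qed (auto simp: Group.Units_def)
  then have "Ring.field R" by (rule cring_fieldI)
  then interpret Ring.field R .
  obtain \<theta> where \<theta>: "\<theta> \<in> carrier (Multiplicative_Group.mult_of R)" "carrier (Multiplicative_Group.mult_of R) = {\<theta> [^]\<^bsub>R\<^esub> i | i :: nat. i \<in> UNIV}"
    using finite_field_mult_group_has_gen[unfolded R(1), OF finite_K] by (elim bexE)
  have pow: "\<theta> [^]\<^bsub>R\<^esub> i = \<theta> ^ i" for i :: nat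
    by (induction i) (simp_all add: mult.commute)
  have "\<exists>k. x = \<theta> ^ k" if "x \<in> K" "x \<noteq> 0" for x
  proof -
    have "x \<in> carrier (Multiplicative_Group.mult_of R)" using that by simp
    then show ?thesis unfolding \<theta>(2) pow by blast
  qed
  then show ?thesis by blast
qed

end

lemma eval_int_poly_hom: "comm_ring_hom (\<lambda>p :: int poly. poly (map_poly of_int p) (t :: 'l::field))"
proof
  fix p q :: "int poly"
  have "map_poly of_int (p + q) = map_poly of_int p + (map_poly of_int q :: 'l poly)"
    by (intro poly_eqI) (simp add: coeff_map_poly)
  then show "poly (map_poly of_int (p + q)) t = poly (map_poly of_int p) t + poly (map_poly of_int q) t" by simp
  have "map_poly of_int (p * q) = map_poly of_int p * (map_poly of_int q :: 'l poly)"
    by (intro poly_eqI) (simp add: coeff_map_poly coeff_mult)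
  then show "poly (map_poly of_int (p * q)) t = poly (map_poly of_int p) t * poly (map_poly of_int q) t" by simp
qed (simp_all add: map_poly_1')

definition pow_opt :: "'c::comm_ring_1 \<Rightarrow> nat option \<Rightarrow> 'c" where
  "pow_opt t k = (case k of None \<Rightarrow> 0 | Some k \<Rightarrow> t ^ k)"

text \<open>In a nonvanishing minor replace \<open>\<theta>\<close> by an indeterminate. The
  determinant is an integer polynomial, nonzero because its value at \<open>\<theta>\<close> is,
  even if \<open>'m\<close> and \<open>'l\<close> have different characteristics.\<close>

lemma indep_cols_lift:
  fixes \<theta> :: "'m::field" and e :: "'e \<Rightarrow> 'y \<Rightarrow> nat option"
  assumes fin: "finite E" "finite Y" and ind: "indep_cols (\<lambda>i y. pow_opt \<theta> (e i y)) E Y"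
  obtains p :: "int poly" where "p \<noteq> 0"
    "\<And>t :: 'l::field. poly (map_poly of_int p) t \<noteq> 0 \<Longrightarrow> indep_cols (\<lambda>i y. pow_opt t (e i y)) E Y"
proof -
  obtain J where J: "J \<subseteq> E" "card J = card Y" "indep_cols (\<lambda>i y. pow_opt \<theta> (e i y)) J Y"
    by (rule indep_cols_square_subset[OF fin ind])
  have finJ: "finite J" using J(1) fin(1) finite_subset by blast
  define d where "d = card Y"
  obtain \<sigma> where \<sigma>: "bij_betw \<sigma> {..<d} J"
    using ex_bij_betw_nat_finite[OF finJ] J(2) by (auto simp: d_def lessThan_atLeast0)
  obtain \<tau> where \<tau>: "bij_betw \<tau> {..<d} Y"
    using ex_bij_betw_nat_finite[OF fin(2)] by (auto simp: d_def lessThan_atLeast0)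
  define A :: "int poly Matrix.mat" where "A = Matrix.mat d d (\<lambda>(r, s). pow_opt (Polynomial.monom 1 (Suc 0)) (e (\<sigma> r) (\<tau> s)))"
  have ev: "poly (map_poly of_int (Determinant.det A)) t \<noteq> 0 \<longleftrightarrow> indep_cols (\<lambda>i y. pow_opt t (e i y)) J Y"
    for t :: "'x::field"
  proof -
    interpret comm_ring_hom "\<lambda>p :: int poly. poly (map_poly of_int p) t" by (rule eval_int_poly_hom)
    have "map_poly of_int (Polynomial.monom 1 (Suc 0) :: int poly) = (Polynomial.monom 1 (Suc 0) :: 'x poly)" by (simp add: map_poly_monom)
    then have m: "poly (map_poly of_int (Polynomial.monom 1 (Suc 0) :: int poly)) t = t" by (simp add: poly_monom)
    have "map_mat (\<lambda>p. poly (map_poly of_int p) t) A = Matrix.mat d d (\<lambda>(r, s). pow_opt t (e (\<sigma> r) (\<tau> s)))"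
      by (rule eq_matI) (auto simp: A_def pow_opt_def hom_zero hom_power m split: option.split)
    then have "poly (map_poly of_int (Determinant.det A)) t =
        Determinant.det (Matrix.mat d d (\<lambda>(r, s). pow_opt t (e (\<sigma> r) (\<tau> s))))"
      using hom_det[of A] by simp
    then show ?thesis using det_nonzero_iff_indep_cols[OF \<sigma> \<tau>, of "\<lambda>i y. pow_opt t (e i y)"] by simp
  qed
  show thesis
  proof
    show "Determinant.det A \<noteq> 0" using ev[of \<theta>] J(3) by auto
    show "indep_cols (\<lambda>i y. pow_opt t (e i y)) E Y" if "poly (map_poly of_int (Determinant.det A)) t \<noteq> 0" for t :: 'l
      using indep_cols_mono[OF _ J(1)] ev[of t] that by blast
  qed
qed

lemma indep_cols_cong:
  assumes "\<And>e y. e \<in> E \<Longrightarrow> y \<in> Y \<Longrightarrow> a e y = b e y"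
  shows "indep_cols a E Y \<longleftrightarrow> indep_cols b E Y"
proof -
  have "(\<Sum>y\<in>Y. a e y * c y) = (\<Sum>y\<in>Y. b e y * c y)" if "e \<in> E" for e c
    using assms[OF that] by (intro sum.cong) auto
  then show ?thesis unfolding indep_cols_def by simp
qed

text \<open>Fixes the size of the finite field: the exponent \<open>n + 2\<close> is large enough
  for the smallest prime.\<close>

lemma two_power_gap: "2 ^ n + 1 < (2 :: nat) ^ (n + 2)"
  by (induction n) auto

lemma independent_forms_exist_char_0:
  fixes N :: nat
  assumes char: "CHAR('l::field) = 0"
    and n: "2 \<le> CARD('v::finite)" and N: "(CARD('v) + 1) * (CARD('v) + 2) \<le> 6 * N"
    and ND: "N \<le> card (mons (UNIV :: 'v set) 2)"
  shows "\<exists>g :: nat \<Rightarrow> ('v \<Rightarrow>\<^sub>0 nat) \<Rightarrow> 'l. indep_cols (cubic_mat g) (cubic_rows N) (mons UNIV 3) \<and>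
    indep_cols (\<lambda>u i. g i u) (mons UNIV 2) {..<N}"
proof -
  have "CHAR(bit) = 2" by (rule CHAR_eq_posI) (auto simp: less_2_cases_iff)
  then have c2: "CHAR(bit alg_closure) = 2" by simp
  define K where "K = {x :: bit alg_closure. x ^ (2 ^ (CARD('v) + 2)) = x}"
  note frob = frobenius_fixed_field[where 'l = "bit alg_closure" and m = "CARD('v) + 2", unfolded c2]
  interpret F: fixed_field "\<lambda>x :: bit alg_closure. x ^ (2 ^ (CARD('v) + 2))" K
    unfolding K_def by (rule frob(1)) simp_all
  have "card K = 2 ^ (CARD('v) + 2)"
    unfolding K_def by (rule frob(2)) simp_all
  then have "2 ^ CARD('v) + 1 < card K" by (simp only: two_power_gap)
  from F.independent_forms_exist[OF n N ND this] obtain g :: "nat \<Rightarrow> ('v \<Rightarrow>\<^sub>0 nat) \<Rightarrow> bit alg_closure" where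
    g: "\<And>i u. i < N \<Longrightarrow> u \<in> mons UNIV 2 \<Longrightarrow> g i u \<in> K"
      "indep_cols (cubic_mat g) (cubic_rows N) (mons UNIV 3)" "indep_cols (\<lambda>u i. g i u) (mons UNIV 2) {..<N}" by (elim exE conjE) auto
  obtain \<theta> where \<theta>: "\<And>x. x \<in> K \<Longrightarrow> x \<noteq> 0 \<Longrightarrow> \<exists>k. x = \<theta> ^ k" using F.cyclic by blast
  define e where "e i u = (if g i u = 0 then None else Some (SOME k. g i u = \<theta> ^ k))" for i u
  have e: "g i u = pow_opt \<theta> (e i u)" if iu: "i < N" "u \<in> mons UNIV 2" for i u
    using someI_ex[OF \<theta>[OF g(1)[OF iu]]] by (auto simp: e_def pow_opt_def)
  define e3 where "e3 r u = (if lk u (snd r) > 0 then e (fst r) (u - evar (snd r)) else None)"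
    for r :: "nat \<times> 'v" and u
  have e3: "cubic_mat (\<lambda>i u. pow_opt t (e i u)) = (\<lambda>r u. pow_opt t (e3 r u))" for t :: "'c::field"
    by (intro ext) (simp add: cubic_mat_def e3_def pow_opt_def)
  have "indep_cols (cubic_mat g) (cubic_rows N) (mons UNIV 3) \<longleftrightarrow>
      indep_cols (cubic_mat (\<lambda>i u. pow_opt \<theta> (e i u))) (cubic_rows N) (mons UNIV 3)"
  proof (rule indep_cols_cong)
    fix r :: "nat \<times> 'v" and u assume "r \<in> cubic_rows N" "u \<in> mons (UNIV :: 'v set) 3"
    then show "cubic_mat g r u = cubic_mat (\<lambda>i u. pow_opt \<theta> (e i u)) r u"
      using mdeg_diff_evar[of u "snd r"] e[of "fst r" "u - evar (snd r)"]
      by (auto simp: cubic_mat_def cubic_rows_def mons_iff)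
  qed
  with g(2) have "indep_cols (cubic_mat (\<lambda>i u. pow_opt \<theta> (e i u))) (cubic_rows N) (mons UNIV 3)" by simp
  then have 1: "indep_cols (\<lambda>r u. pow_opt \<theta> (e3 r u)) (cubic_rows N) (mons UNIV 3)" unfolding e3 .
  have 2: "indep_cols (\<lambda>u i. pow_opt \<theta> (e i u)) (mons UNIV 2) {..<N}"
    by (rule iffD1[OF indep_cols_cong g(3)]) (simp add: e)
  have fin: "finite (cubic_rows N :: (nat \<times> 'v) set)" by (simp add: cubic_rows_def)
  obtain p1 where p1: "p1 \<noteq> 0" "\<And>t :: 'l. poly (map_poly of_int p1) t \<noteq> 0 \<Longrightarrow>
      indep_cols (\<lambda>r u. pow_opt t (e3 r u)) (cubic_rows N) (mons UNIV 3)"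
    using indep_cols_lift[OF fin finite_mons 1, where 'l = 'l] by blast
  obtain p2 where p2: "p2 \<noteq> 0" "\<And>t :: 'l. poly (map_poly of_int p2) t \<noteq> 0 \<Longrightarrow>
      indep_cols (\<lambda>u i. pow_opt t (e i u)) (mons UNIV 2) {..<N}"
    using indep_cols_lift[OF finite_mons finite_lessThan 2, where 'l = 'l] by blast
  have inj: "(of_int c :: 'l) = 0 \<longleftrightarrow> c = 0" for c by (simp add: of_int_eq_0_iff_char_dvd char)
  have nz: "map_poly of_int p \<noteq> (0 :: 'l poly)" if "p \<noteq> 0" for p
  proof
    assume "map_poly of_int p = (0 :: 'l poly)"
    then have "(of_int (Polynomial.coeff p k) :: 'l) = 0" for k by (metis coeff_map_poly coeff_0 of_int_0)
    then have "p = 0" by (intro poly_eqI) (simp add: inj)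
    with that show False by simp
  qed
  \<comment> \<open>A field of characteristic 0 is infinite, so some \<open>t\<close> avoids the
    roots of both polynomials.\<close>
  have "\<not> finite (UNIV :: 'l set)" using finite_imp_CHAR_pos[where 'a = 'l] char by fastforce
  moreover have "finite {t :: 'l. poly (map_poly of_int p1 * map_poly of_int p2) t = 0}"
    by (rule poly_roots_finite) (simp add: nz p1 p2)
  ultimately obtain t :: 'l where "poly (map_poly of_int p1 * map_poly of_int p2) t \<noteq> 0"
    using finite_subset[of UNIV "{t :: 'l. poly (map_poly of_int p1 * map_poly of_int p2) t = 0}"] by auto
  then have t: "poly (map_poly of_int p1) t \<noteq> 0" "poly (map_poly of_int p2) t \<noteq> 0" by auto
  show ?thesis
    using p1(2)[OF t(1)] p2(2)[OF t(2)] unfolding e3[symmetric] by (intro exI conjI)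
qed

theorem independent_forms_exist:
  fixes N :: nat
  assumes n: "2 \<le> CARD('v::finite)" and N: "(CARD('v) + 1) * (CARD('v) + 2) \<le> 6 * N"
    and ND: "N \<le> card (mons (UNIV :: 'v set) 2)"
  shows "\<exists>g :: nat \<Rightarrow> ('v \<Rightarrow>\<^sub>0 nat) \<Rightarrow> 'l::alg_closed_field.
    indep_cols (cubic_mat g) (cubic_rows N) (mons UNIV 3) \<and> indep_cols (\<lambda>u i. g i u) (mons UNIV 2) {..<N}"
proof (cases "CHAR('l) = 0")
  case True
  then show ?thesis by (rule independent_forms_exist_char_0[OF _ n N ND])
next
  case False
  then have prime: "Factorial_Ring.prime CHAR('l)" using prime_CHAR_semidom by blast
  define q where "q = CHAR('l) ^ (CARD('v) + 2)"
  interpret F: fixed_field "\<lambda>x :: 'l. x ^ q" "{x. x ^ q = x}"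
    unfolding q_def by (rule frobenius_fixed_field(1)) (use False in auto)
  have "2 ^ CARD('v) + 1 < (2 :: nat) ^ (CARD('v) + 2)" by (rule two_power_gap)
  also have "\<dots> \<le> q" unfolding q_def using prime by (intro power_mono) (auto simp: prime_ge_2_nat)
  also have "q = card {x :: 'l. x ^ q = x}"
    unfolding q_def by (rule frobenius_fixed_field(2)[symmetric]) (use False in auto)
  finally have "2 ^ CARD('v) + 1 < card {x :: 'l. x ^ q = x}" .
  from F.independent_forms_exist[OF n N ND this] show ?thesis by (elim exE conjE, intro exI conjI)
qed

lemma good_exists:
  fixes N :: nat
  assumes n: "2 \<le> CARD('v::finite)" and N: "(CARD('v) + 1) * (CARD('v) + 2) \<le> 6 * N"
    and ND: "N \<le> card (mons (UNIV :: 'v set) 2)"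
  shows "\<exists>f :: nat \<Rightarrow> ('v, 'l::alg_closed_field) mpoly. good N f"
proof -
  obtain g :: "nat \<Rightarrow> ('v \<Rightarrow>\<^sub>0 nat) \<Rightarrow> 'l" where
    g: "indep_cols (cubic_mat g) (cubic_rows N) (mons UNIV 3)" "indep_cols (\<lambda>u i. g i u) (mons UNIV 2) {..<N}"
    using independent_forms_exist[OF n N ND, where 'l = 'l] by (elim exE conjE)
  define f where "f i = (\<Sum>u\<in>mons UNIV 2. Poly_Mapping.single u (g i u))" for i
  have lkf: "lk (f i) u = g i u" if "u \<in> mons UNIV 2" for i u
    using that by (simp add: f_def lk_sum_fun lookup_single when_def)
  have "cubic_mat (\<lambda>i. lk (f i)) r u = cubic_mat g r u" if "u \<in> mons UNIV 3" for r u
    using that lkf mdeg_diff_evar[of u "snd r"] by (auto simp: cubic_mat_def mons_iff)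
  then have "indep_cols (cubic_mat (\<lambda>i. lk (f i))) (cubic_rows N) (mons UNIV 3)"
    by (intro iffD1[OF indep_cols_cong g(1)]) simp
  moreover have "indep_cols (\<lambda>u i. lk (f i) u) (mons UNIV 2) {..<N}"
    by (rule iffD1[OF indep_cols_cong g(2)]) (simp add: lkf)
  moreover have "f i \<in> forms 2" for i
    unfolding f_def by (intro forms_sum forms_single) (simp add: mons_iff)
  ultimately show ?thesis by (intro exI[of _ f]) (simp add: good_def)
qed

section \<open>Rate and slant\<close>

lemma cubic_mat_pair: "cubic_mat g (i, v) u = (if lk u v > 0 then g i (u - evar v) else 0)"
  by (simp add: cubic_mat_def)

text \<open>An invertible square block expresses any cubic through the products
  \<open>x_v f_i\<close>; grouping by \<open>i\<close> gives the linear coefficients.\<close>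

lemma good_quadrics:
  fixes f :: "nat \<Rightarrow> ('v::finite, 'l::field) mpoly"
  assumes "good N f" shows "quadrics N f"
proof
  have f2: "f i \<in> forms 2" if "i < N" for i using assms that by (simp add: good_def)
  then show "f i \<in> forms 2" if "i < N" for i using that .
  fix p :: "('v, 'l) mpoly" assume p: "p \<in> forms 3"
  let ?a = "cubic_mat (\<lambda>i. lk (f i))"
  have fin: "finite (cubic_rows N :: (nat \<times> 'v) set)" by (simp add: cubic_rows_def)
  have "indep_cols ?a (cubic_rows N) (mons UNIV 3)" using assms by (simp add: good_def)
  then obtain J where J: "J \<subseteq> cubic_rows N" "card J = card (mons (UNIV :: 'v set) 3)" "indep_cols ?a J (mons UNIV 3)"
    using indep_cols_square_subset[OF fin finite_mons] by blast
  have finJ: "finite J" using J(1) fin finite_subset by blast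
  obtain c where c: "\<And>u. u \<in> mons UNIV 3 \<Longrightarrow> (\<Sum>e\<in>J. c e * ?a e u) = lk p u"
    by (rule indep_cols_square_solve[OF finJ finite_mons J(3,2)]) (rule that)
  define c' where "c' e = (if e \<in> J then c e else 0)" for e
  define l where "l i = (\<Sum>v\<in>UNIV. cst (c' (i, v)) * (pvar v :: ('v, 'l) mpoly))" for i
  have l1: "l i \<in> forms 1" for i unfolding l_def by (intro forms_sum forms_cst_mult) simp
  have "(\<Sum>i<N. l i * f i) \<in> forms 3"
    using forms_mult[OF l1 f2] by (intro forms_sum) (simp add: numeral_3_eq_3)
  have "p = (\<Sum>i<N. l i * f i)"
  proof (rule poly_mapping_eqI)
    fix u
    show "lk p u = lk (\<Sum>i<N. l i * f i) u"
    proof (cases "mdeg u = 3")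
      case False
      then show ?thesis using formsD[OF p] formsD[OF \<open>(\<Sum>i<N. l i * f i) \<in> forms 3\<close>] by simp
    next
      case True
      have "lk (\<Sum>i<N. l i * f i) u = (\<Sum>i<N. \<Sum>v\<in>UNIV. c' (i, v) * ?a (i, v) u)"
        unfolding l_def
        by (simp add: lk_sum_fun sum_distrib_right mult.assoc lk_cst_mult lk_pvar_mult' cubic_mat_pair)
      also have "\<dots> = (\<Sum>e\<in>cubic_rows N. c' e * ?a e u)"
        by (simp add: cubic_rows_def sum.cartesian_product)
      also have "\<dots> = (\<Sum>e\<in>J. c e * ?a e u)"
        by (rule sum.mono_neutral_cong_right) (use J(1) fin in \<open>auto simp: c'_def\<close>)
      finally show ?thesis using c[of u] True by (simp add: mons_iff)
    qed
  qed
  with l1 show "\<exists>l. (\<forall>i<N. l i \<in> forms 1) \<and> p = (\<Sum>i<N. l i * f i)" by (intro exI[of _ l]) simp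
qed

text \<open>Linear independence yields a functional on quadrics with value 1 at \<open>f i0\<close>
  and 0 at the other forms. With no condition in degrees 3 and above it cuts out an ideal
  \<open>I\<close> that contains the other generators but not \<open>f i0\<close>.\<close>

lemma good_minimal:
  fixes f :: "nat \<Rightarrow> ('v::finite, 'l::field) mpoly"
  assumes "good N f" shows "of_type_N2 N f"
  unfolding of_type_N2_def
proof (intro conjI allI impI notI)
  have f2: "f i \<in> forms 2" if "i < N" for i using assms that by (simp add: good_def)
  then show "f i \<in> forms 2" if "i < N" for i using that .
  fix J assume J: "J \<subset> {..<N}" and eq: "genideal mpoly_ring (f ` J) = forms_ideal N f"
  obtain i0 where i0: "i0 < N" "i0 \<notin> J" using J by blast
  have "indep_cols (\<lambda>u i. lk (f i) u) (mons UNIV 2) {..<N}" using assms by (simp add: good_def)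
  then obtain E where E: "E \<subseteq> mons UNIV 2" "card E = card {..<N}" "indep_cols (\<lambda>u i. lk (f i) u) E {..<N}"
    using indep_cols_square_subset[OF finite_mons finite_lessThan] by blast
  have finE: "finite E" using E(1) finite_mons finite_subset by blast
  obtain c where c: "\<And>i. i \<in> {..<N} \<Longrightarrow> (\<Sum>u\<in>E. c u * lk (f i) u) = (if i = i0 then 1 else 0)"
    by (rule indep_cols_square_solve[OF finE finite_lessThan E(3,2)]) (rule that)
  define I where "I = {p :: ('v, 'l) mpoly. hcomp 0 p = 0 \<and> hcomp 1 p = 0 \<and> (\<Sum>u\<in>E. c u * lk p u) = 0}"
  have I_mult: "q * p \<in> I" if "p \<in> I" for p q
  proof -
    have p: "hcomp 0 p = 0" "hcomp 1 p = 0" "(\<Sum>u\<in>E. c u * lk p u) = 0" using that by (auto simp: I_def)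
    define d where "d = lk (hcomp 0 q) 0"
    have d: "hcomp 0 q = cst d" unfolding d_def by (rule forms_0_eq_cst) simp
    have "hcomp 2 (q * p) = cst d * hcomp 2 p"
      using p by (simp add: hcomp_mult numeral_2_eq_2 d)
    then have 2: "lk (hcomp 2 (q * p)) u = d * lk (hcomp 2 p) u" for u by (simp add: lk_cst_mult)
    have "lk (q * p) u = d * lk p u" if "u \<in> E" for u
    proof -
      have "mdeg u = 2" using that E(1) by (auto simp: mons_iff)
      then show ?thesis using 2[of u] by (simp add: lk_hcomp)
    qed
    then have "(\<Sum>u\<in>E. c u * lk (q * p) u) = d * (\<Sum>u\<in>E. c u * lk p u)"
      by (simp add: sum_distrib_left mult_ac)
    then show ?thesis using p by (simp add: I_def hcomp_mult)
  qed
  interpret R: cring "mpoly_ring :: ('v, 'l) mpoly ring" by (rule cring_from_type_algebra)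
  have inv: "\<ominus>\<^bsub>mpoly_ring\<^esub> x = - x" for x :: "('v, 'l) mpoly"
    by (rule R.minus_equality) (auto simp: ring_of_type_algebra_def)
  have ideal: "ideal I mpoly_ring"
  proof (rule idealI)
    show "ring (mpoly_ring :: ('v, 'l) mpoly ring)" by (rule ring_from_type_algebra)
    have "0 \<in> I" by (simp add: I_def)
    moreover have "p + q \<in> I" if "p \<in> I" "q \<in> I" for p q
      using that by (simp add: I_def hcomp_add lookup_add distrib_left sum.distrib)
    moreover have "- p \<in> I" if "p \<in> I" for p
      using I_mult[OF that, of "- 1"] by simp
    ultimately show "subgroup I (add_monoid mpoly_ring)"
      by (intro R.add.subgroupI) (auto simp: ring_of_type_algebra_def inv[unfolded ring_of_type_algebra_def])
    show "x \<otimes>\<^bsub>mpoly_ring\<^esub> a \<in> I" "a \<otimes>\<^bsub>mpoly_ring\<^esub> x \<in> I" if "a \<in> I" "x \<in> carrier mpoly_ring" for a x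
      using I_mult[OF that(1), of x] by (simp_all add: ring_of_type_algebra_def mult.commute)
  qed
  have "f i \<in> I" if "i \<in> J" for i
  proof -
    have "i < N" "i \<noteq> i0" using that J i0 by auto
    then show ?thesis using c[of i] hcomp_forms[OF f2[of i]] by (simp add: I_def)
  qed
  then have "forms_ideal N f \<subseteq> I"
    unfolding eq[symmetric] by (intro R.genideal_minimal[OF ideal]) auto
  moreover have "f i0 \<in> forms_ideal N f"
    unfolding forms_ideal_def using R.genideal_self[of "f ` {..<N}"] i0(1) by (auto simp: ring_of_type_algebra_def)
  ultimately show False using c[of i0] i0(1) by (auto simp: I_def)
qed

text \<open>Both quotients are largest at \<open>i = 3\<close>: for the rate by
  \<open>2 * (i div 3) + 1 \<le> i\<close> when \<open>i \<ge> 2\<close>, for the slant by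
  \<open>3 * (i div 3) \<le> i\<close>.\<close>

lemma rate_eq:
  assumes bound: "\<And>i j. tor_nonzero R G i j \<Longrightarrow> j \<le> i + i div 3" and "tor_nonzero R G 3 4"
  shows "rate R G = ereal (3 / 2)" and "slant R G = ereal (4 / 3)"
proof -
  have le: "tor_top R G i \<le> ereal (real (i + i div 3))" for i
    unfolding tor_top_def
  proof (rule SUP_least)
    fix j assume "j \<in> {j. tor_nonzero R G i j}"
    then have "j \<le> i + i div 3" using bound by simp
    then show "ereal (real j) \<le> ereal (real (i + i div 3))" by (simp only: ereal_less_eq of_nat_le_iff)
  qed
  have "ereal (real 4) \<le> tor_top R G 3"
    unfolding tor_top_def by (rule SUP_upper) (use assms(2) in simp)
  with le[of 3] have top3: "tor_top R G 3 = ereal 4" by (intro antisym) auto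
  show "rate R G = ereal (3 / 2)"
    unfolding rate_def
  proof (rule antisym)
    show "(SUP i\<in>{2..}. (tor_top R G i - 1) / ereal (real i - 1)) \<le> ereal (3 / 2)"
    proof (rule SUP_least)
      fix i :: nat assume i: "i \<in> {2..}"
      have "(tor_top R G i - 1) / ereal (real i - 1) \<le> (ereal (real (i + i div 3)) - 1) / ereal (real i - 1)"
        using i by (intro ereal_divide_right_mono ereal_minus_mono le) auto
      also have "\<dots> = ereal ((real (i + i div 3) - 1) / (real i - 1))"
        using i by (simp add: one_ereal_def)
      also have "\<dots> \<le> ereal (3 / 2)"
      proof -
        have "2 * (i div 3) + 1 \<le> i" using i by simp
        then have "2 * real (i div 3) + 1 \<le> real i" by linarith
        then show ?thesis using i by (simp add: field_simps)
      qed
      finally show "(tor_top R G i - 1) / ereal (real i - 1) \<le> ereal (3 / 2)" .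
    qed
    show "ereal (3 / 2) \<le> (SUP i\<in>{2..}. (tor_top R G i - 1) / ereal (real i - 1))"
      by (rule SUP_upper2[of 3]) (simp_all add: top3 one_ereal_def)
  qed
  show "slant R G = ereal (4 / 3)"
    unfolding slant_def
  proof (rule antisym)
    show "(SUP i\<in>{1..}. tor_top R G i / ereal (real i)) \<le> ereal (4 / 3)"
    proof (rule SUP_least)
      fix i :: nat assume i: "i \<in> {1..}"
      have "tor_top R G i / ereal (real i) \<le> ereal (real (i + i div 3)) / ereal (real i)"
        using i by (intro ereal_divide_right_mono le) auto
      also have "\<dots> = ereal (real (i + i div 3) / real i)" using i by simp
      also have "\<dots> \<le> ereal (4 / 3)"
      proof -
        have "3 * (i div 3) \<le> i" by simp
        then have "3 * real (i div 3) \<le> real i" by linarith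
        then have "real (i + i div 3) \<le> 4 / 3 * real i" by simp
        then show ?thesis using i by (simp only: ereal_less_eq) (subst pos_divide_le_eq, auto)
      qed
      finally show "tor_top R G i / ereal (real i) \<le> ereal (4 / 3)" .
    qed
    show "ereal (4 / 3) \<le> (SUP i\<in>{1..}. tor_top R G i / ereal (real i))"
      by (rule SUP_upper2[of 3]) (simp_all add: top3)
  qed
qed

lemma good_rate_slant:
  fixes f :: "nat \<Rightarrow> ('v::finite, 'l::field) mpoly"
  assumes good: "good N f"
    and count: "(CARD('v) choose 2) * N + (CARD('v) * (CARD('v) choose 3) - (CARD('v) choose 4)) + (N choose 2)
      < (CARD('v) choose 2) * (Suc (CARD('v)) choose 2)"
  shows "of_type_N2 N f \<and> rate (quot_ring N f) (quot_grading N f) = ereal (3 / 2) \<and>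
    slant (quot_ring N f) (quot_grading N f) = ereal (4 / 3)"
proof -
  interpret quadrics N f by (rule good_quadrics[OF good])
  obtain z where z: "\<And>i l. i < N \<Longrightarrow> z i l \<in> forms 1" "\<And>i. i < N \<Longrightarrow> f i = (\<Sum>l\<in>UNIV. z i l * pvar l)"
    by (rule lin_parts) (rule that)
  interpret many_syzygies N f z by unfold_locales (use z count in auto)
  show ?thesis
    using good_minimal[OF good] rate_eq[OF tor_nonzero_bound tor_nonzero_3_4] by simp
qed

section \<open>Numerical form of the hypotheses\<close>

lemma real_choose:
  "real (n choose 2) = real n * (real n - 1) / 2"
  "real (n choose 3) = real n * (real n - 1) * (real n - 2) / 6"
  "real (n choose 4) = real n * (real n - 1) * (real n - 2) * (real n - 3) / 24"
proof -
  show 2: "real (n choose 2) = real n * (real n - 1) / 2" for n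
    by (induction n) (simp_all add: numeral_2_eq_2 field_simps)
  have s: "Suc n choose 3 = (n choose 2) + (n choose 3)" "Suc n choose 4 = (n choose 3) + (n choose 4)" for n
    by (simp_all add: eval_nat_numeral)
  show 3: "real (n choose 3) = real n * (real n - 1) * (real n - 2) / 6" for n
    by (induction n) (simp_all add: s 2 field_simps)
  show "real (n choose 4) = real n * (real n - 1) * (real n - 2) * (real n - 3) / 24"
    by (induction n) (simp_all add: s 3 field_simps)
qed

lemma choose_4_le: "(n choose 4) \<le> n * (n choose 3)"
proof (induction n)
  case (Suc n)
  have "Suc n choose 4 = (n choose 3) + (n choose 4)" "(n choose 3) \<le> Suc n choose 3" 
    by (simp_all add: eval_nat_numeral)
  with Suc.IH have "Suc n choose 4 \<le> Suc n * (n choose 3)" by simp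
  also have "\<dots> \<le> Suc n * (Suc n choose 3)" by (rule mult_le_mono2) fact
  finally show ?case .
qed simp

text \<open>Eight times the inequality between equations and unknowns, plus 1 on both sides, reads
  \<open>(2 * N + n^2 - n - 1)^2 < 2 * n^4 - 2 * n^2 + 1\<close>: completing the square in
  \<open>N\<close> is the origin of the square root. If \<open>N\<close> exceeded the number of
  quadratic monomials, the base would be at least \<open>2 * n^2 - 1\<close>, whose square is too
  large.\<close>

lemma numerical_bounds:
  fixes n N :: nat
  assumes n: "2 \<le> n" and lower: "real ((n + 2) choose 3) / real n \<le> real N"
    and upper: "real N < (sqrt (2 * real n ^ 4 - 2 * real n ^ 2 + 1) - real n ^ 2 + real n + 1) / 2"
  shows "(n + 1) * (n + 2) \<le> 6 * N" and "N \<le> Suc n choose 2"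
    and "(n choose 2) * N + (n * (n choose 3) - (n choose 4)) + (N choose 2) < (n choose 2) * (Suc n choose 2)"
proof -
  let ?n = "real n" and ?N = "real N"
  have n2: "2 \<le> ?n" using n by simp
  have "real ((n + 2) choose 3) \<le> ?N * ?n" using lower n by (simp add: divide_le_eq)
  then have "(n + 2) choose 3 \<le> N * n" by (metis of_nat_le_iff of_nat_mult)
  then have "6 * ((n + 2) choose 3) \<le> 6 * (N * n)" by (rule mult_le_mono2)
  then have "n * ((n + 1) * (n + 2)) \<le> n * (6 * N)" unfolding times_6_choose_3 by (simp only: mult_ac)
  then have "0 < n \<longrightarrow> (n + 1) * (n + 2) \<le> 6 * N" by (simp only: nat_mult_le_cancel_disj)
  then show "(n + 1) * (n + 2) \<le> 6 * N" using n by (elim impE) simp_all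
  have "2 * ?n \<le> ?n * ?n" using n2 by (intro mult_right_mono) auto
  \<comment> \<open>Needed for squaring the upper bound.\<close>
  then have pos: "0 \<le> 2 * ?N + ?n\<^sup>2 - ?n - 1"
    unfolding power2_eq_square using n2 of_nat_0_le_iff[of N, where 'a = real] by linarith
  have "2 * ?N + ?n\<^sup>2 - ?n - 1 < sqrt (2 * ?n ^ 4 - 2 * ?n\<^sup>2 + 1)" using upper by simp
  then have "(2 * ?N + ?n\<^sup>2 - ?n - 1)\<^sup>2 < (sqrt (2 * ?n ^ 4 - 2 * ?n\<^sup>2 + 1))\<^sup>2"
    using pos by (intro power_strict_mono) auto
  moreover have "0 < 2 * ?n ^ 4 - 2 * ?n\<^sup>2 + 1"
    using \<open>2 * ?N + ?n\<^sup>2 - ?n - 1 < sqrt _\<close> pos by (metis le_less_trans real_sqrt_gt_0_iff)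
  ultimately have sq: "(2 * ?N + ?n\<^sup>2 - ?n - 1)\<^sup>2 < 2 * ?n ^ 4 - 2 * ?n\<^sup>2 + 1" by simp
  show "N \<le> Suc n choose 2"
  proof (rule ccontr)
    assume "\<not> N \<le> Suc n choose 2"
    then have "real (Suc n choose 2) < ?N" by simp
    then have "2 * ?n\<^sup>2 - 1 \<le> 2 * ?N + ?n\<^sup>2 - ?n - 1"
      by (simp add: real_choose power2_eq_square field_simps)
    moreover have "4 \<le> ?n\<^sup>2" using power_mono[OF n2, of 2] by simp
    ultimately have "(2 * ?n\<^sup>2 - 1)\<^sup>2 \<le> (2 * ?N + ?n\<^sup>2 - ?n - 1)\<^sup>2" by (intro power_mono) auto
    with sq have "(2 * ?n\<^sup>2 - 1)\<^sup>2 < 2 * ?n ^ 4 - 2 * ?n\<^sup>2 + 1" by linarith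
    then have "?n\<^sup>2 * (?n\<^sup>2 - 1) < 0" by (simp add: power2_eq_square power4_eq_xxxx algebra_simps)
    moreover have "0 \<le> ?n\<^sup>2 * (?n\<^sup>2 - 1)" using \<open>4 \<le> ?n\<^sup>2\<close> by (intro mult_nonneg_nonneg) auto
    ultimately show False by linarith
  qed
  have l: "8 * real ((n choose 2) * N + (n * (n choose 3) - (n choose 4)) + (N choose 2)) =
      (2 * ?N + ?n\<^sup>2 - ?n - 1)\<^sup>2 - 1"
    by (simp add: of_nat_diff[OF choose_4_le] real_choose) (simp add: field_simps power2_eq_square)
  have r: "8 * real ((n choose 2) * (Suc n choose 2)) = 2 * ?n ^ 4 - 2 * ?n\<^sup>2"
    by (simp add: real_choose) (simp add: field_simps power2_eq_square power4_eq_xxxx)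
  have "8 * real ((n choose 2) * N + (n * (n choose 3) - (n choose 4)) + (N choose 2)) <
      8 * real ((n choose 2) * (Suc n choose 2))"
    unfolding l r using sq by linarith
  then have "real ((n choose 2) * N + (n * (n choose 3) - (n choose 4)) + (N choose 2)) < real ((n choose 2) * (Suc n choose 2))"
    by (simp only: mult_less_cancel_left_pos[of "8 :: real", OF zero_less_numeral])
  then show "(n choose 2) * N + (n * (n choose 3) - (n choose 4)) + (N choose 2) < (n choose 2) * (Suc n choose 2)"
    by (simp only: of_nat_less_iff)
qed

theorem proposition5p7:
  fixes n N :: nat
  assumes n_def: "n = CARD('v::finite)"
    and n_ge: "n \<ge> 2"
    and N_lower: "real ((n + 2) choose 3) / real n \<le> real N"
    and N_upper: "real N < (sqrt (2 * real n ^ 4 - 2 * real n ^ 2 + 1) - real n ^ 2 + real n + 1) / 2"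
  shows "\<exists>E :: ('v, 'k::field) coeff_poly set.
      (\<forall>P\<in>E. multihomogeneous N P) \<and>
      open_points N to_ac E \<noteq> {} \<and>
      (\<forall>f\<in>open_points N id E.
         of_type_N2 N f \<and>
         rate (quot_ring N f) (quot_grading N f) = ereal (3 / 2) \<and>
         slant (quot_ring N f) (quot_grading N f) = ereal (4 / 3)) \<and>
      (\<forall>f\<in>open_points N to_ac E.
         of_type_N2 N f \<and>
         rate (quot_ring N f) (quot_grading N f) = ereal (3 / 2) \<and>
         slant (quot_ring N f) (quot_grading N f) = ereal (4 / 3))"
proof -
  note bounds = numerical_bounds[OF n_ge N_lower N_upper, unfolded n_def]
  have "N \<le> card (mons (UNIV :: 'v set) 2)" using bounds(2) by (simp add: card_mons)
  \<comment> \<open>The good tuple is sought over the algebraic closure, since over a finite base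
    field the open set may have no point.\<close>
  then obtain f0 :: "nat \<Rightarrow> ('v, 'k alg_closure) mpoly" where f0: "good N f0"
    using good_exists[OF n_ge[unfolded n_def] bounds(1), where 'l = "'k alg_closure"] by (elim meta_impE exE)
  obtain E :: "('v, 'k) coeff_poly set" where E: "\<forall>P\<in>E. multihomogeneous N P" "open_points N to_ac E \<noteq> {}"
    "\<forall>f\<in>open_points N id E. good N f" "\<forall>f\<in>open_points N to_ac E. good N f"
    using good_open[OF f0] by (elim exE conjE)
  show ?thesis
  proof (intro exI[of _ E] conjI ballI)
    show "open_points N to_ac E \<noteq> {}" by (rule E(2))
    show "multihomogeneous N P" if "P \<in> E" for P using E(1) that by (rule bspec)
  qed (use good_rate_slant[OF bspec[OF E(3)] bounds(3)] good_rate_slant[OF bspec[OF E(4)] bounds(3)] in auto)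
qed

end
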